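(* Let $p$ be a prime number, $n\ge0$, $S=\{1,p,\dots,p^n\}$, and let $f\colon R_0\to R$ be a smooth homomorphism of flat $\mathbb{Z}$-algebras, with a presentation $\pi$ as in the context. Assume that $R$ is equipped with a Frobenius lift $\phi_p\colon R\to R$ and $R_0$ with an endomorphism $\varphi_p\colon R_0\to R_0$ such that $f\varphi_p=\phi_pf$. For $\omega=(\omega_k)_{k=0}^n\in(\Omega^{\bullet}_{R/R_0})^S$ (with $\omega_k$ the component at $p^k\in S$) the following are equivalent: (i) $\omega$ lies in the image of the ghost map $\mathcal{G}_S^{\bullet}\colon E_S\Omega^{\bullet}(\pi)\to(\Omega^{\bullet}_{R/R_0})^S$; (ii) $\phi_p(\omega_k)-\omega_{k+1}\in p^{k+1}\Omega^{\bullet}_{R/R_0}+d\Omega^{\bullet}_{R/R_0}$ for all $0\le k\le n-1$.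
   Context: All rings are commutative and unital. A Frobenius lift on $R$ is a ring endomorphism $\phi_p$ with $\phi_p(r)-r^p\in pR$ for all $r\in R$. The map $\phi_p$ on differential forms is the following normalized one: in degree $q\ge0$, $\phi_p\colon\Omega^q_{R/R_0}\to\Omega^q_{R/R_0}$, $r_0dr_1\cdots dr_q\mapsto p^{-q}\phi_p(r_0)d\phi_p(r_1)\cdots d\phi_p(r_q)$ (well-defined since $d\phi_p(r)$ is divisible by $p$ and $\Omega^q_{R/R_0}$ is $\mathbb{Z}$-torsion free). A presentation $\pi$ of $f\colon R_0\to R$ consists of a flat $\mathbb{Z}$-algebra $A_0$, a polynomial ring $A$ over $A_0$, and surjective ring homomorphisms $\pi_0\colon A_0\to R_0$ and $\pi\colon A\to R$ with kernels $I_0$ and $I$, such that $\pi|_{A_0}=f\pi_0$. Let $S$ be a finite truncation set (a finite subset of $\mathbb{N}=\{1,2,\dots\}$ closed under divisors). For $m\in S$, $a\in A$ put $V_m\langle a\rangle=(m\,\delta_{m\mid k}\,a^{k/m})_{k\in S}\in A^S$, where $\delta_{m\mid k}=1$ if $m\mid k$ and the entry is $0$ otherwise. Let $X_S(A)\subseteq A^S$ be the subring generated by all $V_m\langle a\rangle$ ($a\in A$, $m\in S$) and $X_S(I)\subseteq X_S(A)$ the ideal generated by all $V_m\langle a\rangle$ with $a\in I$, $m\in S$. Let $A_{\mathbb{Q}}=A\otimes\mathbb{Q}$, $A_{0,\mathbb{Q}}=A_0\otimes\mathbb{Q}$, and equip $(\Omega^\bullet_{A_{\mathbb{Q}}/A_{0,\mathbb{Q}}})^S$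 with the differential $\mathbb{d}=(\tfrac1m d)_{m\in S}$. Let $X_S^\bullet(A)$ be the differential graded subring of it generated by $X_S(A)$, $X_S^\bullet(I,A)\subseteq X_S^\bullet(A)$ the differential graded ideal generated by $X_S(I)$, and $E_S\Omega^\bullet(\pi)=X_S^\bullet(A)/X_S^\bullet(I,A)$ (this is identified with the relative de Rham-Witt complex $W_S\Omega^\bullet_{R/R_0}$). One has $X_S^\bullet(A)\subseteq(\Omega^\bullet_{A/A_0})^S$, and the components of $X_S^\bullet(I,A)$ lie in the differential graded ideal $I^\bullet\subseteq\Omega^\bullet_{A/A_0}$ generated by $I$; the ghost map is the induced homomorphism of graded rings $$\mathcal{G}_S^\bullet\colon E_S\Omega^\bullet(\pi)\to(\Omega^\bullet_{A/A_0}/I^\bullet)^S\cong(\Omega^\bullet_{R/R_0})^S.$$ *)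

theory Defs
  imports "HOL-Algebra.Algebra" "HOL-Algebra.Algebraic_Closure_Type"
begin

section \<open>Monoid rings and polynomial rings\<close>

text \<open>\<open>monoid_ring K M\<close> is \<open>K[M]\<close>: finitely supported functions on \<open>M\<close> with convolution.
  It is used for free commutative monoids (polynomial rings in an arbitrary set of variables)
  and for free monoids (tensor algebras of free modules).\<close>

definition monoid_ring ::
    "('k, 'c) ring_scheme \<Rightarrow> ('m, 'd) monoid_scheme \<Rightarrow> ('m \<Rightarrow> 'k) ring" where
  "monoid_ring K M =
    \<lparr>carrier = {s. (\<forall>m. s m \<in> carrier K) \<and> finite {m. s m \<noteq> \<zero>\<^bsub>K\<^esub>} \<and> {m. s m \<noteq> \<zero>\<^bsub>K\<^esub>} \<subseteq> carrier M},
     monoid.mult = (\<lambda>s t m. finsum K (\<lambda>(u, v). s u \<otimes>\<^bsub>K\<^esub> t v)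
        {(u, v). s u \<noteq> \<zero>\<^bsub>K\<^esub> \<and> t v \<noteq> \<zero>\<^bsub>K\<^esub> \<and> u \<otimes>\<^bsub>M\<^esub> v = m}),
     monoid.one = (\<lambda>m. if m = \<one>\<^bsub>M\<^esub> then \<one>\<^bsub>K\<^esub> else \<zero>\<^bsub>K\<^esub>),
     ring.zero = (\<lambda>m. \<zero>\<^bsub>K\<^esub>),
     ring.add = (\<lambda>s t m. s m \<oplus>\<^bsub>K\<^esub> t m)\<rparr>"

definition mr_monom :: "('k, 'c) ring_scheme \<Rightarrow> 'k \<Rightarrow> 'm \<Rightarrow> 'm \<Rightarrow> 'k" where
  "mr_monom K a m = (\<lambda>x. if x = m then a else \<zero>\<^bsub>K\<^esub>)"

definition mpoly_ring :: "('k, 'c) ring_scheme \<Rightarrow> 'x set \<Rightarrow> ('x multiset \<Rightarrow> 'k) ring" where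
  "mpoly_ring K U = monoid_ring K \<lparr>carrier = {M. set_mset M \<subseteq> U}, monoid.mult = (+), monoid.one = {#}\<rparr>"

definition mpoly_const :: "('k, 'c) ring_scheme \<Rightarrow> 'k \<Rightarrow> 'x multiset \<Rightarrow> 'k" where
  "mpoly_const K a = mr_monom K a {#}"


section \<open>Tensor products over the integers, flatness, rationalization\<close>

abbreviation tensor_free ::
    "('g, 'c) monoid_scheme \<Rightarrow> ('h, 'd) monoid_scheme \<Rightarrow> (('g \<times> 'h) \<Rightarrow>\<^sub>0 int) monoid" where
  "tensor_free G H \<equiv> free_Abelian_group (carrier G \<times> carrier H)"

definition tensor_relations ::
    "('g, 'c) monoid_scheme \<Rightarrow> ('h, 'd) monoid_scheme \<Rightarrow> (('g \<times> 'h) \<Rightarrow>\<^sub>0 int) set" where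
  "tensor_relations G H = generate (tensor_free G H)
    ({frag_of (g \<otimes>\<^bsub>G\<^esub> g', h) - (frag_of (g, h) + frag_of (g', h)) | g g' h.
        g \<in> carrier G \<and> g' \<in> carrier G \<and> h \<in> carrier H} \<union>
     {frag_of (g, h \<otimes>\<^bsub>H\<^esub> h') - (frag_of (g, h) + frag_of (g, h')) | g h h'.
        g \<in> carrier G \<and> h \<in> carrier H \<and> h' \<in> carrier H})"

definition tensor_group ::
    "('g, 'c) monoid_scheme \<Rightarrow> ('h, 'd) monoid_scheme \<Rightarrow> (('g \<times> 'h) \<Rightarrow>\<^sub>0 int) set monoid" where
  "tensor_group G H = tensor_free G H Mod tensor_relations G H"

definition tensor_class ::
    "('g, 'c) monoid_scheme \<Rightarrow> ('h, 'd) monoid_scheme \<Rightarrow> (('g \<times> 'h) \<Rightarrow>\<^sub>0 int) \<Rightarrow>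
      (('g \<times> 'h) \<Rightarrow>\<^sub>0 int) set" where
  "tensor_class G H c = tensor_relations G H #>\<^bsub>tensor_free G H\<^esub> c"

text \<open>Maps out of quotients are written as unions over all representatives; the union is a single
  coset because the map does not depend on the representative.\<close>

definition tensor_map_left ::
    "('g', 'c) monoid_scheme \<Rightarrow> ('h, 'd) monoid_scheme \<Rightarrow> ('g \<Rightarrow> 'g') \<Rightarrow>
      (('g \<times> 'h) \<Rightarrow>\<^sub>0 int) set \<Rightarrow> (('g' \<times> 'h) \<Rightarrow>\<^sub>0 int) set" where
  "tensor_map_left G' H u U =
    (\<Union>c\<in>U. tensor_class G' H (frag_extend (\<lambda>(g, h). frag_of (u g, h)) c))"

text \<open>Flatness of an abelian group \<open>M\<close>: tensoring with \<open>M\<close> preserves injectivity. HOL cannot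
  quantify over groups of all types; since injectivity of \<open>u \<otimes> M\<close> can be tested on finitely
  generated (hence countable) groups, groups carried by sets of integers suffice.\<close>

definition flat_group :: "('h, 'd) monoid_scheme \<Rightarrow> bool" where
  "flat_group M \<longleftrightarrow> (\<forall>(G :: int monoid) (G' :: int monoid) u.
     comm_group G \<and> comm_group G' \<and> u \<in> mon G G' \<longrightarrow>
       inj_on (tensor_map_left G' M u) (carrier (tensor_group G M)))"

definition flat_Z_algebra :: "('a, 'c) ring_scheme \<Rightarrow> bool" where
  "flat_Z_algebra A \<longleftrightarrow> cring A \<and> flat_group (add_monoid A)"

definition tensor_ring ::
    "('a, 'c) ring_scheme \<Rightarrow> ('b, 'd) ring_scheme \<Rightarrow> (('a \<times> 'b) \<Rightarrow>\<^sub>0 int) set ring" where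
  "tensor_ring A B =
    \<lparr>carrier = carrier (tensor_group (add_monoid A) (add_monoid B)),
     monoid.mult = (\<lambda>U Y. \<Union>x\<in>U. \<Union>y\<in>Y. tensor_class (add_monoid A) (add_monoid B)
        (frag_extend (\<lambda>(a, b). frag_extend (\<lambda>(a', b'). frag_of (a \<otimes>\<^bsub>A\<^esub> a', b \<otimes>\<^bsub>B\<^esub> b')) y) x)),
     monoid.one = tensor_class (add_monoid A) (add_monoid B) (frag_of (\<one>\<^bsub>A\<^esub>, \<one>\<^bsub>B\<^esub>)),
     ring.zero = \<one>\<^bsub>tensor_group (add_monoid A) (add_monoid B)\<^esub>,
     ring.add = monoid.mult (tensor_group (add_monoid A) (add_monoid B))\<rparr>"

abbreviation rat_ring :: "rat ring" where
  "rat_ring \<equiv> ring_of_type_algebra"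

definition rationalization :: "('a, 'c) ring_scheme \<Rightarrow> (('a \<times> rat) \<Rightarrow>\<^sub>0 int) set ring" where
  "rationalization A = tensor_ring A rat_ring"

definition rat_elem :: "('a, 'c) ring_scheme \<Rightarrow> 'a \<Rightarrow> rat \<Rightarrow> (('a \<times> rat) \<Rightarrow>\<^sub>0 int) set" where
  "rat_elem A a r = tensor_class (add_monoid A) (add_monoid rat_ring) (frag_of (a, r))"

definition rationalization_map ::
    "('b, 'c) ring_scheme \<Rightarrow> ('a \<Rightarrow> 'b) \<Rightarrow>
      (('a \<times> rat) \<Rightarrow>\<^sub>0 int) set \<Rightarrow> (('b \<times> rat) \<Rightarrow>\<^sub>0 int) set" where
  "rationalization_map B g = tensor_map_left (add_monoid B) (add_monoid rat_ring) g"


section \<open>Smooth homomorphisms\<close>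

definition finitely_presented ::
    "('a, 'c) ring_scheme \<Rightarrow> ('b, 'd) ring_scheme \<Rightarrow> ('a \<Rightarrow> 'b) \<Rightarrow> bool" where
  "finitely_presented R0 R f \<longleftrightarrow>
    (\<exists>(N :: nat) h F. h \<in> ring_hom (mpoly_ring R0 {..<N}) R \<and>
       h ` carrier (mpoly_ring R0 {..<N}) = carrier R \<and>
       (\<forall>r\<in>carrier R0. h (mpoly_const R0 r) = f r) \<and>
       finite F \<and> F \<subseteq> carrier (mpoly_ring R0 {..<N}) \<and>
       a_kernel (mpoly_ring R0 {..<N}) R h = Idl\<^bsub>mpoly_ring R0 {..<N}\<^esub> F)"

text \<open>Infinitesimal lifting property against square-zero ideals. The test rings \<open>B\<close> are carried by
  subsets of a fixed type that contains a copy of \<open>P/K\<^sup>2\<close> whenever \<open>P = R\<^sub>0[x\<^sub>1,\<dots>,x\<^sub>N]\<close> and \<open>R = P/K\<close>;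
  for finitely presented \<open>f\<close>, lifting the isomorphism \<open>R \<longrightarrow> P/K\<close> to \<open>P/K\<^sup>2\<close> already yields
  lifts against all test rings.\<close>

definition formally_smooth ::
    "('a, 'c) ring_scheme \<Rightarrow> ('b, 'd) ring_scheme \<Rightarrow> ('a \<Rightarrow> 'b) \<Rightarrow> bool" where
  "formally_smooth R0 R f \<longleftrightarrow>
    (\<forall>(B :: (nat multiset \<Rightarrow> 'a) set ring) J g h.
       cring B \<and> ideal J B \<and> (\<forall>x\<in>J. \<forall>y\<in>J. x \<otimes>\<^bsub>B\<^esub> y = \<zero>\<^bsub>B\<^esub>) \<and>
       g \<in> ring_hom R0 B \<and> h \<in> ring_hom R (B Quot J) \<and>
       (\<forall>r\<in>carrier R0. h (f r) = J +>\<^bsub>B\<^esub> g r) \<longrightarrow>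
       (\<exists>l \<in> ring_hom R B. (\<forall>r\<in>carrier R0. l (f r) = g r) \<and>
          (\<forall>r\<in>carrier R. J +>\<^bsub>B\<^esub> l r = h r)))"

definition smooth_hom ::
    "('a, 'c) ring_scheme \<Rightarrow> ('b, 'd) ring_scheme \<Rightarrow> ('a \<Rightarrow> 'b) \<Rightarrow> bool" where
  "smooth_hom R0 R f \<longleftrightarrow> cring R0 \<and> cring R \<and> f \<in> ring_hom R0 R \<and>
     finitely_presented R0 R f \<and> formally_smooth R0 R f"


section \<open>Differential graded rings\<close>

record 'a dg_ring = "'a ring" +
  degree_part :: "nat \<Rightarrow> 'a set"
  differential :: "'a \<Rightarrow> 'a"

definition graded_subset :: "'a set \<Rightarrow> ('a, 'c) dg_ring_scheme \<Rightarrow> bool" where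
  "graded_subset H D \<longleftrightarrow> (\<forall>x\<in>H. \<exists>N y. (\<forall>q\<le>N. y q \<in> H \<inter> degree_part D q) \<and>
      x = (\<Oplus>\<^bsub>D\<^esub>q\<in>{..N::nat}. y q))"

definition dg_subring :: "'a set \<Rightarrow> ('a, 'c) dg_ring_scheme \<Rightarrow> bool" where
  "dg_subring H D \<longleftrightarrow> subring H D \<and> graded_subset H D \<and> (\<forall>x\<in>H. differential D x \<in> H)"

definition dg_subring_gen :: "('a, 'c) dg_ring_scheme \<Rightarrow> 'a set \<Rightarrow> 'a set" where
  "dg_subring_gen D U = \<Inter>{H. dg_subring H D \<and> U \<subseteq> H}"

definition dg_ideal :: "'a set \<Rightarrow> ('a, 'c) dg_ring_scheme \<Rightarrow> bool" where
  "dg_ideal J D \<longleftrightarrow> ideal J D \<and> graded_subset J D \<and> (\<forall>x\<in>J. differential D x \<in> J)"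

definition dg_ideal_gen :: "('a, 'c) dg_ring_scheme \<Rightarrow> 'a set \<Rightarrow> 'a set" where
  "dg_ideal_gen D U = \<Inter>{J. dg_ideal J D \<and> U \<subseteq> J}"


section \<open>The algebraic de Rham complex\<close>

text \<open>\<open>form_words B\<close> is the free \<open>B\<close>-algebra on symbols \<open>db\<close> (\<open>b \<in> B\<close>), i.e. the tensor algebra of
  the free \<open>B\<close>-module on these symbols; \<open>mr_monom B b [b\<^sub>1,\<dots>,b\<^sub>q]\<close> stands for
  \<open>b db\<^sub>1 \<otimes> \<dots> \<otimes> db\<^sub>q\<close>.  Dividing by the relations of Kaehler differentials and by the squares of
  elements of degree 1 gives the exterior algebra over \<open>B\<close> of \<open>\<Omega>\<^sup>1\<close> of \<open>B\<close> over \<open>B0\<close>.\<close>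

definition form_words :: "('b, 'd) ring_scheme \<Rightarrow> ('b list \<Rightarrow> 'b) ring" where
  "form_words B = monoid_ring B \<lparr>carrier = lists (carrier B), monoid.mult = (@), monoid.one = []\<rparr>"

definition form_words_deg :: "('b, 'd) ring_scheme \<Rightarrow> nat \<Rightarrow> ('b list \<Rightarrow> 'b) set" where
  "form_words_deg B q = {t \<in> carrier (form_words B). \<forall>w. t w \<noteq> \<zero>\<^bsub>B\<^esub> \<longrightarrow> length w = q}"

definition de_rham_ideal ::
    "('a, 'c) ring_scheme \<Rightarrow> ('b, 'd) ring_scheme \<Rightarrow> ('a \<Rightarrow> 'b) \<Rightarrow> ('b list \<Rightarrow> 'b) set" where
  "de_rham_ideal B0 B g = Idl\<^bsub>form_words B\<^esub>
    ({mr_monom B \<one>\<^bsub>B\<^esub> [a \<oplus>\<^bsub>B\<^esub> b] \<ominus>\<^bsub>form_words B\<^esub>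
        (mr_monom B \<one>\<^bsub>B\<^esub> [a] \<oplus>\<^bsub>form_words B\<^esub> mr_monom B \<one>\<^bsub>B\<^esub> [b]) | a b. a \<in> carrier B \<and> b \<in> carrier B} \<union>
     {mr_monom B \<one>\<^bsub>B\<^esub> [a \<otimes>\<^bsub>B\<^esub> b] \<ominus>\<^bsub>form_words B\<^esub>
        (mr_monom B a [b] \<oplus>\<^bsub>form_words B\<^esub> mr_monom B b [a]) | a b. a \<in> carrier B \<and> b \<in> carrier B} \<union>
     {mr_monom B \<one>\<^bsub>B\<^esub> [g a] | a. a \<in> carrier B0} \<union>
     {x \<otimes>\<^bsub>form_words B\<^esub> x | x. x \<in> form_words_deg B 1})"

definition form_class ::
    "('a, 'c) ring_scheme \<Rightarrow> ('b, 'd) ring_scheme \<Rightarrow> ('a \<Rightarrow> 'b) \<Rightarrow>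
      ('b list \<Rightarrow> 'b) \<Rightarrow> ('b list \<Rightarrow> 'b) set" where
  "form_class B0 B g t = de_rham_ideal B0 B g +>\<^bsub>form_words B\<^esub> t"

text \<open>The differential is \<open>b db\<^sub>1 \<dots> db\<^sub>q \<mapsto> db db\<^sub>1 \<dots> db\<^sub>q\<close>.\<close>

definition de_rham ::
    "('a, 'c) ring_scheme \<Rightarrow> ('b, 'd) ring_scheme \<Rightarrow> ('a \<Rightarrow> 'b) \<Rightarrow> ('b list \<Rightarrow> 'b) set dg_ring" where
  "de_rham B0 B g = ring.extend (form_words B Quot de_rham_ideal B0 B g)
    \<lparr>degree_part = (\<lambda>q. form_class B0 B g ` form_words_deg B q),
     differential = (\<lambda>U. \<Union>t\<in>U. form_class B0 B g
        (\<Oplus>\<^bsub>form_words B\<^esub>w\<in>{w. t w \<noteq> \<zero>\<^bsub>B\<^esub>}. mr_monom B \<one>\<^bsub>B\<^esub> (t w # w)))\<rparr>"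

text \<open>The form \<open>b db\<^sub>1 \<dots> db\<^sub>q\<close>; for the empty list, the element \<open>b\<close> in degree 0.\<close>

definition form ::
    "('a, 'c) ring_scheme \<Rightarrow> ('b, 'd) ring_scheme \<Rightarrow> ('a \<Rightarrow> 'b) \<Rightarrow>
      'b \<Rightarrow> 'b list \<Rightarrow> ('b list \<Rightarrow> 'b) set" where
  "form B0 B g b bs = form_class B0 B g (mr_monom B b bs)"

text \<open>The map \<open>b db\<^sub>1 \<dots> db\<^sub>q \<mapsto> u(b) du(b\<^sub>1) \<dots> du(b\<^sub>q)\<close> from forms on \<open>B\<close> to forms on \<open>B'\<close> over \<open>B0'\<close>.\<close>

definition de_rham_map ::
    "('b, 'd) ring_scheme \<Rightarrow> ('a', 'c) ring_scheme \<Rightarrow> ('b', 'e) ring_scheme \<Rightarrow> ('a' \<Rightarrow> 'b') \<Rightarrow>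
      ('b \<Rightarrow> 'b') \<Rightarrow> ('b list \<Rightarrow> 'b) set \<Rightarrow> ('b' list \<Rightarrow> 'b') set" where
  "de_rham_map B B0' B' g' u U = (\<Union>t\<in>U. form_class B0' B' g'
     (\<Oplus>\<^bsub>form_words B'\<^esub>w\<in>{w. t w \<noteq> \<zero>\<^bsub>B\<^esub>}. mr_monom B' (u (t w)) (map u w)))"


section \<open>Frobenius lifts\<close>

definition frobenius_lift :: "nat \<Rightarrow> ('r, 'c) ring_scheme \<Rightarrow> ('r \<Rightarrow> 'r) \<Rightarrow> bool" where
  "frobenius_lift p R \<phi> \<longleftrightarrow> \<phi> \<in> ring_hom R R \<and>
     (\<forall>r\<in>carrier R. \<exists>s\<in>carrier R. \<phi> r \<ominus>\<^bsub>R\<^esub> r [^]\<^bsub>R\<^esub> p = [p] \<cdot>\<^bsub>R\<^esub> s)"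

text \<open>The degree-preserving additive map \<open>r\<^sub>0 dr\<^sub>1 \<dots> dr\<^sub>q \<mapsto> p\<^sup>-\<^sup>q \<phi>(r\<^sub>0) d\<phi>(r\<^sub>1) \<dots> d\<phi>(r\<^sub>q)\<close>; it is
  unique when the forms have no \<open>p\<close>-torsion.\<close>

definition normalized_frobenius ::
    "nat \<Rightarrow> ('a, 'c) ring_scheme \<Rightarrow> ('r, 'd) ring_scheme \<Rightarrow> ('a \<Rightarrow> 'r) \<Rightarrow> ('r \<Rightarrow> 'r) \<Rightarrow>
      ('r list \<Rightarrow> 'r) set \<Rightarrow> ('r list \<Rightarrow> 'r) set" where
  "normalized_frobenius p R0 R f \<phi> = (THE \<Phi>.
     \<Phi> \<in> extensional (carrier (de_rham R0 R f)) \<and>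
     \<Phi> \<in> hom (add_monoid (de_rham R0 R f)) (add_monoid (de_rham R0 R f)) \<and>
     (\<forall>q. \<Phi> ` degree_part (de_rham R0 R f) q \<subseteq> degree_part (de_rham R0 R f) q) \<and>
     (\<forall>r\<in>carrier R. \<forall>rs\<in>lists (carrier R).
        [(p ^ length rs)] \<cdot>\<^bsub>de_rham R0 R f\<^esub> \<Phi> (form R0 R f r rs) = form R0 R f (\<phi> r) (map \<phi> rs)))"


section \<open>Presentations and the ghost map\<close>

text \<open>The polynomial ring \<open>A\<close> over \<open>A0\<close> is taken to be \<open>A0[U]\<close> for an arbitrary,
  possibly empty or infinite, set \<open>U\<close> of variables.\<close>

definition presentation ::
    "('r0, 'c) ring_scheme \<Rightarrow> ('r, 'd) ring_scheme \<Rightarrow> ('r0 \<Rightarrow> 'r) \<Rightarrow> ('a, 'e) ring_scheme \<Rightarrow> 'x set \<Rightarrow>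
      ('a \<Rightarrow> 'r0) \<Rightarrow> (('x multiset \<Rightarrow> 'a) \<Rightarrow> 'r) \<Rightarrow> bool" where
  "presentation R0 R f A0 U \<pi>0 \<pi> \<longleftrightarrow> flat_Z_algebra A0 \<and>
     \<pi>0 \<in> ring_hom A0 R0 \<and> \<pi>0 ` carrier A0 = carrier R0 \<and>
     \<pi> \<in> ring_hom (mpoly_ring A0 U) R \<and> \<pi> ` carrier (mpoly_ring A0 U) = carrier R \<and>
     (\<forall>a\<in>carrier A0. \<pi> (mpoly_const A0 a) = f (\<pi>0 a))"

definition power_ring :: "nat set \<Rightarrow> ('a, 'c) ring_scheme \<Rightarrow> (nat \<Rightarrow> 'a) ring" where
  "power_ring S A =
    \<lparr>carrier = S \<rightarrow>\<^sub>E carrier A,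
     monoid.mult = (\<lambda>x y. \<lambda>k\<in>S. x k \<otimes>\<^bsub>A\<^esub> y k),
     monoid.one = (\<lambda>k\<in>S. \<one>\<^bsub>A\<^esub>),
     ring.zero = (\<lambda>k\<in>S. \<zero>\<^bsub>A\<^esub>),
     ring.add = (\<lambda>x y. \<lambda>k\<in>S. x k \<oplus>\<^bsub>A\<^esub> y k)\<rparr>"

definition V_elem :: "nat set \<Rightarrow> ('a, 'c) ring_scheme \<Rightarrow> nat \<Rightarrow> 'a \<Rightarrow> nat \<Rightarrow> 'a" where
  "V_elem S A m a = (\<lambda>k\<in>S. if m dvd k then [m] \<cdot>\<^bsub>A\<^esub> (a [^]\<^bsub>A\<^esub> (k div m)) else \<zero>\<^bsub>A\<^esub>)"

definition X_ring :: "nat set \<Rightarrow> ('a, 'c) ring_scheme \<Rightarrow> (nat \<Rightarrow> 'a) set" where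
  "X_ring S A = generate_ring (power_ring S A) {V_elem S A m a | m a. m \<in> S \<and> a \<in> carrier A}"

definition X_ideal :: "nat set \<Rightarrow> ('a, 'c) ring_scheme \<Rightarrow> 'a set \<Rightarrow> (nat \<Rightarrow> 'a) set" where
  "X_ideal S A I = Idl\<^bsub>(power_ring S A)\<lparr>carrier := X_ring S A\<rparr>\<^esub> {V_elem S A m a | m a. m \<in> S \<and> a \<in> I}"

text \<open>In the following, \<open>i\<close> is the structure map from \<open>A0\<close> to \<open>A\<close>.\<close>

definition de_rham_rat ::
    "('a0, 'c) ring_scheme \<Rightarrow> ('a, 'd) ring_scheme \<Rightarrow> ('a0 \<Rightarrow> 'a) \<Rightarrow>
      ((('a \<times> rat) \<Rightarrow>\<^sub>0 int) set list \<Rightarrow> (('a \<times> rat) \<Rightarrow>\<^sub>0 int) set) set dg_ring" where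
  "de_rham_rat A0 A i = de_rham (rationalization A0) (rationalization A) (rationalization_map A i)"

definition rat_form ::
    "('a0, 'c) ring_scheme \<Rightarrow> ('a, 'd) ring_scheme \<Rightarrow> ('a0 \<Rightarrow> 'a) \<Rightarrow> 'a \<Rightarrow> rat \<Rightarrow>
      ((('a \<times> rat) \<Rightarrow>\<^sub>0 int) set list \<Rightarrow> (('a \<times> rat) \<Rightarrow>\<^sub>0 int) set) set" where
  "rat_form A0 A i a r =
    form (rationalization A0) (rationalization A) (rationalization_map A i) (rat_elem A a r) []"

definition de_rham_to_rat ::
    "('a0, 'c) ring_scheme \<Rightarrow> ('a, 'd) ring_scheme \<Rightarrow> ('a0 \<Rightarrow> 'a) \<Rightarrow> ('a list \<Rightarrow> 'a) set \<Rightarrow>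
      ((('a \<times> rat) \<Rightarrow>\<^sub>0 int) set list \<Rightarrow> (('a \<times> rat) \<Rightarrow>\<^sub>0 int) set) set" where
  "de_rham_to_rat A0 A i =
    de_rham_map A (rationalization A0) (rationalization A) (rationalization_map A i)
      (\<lambda>a. rat_elem A a 1)"

definition ghost_dg ::
    "nat set \<Rightarrow> ('a0, 'c) ring_scheme \<Rightarrow> ('a, 'd) ring_scheme \<Rightarrow> ('a0 \<Rightarrow> 'a) \<Rightarrow>
      (nat \<Rightarrow> ((('a \<times> rat) \<Rightarrow>\<^sub>0 int) set list \<Rightarrow> (('a \<times> rat) \<Rightarrow>\<^sub>0 int) set) set) dg_ring" where
  "ghost_dg S A0 A i = ring.extend (power_ring S (de_rham_rat A0 A i))
    \<lparr>degree_part = (\<lambda>q. S \<rightarrow>\<^sub>E degree_part (de_rham_rat A0 A i) q),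
     differential = (\<lambda>x. \<lambda>m\<in>S. rat_form A0 A i \<one>\<^bsub>A\<^esub> (1 / of_nat m)
        \<otimes>\<^bsub>de_rham_rat A0 A i\<^esub> differential (de_rham_rat A0 A i) (x m))\<rparr>"

definition X_embed ::
    "nat set \<Rightarrow> ('a0, 'c) ring_scheme \<Rightarrow> ('a, 'd) ring_scheme \<Rightarrow> ('a0 \<Rightarrow> 'a) \<Rightarrow> (nat \<Rightarrow> 'a) \<Rightarrow>
      nat \<Rightarrow> ((('a \<times> rat) \<Rightarrow>\<^sub>0 int) set list \<Rightarrow> (('a \<times> rat) \<Rightarrow>\<^sub>0 int) set) set" where
  "X_embed S A0 A i x = (\<lambda>k\<in>S. rat_form A0 A i (x k) 1)"

definition X_dg ::
    "nat set \<Rightarrow> ('a0, 'c) ring_scheme \<Rightarrow> ('a, 'd) ring_scheme \<Rightarrow> ('a0 \<Rightarrow> 'a) \<Rightarrow>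
      (nat \<Rightarrow> ((('a \<times> rat) \<Rightarrow>\<^sub>0 int) set list \<Rightarrow> (('a \<times> rat) \<Rightarrow>\<^sub>0 int) set) set) dg_ring" where
  "X_dg S A0 A i = (ghost_dg S A0 A i)
    \<lparr>carrier := dg_subring_gen (ghost_dg S A0 A i) (X_embed S A0 A i ` X_ring S A)\<rparr>"

definition X_dg_ideal ::
    "nat set \<Rightarrow> ('a0, 'c) ring_scheme \<Rightarrow> ('a, 'd) ring_scheme \<Rightarrow> ('a0 \<Rightarrow> 'a) \<Rightarrow> 'a set \<Rightarrow>
      (nat \<Rightarrow> ((('a \<times> rat) \<Rightarrow>\<^sub>0 int) set list \<Rightarrow> (('a \<times> rat) \<Rightarrow>\<^sub>0 int) set) set) set" where
  "X_dg_ideal S A0 A i I = dg_ideal_gen (X_dg S A0 A i) (X_embed S A0 A i ` X_ideal S A I)"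

definition E_forms ::
    "nat set \<Rightarrow> ('a0, 'c) ring_scheme \<Rightarrow> ('a, 'd) ring_scheme \<Rightarrow> ('a0 \<Rightarrow> 'a) \<Rightarrow> 'a set \<Rightarrow>
      (nat \<Rightarrow> ((('a \<times> rat) \<Rightarrow>\<^sub>0 int) set list \<Rightarrow> (('a \<times> rat) \<Rightarrow>\<^sub>0 int) set) set) set ring" where
  "E_forms S A0 A i I = X_dg S A0 A i Quot X_dg_ideal S A0 A i I"

definition kernel_forms ::
    "('a0, 'c) ring_scheme \<Rightarrow> ('a, 'd) ring_scheme \<Rightarrow> ('a0 \<Rightarrow> 'a) \<Rightarrow> 'a set \<Rightarrow> ('a list \<Rightarrow> 'a) set set" where
  "kernel_forms A0 A i I = dg_ideal_gen (de_rham A0 A i) ((\<lambda>a. form A0 A i a []) ` I)"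

text \<open>A class in \<open>E_forms\<close> is represented by a family \<open>x\<close> of rational forms, whose components come
  from unique integral forms \<open>w\<close>; the \<open>k\<close>-th component of the result is the class of \<open>w\<close> modulo
  \<open>kernel_forms\<close>.\<close>

definition ghost_map_quot ::
    "nat set \<Rightarrow> ('a0, 'c) ring_scheme \<Rightarrow> ('a, 'd) ring_scheme \<Rightarrow> ('a0 \<Rightarrow> 'a) \<Rightarrow> 'a set \<Rightarrow>
      (nat \<Rightarrow> ((('a \<times> rat) \<Rightarrow>\<^sub>0 int) set list \<Rightarrow> (('a \<times> rat) \<Rightarrow>\<^sub>0 int) set) set) set \<Rightarrow>
      nat \<Rightarrow> ('a list \<Rightarrow> 'a) set set" where
  "ghost_map_quot S A0 A i I c = (\<lambda>k\<in>S. the_elem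
     {kernel_forms A0 A i I +>\<^bsub>de_rham A0 A i\<^esub> w | w x.
        x \<in> c \<and> w \<in> carrier (de_rham A0 A i) \<and> de_rham_to_rat A0 A i w = x k})"

text \<open>The ghost map of the presentation, with values in forms on \<open>R\<close> over \<open>R0\<close>; the last step is the
  isomorphism from forms on \<open>A\<close> modulo \<open>kernel_forms\<close> to forms on \<open>R\<close> that \<open>\<pi>\<close> induces.\<close>

definition ghost_map ::
    "nat set \<Rightarrow> ('r0, 'c) ring_scheme \<Rightarrow> ('r, 'd) ring_scheme \<Rightarrow> ('r0 \<Rightarrow> 'r) \<Rightarrow>
      ('a0, 'e) ring_scheme \<Rightarrow> ('a, 'g) ring_scheme \<Rightarrow> ('a0 \<Rightarrow> 'a) \<Rightarrow> ('a \<Rightarrow> 'r) \<Rightarrow>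
      (nat \<Rightarrow> ((('a \<times> rat) \<Rightarrow>\<^sub>0 int) set list \<Rightarrow> (('a \<times> rat) \<Rightarrow>\<^sub>0 int) set) set) set \<Rightarrow>
      nat \<Rightarrow> ('r list \<Rightarrow> 'r) set" where
  "ghost_map S R0 R f A0 A i \<pi> c = (\<lambda>k\<in>S. the_elem
     (de_rham_map A R0 R f \<pi> ` ghost_map_quot S A0 A i (a_kernel A R \<pi>) c k))"

end

theory Submission
  imports Defs
begin

text \<open>
Why the theorem holds.  All maps on forms come from one universal property, \<open>de_rham_universal\<close>: a homomorphism of
\<open>B\<close> to an arbitrary ring and a derivation along it, with values of square zero that commute with \<open>B\<close>, extend to
the forms on \<open>B\<close>.  Triangular matrices as the target give the differential with its Leibniz rule
(\<open>differential_exists\<close>); endomorphisms of an exterior algebra show that forms on polynomial rings and on smooth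
algebras have no torsion (\<open>no_torsion\<close>, \<open>smooth_forms_torsion_free\<close>); the tensor product of forms with \<open>\<rat>\<close> shows
that integral forms embed into rational ones (\<open>to_rat_inj\<close>); the forms themselves give the normalized Frobenius \<open>N\<close>,
which is a homomorphism of rings with \<open>d N = p N d\<close> (\<open>normalized_frobenius_props\<close>).

Let \<open>dwork n \<omega>\<close> denote the congruences \<open>N \<omega>\<^sub>k \<equiv> \<omega>\<^sub>k\<^sub>+\<^sub>1\<close> modulo \<open>p\<^bsup>k+1\<^esup>\<Omega> + d\<Omega>\<close>.  Applying \<open>d\<close> to them
shows inductively that \<open>d\<omega>\<^sub>k\<close> is divisible by \<open>p\<^sup>k\<close>.  Therefore the error terms of a product are again exact modulo
\<open>p\<^bsup>k+1\<^esup>\<close>, and the families with these congruences form a ring that is closed under the divided differential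
(\<open>dwork_mult\<close>, \<open>dwork_divided_differential\<close>).  It contains the images of the \<open>V\<^sub>m\<langle>a\<rangle>\<close>, because
\<open>\<phi>(a)\<close> and \<open>a\<^sup>p\<close> have \<open>p\<^sup>i\<close>-th powers that are congruent modulo \<open>p\<^bsup>i+1\<^esup>\<close> (\<open>dwork_Verschiebung\<close>).  As the
differential graded ring of the presentation is generated by the \<open>V\<^sub>m\<langle>a\<rangle>\<close>, all its elements have integral components
whose images on \<open>R\<close> satisfy the congruences (\<open>Xc_T\<close>), and (i) implies (ii).

For the converse, a family with the congruences is matched component by component (\<open>ghost_family_below\<close>).  If
two such families agree below \<open>k\<close>, then their components at \<open>k\<close> differ by an element of \<open>p\<^sup>k\<Omega> + d\<Omega>\<close>
(\<open>dwork_difference\<close>).  Each such element is the component at \<open>k\<close> of a ghost family that vanishes below: with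
\<open>V = V\<^sub>m\<close> for \<open>m = p\<^sup>k\<close> and the divided differential, the products of \<open>V\<langle>b\<rangle>\<close> or \<open>dV\<langle>b\<rangle>\<close> with \<open>dV\<langle>b\<^sub>1\<rangle>, \<dots>, dV\<langle>b\<^sub>q\<rangle>\<close> vanish below
\<open>k\<close> and have the components \<open>p\<^sup>k b db\<^sub>1 \<dots> db\<^sub>q\<close> and \<open>db db\<^sub>1 \<dots> db\<^sub>q\<close> at \<open>k\<close> (\<open>realizable_exact\<close>).

These computations take place in families of forms on \<open>A\<close>.  They determine the ghost map on classes because elements of the
ideal have components in \<open>I\<^sup>\<bullet>\<close> (\<open>XI_facts\<close>, \<open>ghost_map_class\<close>): the families in \<open>I\<^sup>\<bullet>\<close> whose divided
differential is also in \<open>I\<^sup>\<bullet>\<close> are closed under all operations, and they contain the generators.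
\<close>

section \<open>Additive maps and rings with equal operations\<close>

lemma additive_mapI:
  assumes "abelian_group G" "abelian_group H"
    and "\<And>x. x \<in> carrier G \<Longrightarrow> h x \<in> carrier H"
    and "\<And>x y. x \<in> carrier G \<Longrightarrow> y \<in> carrier G \<Longrightarrow> h (x \<oplus>\<^bsub>G\<^esub> y) = h x \<oplus>\<^bsub>H\<^esub> h y"
  shows "abelian_group_hom G H h"
proof (rule abelian_group_homI[OF assms(1,2)])
  interpret G: abelian_group G by fact
  interpret H: abelian_group H by fact
  show "group_hom (add_monoid G) (add_monoid H) h"
    using assms(3,4) by (intro group_hom.intro group_hom_axioms.intro)
      (auto simp: hom_def G.a_group H.a_group)
qed

lemma additive_map_of_ring_hom:
  assumes "ring R" "ring S" "h \<in> ring_hom R S"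
  shows "abelian_group_hom R S h"
  using assms by (intro additive_mapI) (auto simp: ring_hom_def ring.is_abelian_group)

context abelian_group_hom
begin

lemma hom_finsum:
  assumes "g \<in> Z \<rightarrow> carrier G"
  shows "h (finsum G g Z) = finsum H (\<lambda>x. h (g x)) Z"
  using assms
proof (induction Z rule: infinite_finite_induct)
  case (insert x Z)
  then show ?case by (auto simp: Pi_def)
qed auto

lemma hom_add_pow:
  assumes "x \<in> carrier G"
  shows "h ([(n::nat)] \<cdot>\<^bsub>G\<^esub> x) = [n] \<cdot>\<^bsub>H\<^esub> h x"
  using assms by (induction n) auto

lemma hom_minus:
  assumes "x \<in> carrier G" "y \<in> carrier G"
  shows "h (x \<ominus>\<^bsub>G\<^esub> y) = h x \<ominus>\<^bsub>H\<^esub> h y"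
  using assms by (simp add: a_minus_def)

end

lemma ring_cong_ops:
  assumes "ring R" "carrier S = carrier R" "monoid.mult S = monoid.mult R" "\<one>\<^bsub>S\<^esub> = \<one>\<^bsub>R\<^esub>"
    "\<zero>\<^bsub>S\<^esub> = \<zero>\<^bsub>R\<^esub>" "ring.add S = ring.add R"
  shows "ring S"
proof -
  interpret ring R by fact
  have ag: "abelian_group S"
  proof (rule abelian_groupI)
    fix x assume "x \<in> carrier S"
    then show "\<exists>y\<in>carrier S. y \<oplus>\<^bsub>S\<^esub> x = \<zero>\<^bsub>S\<^esub>"
      using assms l_neg a_inv_closed by metis
  qed (unfold assms, auto simp: a_ac)
  have "Group.monoid S"
    by (rule monoidI) (unfold assms, auto simp: m_assoc)
  then show ?thesis
    by (rule ringI[OF ag]) (unfold assms, auto simp: l_distr r_distr)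
qed

lemma (in abelian_monoid) finsum_induct:
  assumes "P \<zero>" "\<And>x. x \<in> Z \<Longrightarrow> g x \<in> carrier G \<and> P (g x)"
    and "\<And>a b. a \<in> carrier G \<Longrightarrow> b \<in> carrier G \<Longrightarrow> P a \<Longrightarrow> P b \<Longrightarrow> P (a \<oplus> b)"
  shows "P (finsum G g Z)"
  using assms(2)
proof (induction Z rule: infinite_finite_induct)
  case (insert x Z)
  then have "g \<in> Z \<rightarrow> carrier G" "g x \<in> carrier G" "P (g x)" "P (finsum G g Z)" by auto
  then show ?case using insert.hyps assms(3)[of "g x" "finsum G g Z"] by simp
qed (auto simp: assms(1))

section \<open>Monoid rings\<close>

locale monoid_algebra = K: cring K + M: monoid M for K :: "('k, 'c) ring_scheme" (structure)
  and M :: "('m, 'd) monoid_scheme"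
begin

abbreviation (input) KM where "KM \<equiv> monoid_ring K M"

abbreviation supp :: "('m \<Rightarrow> 'k) \<Rightarrow> 'm set" where "supp s \<equiv> {m. s m \<noteq> \<zero>}"

lemma carrier_KM: "s \<in> carrier KM \<longleftrightarrow> (\<forall>m. s m \<in> carrier K) \<and> finite (supp s) \<and> supp s \<subseteq> carrier M"
  by (simp add: monoid_ring_def)

lemma coeff_closed [simp]: "s \<in> carrier KM \<Longrightarrow> s m \<in> carrier K"
  by (simp add: carrier_KM)

lemma zero_KM: "\<zero>\<^bsub>KM\<^esub> = (\<lambda>m. \<zero>)" by (simp only: monoid_ring_def ring.simps)
lemma add_KM: "s \<oplus>\<^bsub>KM\<^esub> t = (\<lambda>m. s m \<oplus> t m)" by (simp only: monoid_ring_def ring.simps)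
lemma one_KM: "\<one>\<^bsub>KM\<^esub> = mr_monom K \<one> \<one>\<^bsub>M\<^esub>" by (simp only: monoid_ring_def monoid.simps mr_monom_def)

lemma monom_closed [simp]:
  assumes "a \<in> carrier K" "m \<in> carrier M"
  shows "mr_monom K a m \<in> carrier KM"
proof -
  have "supp (mr_monom K a m) \<subseteq> {m}" by (auto simp: mr_monom_def)
  then show ?thesis using assms unfolding carrier_KM by (auto simp: mr_monom_def finite_subset)
qed

lemma add_closed:
  assumes "s \<in> carrier KM" "t \<in> carrier KM"
  shows "s \<oplus>\<^bsub>KM\<^esub> t \<in> carrier KM"
proof -
  have "supp (\<lambda>m. s m \<oplus> t m) \<subseteq> supp s \<union> supp t" by auto
  moreover have "finite (supp s \<union> supp t)" "supp s \<union> supp t \<subseteq> carrier M"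
    using assms by (auto simp: carrier_KM)
  ultimately have "finite (supp (\<lambda>m. s m \<oplus> t m)) \<and> supp (\<lambda>m. s m \<oplus> t m) \<subseteq> carrier M"
    by (meson finite_subset subset_trans)
  then show ?thesis using assms by (simp add: carrier_KM add_KM)
qed

lemma uminus_closed:
  assumes "s \<in> carrier KM"
  shows "(\<lambda>m. \<ominus> s m) \<in> carrier KM"
proof -
  have "supp (\<lambda>m. \<ominus> s m) \<subseteq> supp s" by auto
  then show ?thesis using assms by (auto simp: carrier_KM intro: finite_subset)
qed

lemma abelian_group_KM: "abelian_group KM"
proof (rule abelian_groupI)
  fix s assume s: "s \<in> carrier KM"
  show "\<exists>t\<in>carrier KM. t \<oplus>\<^bsub>KM\<^esub> s = \<zero>\<^bsub>KM\<^esub>"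
    by (rule bexI[OF _ uminus_closed[OF s]]) (use s in \<open>simp add: add_KM zero_KM K.l_neg\<close>)
next
  fix s t r assume "s \<in> carrier KM" "t \<in> carrier KM" "r \<in> carrier KM"
  then show "s \<oplus>\<^bsub>KM\<^esub> t \<oplus>\<^bsub>KM\<^esub> r = s \<oplus>\<^bsub>KM\<^esub> (t \<oplus>\<^bsub>KM\<^esub> r)"
    by (simp add: add_KM K.a_assoc)
next
  fix s t assume "s \<in> carrier KM" "t \<in> carrier KM"
  then show "s \<oplus>\<^bsub>KM\<^esub> t = t \<oplus>\<^bsub>KM\<^esub> s" by (simp add: add_KM K.a_comm)
next
  fix s assume "s \<in> carrier KM"
  then show "\<zero>\<^bsub>KM\<^esub> \<oplus>\<^bsub>KM\<^esub> s = s" by (simp add: add_KM zero_KM)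
next
  show "\<zero>\<^bsub>KM\<^esub> \<in> carrier KM" by (simp add: carrier_KM zero_KM)
qed (fact add_closed)

sublocale KM: abelian_group "monoid_ring K M" by (rule abelian_group_KM)

lemma coeff_hom: "abelian_group_hom KM K (\<lambda>s. s m)"
  by (rule additive_mapI) (auto simp: add_KM K.abelian_group_axioms KM.abelian_group_axioms)

lemma finsum_coeff:
  assumes "g \<in> Z \<rightarrow> carrier KM"
  shows "(finsum KM g Z) m = (\<Oplus>x\<in>Z. g x m)"
  using abelian_group_hom.hom_finsum[OF coeff_hom assms] .

lemma sum_of_terms:
  assumes s: "s \<in> carrier KM"
  shows "s = (\<Oplus>\<^bsub>KM\<^esub>m\<in>supp s. mr_monom K (s m) m)"
proof
  fix x
  have mem: "(\<lambda>m. mr_monom K (s m) m) \<in> supp s \<rightarrow> carrier KM"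
    using s by (auto simp: carrier_KM intro!: monom_closed)
  have "(\<Oplus>m\<in>supp s. mr_monom K (s m) m x) = (\<Oplus>m\<in>{x} \<inter> supp s. s m)"
    by (rule K.add.finprod_mono_neutral_cong_right)
      (use s in \<open>auto simp: mr_monom_def carrier_KM\<close>)
  also have "\<dots> = s x" using s by (cases "s x = \<zero>") (auto simp: Pi_def)
  finally show "s x = (\<Oplus>\<^bsub>KM\<^esub>m\<in>supp s. mr_monom K (s m) m) x"
    by (simp add: finsum_coeff[OF mem])
qed

lemma induct_terms [consumes 1, case_names zero monom add]:
  assumes s: "s \<in> carrier KM"
    and "P \<zero>\<^bsub>KM\<^esub>"
    and "\<And>a m. a \<in> carrier K \<Longrightarrow> m \<in> carrier M \<Longrightarrow> s m \<noteq> \<zero> \<Longrightarrow> P (mr_monom K a m)"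
    and "\<And>x y. x \<in> carrier KM \<Longrightarrow> y \<in> carrier KM \<Longrightarrow> P x \<Longrightarrow> P y \<Longrightarrow> P (x \<oplus>\<^bsub>KM\<^esub> y)"
  shows "P s"
proof -
  have "P (\<Oplus>\<^bsub>KM\<^esub>m\<in>supp s. mr_monom K (s m) m)"
  proof (rule KM.finsum_induct[where P = P])
    fix m assume "m \<in> supp s"
    then have m: "s m \<in> carrier K" "m \<in> carrier M" "s m \<noteq> \<zero>"
      using s by (auto simp: carrier_KM)
    show "mr_monom K (s m) m \<in> carrier KM \<and> P (mr_monom K (s m) m)"
      using assms(3)[OF m] monom_closed[OF m(1,2)] by blast
  qed (fact assms(2), fact assms(4))
  then show ?thesis using sum_of_terms[OF s] by simp
qed

text \<open>The convolution may be summed over any finite sets that contain the supports; this makes it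
  visibly bilinear.\<close>

lemma mult_coeff:
  assumes s: "s \<in> carrier KM" and t: "t \<in> carrier KM"
    and Z: "finite Z" "supp s \<subseteq> Z" and Y: "finite Y" "supp t \<subseteq> Y"
  shows "(s \<otimes>\<^bsub>KM\<^esub> t) m = (\<Oplus>w\<in>Z \<times> Y. if fst w \<otimes>\<^bsub>M\<^esub> snd w = m then s (fst w) \<otimes> t (snd w) else \<zero>)"
proof -
  have "(s \<otimes>\<^bsub>KM\<^esub> t) m
      = (\<Oplus>w\<in>{(u, v). s u \<noteq> \<zero> \<and> t v \<noteq> \<zero> \<and> u \<otimes>\<^bsub>M\<^esub> v = m}. case w of (u, v) \<Rightarrow> s u \<otimes> t v)"
    by (simp only: monoid_ring_def monoid.simps)
  also have "\<dots> = (\<Oplus>w\<in>Z \<times> Y. if fst w \<otimes>\<^bsub>M\<^esub> snd w = m then s (fst w) \<otimes> t (snd w) else \<zero>)"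
    by (rule K.add.finprod_mono_neutral_cong_left)
      (use Z Y s t in \<open>auto simp: split: prod.splits\<close>)
  finally show ?thesis .
qed

lemma mult_closed:
  assumes s: "s \<in> carrier KM" and t: "t \<in> carrier KM"
  shows "s \<otimes>\<^bsub>KM\<^esub> t \<in> carrier KM"
proof -
  let ?S = "supp s \<times> supp t"
  have fin: "finite (supp s)" "finite (supp t)" using s t by (auto simp: carrier_KM)
  note mc = mult_coeff[OF s t fin(1) order_refl fin(2) order_refl]
  have "supp (s \<otimes>\<^bsub>KM\<^esub> t) \<subseteq> (\<lambda>w. fst w \<otimes>\<^bsub>M\<^esub> snd w) ` ?S"
  proof (rule subsetI, rule ccontr)
    fix m assume m: "m \<in> supp (s \<otimes>\<^bsub>KM\<^esub> t)" "m \<notin> (\<lambda>w. fst w \<otimes>\<^bsub>M\<^esub> snd w) ` ?S"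
    have "(s \<otimes>\<^bsub>KM\<^esub> t) m = \<zero>" unfolding mc by (rule K.add.finprod_one_eqI) (use m(2) in auto)
    then show False using m(1) by simp
  qed
  moreover have "(\<lambda>w. fst w \<otimes>\<^bsub>M\<^esub> snd w) ` ?S \<subseteq> carrier M"
    using s t by (auto simp: carrier_KM intro!: M.m_closed)
  moreover have "(s \<otimes>\<^bsub>KM\<^esub> t) m \<in> carrier K" for m
    unfolding mc by (rule K.finsum_closed) (use s t in auto)
  ultimately show ?thesis using fin unfolding carrier_KM
    by (meson finite_SigmaI finite_imageI finite_subset subset_trans)
qed

lemma mult_l_distr:
  assumes "s \<in> carrier KM" "t \<in> carrier KM" "r \<in> carrier KM"
  shows "(s \<oplus>\<^bsub>KM\<^esub> t) \<otimes>\<^bsub>KM\<^esub> r = s \<otimes>\<^bsub>KM\<^esub> r \<oplus>\<^bsub>KM\<^esub> t \<otimes>\<^bsub>KM\<^esub> r"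
proof
  fix m
  let ?Z = "supp s \<union> supp t" and ?Y = "supp r"
  have f: "finite ?Z" "finite ?Y" using assms by (auto simp: carrier_KM)
  have 1: "supp (s \<oplus>\<^bsub>KM\<^esub> t) \<subseteq> ?Z" by (auto simp: add_KM)
  let ?g = "\<lambda>s w. if fst w \<otimes>\<^bsub>M\<^esub> snd w = m then s (fst w) \<otimes> r (snd w) else \<zero>"
  have "((s \<oplus>\<^bsub>KM\<^esub> t) \<otimes>\<^bsub>KM\<^esub> r) m = (\<Oplus>w\<in>?Z \<times> ?Y. ?g (s \<oplus>\<^bsub>KM\<^esub> t) w)"
    by (rule mult_coeff) (use assms f 1 in \<open>auto simp: add_closed\<close>)
  also have "\<dots> = (\<Oplus>w\<in>?Z \<times> ?Y. ?g s w \<oplus> ?g t w)"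
    by (rule K.finsum_cong') (use assms in \<open>auto simp: add_KM K.l_distr\<close>)
  also have "\<dots> = (\<Oplus>w\<in>?Z \<times> ?Y. ?g s w) \<oplus> (\<Oplus>w\<in>?Z \<times> ?Y. ?g t w)"
    by (rule K.finsum_addf) (use assms in auto)
  also have "(\<Oplus>w\<in>?Z \<times> ?Y. ?g s w) = (s \<otimes>\<^bsub>KM\<^esub> r) m"
    by (rule mult_coeff[symmetric]) (use assms f in auto)
  also have "(\<Oplus>w\<in>?Z \<times> ?Y. ?g t w) = (t \<otimes>\<^bsub>KM\<^esub> r) m"
    by (rule mult_coeff[symmetric]) (use assms f in auto)
  finally show "((s \<oplus>\<^bsub>KM\<^esub> t) \<otimes>\<^bsub>KM\<^esub> r) m = (s \<otimes>\<^bsub>KM\<^esub> r \<oplus>\<^bsub>KM\<^esub> t \<otimes>\<^bsub>KM\<^esub> r) m"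
    by (simp add: add_KM)
qed

lemma mult_r_distr:
  assumes "s \<in> carrier KM" "t \<in> carrier KM" "r \<in> carrier KM"
  shows "r \<otimes>\<^bsub>KM\<^esub> (s \<oplus>\<^bsub>KM\<^esub> t) = r \<otimes>\<^bsub>KM\<^esub> s \<oplus>\<^bsub>KM\<^esub> r \<otimes>\<^bsub>KM\<^esub> t"
proof
  fix m
  let ?Z = "supp s \<union> supp t" and ?Y = "supp r"
  have f: "finite ?Z" "finite ?Y" using assms by (auto simp: carrier_KM)
  have 1: "supp (s \<oplus>\<^bsub>KM\<^esub> t) \<subseteq> ?Z" by (auto simp: add_KM)
  let ?g = "\<lambda>s w. if fst w \<otimes>\<^bsub>M\<^esub> snd w = m then r (fst w) \<otimes> s (snd w) else \<zero>"
  have "(r \<otimes>\<^bsub>KM\<^esub> (s \<oplus>\<^bsub>KM\<^esub> t)) m = (\<Oplus>w\<in>?Y \<times> ?Z. ?g (s \<oplus>\<^bsub>KM\<^esub> t) w)"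
    by (rule mult_coeff) (use assms f 1 in \<open>auto simp: add_closed\<close>)
  also have "\<dots> = (\<Oplus>w\<in>?Y \<times> ?Z. ?g s w \<oplus> ?g t w)"
    by (rule K.finsum_cong') (use assms in \<open>auto simp: add_KM K.r_distr\<close>)
  also have "\<dots> = (\<Oplus>w\<in>?Y \<times> ?Z. ?g s w) \<oplus> (\<Oplus>w\<in>?Y \<times> ?Z. ?g t w)"
    by (rule K.finsum_addf) (use assms in auto)
  also have "(\<Oplus>w\<in>?Y \<times> ?Z. ?g s w) = (r \<otimes>\<^bsub>KM\<^esub> s) m"
    by (rule mult_coeff[symmetric]) (use assms f in auto)
  also have "(\<Oplus>w\<in>?Y \<times> ?Z. ?g t w) = (r \<otimes>\<^bsub>KM\<^esub> t) m"
    by (rule mult_coeff[symmetric]) (use assms f in auto)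
  finally show "(r \<otimes>\<^bsub>KM\<^esub> (s \<oplus>\<^bsub>KM\<^esub> t)) m = (r \<otimes>\<^bsub>KM\<^esub> s \<oplus>\<^bsub>KM\<^esub> r \<otimes>\<^bsub>KM\<^esub> t) m"
    by (simp add: add_KM)
qed

lemma monom_mult:
  assumes "a \<in> carrier K" "b \<in> carrier K" "u \<in> carrier M" "v \<in> carrier M"
  shows "mr_monom K a u \<otimes>\<^bsub>KM\<^esub> mr_monom K b v = mr_monom K (a \<otimes> b) (u \<otimes>\<^bsub>M\<^esub> v)"
proof
  fix m
  have "(mr_monom K a u \<otimes>\<^bsub>KM\<^esub> mr_monom K b v) m = (\<Oplus>w\<in>{u} \<times> {v}. if fst w \<otimes>\<^bsub>M\<^esub> snd w = m
      then mr_monom K a u (fst w) \<otimes> mr_monom K b v (snd w) else \<zero>)"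
    by (rule mult_coeff[OF monom_closed monom_closed]) (use assms in \<open>auto simp: mr_monom_def\<close>)
  also have "\<dots> = mr_monom K (a \<otimes> b) (u \<otimes>\<^bsub>M\<^esub> v) m"
    using assms by (simp add: mr_monom_def)
  finally show "(mr_monom K a u \<otimes>\<^bsub>KM\<^esub> mr_monom K b v) m = mr_monom K (a \<otimes> b) (u \<otimes>\<^bsub>M\<^esub> v) m" .
qed

lemma monom_add:
  assumes "a \<in> carrier K" "b \<in> carrier K"
  shows "mr_monom K a u \<oplus>\<^bsub>KM\<^esub> mr_monom K b u = mr_monom K (a \<oplus> b) u"
  using assms by (auto simp: add_KM mr_monom_def)

lemma monom_zero: "mr_monom K \<zero> u = \<zero>\<^bsub>KM\<^esub>"
  by (auto simp: zero_KM mr_monom_def)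

lemma mult_zero:
  assumes "s \<in> carrier KM"
  shows "\<zero>\<^bsub>KM\<^esub> \<otimes>\<^bsub>KM\<^esub> s = \<zero>\<^bsub>KM\<^esub>" "s \<otimes>\<^bsub>KM\<^esub> \<zero>\<^bsub>KM\<^esub> = \<zero>\<^bsub>KM\<^esub>"
proof -
  have fin: "finite (supp s)" using assms by (simp add: carrier_KM)
  have sz: "supp \<zero>\<^bsub>KM\<^esub> \<subseteq> {}" by (auto simp: zero_KM)
  show "\<zero>\<^bsub>KM\<^esub> \<otimes>\<^bsub>KM\<^esub> s = \<zero>\<^bsub>KM\<^esub>"
    using mult_coeff[OF KM.zero_closed assms finite.emptyI sz fin order_refl]
    by (auto simp: zero_KM)
  show "s \<otimes>\<^bsub>KM\<^esub> \<zero>\<^bsub>KM\<^esub> = \<zero>\<^bsub>KM\<^esub>"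
    using mult_coeff[OF assms KM.zero_closed fin order_refl finite.emptyI sz]
    by (auto simp: zero_KM)
qed

lemma mult_assoc:
  assumes s: "s \<in> carrier KM" and t: "t \<in> carrier KM" and r: "r \<in> carrier KM"
  shows "(s \<otimes>\<^bsub>KM\<^esub> t) \<otimes>\<^bsub>KM\<^esub> r = s \<otimes>\<^bsub>KM\<^esub> (t \<otimes>\<^bsub>KM\<^esub> r)"
  using s
proof (induction rule: induct_terms)
  case zero
  then show ?case using t r by (simp add: mult_zero mult_closed)
next
  case (add x y)
  then show ?case using t r by (simp add: mult_l_distr mult_closed)
next
  case (monom a u)
  note au = monom
  show ?case using t
  proof (induction rule: induct_terms)
    case zero
    then show ?case using au r by (simp add: mult_zero mult_closed)
  next
    case (add x y)
    then show ?case using au r by (simp add: mult_l_distr mult_r_distr mult_closed)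
  next
    case (monom b v)
    note bv = monom
    show ?case using r
    proof (induction rule: induct_terms)
      case zero
      then show ?case using au bv by (simp add: mult_zero mult_closed)
    next
      case (add x y)
      then show ?case using au bv by (simp add: mult_r_distr mult_closed)
    next
      case (monom c w)
      then show ?case using au bv by (simp add: monom_mult K.m_assoc M.m_assoc)
    qed
  qed
qed

lemma ring_KM: "ring KM"
proof (rule ringI[OF abelian_group_KM])
  show "Group.monoid KM"
  proof (rule monoidI)
    show "\<one>\<^bsub>KM\<^esub> \<in> carrier KM" by (simp add: one_KM)
    fix s assume s: "s \<in> carrier KM"
    then show "\<one>\<^bsub>KM\<^esub> \<otimes>\<^bsub>KM\<^esub> s = s"
      by (induction rule: induct_terms)
        (auto simp: one_KM mult_zero monom_mult mult_r_distr)
    from s show "s \<otimes>\<^bsub>KM\<^esub> \<one>\<^bsub>KM\<^esub> = s"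
      by (induction rule: induct_terms)
        (auto simp: one_KM mult_zero monom_mult mult_l_distr)
  qed (auto simp: mult_closed mult_assoc)
qed (auto simp: mult_l_distr mult_r_distr)

lemma cring_KM:
  assumes "comm_monoid M"
  shows "cring KM"
proof -
  interpret comm_monoid M by fact
  have "s \<otimes>\<^bsub>KM\<^esub> t = t \<otimes>\<^bsub>KM\<^esub> s" if s: "s \<in> carrier KM" and t: "t \<in> carrier KM" for s t
    using s
  proof (induction rule: induct_terms)
    case (monom a u)
    note au = monom
    show ?case using t
      by (induction rule: induct_terms)
        (use au in \<open>auto simp: mult_zero monom_mult mult_l_distr mult_r_distr K.m_comm m_comm\<close>)
  qed (use t in \<open>auto simp: mult_zero mult_l_distr mult_r_distr\<close>)
  then show ?thesis
    by (intro cring.intro ring_KM monoid.monoid_comm_monoidI ring.is_monoid) auto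
qed

text \<open>A ring homomorphism on the coefficients and a monoid homomorphism with commuting images extend
  to the monoid ring.\<close>

theorem monoid_ring_universal:
  assumes "ring E" and u: "u \<in> ring_hom K E"
    and \<chi>: "\<And>m. m \<in> carrier M \<Longrightarrow> \<chi> m \<in> carrier E" "\<chi> \<one>\<^bsub>M\<^esub> = \<one>\<^bsub>E\<^esub>"
      "\<And>m n. m \<in> carrier M \<Longrightarrow> n \<in> carrier M \<Longrightarrow> \<chi> (m \<otimes>\<^bsub>M\<^esub> n) = \<chi> m \<otimes>\<^bsub>E\<^esub> \<chi> n"
    and comm: "\<And>a m. a \<in> carrier K \<Longrightarrow> m \<in> carrier M \<Longrightarrow> u a \<otimes>\<^bsub>E\<^esub> \<chi> m = \<chi> m \<otimes>\<^bsub>E\<^esub> u a"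
  obtains h where "h \<in> ring_hom KM E"
    "\<And>a m. a \<in> carrier K \<Longrightarrow> m \<in> carrier M \<Longrightarrow> h (mr_monom K a m) = u a \<otimes>\<^bsub>E\<^esub> \<chi> m"
proof -
  interpret E: ring E by fact
  have uc [simp]: "u a \<in> carrier E" if "a \<in> carrier K" for a using u that by (rule ring_hom_closed)
  have u0: "u \<zero> = \<zero>\<^bsub>E\<^esub>" by (rule ring_hom_zero[OF u K.ring_axioms E.ring_axioms])
  define h where "h s = (\<Oplus>\<^bsub>E\<^esub>m\<in>supp s. u (s m) \<otimes>\<^bsub>E\<^esub> \<chi> m)" for s
  have h_sup: "h s = (\<Oplus>\<^bsub>E\<^esub>m\<in>Z. u (s m) \<otimes>\<^bsub>E\<^esub> \<chi> m)"
    if "s \<in> carrier KM" "finite Z" "supp s \<subseteq> Z" "Z \<subseteq> carrier M" for s Z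
    unfolding h_def by (rule E.add.finprod_mono_neutral_cong_left)
      (use that \<chi>(1) in \<open>auto simp: u0 subset_iff\<close>)
  have h_closed: "h s \<in> carrier E" if "s \<in> carrier KM" for s
    unfolding h_def by (rule E.finsum_closed) (use that \<chi>(1) in \<open>auto simp: carrier_KM\<close>)
  have h_monom: "h (mr_monom K a m) = u a \<otimes>\<^bsub>E\<^esub> \<chi> m" if "a \<in> carrier K" "m \<in> carrier M" for a m
  proof -
    have "h (mr_monom K a m) = (\<Oplus>\<^bsub>E\<^esub>x\<in>{m}. u (mr_monom K a m x) \<otimes>\<^bsub>E\<^esub> \<chi> x)"
      by (rule h_sup) (use that in \<open>auto simp: mr_monom_def[of K a m]\<close>, auto simp: carrier_KM)
    then show ?thesis using that \<chi>(1) by (simp add: mr_monom_def)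
  qed
  have h_add: "h (s \<oplus>\<^bsub>KM\<^esub> t) = h s \<oplus>\<^bsub>E\<^esub> h t" if s: "s \<in> carrier KM" and t: "t \<in> carrier KM" for s t
  proof -
    let ?Z = "supp s \<union> supp t"
    have Z: "finite ?Z" "?Z \<subseteq> carrier M" using s t by (auto simp: carrier_KM)
    have "h (s \<oplus>\<^bsub>KM\<^esub> t) = (\<Oplus>\<^bsub>E\<^esub>m\<in>?Z. u ((s \<oplus>\<^bsub>KM\<^esub> t) m) \<otimes>\<^bsub>E\<^esub> \<chi> m)"
      by (rule h_sup) (use Z s t in \<open>auto simp: add_closed, auto simp: add_KM\<close>)
    also have "\<dots> = (\<Oplus>\<^bsub>E\<^esub>m\<in>?Z. u (s m) \<otimes>\<^bsub>E\<^esub> \<chi> m \<oplus>\<^bsub>E\<^esub> u (t m) \<otimes>\<^bsub>E\<^esub> \<chi> m)"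
      by (rule E.finsum_cong')
        (use Z s t \<chi>(1) in \<open>auto simp: add_KM ring_hom_add[OF u] subset_iff E.l_distr\<close>)
    also have "\<dots> = (\<Oplus>\<^bsub>E\<^esub>m\<in>?Z. u (s m) \<otimes>\<^bsub>E\<^esub> \<chi> m) \<oplus>\<^bsub>E\<^esub> (\<Oplus>\<^bsub>E\<^esub>m\<in>?Z. u (t m) \<otimes>\<^bsub>E\<^esub> \<chi> m)"
      by (rule E.finsum_addf) (use Z s t \<chi>(1) in \<open>auto simp: subset_iff\<close>)
    also have "\<dots> = h s \<oplus>\<^bsub>E\<^esub> h t" using h_sup[OF s Z(1) _ Z(2)] h_sup[OF t Z(1) _ Z(2)] by simp
    finally show ?thesis .
  qed
  have h0: "h \<zero>\<^bsub>KM\<^esub> = \<zero>\<^bsub>E\<^esub>" by (simp add: h_def zero_KM)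
  have h_mult: "h (s \<otimes>\<^bsub>KM\<^esub> t) = h s \<otimes>\<^bsub>E\<^esub> h t" if s: "s \<in> carrier KM" and t: "t \<in> carrier KM" for s t
    using s
  proof (induction rule: induct_terms)
    case (monom a m)
    note am = monom
    show ?case using t
    proof (induction rule: induct_terms)
      case (monom b n)
      have mn [simp]: "\<chi> m \<in> carrier E" "\<chi> n \<in> carrier E" using am monom \<chi> by auto
      have "u (a \<otimes> b) \<otimes>\<^bsub>E\<^esub> \<chi> (m \<otimes>\<^bsub>M\<^esub> n) = u a \<otimes>\<^bsub>E\<^esub> ((u b \<otimes>\<^bsub>E\<^esub> \<chi> m) \<otimes>\<^bsub>E\<^esub> \<chi> n)"
        using am monom \<chi> by (simp add: ring_hom_mult[OF u] E.m_assoc)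
      also have "u b \<otimes>\<^bsub>E\<^esub> \<chi> m = \<chi> m \<otimes>\<^bsub>E\<^esub> u b" using am monom comm by simp
      also have "u a \<otimes>\<^bsub>E\<^esub> ((\<chi> m \<otimes>\<^bsub>E\<^esub> u b) \<otimes>\<^bsub>E\<^esub> \<chi> n) = (u a \<otimes>\<^bsub>E\<^esub> \<chi> m) \<otimes>\<^bsub>E\<^esub> (u b \<otimes>\<^bsub>E\<^esub> \<chi> n)"
        using am monom by (simp add: E.m_assoc)
      finally show ?case using am monom by (simp add: monom_mult h_monom)
    qed (use am in \<open>auto simp: mult_zero h0 h_closed mult_r_distr h_add mult_closed E.r_distr\<close>)
  qed (use t in \<open>auto simp: mult_zero h0 h_closed mult_l_distr h_add mult_closed E.l_distr\<close>)
  have "h \<in> ring_hom KM E"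
    by (rule ring_hom_memI)
      (auto simp: h_closed h_mult h_add one_KM h_monom \<chi> ring_hom_one[OF u])
  then show thesis using that h_monom by blast
qed

end

section \<open>Homomorphisms out of quotients and sums of square zero\<close>

lemma (in ideal) quotient_hom:
  assumes "ring S" and h: "h \<in> ring_hom R S" and kill: "\<And>x. x \<in> I \<Longrightarrow> h x = \<zero>\<^bsub>S\<^esub>"
  shows "(\<lambda>U. the_elem (h ` U)) \<in> ring_hom (R Quot I) S"
    and "\<And>a. a \<in> carrier R \<Longrightarrow> the_elem (h ` (I +> a)) = h a"
proof -
  interpret S: ring S by fact
  have img: "h ` (I +> a) = {h a}" if a: "a \<in> carrier R" for a
  proof -
    have "h x = h a" if x: "x \<in> I +> a" for x
    proof -
      obtain i where i: "i \<in> I" "x = i \<oplus> a" using x by (auto simp: a_r_coset_def')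
      then have "h x = h i \<oplus>\<^bsub>S\<^esub> h a" using a h by (simp add: ring_hom_add a_Hcarr)
      then show ?thesis using kill[OF i(1)] ring_hom_closed[OF h a] by simp
    qed
    then show ?thesis using a_rcos_self[OF a] by blast
  qed
  then show el: "the_elem (h ` (I +> a)) = h a" if "a \<in> carrier R" for a using that by simp
  show "(\<lambda>U. the_elem (h ` U)) \<in> ring_hom (R Quot I) S"
  proof (rule ring_hom_memI)
    fix U V assume "U \<in> carrier (R Quot I)" "V \<in> carrier (R Quot I)"
    then obtain a b where ab: "a \<in> carrier R" "U = I +> a" "b \<in> carrier R" "V = I +> b"
      by (auto simp: FactRing_def A_RCOSETS_def')
    then show "the_elem (h ` U) \<in> carrier S"
      "the_elem (h ` (U \<otimes>\<^bsub>R Quot I\<^esub> V)) = the_elem (h ` U) \<otimes>\<^bsub>S\<^esub> the_elem (h ` V)"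
      "the_elem (h ` (U \<oplus>\<^bsub>R Quot I\<^esub> V)) = the_elem (h ` U) \<oplus>\<^bsub>S\<^esub> the_elem (h ` V)"
      using h by (simp_all add: FactRing_def rcoset_mult_add a_rcos_sum el ring_hom_closed
        ring_hom_mult ring_hom_add)
  next
    show "the_elem (h ` \<one>\<^bsub>R Quot I\<^esub>) = \<one>\<^bsub>S\<^esub>" using h by (simp add: FactRing_def el ring_hom_one)
  qed
qed

text \<open>The square expands into the diagonal terms, which vanish, and into pairs of anticommuting terms, which
  cancel.  Thus the relation that elements of degree 1 have square zero only needs to be checked on the symbols \<open>db\<close>.\<close>

lemma (in ring) finsum_square_zero:
  assumes f: "f \<in> Z \<rightarrow> carrier R" and sq: "\<And>i. i \<in> Z \<Longrightarrow> f i \<otimes> f i = \<zero>"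
    and anti: "\<And>i j. i \<in> Z \<Longrightarrow> j \<in> Z \<Longrightarrow> f i \<otimes> f j \<oplus> f j \<otimes> f i = \<zero>"
  shows "finsum R f Z \<otimes> finsum R f Z = \<zero>"
proof -
  have *: "f i \<otimes> finsum R f Y \<oplus> finsum R f Y \<otimes> f i = \<zero>" if "i \<in> Z" "Y \<subseteq> Z" for i Y
    using that(2)
  proof (induction Y rule: infinite_finite_induct)
    case (insert j Y)
    then have c: "f i \<in> carrier R" "f j \<in> carrier R" "finsum R f Y \<in> carrier R"
      using f that by (auto intro!: finsum_closed)
    have ins: "finsum R f (insert j Y) = f j \<oplus> finsum R f Y"
      using insert f c by (intro finsum_insert) auto
    have "f i \<otimes> finsum R f (insert j Y) \<oplus> finsum R f (insert j Y) \<otimes> f i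
        = (f i \<otimes> f j \<oplus> f j \<otimes> f i) \<oplus> (f i \<otimes> finsum R f Y \<oplus> finsum R f Y \<otimes> f i)"
      unfolding ins using c by algebra
    also have "\<dots> = \<zero>" using insert that anti by auto
    finally show ?case .
  qed (use f that in \<open>auto simp: Pi_iff\<close>)
  have "finsum R f Y \<otimes> finsum R f Y = \<zero>" if "Y \<subseteq> Z" for Y
    using that
  proof (induction Y rule: infinite_finite_induct)
    case (insert j Y)
    then have c: "f j \<in> carrier R" "finsum R f Y \<in> carrier R"
      using f by (auto intro!: finsum_closed)
    have ins: "finsum R f (insert j Y) = f j \<oplus> finsum R f Y"
      using insert f c by (intro finsum_insert) auto
    have "finsum R f (insert j Y) \<otimes> finsum R f (insert j Y)
        = f j \<otimes> f j \<oplus> (f j \<otimes> finsum R f Y \<oplus> finsum R f Y \<otimes> f j) \<oplus> finsum R f Y \<otimes> finsum R f Y"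
      unfolding ins using c by algebra
    also have "\<dots> = \<zero>" using insert *[of j Y] sq by auto
    finally show ?case .
  qed auto
  then show ?thesis by blast
qed

lemma (in monoid) multlist_append:
  assumes "set xs \<subseteq> carrier G" "set ys \<subseteq> carrier G"
  shows "foldr (\<otimes>) (xs @ ys) \<one> = foldr (\<otimes>) xs \<one> \<otimes> foldr (\<otimes>) ys \<one>"
  using assms(1) by (induction xs) (auto simp: assms(2) m_assoc)

lemma (in monoid) multlist_commute:
  assumes "a \<in> carrier G" "set xs \<subseteq> carrier G" "\<And>x. x \<in> set xs \<Longrightarrow> a \<otimes> x = x \<otimes> a"
  shows "a \<otimes> foldr (\<otimes>) xs \<one> = foldr (\<otimes>) xs \<one> \<otimes> a"
  using assms(2,3)
proof (induction xs)
  case (Cons x xs)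
  have c: "x \<in> carrier G" "foldr (\<otimes>) xs \<one> \<in> carrier G" using Cons.prems by auto
  have "a \<otimes> (x \<otimes> foldr (\<otimes>) xs \<one>) = (x \<otimes> a) \<otimes> foldr (\<otimes>) xs \<one>"
    using Cons.prems c assms(1) by (metis list.set_intros(1) m_assoc)
  also have "\<dots> = (x \<otimes> foldr (\<otimes>) xs \<one>) \<otimes> a"
    using Cons c assms(1) by (simp add: m_assoc)
  finally show ?case by simp
qed (use assms(1) in simp)

section \<open>The universal property of the de Rham complex\<close>

locale de_rham_complex = B: cring B
  for B0 :: "('a, 'c) ring_scheme" and B :: "('b, 'd) ring_scheme" and g :: "'a \<Rightarrow> 'b" +
  assumes g_closed: "\<And>a. a \<in> carrier B0 \<Longrightarrow> g a \<in> carrier B"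
begin

sublocale W: monoid_algebra B "\<lparr>carrier = lists (carrier B), monoid.mult = (@), monoid.one = []\<rparr>"
  rewrites "monoid_ring B \<lparr>carrier = lists (carrier B), monoid.mult = (@), monoid.one = []\<rparr> = form_words B"
    and "carrier \<lparr>carrier = lists (carrier B), monoid.mult = (@), monoid.one = []\<rparr> = lists (carrier B)"
    and "monoid.mult \<lparr>carrier = lists (carrier B), monoid.mult = (@), monoid.one = []\<rparr> = (@)"
    and "\<one>\<^bsub>\<lparr>carrier = lists (carrier B), monoid.mult = (@), monoid.one = []\<rparr>\<^esub> = []"
proof -
  show "monoid_algebra B \<lparr>carrier = lists (carrier B), monoid.mult = (@), monoid.one = []\<rparr>"
    by (intro monoid_algebra.intro B.cring_axioms monoidI) auto
qed (simp_all add: form_words_def)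

abbreviation FW where "FW \<equiv> form_words B"
abbreviation Om where "Om \<equiv> de_rham B0 B g"
abbreviation I where "I \<equiv> de_rham_ideal B0 B g"
abbreviation cls where "cls \<equiv> form_class B0 B g"
abbreviation frm where "frm \<equiv> form B0 B g"
abbreviation d where "d \<equiv> differential Om"

sublocale FW: ring "form_words B" by (rule W.ring_KM)

definition relations where
  "relations = {mr_monom B \<one>\<^bsub>B\<^esub> [a \<oplus>\<^bsub>B\<^esub> b] \<ominus>\<^bsub>form_words B\<^esub>
        (mr_monom B \<one>\<^bsub>B\<^esub> [a] \<oplus>\<^bsub>form_words B\<^esub> mr_monom B \<one>\<^bsub>B\<^esub> [b]) | a b. a \<in> carrier B \<and> b \<in> carrier B} \<union>
     {mr_monom B \<one>\<^bsub>B\<^esub> [a \<otimes>\<^bsub>B\<^esub> b] \<ominus>\<^bsub>form_words B\<^esub>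
        (mr_monom B a [b] \<oplus>\<^bsub>form_words B\<^esub> mr_monom B b [a]) | a b. a \<in> carrier B \<and> b \<in> carrier B} \<union>
     {mr_monom B \<one>\<^bsub>B\<^esub> [g a] | a. a \<in> carrier B0} \<union>
     {x \<otimes>\<^bsub>form_words B\<^esub> x | x. x \<in> form_words_deg B 1}"

lemma I_eq: "I = Idl\<^bsub>FW\<^esub> relations"
  by (simp add: de_rham_ideal_def relations_def)

lemma deg_carrier: "x \<in> form_words_deg B q \<Longrightarrow> x \<in> carrier FW"
  by (simp add: form_words_deg_def)

lemma relations_carrier: "relations \<subseteq> carrier FW"
  unfolding relations_def
  by (auto intro!: W.monom_closed dest: deg_carrier simp: g_closed)

sublocale I: ideal "de_rham_ideal B0 B g" "form_words B"
  unfolding I_eq by (rule FW.genideal_ideal[OF relations_carrier])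

lemma Om_simps:
  "carrier Om = carrier (FW Quot I)" "monoid.mult Om = monoid.mult (FW Quot I)"
  "\<one>\<^bsub>Om\<^esub> = \<one>\<^bsub>FW Quot I\<^esub>" "\<zero>\<^bsub>Om\<^esub> = \<zero>\<^bsub>FW Quot I\<^esub>" "ring.add Om = ring.add (FW Quot I)"
  by (simp_all add: de_rham_def ring.defs)

lemma degree_part_Om: "degree_part Om q = cls ` form_words_deg B q"
  by (simp add: de_rham_def ring.defs)

lemma differential_Om: "d U = (\<Union>t\<in>U. cls
        (\<Oplus>\<^bsub>FW\<^esub>w\<in>{w. t w \<noteq> \<zero>\<^bsub>B\<^esub>}. mr_monom B \<one>\<^bsub>B\<^esub> (t w # w)))"
  by (simp add: de_rham_def ring.defs)

lemma ring_Om: "ring Om"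
  by (rule ring_cong_ops[OF I.quotient_is_ring]) (simp_all add: Om_simps)

sublocale Om: ring "de_rham B0 B g" by (rule ring_Om)

lemma cls_hom: "cls \<in> ring_hom FW Om"
proof -
  have "cls = (+>\<^bsub>FW\<^esub>) I" by (rule ext) (simp add: form_class_def)
  then show ?thesis using I.rcos_ring_hom by (simp add: ring_hom_def Om_simps)
qed

lemma Om_cases:
  assumes "U \<in> carrier Om"
  obtains t where "t \<in> carrier FW" "U = cls t"
  using assms by (auto simp: Om_simps FactRing_def A_RCOSETS_def' form_class_def)

lemma mem_Om:
  assumes "U \<in> carrier Om" "t \<in> U"
  shows "t \<in> carrier FW" "cls t = U"
proof -
  obtain s where s: "s \<in> carrier FW" "U = cls s" using assms(1) by (rule Om_cases)
  show "t \<in> carrier FW" using assms(2) s I.a_elemrcos_carrier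
    by (auto simp: form_class_def)
  show "cls t = U" using assms(2) s W.KM.a_repr_independence[OF _ _ I.a_subgroup, of t s]
    by (simp add: form_class_def)
qed

lemma Om_nonempty: "U \<in> carrier Om \<Longrightarrow> U \<noteq> {}"
  using I.a_rcos_self by (elim Om_cases) (auto simp: form_class_def)

text \<open>The maps on forms are defined as unions over all representatives; they are computed by any map
  that agrees with them on representatives.\<close>

lemma union_over_class:
  assumes "\<And>t. t \<in> carrier FW \<Longrightarrow> F t = \<Psi> (cls t)" "U \<in> carrier Om"
  shows "(\<Union>t\<in>U. F t) = \<Psi> U"
proof -
  have "F t = \<Psi> U" if "t \<in> U" for t using assms mem_Om[OF assms(2) that] by simp
  then show ?thesis using Om_nonempty[OF assms(2)] by auto
qed

lemma frm_closed [simp]: "b \<in> carrier B \<Longrightarrow> set bs \<subseteq> carrier B \<Longrightarrow> frm b bs \<in> carrier Om"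
  using ring_hom_closed[OF cls_hom, of "mr_monom B b bs"] by (simp add: form_def in_lists_conv_set subset_iff)

lemma frm_mult:
  assumes "b \<in> carrier B" "set bs \<subseteq> carrier B" "c \<in> carrier B" "set cs \<subseteq> carrier B"
  shows "frm b bs \<otimes>\<^bsub>Om\<^esub> frm c cs = frm (b \<otimes>\<^bsub>B\<^esub> c) (bs @ cs)"
  using assms by (simp add: form_def ring_hom_mult[OF cls_hom, symmetric] W.monom_mult
      in_lists_conv_set subset_iff)

lemma frm_add:
  assumes "b \<in> carrier B" "c \<in> carrier B" "set bs \<subseteq> carrier B"
  shows "frm b bs \<oplus>\<^bsub>Om\<^esub> frm c bs = frm (b \<oplus>\<^bsub>B\<^esub> c) bs"
  using assms by (simp add: form_def ring_hom_add[OF cls_hom, symmetric] W.monom_add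
      in_lists_conv_set subset_iff)

lemma frm_one: "frm \<one>\<^bsub>B\<^esub> [] = \<one>\<^bsub>Om\<^esub>"
  using ring_hom_one[OF cls_hom] by (simp add: form_def W.one_KM)

lemma frm_zero: assumes "set bs \<subseteq> carrier B" shows "frm \<zero>\<^bsub>B\<^esub> bs = \<zero>\<^bsub>Om\<^esub>"
  using ring_hom_zero[OF cls_hom FW.ring_axioms ring_Om] by (simp add: form_def W.monom_zero)

lemma frm_hom: assumes "set bs \<subseteq> carrier B" shows "abelian_group_hom B Om (\<lambda>b. frm b bs)"
  by (rule additive_mapI) (use assms in \<open>auto simp: frm_add B.abelian_group_axioms Om.abelian_group_axioms\<close>)

lemma cls_I: "t \<in> I \<Longrightarrow> cls t = \<zero>\<^bsub>Om\<^esub>"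
  by (simp add: form_class_def I.a_rcos_const Om_simps FactRing_def)

lemma relation_zero: "t \<in> relations \<Longrightarrow> cls t = \<zero>\<^bsub>Om\<^esub>"
  using FW.genideal_self[OF relations_carrier] by (intro cls_I) (auto simp: I_eq)

lemma cls_eqI:
  assumes "s \<ominus>\<^bsub>FW\<^esub> t \<in> relations" "s \<in> carrier FW" "t \<in> carrier FW"
  shows "cls s = cls t"
proof -
  interpret c: abelian_group_hom FW Om cls
    by (rule additive_map_of_ring_hom[OF FW.ring_axioms ring_Om cls_hom])
  have "cls s \<ominus>\<^bsub>Om\<^esub> cls t = \<zero>\<^bsub>Om\<^esub>" using relation_zero[OF assms(1)] c.hom_minus assms by simp
  then show ?thesis using assms by (simp add: Om.r_right_minus_eq)
qed

lemma d_add: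
  assumes "a \<in> carrier B" "b \<in> carrier B"
  shows "frm \<one>\<^bsub>B\<^esub> [a \<oplus>\<^bsub>B\<^esub> b] = frm \<one>\<^bsub>B\<^esub> [a] \<oplus>\<^bsub>Om\<^esub> frm \<one>\<^bsub>B\<^esub> [b]"
proof -
  have "cls (mr_monom B \<one>\<^bsub>B\<^esub> [a \<oplus>\<^bsub>B\<^esub> b]) = cls (mr_monom B \<one>\<^bsub>B\<^esub> [a] \<oplus>\<^bsub>FW\<^esub> mr_monom B \<one>\<^bsub>B\<^esub> [b])"
    by (rule cls_eqI) (use assms in \<open>auto simp: relations_def\<close>)
  then show ?thesis using assms by (simp add: form_def ring_hom_add[OF cls_hom])
qed

lemma d_mult:
  assumes "a \<in> carrier B" "b \<in> carrier B"
  shows "frm \<one>\<^bsub>B\<^esub> [a \<otimes>\<^bsub>B\<^esub> b] = frm a [b] \<oplus>\<^bsub>Om\<^esub> frm b [a]"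
proof -
  have "cls (mr_monom B \<one>\<^bsub>B\<^esub> [a \<otimes>\<^bsub>B\<^esub> b]) = cls (mr_monom B a [b] \<oplus>\<^bsub>FW\<^esub> mr_monom B b [a])"
    by (rule cls_eqI) (use assms in \<open>auto simp: relations_def\<close>)
  then show ?thesis using assms by (simp add: form_def ring_hom_add[OF cls_hom])
qed

lemma d_const: "a \<in> carrier B0 \<Longrightarrow> frm \<one>\<^bsub>B\<^esub> [g a] = \<zero>\<^bsub>Om\<^esub>"
  unfolding form_def by (rule relation_zero) (auto simp: relations_def)

lemma d_square:
  assumes "a \<in> carrier B"
  shows "frm \<one>\<^bsub>B\<^esub> [a] \<otimes>\<^bsub>Om\<^esub> frm \<one>\<^bsub>B\<^esub> [a] = \<zero>\<^bsub>Om\<^esub>"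
proof -
  have 1: "mr_monom B \<one>\<^bsub>B\<^esub> [a] \<in> carrier FW" using assms by simp
  then have "mr_monom B \<one>\<^bsub>B\<^esub> [a] \<in> form_words_deg B 1"
    by (auto simp: form_words_deg_def) (auto simp: mr_monom_def split: if_splits)
  then have "cls (mr_monom B \<one>\<^bsub>B\<^esub> [a] \<otimes>\<^bsub>FW\<^esub> mr_monom B \<one>\<^bsub>B\<^esub> [a]) = \<zero>\<^bsub>Om\<^esub>"
    by (intro relation_zero) (unfold relations_def, blast)
  then show ?thesis using 1 by (simp add: form_def ring_hom_mult[OF cls_hom])
qed

lemma d_anticomm:
  assumes "a \<in> carrier B" "b \<in> carrier B"
  shows "frm \<one>\<^bsub>B\<^esub> [a] \<otimes>\<^bsub>Om\<^esub> frm \<one>\<^bsub>B\<^esub> [b] \<oplus>\<^bsub>Om\<^esub> frm \<one>\<^bsub>B\<^esub> [b] \<otimes>\<^bsub>Om\<^esub> frm \<one>\<^bsub>B\<^esub> [a] = \<zero>\<^bsub>Om\<^esub>"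
proof -
  let ?a = "frm \<one>\<^bsub>B\<^esub> [a]" and ?b = "frm \<one>\<^bsub>B\<^esub> [b]"
  have c: "?a \<in> carrier Om" "?b \<in> carrier Om" using assms by auto
  have "\<zero>\<^bsub>Om\<^esub> = (?a \<oplus>\<^bsub>Om\<^esub> ?b) \<otimes>\<^bsub>Om\<^esub> (?a \<oplus>\<^bsub>Om\<^esub> ?b)"
    using assms d_square[of "a \<oplus>\<^bsub>B\<^esub> b"] by (simp add: d_add)
  also have "\<dots> = ?a \<otimes>\<^bsub>Om\<^esub> ?a \<oplus>\<^bsub>Om\<^esub> (?a \<otimes>\<^bsub>Om\<^esub> ?b \<oplus>\<^bsub>Om\<^esub> ?b \<otimes>\<^bsub>Om\<^esub> ?a) \<oplus>\<^bsub>Om\<^esub> ?b \<otimes>\<^bsub>Om\<^esub> ?b"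
    using c by algebra
  also have "\<dots> = ?a \<otimes>\<^bsub>Om\<^esub> ?b \<oplus>\<^bsub>Om\<^esub> ?b \<otimes>\<^bsub>Om\<^esub> ?a"
    using assms c by (simp add: d_square)
  finally show ?thesis by simp
qed

lemma d_one: "frm \<one>\<^bsub>B\<^esub> [\<one>\<^bsub>B\<^esub>] = \<zero>\<^bsub>Om\<^esub>"
proof -
  let ?x = "frm \<one>\<^bsub>B\<^esub> [\<one>\<^bsub>B\<^esub>]"
  have "?x = ?x \<oplus>\<^bsub>Om\<^esub> ?x" using d_mult[of "\<one>\<^bsub>B\<^esub>" "\<one>\<^bsub>B\<^esub>"] by simp
  then show ?thesis using Om.add.l_cancel_one' frm_closed by (metis B.one_closed empty_subsetI insert_subset list.set(1) list.set(2))
qed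

lemma frm_Cons:
  assumes "b \<in> carrier B" "c \<in> carrier B" "set bs \<subseteq> carrier B"
  shows "frm b (c # bs) = frm b [c] \<otimes>\<^bsub>Om\<^esub> frm \<one>\<^bsub>B\<^esub> bs"
    and "frm b bs = frm b [] \<otimes>\<^bsub>Om\<^esub> frm \<one>\<^bsub>B\<^esub> bs"
  using assms by (simp_all add: frm_mult)

lemma cls_sum_of_forms:
  assumes t: "t \<in> carrier FW"
  shows "(\<lambda>w. mr_monom B (t w) w) \<in> W.supp t \<rightarrow> carrier FW"
    and "(\<lambda>w. frm (t w) w) \<in> W.supp t \<rightarrow> carrier Om"
    and "cls t = (\<Oplus>\<^bsub>Om\<^esub>w\<in>W.supp t. frm (t w) w)"
proof -
  interpret c: abelian_group_hom FW Om cls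
    by (rule additive_map_of_ring_hom[OF FW.ring_axioms ring_Om cls_hom])
  have *: "w \<in> lists (carrier B)" if "t w \<noteq> \<zero>\<^bsub>B\<^esub>" for w
    using t that unfolding W.carrier_KM by auto
  show 1: "(\<lambda>w. mr_monom B (t w) w) \<in> W.supp t \<rightarrow> carrier FW" using t * by auto
  then show "(\<lambda>w. frm (t w) w) \<in> W.supp t \<rightarrow> carrier Om"
    using ring_hom_closed[OF cls_hom] by (simp add: form_def Pi_iff)
  show "cls t = (\<Oplus>\<^bsub>Om\<^esub>w\<in>W.supp t. frm (t w) w)"
    using c.hom_finsum[OF 1] W.sum_of_terms[OF t] by (simp add: form_def)
qed

lemma forms_induct [consumes 1, case_names frm add]:
  assumes "x \<in> carrier Om"
    and frm: "\<And>b bs. b \<in> carrier B \<Longrightarrow> set bs \<subseteq> carrier B \<Longrightarrow> P (frm b bs)"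
    and add: "\<And>x y. x \<in> carrier Om \<Longrightarrow> y \<in> carrier Om \<Longrightarrow> P x \<Longrightarrow> P y \<Longrightarrow> P (x \<oplus>\<^bsub>Om\<^esub> y)"
  shows "P x"
proof -
  obtain t where t: "t \<in> carrier FW" "x = cls t" using assms(1) by (rule Om_cases)
  from t(1) have "P (cls t)"
  proof (induction rule: W.induct_terms)
    case zero
    then show ?case using frm[of "\<zero>\<^bsub>B\<^esub>" "[]"] by (simp add: form_def W.monom_zero)
  next
    case (monom a m)
    then show ?case using frm[of a m] by (auto simp: form_def)
  next
    case (add x y)
    then show ?case using assms(3)[of "cls x" "cls y"] ring_hom_closed[OF cls_hom]
      by (simp add: ring_hom_add[OF cls_hom])
  qed
  then show ?thesis using t by simp
qed

lemma frm_degree: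
  assumes "b \<in> carrier B" "set bs \<subseteq> carrier B"
  shows "frm b bs \<in> degree_part Om (length bs)"
proof -
  have "mr_monom B b bs \<in> carrier FW" using assms by (auto intro!: W.monom_closed)
  then have "mr_monom B b bs \<in> form_words_deg B (length bs)"
    by (auto simp: form_words_deg_def) (auto simp: mr_monom_def split: if_splits)
  then show ?thesis by (auto simp: degree_part_Om form_def)
qed

lemma degree_closed: "x \<in> degree_part Om q \<Longrightarrow> x \<in> carrier Om"
  using ring_hom_closed[OF cls_hom] deg_carrier by (auto simp: degree_part_Om)

lemma degree_add:
  assumes "x \<in> degree_part Om q" "y \<in> degree_part Om q"
  shows "x \<oplus>\<^bsub>Om\<^esub> y \<in> degree_part Om q"
proof -
  obtain s t where st: "s \<in> form_words_deg B q" "x = cls s" "t \<in> form_words_deg B q" "y = cls t"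
    using assms by (auto simp: degree_part_Om)
  then have "s \<oplus>\<^bsub>FW\<^esub> t \<in> form_words_deg B q"
    by (auto simp: form_words_deg_def) (auto simp: W.add_KM, metis B.l_zero B.zero_closed)
  moreover have "x \<oplus>\<^bsub>Om\<^esub> y = cls (s \<oplus>\<^bsub>FW\<^esub> t)"
    using st deg_carrier by (simp add: ring_hom_add[OF cls_hom])
  ultimately show ?thesis by (simp add: degree_part_Om)
qed

lemma degree_induct [consumes 1, case_names frm add]:
  assumes "x \<in> degree_part Om q"
    and frm: "\<And>b bs. b \<in> carrier B \<Longrightarrow> set bs \<subseteq> carrier B \<Longrightarrow> length bs = q \<Longrightarrow> P (frm b bs)"
    and add: "\<And>x y. x \<in> degree_part Om q \<Longrightarrow> y \<in> degree_part Om q \<Longrightarrow> P x \<Longrightarrow> P y \<Longrightarrow> P (x \<oplus>\<^bsub>Om\<^esub> y)"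
  shows "P x"
proof -
  obtain t where t: "t \<in> carrier FW" "\<And>w. t w \<noteq> \<zero>\<^bsub>B\<^esub> \<Longrightarrow> length w = q" "x = cls t"
    using assms(1) by (auto simp: degree_part_Om form_words_deg_def)
  have z: "\<zero>\<^bsub>Om\<^esub> \<in> degree_part Om q \<and> P \<zero>\<^bsub>Om\<^esub>"
  proof -
    have "frm \<zero>\<^bsub>B\<^esub> (replicate q \<zero>\<^bsub>B\<^esub>) = \<zero>\<^bsub>Om\<^esub>" by (rule frm_zero) auto
    then show ?thesis using frm[of "\<zero>\<^bsub>B\<^esub>" "replicate q \<zero>\<^bsub>B\<^esub>"] frm_degree[of "\<zero>\<^bsub>B\<^esub>" "replicate q \<zero>\<^bsub>B\<^esub>"]
      by (simp add: subset_iff)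
  qed
  have "cls t \<in> degree_part Om q \<and> P (cls t)" unfolding cls_sum_of_forms(3)[OF t(1)]
  proof (rule Om.finsum_induct[where P = "\<lambda>x. x \<in> degree_part Om q \<and> P x"])
    fix w assume w: "w \<in> W.supp t"
    then have "w \<in> lists (carrier B)" using t(1) unfolding W.carrier_KM by auto
    then have "t w \<in> carrier B" "set w \<subseteq> carrier B" "length w = q" using w t by auto
    then show "frm (t w) w \<in> carrier Om \<and> frm (t w) w \<in> degree_part Om q \<and> P (frm (t w) w)"
      using frm frm_degree[of "t w" w] by auto
  next
    fix a b assume "a \<in> degree_part Om q \<and> P a" "b \<in> degree_part Om q \<and> P b"
    then show "a \<oplus>\<^bsub>Om\<^esub> b \<in> degree_part Om q \<and> P (a \<oplus>\<^bsub>Om\<^esub> b)" using degree_add add by blast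
  qed (rule z)
  then show ?thesis using t by simp
qed

lemma degree_zero: "\<zero>\<^bsub>Om\<^esub> \<in> degree_part Om q"
  using frm_degree[of "\<zero>\<^bsub>B\<^esub>" "replicate q \<zero>\<^bsub>B\<^esub>"] frm_zero[of "replicate q \<zero>\<^bsub>B\<^esub>"]
  by (simp add: subset_iff)

lemma degree_mult:
  assumes "x \<in> degree_part Om q" "y \<in> degree_part Om r"
  shows "x \<otimes>\<^bsub>Om\<^esub> y \<in> degree_part Om (q + r)"
  using assms(1)
proof (induction rule: degree_induct)
  case (frm b bs)
  note b = frm
  show ?case using assms(2)
  proof (induction rule: degree_induct)
    case (frm c cs)
    then show ?case using b frm_degree[of "b \<otimes>\<^bsub>B\<^esub> c" "bs @ cs"] by (simp add: frm_mult)
  qed (use b in \<open>simp add: Om.r_distr degree_closed degree_add\<close>)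
qed (use assms(2) in \<open>simp add: Om.l_distr degree_closed degree_add\<close>)

text \<open>The universal property: a homomorphism of \<open>B\<close> to a ring \<open>E\<close>, not necessarily commutative, and a
  \<open>B\<^sub>0\<close>-derivation \<open>\<delta>\<close> whose values commute with \<open>B\<close> and have square zero extend to forms.  Applied to
  suitable rings \<open>E\<close> it yields every map on forms below, including the differential.\<close>

theorem de_rham_universal:
  assumes E: "ring E" and u: "u \<in> ring_hom B E"
    and \<delta>: "\<And>b. b \<in> carrier B \<Longrightarrow> \<delta> b \<in> carrier E"
    and comm: "\<And>a b. a \<in> carrier B \<Longrightarrow> b \<in> carrier B \<Longrightarrow> u a \<otimes>\<^bsub>E\<^esub> \<delta> b = \<delta> b \<otimes>\<^bsub>E\<^esub> u a"
    and add: "\<And>a b. a \<in> carrier B \<Longrightarrow> b \<in> carrier B \<Longrightarrow> \<delta> (a \<oplus>\<^bsub>B\<^esub> b) = \<delta> a \<oplus>\<^bsub>E\<^esub> \<delta> b"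
    and leib: "\<And>a b. a \<in> carrier B \<Longrightarrow> b \<in> carrier B \<Longrightarrow>
      \<delta> (a \<otimes>\<^bsub>B\<^esub> b) = u a \<otimes>\<^bsub>E\<^esub> \<delta> b \<oplus>\<^bsub>E\<^esub> u b \<otimes>\<^bsub>E\<^esub> \<delta> a"
    and const: "\<And>a. a \<in> carrier B0 \<Longrightarrow> \<delta> (g a) = \<zero>\<^bsub>E\<^esub>"
    and sq: "\<And>b. b \<in> carrier B \<Longrightarrow> \<delta> b \<otimes>\<^bsub>E\<^esub> \<delta> b = \<zero>\<^bsub>E\<^esub>"
  obtains \<Psi> where "\<Psi> \<in> ring_hom Om E"
    "\<And>b bs. b \<in> carrier B \<Longrightarrow> set bs \<subseteq> carrier B \<Longrightarrow>
      \<Psi> (frm b bs) = u b \<otimes>\<^bsub>E\<^esub> foldr (\<otimes>\<^bsub>E\<^esub>) (map \<delta> bs) \<one>\<^bsub>E\<^esub>"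
proof -
  interpret E: ring E by fact
  have uc: "u a \<in> carrier E" if "a \<in> carrier B" for a using ring_hom_closed[OF u that] .
  obtain h where h: "h \<in> ring_hom FW E"
    and hm: "\<And>b bs. b \<in> carrier B \<Longrightarrow> bs \<in> lists (carrier B) \<Longrightarrow>
      h (mr_monom B b bs) = u b \<otimes>\<^bsub>E\<^esub> foldr (\<otimes>\<^bsub>E\<^esub>) (map \<delta> bs) \<one>\<^bsub>E\<^esub>"
  proof (rule W.monoid_ring_universal[OF E u, of "\<lambda>bs. foldr (\<otimes>\<^bsub>E\<^esub>) (map \<delta> bs) \<one>\<^bsub>E\<^esub>"])
    fix m n assume "m \<in> lists (carrier B)" "n \<in> lists (carrier B)"
    then show "foldr (\<otimes>\<^bsub>E\<^esub>) (map \<delta> (m @ n)) \<one>\<^bsub>E\<^esub>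
        = foldr (\<otimes>\<^bsub>E\<^esub>) (map \<delta> m) \<one>\<^bsub>E\<^esub> \<otimes>\<^bsub>E\<^esub> foldr (\<otimes>\<^bsub>E\<^esub>) (map \<delta> n) \<one>\<^bsub>E\<^esub>"
      unfolding map_append by (intro E.multlist_append) (auto simp: \<delta>)
  next
    fix a m assume a: "a \<in> carrier B" and m: "m \<in> lists (carrier B)"
    show "u a \<otimes>\<^bsub>E\<^esub> foldr (\<otimes>\<^bsub>E\<^esub>) (map \<delta> m) \<one>\<^bsub>E\<^esub> = foldr (\<otimes>\<^bsub>E\<^esub>) (map \<delta> m) \<one>\<^bsub>E\<^esub> \<otimes>\<^bsub>E\<^esub> u a"
      by (rule E.multlist_commute) (use a m comm \<delta> uc in \<open>auto\<close>)
  qed (auto intro!: E.multlist_closed simp: \<delta>)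
  have h1: "h (mr_monom B b [a]) = u b \<otimes>\<^bsub>E\<^esub> \<delta> a" if "b \<in> carrier B" "a \<in> carrier B" for a b
    using hm[of b "[a]"] that \<delta> by simp
  interpret h: ring_hom_ring FW E h by (rule ring_hom_ringI2[OF FW.ring_axioms E h])
  have anti: "\<delta> a \<otimes>\<^bsub>E\<^esub> \<delta> b \<oplus>\<^bsub>E\<^esub> \<delta> b \<otimes>\<^bsub>E\<^esub> \<delta> a = \<zero>\<^bsub>E\<^esub>" if "a \<in> carrier B" "b \<in> carrier B" for a b
  proof -
    have c: "\<delta> a \<in> carrier E" "\<delta> b \<in> carrier E" using that \<delta> by auto
    have "\<zero>\<^bsub>E\<^esub> = (\<delta> a \<oplus>\<^bsub>E\<^esub> \<delta> b) \<otimes>\<^bsub>E\<^esub> (\<delta> a \<oplus>\<^bsub>E\<^esub> \<delta> b)"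
      using that sq[of "a \<oplus>\<^bsub>B\<^esub> b"] by (simp add: add)
    also have "\<dots> = \<delta> a \<otimes>\<^bsub>E\<^esub> \<delta> a \<oplus>\<^bsub>E\<^esub> (\<delta> a \<otimes>\<^bsub>E\<^esub> \<delta> b \<oplus>\<^bsub>E\<^esub> \<delta> b \<otimes>\<^bsub>E\<^esub> \<delta> a) \<oplus>\<^bsub>E\<^esub> \<delta> b \<otimes>\<^bsub>E\<^esub> \<delta> b"
      using c by algebra
    also have "\<dots> = \<delta> a \<otimes>\<^bsub>E\<^esub> \<delta> b \<oplus>\<^bsub>E\<^esub> \<delta> b \<otimes>\<^bsub>E\<^esub> \<delta> a" using that c by (simp add: sq)
    finally show ?thesis by simp
  qed
  have swap: "(u c \<otimes>\<^bsub>E\<^esub> \<delta> a) \<otimes>\<^bsub>E\<^esub> (u c' \<otimes>\<^bsub>E\<^esub> \<delta> b) = u (c \<otimes>\<^bsub>B\<^esub> c') \<otimes>\<^bsub>E\<^esub> (\<delta> a \<otimes>\<^bsub>E\<^esub> \<delta> b)"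
    if "a \<in> carrier B" "b \<in> carrier B" "c \<in> carrier B" "c' \<in> carrier B" for a b c c'
  proof -
    have "(u c \<otimes>\<^bsub>E\<^esub> \<delta> a) \<otimes>\<^bsub>E\<^esub> (u c' \<otimes>\<^bsub>E\<^esub> \<delta> b) = u c \<otimes>\<^bsub>E\<^esub> ((\<delta> a \<otimes>\<^bsub>E\<^esub> u c') \<otimes>\<^bsub>E\<^esub> \<delta> b)"
      using that \<delta> uc by (simp add: E.m_assoc)
    also have "\<delta> a \<otimes>\<^bsub>E\<^esub> u c' = u c' \<otimes>\<^bsub>E\<^esub> \<delta> a" using comm that by simp
    finally show ?thesis using that \<delta> uc by (simp add: E.m_assoc ring_hom_mult[OF u])
  qed
  have h_sq: "h x \<otimes>\<^bsub>E\<^esub> h x = \<zero>\<^bsub>E\<^esub>" if x: "x \<in> form_words_deg B 1" for x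
  proof -
    have xc: "x \<in> carrier FW" and len: "\<And>w. x w \<noteq> \<zero>\<^bsub>B\<^esub> \<Longrightarrow> length w = 1"
      using x by (auto simp: form_words_deg_def)
    have w: "\<exists>a\<in>carrier B. w = [a]" if "w \<in> W.supp x" for w
      using xc len[of w] that unfolding W.carrier_KM by (cases w) auto
    have hx: "h x = (\<Oplus>\<^bsub>E\<^esub>w\<in>W.supp x. h (mr_monom B (x w) w))"
      using h.hom_finsum[OF cls_sum_of_forms(1)[OF xc]] W.sum_of_terms[OF xc] by (simp add: o_def)
    show ?thesis unfolding hx
    proof (rule E.finsum_square_zero)
      show "(\<lambda>w. h (mr_monom B (x w) w)) \<in> W.supp x \<rightarrow> carrier E"
        using cls_sum_of_forms(1)[OF xc] by (simp add: Pi_iff)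
    next
      fix i assume "i \<in> W.supp x"
      then obtain a where "a \<in> carrier B" "i = [a]" using w by blast
      then show "h (mr_monom B (x i) i) \<otimes>\<^bsub>E\<^esub> h (mr_monom B (x i) i) = \<zero>\<^bsub>E\<^esub>"
        using xc uc by (simp add: h1 swap sq)
    next
      fix i j assume "i \<in> W.supp x" "j \<in> W.supp x"
      then obtain a b where ab: "a \<in> carrier B" "i = [a]" "b \<in> carrier B" "j = [b]" using w by blast
      let ?c = "x i \<otimes>\<^bsub>B\<^esub> x j"
      have "h (mr_monom B (x i) i) \<otimes>\<^bsub>E\<^esub> h (mr_monom B (x j) j) \<oplus>\<^bsub>E\<^esub> h (mr_monom B (x j) j) \<otimes>\<^bsub>E\<^esub> h (mr_monom B (x i) i)
        = u ?c \<otimes>\<^bsub>E\<^esub> (\<delta> a \<otimes>\<^bsub>E\<^esub> \<delta> b) \<oplus>\<^bsub>E\<^esub> u ?c \<otimes>\<^bsub>E\<^esub> (\<delta> b \<otimes>\<^bsub>E\<^esub> \<delta> a)"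
        using xc ab by (simp add: h1 swap B.m_comm)
      also have "\<dots> = \<zero>\<^bsub>E\<^esub>"
        using xc ab uc \<delta> anti by (simp flip: E.r_distr)
      finally show "h (mr_monom B (x i) i) \<otimes>\<^bsub>E\<^esub> h (mr_monom B (x j) j) \<oplus>\<^bsub>E\<^esub> h (mr_monom B (x j) j) \<otimes>\<^bsub>E\<^esub> h (mr_monom B (x i) i) = \<zero>\<^bsub>E\<^esub>" .
    qed
  qed
  have u1: "u \<one>\<^bsub>B\<^esub> = \<one>\<^bsub>E\<^esub>" by (rule ring_hom_one[OF u])
  have "h x = \<zero>\<^bsub>E\<^esub>" if "x \<in> relations" for x
  proof -
    consider (sum) a b where "a \<in> carrier B" "b \<in> carrier B"
        "x = mr_monom B \<one>\<^bsub>B\<^esub> [a \<oplus>\<^bsub>B\<^esub> b] \<ominus>\<^bsub>FW\<^esub> (mr_monom B \<one>\<^bsub>B\<^esub> [a] \<oplus>\<^bsub>FW\<^esub> mr_monom B \<one>\<^bsub>B\<^esub> [b])"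
      | (prod) a b where "a \<in> carrier B" "b \<in> carrier B"
        "x = mr_monom B \<one>\<^bsub>B\<^esub> [a \<otimes>\<^bsub>B\<^esub> b] \<ominus>\<^bsub>FW\<^esub> (mr_monom B a [b] \<oplus>\<^bsub>FW\<^esub> mr_monom B b [a])"
      | (const) a where "a \<in> carrier B0" "x = mr_monom B \<one>\<^bsub>B\<^esub> [g a]"
      | (square) y where "y \<in> form_words_deg B 1" "x = y \<otimes>\<^bsub>FW\<^esub> y"
      using \<open>x \<in> relations\<close> unfolding relations_def by blast
    then show ?thesis
    proof cases
      case sum
      then have "h x = \<delta> (a \<oplus>\<^bsub>B\<^esub> b) \<ominus>\<^bsub>E\<^esub> (\<delta> a \<oplus>\<^bsub>E\<^esub> \<delta> b)"
        using \<delta> by (simp add: h.hom_minus h1 u1)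
      then show ?thesis using sum \<delta> by (simp add: add E.r_right_minus_eq)
    next
      case prod
      then have "h x = \<delta> (a \<otimes>\<^bsub>B\<^esub> b) \<ominus>\<^bsub>E\<^esub> (u a \<otimes>\<^bsub>E\<^esub> \<delta> b \<oplus>\<^bsub>E\<^esub> u b \<otimes>\<^bsub>E\<^esub> \<delta> a)"
        using \<delta> by (simp add: h.hom_minus h1 u1)
      then show ?thesis using prod \<delta> uc by (simp add: leib E.r_right_minus_eq)
    next
      case const
      then show ?thesis using assms(7) by (simp add: h1 u1 g_closed)
    next
      case square
      then show ?thesis using deg_carrier[OF square(1)] h_sq by simp
    qed
  qed
  then have "relations \<subseteq> a_kernel FW E h" using relations_carrier unfolding a_kernel_def' by blast
  then have "I \<subseteq> a_kernel FW E h" unfolding I_eq by (rule FW.genideal_minimal[OF h.kernel_is_ideal])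
  then have kill: "h x = \<zero>\<^bsub>E\<^esub>" if "x \<in> I" for x using that unfolding a_kernel_def' by blast
  show thesis
  proof (rule that[of "\<lambda>U. the_elem (h ` U)"])
    show "(\<lambda>U. the_elem (h ` U)) \<in> ring_hom Om E"
      using I.quotient_hom(1)[OF E h kill] by (simp add: ring_hom_def Om_simps)
    fix b bs assume "b \<in> carrier B" "set bs \<subseteq> carrier B"
    then show "the_elem (h ` frm b bs) = u b \<otimes>\<^bsub>E\<^esub> foldr (\<otimes>\<^bsub>E\<^esub>) (map \<delta> bs) \<one>\<^bsub>E\<^esub>"
      using I.quotient_hom(2)[OF E h kill] by (simp add: form_def form_class_def hm in_lists_conv_set subset_iff)
  qed
qed

end

section \<open>The differential\<close>

text \<open>The triples \<open>(a, b, c)\<close> stand for triangular matrices with rows \<open>a b\<close> and \<open>0 c\<close>.\<close>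

definition triangular_ring :: "('e, 'c) ring_scheme \<Rightarrow> ('e \<times> 'e \<times> 'e) ring" where
  "triangular_ring E =
    \<lparr>carrier = carrier E \<times> carrier E \<times> carrier E,
     monoid.mult = (\<lambda>(a, b, c) (a', b', c').
       (a \<otimes>\<^bsub>E\<^esub> a', (a \<otimes>\<^bsub>E\<^esub> b') \<oplus>\<^bsub>E\<^esub> (b \<otimes>\<^bsub>E\<^esub> c'), c \<otimes>\<^bsub>E\<^esub> c')),
     monoid.one = (\<one>\<^bsub>E\<^esub>, \<zero>\<^bsub>E\<^esub>, \<one>\<^bsub>E\<^esub>),
     ring.zero = (\<zero>\<^bsub>E\<^esub>, \<zero>\<^bsub>E\<^esub>, \<zero>\<^bsub>E\<^esub>),
     ring.add = (\<lambda>(a, b, c) (a', b', c'). (a \<oplus>\<^bsub>E\<^esub> a', b \<oplus>\<^bsub>E\<^esub> b', c \<oplus>\<^bsub>E\<^esub> c'))\<rparr>"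

lemma triangular_simps:
  "carrier (triangular_ring E) = carrier E \<times> carrier E \<times> carrier E"
  "(a, b, c) \<otimes>\<^bsub>triangular_ring E\<^esub> (a', b', c')
    = (a \<otimes>\<^bsub>E\<^esub> a', (a \<otimes>\<^bsub>E\<^esub> b') \<oplus>\<^bsub>E\<^esub> (b \<otimes>\<^bsub>E\<^esub> c'), c \<otimes>\<^bsub>E\<^esub> c')"
  "\<one>\<^bsub>triangular_ring E\<^esub> = (\<one>\<^bsub>E\<^esub>, \<zero>\<^bsub>E\<^esub>, \<one>\<^bsub>E\<^esub>)"
  "\<zero>\<^bsub>triangular_ring E\<^esub> = (\<zero>\<^bsub>E\<^esub>, \<zero>\<^bsub>E\<^esub>, \<zero>\<^bsub>E\<^esub>)"
  "(a, b, c) \<oplus>\<^bsub>triangular_ring E\<^esub> (a', b', c') = (a \<oplus>\<^bsub>E\<^esub> a', b \<oplus>\<^bsub>E\<^esub> b', c \<oplus>\<^bsub>E\<^esub> c')"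
  by (simp_all add: triangular_ring_def)

lemma (in ring) triangular_is_ring: "ring (triangular_ring R)"
proof (rule ringI)
  show "abelian_group (triangular_ring R)"
  proof (rule abelian_groupI)
    fix x assume "x \<in> carrier (triangular_ring R)"
    then obtain a b c where x: "x = (a, b, c)" "a \<in> carrier R" "b \<in> carrier R" "c \<in> carrier R"
      by (auto simp: triangular_simps)
    then show "\<exists>y\<in>carrier (triangular_ring R). y \<oplus>\<^bsub>triangular_ring R\<^esub> x = \<zero>\<^bsub>triangular_ring R\<^esub>"
      by (intro bexI[of _ "(\<ominus> a, \<ominus> b, \<ominus> c)"]) (auto simp: triangular_simps l_neg)
  qed (auto simp: triangular_simps a_ac)
  show "Group.monoid (triangular_ring R)"
    by (rule monoidI) (auto simp: triangular_simps m_assoc l_distr r_distr a_ac)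
qed (auto simp: triangular_simps l_distr r_distr a_ac)

context de_rham_complex
begin

lemma frm_central:
  assumes "a \<in> carrier B" "x \<in> carrier Om"
  shows "frm a [] \<otimes>\<^bsub>Om\<^esub> x = x \<otimes>\<^bsub>Om\<^esub> frm a []"
  using assms(2)
  by (induction rule: forms_induct)
    (use assms(1) in \<open>auto simp: frm_mult B.m_comm Om.l_distr Om.r_distr\<close>)

lemma d_d_same:
  assumes "a \<in> carrier B"
  shows "frm \<one>\<^bsub>B\<^esub> [a, a] = \<zero>\<^bsub>Om\<^esub>"
  using d_square[OF assms] assms by (simp add: frm_mult)

lemma foldr_d:
  assumes "set bs \<subseteq> carrier B"
  shows "foldr (\<otimes>\<^bsub>Om\<^esub>) (map (\<lambda>b. frm \<one>\<^bsub>B\<^esub> [b]) bs) \<one>\<^bsub>Om\<^esub> = frm \<one>\<^bsub>B\<^esub> bs"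
  using assms by (induction bs) (auto simp: frm_one frm_mult)

definition signed :: "nat \<Rightarrow> ('b list \<Rightarrow> 'b) set \<Rightarrow> ('b list \<Rightarrow> 'b) set" where
  "signed q x = (if even q then x else \<ominus>\<^bsub>Om\<^esub> x)"

lemma signed_closed [simp]: "x \<in> carrier Om \<Longrightarrow> signed q x \<in> carrier Om"
  by (simp add: signed_def)

text \<open>The differential is the upper right entry of the homomorphism to triangular matrices that
  sends \<open>b\<close> to the matrix with diagonal \<open>b, b\<close> and corner \<open>db\<close>, and \<open>db\<close> to the diagonal matrix
  with entries \<open>- db, db\<close>.  The upper left entry is the grading involution \<open>\<sigma>\<close>.\<close>

lemma triangular_hom:
  obtains \<Psi> where "\<Psi> \<in> ring_hom Om (triangular_ring Om)"
    "\<And>b bs. b \<in> carrier B \<Longrightarrow> set bs \<subseteq> carrier B \<Longrightarrow>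
      \<Psi> (frm b bs) = (signed (length bs) (frm b bs), frm \<one>\<^bsub>B\<^esub> (b # bs), frm b bs)"
proof -
  let ?T = "triangular_ring Om"
  define \<delta> where "\<delta> b = (\<ominus>\<^bsub>Om\<^esub> frm \<one>\<^bsub>B\<^esub> [b], \<zero>\<^bsub>Om\<^esub>, frm \<one>\<^bsub>B\<^esub> [b])" for b
  define u where "u b = (frm b [], frm \<one>\<^bsub>B\<^esub> [b], frm b [])" for b
  have anti: "frm \<one>\<^bsub>B\<^esub> [a] \<otimes>\<^bsub>Om\<^esub> frm \<one>\<^bsub>B\<^esub> [b] = \<ominus>\<^bsub>Om\<^esub> (frm \<one>\<^bsub>B\<^esub> [b] \<otimes>\<^bsub>Om\<^esub> frm \<one>\<^bsub>B\<^esub> [a])"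
    if "a \<in> carrier B" "b \<in> carrier B" for a b
    using d_anticomm[OF that] that by (intro Om.add.inv_equality[symmetric]) auto
  have u_hom: "u \<in> ring_hom B ?T"
    by (rule ring_hom_memI)
      (auto simp: u_def triangular_simps frm_mult frm_add d_add frm_one d_one d_mult Om.a_comm B.m_comm)
  obtain \<Psi> where \<Psi>: "\<Psi> \<in> ring_hom Om ?T"
    and \<Psi>f: "\<And>b bs. b \<in> carrier B \<Longrightarrow> set bs \<subseteq> carrier B \<Longrightarrow>
      \<Psi> (frm b bs) = u b \<otimes>\<^bsub>?T\<^esub> foldr (\<otimes>\<^bsub>?T\<^esub>) (map \<delta> bs) \<one>\<^bsub>?T\<^esub>"
  proof (rule de_rham_universal[OF Om.triangular_is_ring u_hom, of \<delta>])
    fix a b assume ab: "a \<in> carrier B" "b \<in> carrier B"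
    show "\<delta> (a \<oplus>\<^bsub>B\<^esub> b) = \<delta> a \<oplus>\<^bsub>?T\<^esub> \<delta> b"
      using ab by (auto simp: \<delta>_def triangular_simps d_add Om.minus_add)
    show "u a \<otimes>\<^bsub>?T\<^esub> \<delta> b = \<delta> b \<otimes>\<^bsub>?T\<^esub> u a"
      using ab frm_central[OF ab(1), of "frm \<one>\<^bsub>B\<^esub> [b]"] anti[OF ab]
      by (simp add: \<delta>_def u_def triangular_simps Om.l_minus Om.r_minus)
    show "\<delta> (a \<otimes>\<^bsub>B\<^esub> b) = u a \<otimes>\<^bsub>?T\<^esub> \<delta> b \<oplus>\<^bsub>?T\<^esub> u b \<otimes>\<^bsub>?T\<^esub> \<delta> a"
      using ab d_anticomm[OF ab]
      by (simp add: \<delta>_def u_def triangular_simps d_mult frm_mult Om.minus_add Om.r_minus)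
  next
    fix b assume b: "b \<in> carrier B"
    show "\<delta> b \<in> carrier ?T" using b by (simp add: \<delta>_def triangular_simps)
    show "\<delta> b \<otimes>\<^bsub>?T\<^esub> \<delta> b = \<zero>\<^bsub>?T\<^esub>"
      using b d_square[OF b] by (simp add: \<delta>_def triangular_simps Om.l_minus Om.r_minus)
  qed (auto simp: \<delta>_def triangular_simps d_const)
  have fold: "foldr (\<otimes>\<^bsub>?T\<^esub>) (map \<delta> bs) \<one>\<^bsub>?T\<^esub> = (signed (length bs) (frm \<one>\<^bsub>B\<^esub> bs), \<zero>\<^bsub>Om\<^esub>, frm \<one>\<^bsub>B\<^esub> bs)"
    if "set bs \<subseteq> carrier B" for bs
    using that
  proof (induction bs)
    case (Cons b bs)
    then show ?case
      by (auto simp: \<delta>_def triangular_simps signed_def Om.l_minus Om.r_minus frm_mult)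
  qed (simp add: triangular_simps signed_def frm_one)
  have "\<Psi> (frm b bs) = (signed (length bs) (frm b bs), frm \<one>\<^bsub>B\<^esub> (b # bs), frm b bs)"
    if "b \<in> carrier B" "set bs \<subseteq> carrier B" for b bs
    unfolding \<Psi>f[OF that] fold[OF that(2)]
    using that by (auto simp: u_def triangular_simps signed_def Om.r_minus frm_mult)
  with \<Psi> show thesis using that by blast
qed

text \<open>The diagonal of the image of \<open>x\<close> is \<open>\<sigma> x, x\<close>, so the corner of a product of two such matrices is the
  Leibniz rule twisted by the sign automorphism \<open>\<sigma>\<close>.\<close>

theorem differential_exists:
  obtains \<sigma> where "\<sigma> \<in> ring_hom Om Om"
    "\<And>b bs. b \<in> carrier B \<Longrightarrow> set bs \<subseteq> carrier B \<Longrightarrow> \<sigma> (frm b bs) = signed (length bs) (frm b bs)"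
    "\<And>x. x \<in> carrier Om \<Longrightarrow> \<sigma> (\<sigma> x) = x"
    "\<And>x. x \<in> carrier Om \<Longrightarrow> d (\<sigma> x) = \<ominus>\<^bsub>Om\<^esub> \<sigma> (d x)"
    "abelian_group_hom Om Om d"
    "\<And>b bs. b \<in> carrier B \<Longrightarrow> set bs \<subseteq> carrier B \<Longrightarrow> d (frm b bs) = frm \<one>\<^bsub>B\<^esub> (b # bs)"
    "\<And>x y. x \<in> carrier Om \<Longrightarrow> y \<in> carrier Om \<Longrightarrow>
      d (x \<otimes>\<^bsub>Om\<^esub> y) = \<sigma> x \<otimes>\<^bsub>Om\<^esub> d y \<oplus>\<^bsub>Om\<^esub> d x \<otimes>\<^bsub>Om\<^esub> y"
proof -
  let ?T = "triangular_ring Om"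
  obtain \<Psi> where \<Psi>: "\<Psi> \<in> ring_hom Om ?T"
    and \<Psi>f: "\<And>b bs. b \<in> carrier B \<Longrightarrow> set bs \<subseteq> carrier B \<Longrightarrow>
      \<Psi> (frm b bs) = (signed (length bs) (frm b bs), frm \<one>\<^bsub>B\<^esub> (b # bs), frm b bs)"
    by (rule triangular_hom) blast
  define \<sigma> where "\<sigma> x = fst (\<Psi> x)" for x
  define D where "D x = fst (snd (\<Psi> x))" for x
  have third: "snd (snd (\<Psi> x)) = x" if "x \<in> carrier Om" for x
    using that
  proof (induction rule: forms_induct)
    case (add x y)
    then show ?case using ring_hom_closed[OF \<Psi>, of x] ring_hom_closed[OF \<Psi>, of y]
      by (auto simp: ring_hom_add[OF \<Psi>] triangular_simps)
  qed (simp add: \<Psi>f)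
  have eq: "\<Psi> x = (\<sigma> x, D x, x)" if "x \<in> carrier Om" for x
    using third[OF that] by (auto simp: \<sigma>_def D_def prod_eq_iff)
  have cl: "\<sigma> x \<in> carrier Om" "D x \<in> carrier Om" if "x \<in> carrier Om" for x
    using ring_hom_closed[OF \<Psi> that] eq[OF that] by (auto simp: triangular_simps)
  have mult: "\<sigma> (x \<otimes>\<^bsub>Om\<^esub> y) = \<sigma> x \<otimes>\<^bsub>Om\<^esub> \<sigma> y"
    "D (x \<otimes>\<^bsub>Om\<^esub> y) = \<sigma> x \<otimes>\<^bsub>Om\<^esub> D y \<oplus>\<^bsub>Om\<^esub> D x \<otimes>\<^bsub>Om\<^esub> y" if "x \<in> carrier Om" "y \<in> carrier Om" for x y
    using ring_hom_mult[OF \<Psi> that] that eq[of x] eq[of y] eq[of "x \<otimes>\<^bsub>Om\<^esub> y"]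
    by (auto simp: triangular_simps)
  have add: "\<sigma> (x \<oplus>\<^bsub>Om\<^esub> y) = \<sigma> x \<oplus>\<^bsub>Om\<^esub> \<sigma> y" "D (x \<oplus>\<^bsub>Om\<^esub> y) = D x \<oplus>\<^bsub>Om\<^esub> D y"
    if "x \<in> carrier Om" "y \<in> carrier Om" for x y
    using ring_hom_add[OF \<Psi> that] that eq[of x] eq[of y] eq[of "x \<oplus>\<^bsub>Om\<^esub> y"]
    by (auto simp: triangular_simps)
  have f: "\<sigma> (frm b bs) = signed (length bs) (frm b bs)" "D (frm b bs) = frm \<one>\<^bsub>B\<^esub> (b # bs)"
    if "b \<in> carrier B" "set bs \<subseteq> carrier B" for b bs
    using \<Psi>f[OF that] by (auto simp: \<sigma>_def D_def)
  have \<sigma>: "\<sigma> \<in> ring_hom Om Om"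
  proof (rule ring_hom_memI)
    show "\<sigma> \<one>\<^bsub>Om\<^esub> = \<one>\<^bsub>Om\<^esub>" using f(1)[of "\<one>\<^bsub>B\<^esub>" "[]"] by (simp add: frm_one signed_def)
  qed (auto simp: cl mult add)
  interpret \<sigma>: ring_hom_ring Om Om \<sigma> by (rule ring_hom_ringI2[OF ring_Om ring_Om \<sigma>])
  have Dhom: "abelian_group_hom Om Om D"
    by (rule additive_mapI) (auto simp: cl add Om.abelian_group_axioms)
  interpret D: abelian_group_hom Om Om D by (rule Dhom)
  have dD: "d x = D x" if "x \<in> carrier Om" for x
    unfolding differential_Om
  proof (rule union_over_class[OF _ that])
    fix t assume t: "t \<in> carrier FW"
    have tw: "t w \<in> carrier B \<and> set w \<subseteq> carrier B" if "w \<in> W.supp t" for w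
      using t that unfolding W.carrier_KM by auto
    interpret c: abelian_group_hom FW Om cls
      by (rule additive_map_of_ring_hom[OF FW.ring_axioms ring_Om cls_hom])
    have 1: "(\<lambda>w. mr_monom B \<one>\<^bsub>B\<^esub> (t w # w)) \<in> W.supp t \<rightarrow> carrier FW"
      using tw by (auto intro!: W.monom_closed simp: subset_iff)
    have "cls (\<Oplus>\<^bsub>FW\<^esub>w\<in>W.supp t. mr_monom B \<one>\<^bsub>B\<^esub> (t w # w))
        = (\<Oplus>\<^bsub>Om\<^esub>w\<in>W.supp t. frm \<one>\<^bsub>B\<^esub> (t w # w))"
      using c.hom_finsum[OF 1] by (simp add: form_def)
    also have "\<dots> = (\<Oplus>\<^bsub>Om\<^esub>w\<in>W.supp t. D (frm (t w) w))"
      by (rule Om.finsum_cong') (use tw in \<open>auto simp: f\<close>)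
    also have "\<dots> = D (cls t)"
      unfolding cls_sum_of_forms(3)[OF t] using D.hom_finsum[OF cls_sum_of_forms(2)[OF t]] by simp
    finally show "cls (\<Oplus>\<^bsub>FW\<^esub>w\<in>W.supp t. mr_monom B \<one>\<^bsub>B\<^esub> (t w # w)) = D (cls t)" .
  qed
  have signed_hom: "abelian_group_hom Om Om (signed q)" for q
    by (rule additive_mapI) (auto simp: signed_def Om.abelian_group_axioms Om.minus_add)
  have \<sigma>s: "\<sigma> (signed q x) = signed q (\<sigma> x)" "D (signed q x) = signed q (D x)" if "x \<in> carrier Om" for x q
    using that by (auto simp: signed_def)
  have "\<sigma> (\<sigma> x) = x" if "x \<in> carrier Om" for x
    using that
  proof (induction rule: forms_induct)
    case (frm b bs)
    then show ?case by (simp add: f \<sigma>s) (simp add: signed_def)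
  qed (simp add: cl)
  moreover have "D (\<sigma> x) = \<ominus>\<^bsub>Om\<^esub> \<sigma> (D x)" if "x \<in> carrier Om" for x
    using that
  proof (induction rule: forms_induct)
    case (frm b bs)
    then show ?case by (simp add: f \<sigma>s) (simp add: signed_def)
  qed (simp add: cl Om.minus_add)
  moreover have "abelian_group_hom Om Om d"
    by (rule additive_mapI) (auto simp: dD cl Om.abelian_group_axioms)
  ultimately show thesis
    using \<sigma> f dD cl mult frm_closed by (intro that[of \<sigma>]) (simp_all only: Om.m_closed)
qed

lemma d_hom: "abelian_group_hom Om Om d"
  by (rule differential_exists)

sublocale d: abelian_group_hom "de_rham B0 B g" "de_rham B0 B g" "differential (de_rham B0 B g)"
  by (rule d_hom)

lemma d_frm:
  assumes "b \<in> carrier B" "set bs \<subseteq> carrier B"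
  shows "d (frm b bs) = frm \<one>\<^bsub>B\<^esub> (b # bs)"
proof -
  have "\<And>b bs. b \<in> carrier B \<Longrightarrow> set bs \<subseteq> carrier B \<Longrightarrow> d (frm b bs) = frm \<one>\<^bsub>B\<^esub> (b # bs)"
    by (rule differential_exists)
  then show ?thesis using assms .
qed

lemma d_d:
  assumes "x \<in> carrier Om"
  shows "d (d x) = \<zero>\<^bsub>Om\<^esub>"
  using assms
proof (induction rule: forms_induct)
  case (frm b bs)
  have "frm \<one>\<^bsub>B\<^esub> (\<one>\<^bsub>B\<^esub> # b # bs) = frm \<one>\<^bsub>B\<^esub> [\<one>\<^bsub>B\<^esub>] \<otimes>\<^bsub>Om\<^esub> frm \<one>\<^bsub>B\<^esub> (b # bs)"
    using frm by (intro frm_Cons(1)) auto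
  then show ?case using frm by (simp add: d_frm d_one)
qed simp

lemma d_degree:
  assumes "x \<in> degree_part Om q"
  shows "d x \<in> degree_part Om (Suc q)"
  using assms
proof (induction rule: degree_induct)
  case (frm b bs)
  then show ?case using frm_degree[of "\<one>\<^bsub>B\<^esub>" "b # bs"] by (simp add: d_frm)
qed (simp add: degree_closed degree_add)

lemma degree_minus:
  assumes "x \<in> degree_part Om q"
  shows "\<ominus>\<^bsub>Om\<^esub> x \<in> degree_part Om q"
  using assms
proof (induction rule: degree_induct)
  case (frm b bs)
  interpret abelian_group_hom B Om "\<lambda>b. frm b bs" using frm by (intro frm_hom)
  show ?case using frm frm_degree[of "\<ominus>\<^bsub>B\<^esub> b" bs] by simp
qed (simp add: degree_closed degree_add Om.minus_add)

end

section \<open>Functoriality of forms\<close>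

locale de_rham_morphism = D: de_rham_complex B0 B g + D': de_rham_complex B0' B' g'
  for B0 :: "('a, 'c) ring_scheme" and B :: "('b, 'd) ring_scheme" and g
    and B0' :: "('a1, 'e) ring_scheme" and B' :: "('b1, 'f) ring_scheme" and g' +
  fixes u :: "'b \<Rightarrow> 'b1"
  assumes u: "u \<in> ring_hom B B'"
    and u_base: "\<And>a. a \<in> carrier B0 \<Longrightarrow> \<exists>a'\<in>carrier B0'. u (g a) = g' a'"
begin

abbreviation U where "U \<equiv> de_rham_map B B0' B' g' u"

lemma u_closed: "b \<in> carrier B \<Longrightarrow> u b \<in> carrier B'" using u by (rule ring_hom_closed)

lemma map_closed: "set bs \<subseteq> carrier B \<Longrightarrow> set (map u bs) \<subseteq> carrier B'" using u_closed by auto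

lemma de_rham_map_exists:
  "U \<in> ring_hom D.Om D'.Om \<and>
    (\<forall>b bs. b \<in> carrier B \<longrightarrow> set bs \<subseteq> carrier B \<longrightarrow> U (D.frm b bs) = D'.frm (u b) (map u bs))"
proof -
  let ?E = "D'.Om"
  have uh: "(\<lambda>b. D'.frm (u b) []) \<in> ring_hom B ?E"
    by (rule ring_hom_memI) (auto simp: u_closed D'.frm_mult D'.frm_add D'.frm_one
        ring_hom_mult[OF u] ring_hom_add[OF u] ring_hom_one[OF u])
  obtain \<Psi> where \<Psi>: "\<Psi> \<in> ring_hom D.Om ?E"
    and \<Psi>f: "\<And>b bs. b \<in> carrier B \<Longrightarrow> set bs \<subseteq> carrier B \<Longrightarrow> \<Psi> (D.frm b bs)
      = D'.frm (u b) [] \<otimes>\<^bsub>?E\<^esub> foldr (\<otimes>\<^bsub>?E\<^esub>) (map (\<lambda>b. D'.frm \<one>\<^bsub>B'\<^esub> [u b]) bs) \<one>\<^bsub>?E\<^esub>"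
  proof (rule D.de_rham_universal[OF D'.ring_Om uh, of "\<lambda>b. D'.frm \<one>\<^bsub>B'\<^esub> [u b]"])
    fix a assume "a \<in> carrier B0"
    then obtain a' where "a' \<in> carrier B0'" "u (g a) = g' a'" using u_base by blast
    then show "D'.frm \<one>\<^bsub>B'\<^esub> [u (g a)] = \<zero>\<^bsub>?E\<^esub>" using D'.d_const by simp
  qed (auto simp: u_closed D'.frm_mult ring_hom_add[OF u] D'.d_add D'.d_mult ring_hom_mult[OF u] D'.d_d_same)
  have f: "\<Psi> (D.frm b bs) = D'.frm (u b) (map u bs)" if "b \<in> carrier B" "set bs \<subseteq> carrier B" for b bs
    using \<Psi>f[OF that] D'.foldr_d[OF map_closed[OF that(2)]] that map_closed[OF that(2)] u_closed
    by (simp add: o_def D'.frm_mult)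
  interpret \<Psi>: ring_hom_ring D.Om D'.Om \<Psi> by (rule ring_hom_ringI2[OF D.ring_Om D'.ring_Om \<Psi>])
  have eq: "U x = \<Psi> x" if "x \<in> carrier D.Om" for x
    unfolding de_rham_map_def
  proof (rule D.union_over_class[OF _ that])
    fix t assume t: "t \<in> carrier D.FW"
    have tw: "t w \<in> carrier B \<and> set w \<subseteq> carrier B" if "w \<in> D.W.supp t" for w
      using t that unfolding D.W.carrier_KM by auto
    interpret c: abelian_group_hom D'.FW D'.Om D'.cls
      by (rule additive_map_of_ring_hom[OF D'.FW.ring_axioms D'.ring_Om D'.cls_hom])
    have 1: "(\<lambda>w. mr_monom B' (u (t w)) (map u w)) \<in> D.W.supp t \<rightarrow> carrier D'.FW"
      using tw u_closed by (auto intro!: D'.W.monom_closed simp: subset_iff)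
    have "D'.cls (\<Oplus>\<^bsub>D'.FW\<^esub>w\<in>D.W.supp t. mr_monom B' (u (t w)) (map u w))
        = (\<Oplus>\<^bsub>D'.Om\<^esub>w\<in>D.W.supp t. D'.frm (u (t w)) (map u w))"
      using c.hom_finsum[OF 1] by (simp add: form_def)
    also have "\<dots> = (\<Oplus>\<^bsub>D'.Om\<^esub>w\<in>D.W.supp t. \<Psi> (D.frm (t w) w))"
      by (rule D'.Om.finsum_cong')
        (use tw in \<open>auto simp: f Pi_iff subset_iff intro!: D'.frm_closed u_closed\<close>)
    also have "\<dots> = \<Psi> (D.cls t)"
      unfolding D.cls_sum_of_forms(3)[OF t] using \<Psi>.hom_finsum[OF D.cls_sum_of_forms(2)[OF t]]
      by (simp add: o_def)
    finally show "D'.cls (\<Oplus>\<^bsub>D'.FW\<^esub>w\<in>D.W.supp t. mr_monom B' (u (t w)) (map u w)) = \<Psi> (D.cls t)" .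
  qed
  have "U \<in> ring_hom D.Om D'.Om"
    by (rule ring_hom_memI) (auto simp: eq \<Psi>.hom_closed)
  then show ?thesis by (auto simp: eq f)
qed

lemma U_hom: "U \<in> ring_hom D.Om D'.Om" and
  U_frm: "b \<in> carrier B \<Longrightarrow> set bs \<subseteq> carrier B \<Longrightarrow> U (D.frm b bs) = D'.frm (u b) (map u bs)"
  using de_rham_map_exists by blast+

sublocale U: ring_hom_ring "de_rham B0 B g" "de_rham B0' B' g'" "de_rham_map B B0' B' g' u"
  by (rule ring_hom_ringI2[OF D.ring_Om D'.ring_Om U_hom])

lemma U_d:
  assumes "x \<in> carrier D.Om"
  shows "U (D.d x) = D'.d (U x)"
  using assms
proof (induction rule: D.forms_induct)
  case (frm b bs)
  then show ?case using map_closed[of bs] u_closed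
    by (simp add: D.d_frm D'.d_frm U_frm ring_hom_one[OF u])
qed simp

lemma U_degree:
  assumes "x \<in> degree_part D.Om q"
  shows "U x \<in> degree_part D'.Om q"
  using assms
proof (induction rule: D.degree_induct)
  case (frm b bs)
  then show ?case using map_closed[of bs] u_closed D'.frm_degree[of "u b" "map u bs"]
    by (simp add: U_frm)
qed (simp add: D.degree_closed D'.degree_add)

end

section \<open>The exterior algebra representation and torsion\<close>

definition end_ring :: "('m, 'c) ring_scheme \<Rightarrow> ('m \<Rightarrow> 'm) ring" where
  "end_ring M =
    \<lparr>carrier = {L \<in> carrier M \<rightarrow>\<^sub>E carrier M. \<forall>x\<in>carrier M. \<forall>y\<in>carrier M. L (x \<oplus>\<^bsub>M\<^esub> y) = L x \<oplus>\<^bsub>M\<^esub> L y},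
     monoid.mult = (\<lambda>K L. \<lambda>x\<in>carrier M. K (L x)),
     monoid.one = (\<lambda>x\<in>carrier M. x),
     ring.zero = (\<lambda>x\<in>carrier M. \<zero>\<^bsub>M\<^esub>),
     ring.add = (\<lambda>K L. \<lambda>x\<in>carrier M. K x \<oplus>\<^bsub>M\<^esub> L x)\<rparr>"

lemma end_ring_simps:
  "L \<in> carrier (end_ring M) \<longleftrightarrow> L \<in> carrier M \<rightarrow>\<^sub>E carrier M \<and>
    (\<forall>x\<in>carrier M. \<forall>y\<in>carrier M. L (x \<oplus>\<^bsub>M\<^esub> y) = L x \<oplus>\<^bsub>M\<^esub> L y)"
  "K \<otimes>\<^bsub>end_ring M\<^esub> L = (\<lambda>x\<in>carrier M. K (L x))"
  "\<one>\<^bsub>end_ring M\<^esub> = (\<lambda>x\<in>carrier M. x)"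
  "\<zero>\<^bsub>end_ring M\<^esub> = (\<lambda>x\<in>carrier M. \<zero>\<^bsub>M\<^esub>)"
  "K \<oplus>\<^bsub>end_ring M\<^esub> L = (\<lambda>x\<in>carrier M. K x \<oplus>\<^bsub>M\<^esub> L x)"
  by (simp_all add: end_ring_def)

lemma end_ring_closed:
  "L \<in> carrier (end_ring M) \<Longrightarrow> x \<in> carrier M \<Longrightarrow> L x \<in> carrier M"
  by (auto simp: end_ring_simps)

lemma end_ring_eqI:
  assumes "K \<in> carrier (end_ring M)" "L \<in> carrier (end_ring M)"
    and "\<And>x. x \<in> carrier M \<Longrightarrow> K x = L x"
  shows "K = L"
  by (rule extensionalityI[of K "carrier M"]) (use assms in \<open>auto simp: end_ring_simps PiE_iff\<close>)

lemma (in abelian_group) ring_end: "ring (end_ring G)"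
proof -
  have add: "K \<oplus>\<^bsub>end_ring G\<^esub> L \<in> carrier (end_ring G)"
    if "K \<in> carrier (end_ring G)" "L \<in> carrier (end_ring G)" for K L
    using that end_ring_closed[OF that(1)] end_ring_closed[OF that(2)]
    by (auto simp: end_ring_simps a_ac)
  have mult: "K \<otimes>\<^bsub>end_ring G\<^esub> L \<in> carrier (end_ring G)"
    if "K \<in> carrier (end_ring G)" "L \<in> carrier (end_ring G)" for K L
    using that end_ring_closed[OF that(1)] end_ring_closed[OF that(2)]
    by (auto simp: end_ring_simps)
  have zero: "\<zero>\<^bsub>end_ring G\<^esub> \<in> carrier (end_ring G)" and one: "\<one>\<^bsub>end_ring G\<^esub> \<in> carrier (end_ring G)"
    by (auto simp: end_ring_simps)
  have neg: "(\<lambda>x\<in>carrier G. \<ominus> L x) \<in> carrier (end_ring G)" if "L \<in> carrier (end_ring G)" for L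
    using that end_ring_closed[OF that] by (auto simp: end_ring_simps minus_add a_comm)
  show ?thesis
  proof (rule ringI)
    show "abelian_group (end_ring G)"
    proof (rule abelian_groupI)
      fix L assume L: "L \<in> carrier (end_ring G)"
      show "\<exists>K\<in>carrier (end_ring G). K \<oplus>\<^bsub>end_ring G\<^esub> L = \<zero>\<^bsub>end_ring G\<^esub>"
        by (rule bexI[OF _ neg[OF L]], rule end_ring_eqI[OF add[OF neg[OF L] L] zero])
          (use end_ring_closed[OF L] in \<open>simp add: end_ring_simps l_neg\<close>)
    next
      fix K L P assume c: "K \<in> carrier (end_ring G)" "L \<in> carrier (end_ring G)" "P \<in> carrier (end_ring G)"
      note cl = c[THEN end_ring_closed]
      show "K \<oplus>\<^bsub>end_ring G\<^esub> L \<oplus>\<^bsub>end_ring G\<^esub> P = K \<oplus>\<^bsub>end_ring G\<^esub> (L \<oplus>\<^bsub>end_ring G\<^esub> P)"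
        by (rule end_ring_eqI) (use c add in auto, use cl in \<open>simp add: end_ring_simps a_assoc\<close>)
      show "K \<oplus>\<^bsub>end_ring G\<^esub> L = L \<oplus>\<^bsub>end_ring G\<^esub> K"
        by (rule end_ring_eqI) (use c add in auto, use cl in \<open>simp add: end_ring_simps a_comm\<close>)
      show "\<zero>\<^bsub>end_ring G\<^esub> \<oplus>\<^bsub>end_ring G\<^esub> K = K"
        by (rule end_ring_eqI) (use c add zero in auto, use cl in \<open>simp add: end_ring_simps\<close>)
    qed (auto simp: add zero)
    show "Group.monoid (end_ring G)"
    proof (rule monoidI)
      fix K L P assume c: "K \<in> carrier (end_ring G)" "L \<in> carrier (end_ring G)" "P \<in> carrier (end_ring G)"
      note cl = c[THEN end_ring_closed]
      show "K \<otimes>\<^bsub>end_ring G\<^esub> L \<otimes>\<^bsub>end_ring G\<^esub> P = K \<otimes>\<^bsub>end_ring G\<^esub> (L \<otimes>\<^bsub>end_ring G\<^esub> P)"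
        by (rule end_ring_eqI) (use c mult in auto, use cl in \<open>simp add: end_ring_simps\<close>)
      show "\<one>\<^bsub>end_ring G\<^esub> \<otimes>\<^bsub>end_ring G\<^esub> K = K"
        by (rule end_ring_eqI) (use c mult one in auto, use cl in \<open>simp add: end_ring_simps\<close>)
      show "K \<otimes>\<^bsub>end_ring G\<^esub> \<one>\<^bsub>end_ring G\<^esub> = K"
        by (rule end_ring_eqI) (use c mult one in auto, use cl in \<open>simp add: end_ring_simps\<close>)
    qed (auto simp: mult one)
    fix K L P assume c: "K \<in> carrier (end_ring G)" "L \<in> carrier (end_ring G)" "P \<in> carrier (end_ring G)"
    note cl = c[THEN end_ring_closed]
    show "(K \<oplus>\<^bsub>end_ring G\<^esub> L) \<otimes>\<^bsub>end_ring G\<^esub> P = K \<otimes>\<^bsub>end_ring G\<^esub> P \<oplus>\<^bsub>end_ring G\<^esub> L \<otimes>\<^bsub>end_ring G\<^esub> P"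
      by (rule end_ring_eqI) (use c mult add in auto, use cl in \<open>simp add: end_ring_simps\<close>)
    have Padd: "P (x \<oplus> y) = P x \<oplus> P y" if "x \<in> carrier G" "y \<in> carrier G" for x y
      using c(3) that by (simp add: end_ring_simps)
    show "P \<otimes>\<^bsub>end_ring G\<^esub> (K \<oplus>\<^bsub>end_ring G\<^esub> L) = P \<otimes>\<^bsub>end_ring G\<^esub> K \<oplus>\<^bsub>end_ring G\<^esub> P \<otimes>\<^bsub>end_ring G\<^esub> L"
      by (rule end_ring_eqI) (use c mult add in auto, use cl Padd in \<open>simp add: end_ring_simps\<close>)
  qed
qed

text \<open>The underlying group of the exterior algebra over \<open>B\<close> on generators indexed by numbers: the value at
  a set \<open>T\<close> is the coefficient of the product of the generators in \<open>T\<close> in increasing order.\<close>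

definition exterior_group :: "('b, 'c) ring_scheme \<Rightarrow> (nat set \<Rightarrow> 'b) ring" where
  "exterior_group B = \<lparr>carrier = {F. \<forall>T. F T \<in> carrier B}, monoid.mult = (\<lambda>F H. F),
     monoid.one = (\<lambda>T. \<zero>\<^bsub>B\<^esub>), ring.zero = (\<lambda>T. \<zero>\<^bsub>B\<^esub>), ring.add = (\<lambda>F H T. F T \<oplus>\<^bsub>B\<^esub> H T)\<rparr>"

lemma exterior_simps:
  "F \<in> carrier (exterior_group B) \<longleftrightarrow> (\<forall>T. F T \<in> carrier B)"
  "\<zero>\<^bsub>exterior_group B\<^esub> = (\<lambda>T. \<zero>\<^bsub>B\<^esub>)"
  "F \<oplus>\<^bsub>exterior_group B\<^esub> H = (\<lambda>T. F T \<oplus>\<^bsub>B\<^esub> H T)"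
  by (simp_all add: exterior_group_def)

lemma (in abelian_group) abelian_group_exterior: "abelian_group (exterior_group G)"
proof (rule abelian_groupI)
  fix F assume "F \<in> carrier (exterior_group G)"
  then show "\<exists>H\<in>carrier (exterior_group G). H \<oplus>\<^bsub>exterior_group G\<^esub> F = \<zero>\<^bsub>exterior_group G\<^esub>"
    by (intro bexI[of _ "\<lambda>T. \<ominus> F T"]) (auto simp: exterior_simps l_neg)
qed (auto simp: exterior_simps a_ac)

definition wedge_sign :: "('b, 'c) ring_scheme \<Rightarrow> nat \<Rightarrow> nat set \<Rightarrow> 'b \<Rightarrow> 'b" where
  "wedge_sign B i T x = (if even (card {j \<in> T. j < i}) then x else \<ominus>\<^bsub>B\<^esub> x)"

text \<open>Left multiplication by the \<open>i\<close>-th generator; the sign counts the generators that it has to pass.\<close>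

definition wedge :: "('b, 'c) ring_scheme \<Rightarrow> nat \<Rightarrow> (nat set \<Rightarrow> 'b) \<Rightarrow> nat set \<Rightarrow> 'b" where
  "wedge B i = (\<lambda>F\<in>carrier (exterior_group B). \<lambda>T.
     if i \<in> T then wedge_sign B i T (F (T - {i})) else \<zero>\<^bsub>B\<^esub>)"

definition scale :: "('b, 'c) ring_scheme \<Rightarrow> 'b \<Rightarrow> (nat set \<Rightarrow> 'b) \<Rightarrow> nat set \<Rightarrow> 'b" where
  "scale B c = (\<lambda>F\<in>carrier (exterior_group B). \<lambda>T. c \<otimes>\<^bsub>B\<^esub> F T)"

context cring
begin

abbreviation ER where "ER \<equiv> end_ring (exterior_group R)"

lemma ring_ER: "ring ER"
  by (rule abelian_group.ring_end[OF abelian_group_exterior])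

lemma wedge_sign_closed [simp]: "x \<in> carrier R \<Longrightarrow> wedge_sign R i T x \<in> carrier R"
  by (simp add: wedge_sign_def)

lemma wedge_closed: "wedge R i \<in> carrier ER"
  by (auto simp: end_ring_simps exterior_simps wedge_def) (auto simp: wedge_sign_def minus_add a_comm)

lemma scale_closed: "c \<in> carrier R \<Longrightarrow> scale R c \<in> carrier ER"
  by (auto simp: end_ring_simps exterior_simps scale_def r_distr)

lemma scale_hom: "scale R \<in> ring_hom R ER"
proof -
  interpret E: ring ER by (rule ring_ER)
  show ?thesis
  proof (rule ring_hom_memI)
    fix x y assume xy: "x \<in> carrier R" "y \<in> carrier R"
    show "scale R (x \<otimes> y) = scale R x \<otimes>\<^bsub>ER\<^esub> scale R y"
      by (rule end_ring_eqI)
        (use xy in \<open>auto simp: scale_closed\<close>, use xy in \<open>auto simp: end_ring_simps exterior_simps scale_def m_assoc\<close>)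
    show "scale R (x \<oplus> y) = scale R x \<oplus>\<^bsub>ER\<^esub> scale R y"
      by (rule end_ring_eqI)
        (use xy in \<open>auto simp: scale_closed\<close>, use xy in \<open>auto simp: end_ring_simps exterior_simps scale_def l_distr\<close>)
  next
    show "scale R \<one> = \<one>\<^bsub>ER\<^esub>"
      by (rule end_ring_eqI) (auto simp: scale_closed, auto simp: end_ring_simps exterior_simps scale_def)
  qed (rule scale_closed)
qed

lemma scale_wedge: "c \<in> carrier R \<Longrightarrow> scale R c \<otimes>\<^bsub>ER\<^esub> wedge R i = wedge R i \<otimes>\<^bsub>ER\<^esub> scale R c"
proof -
  interpret E: ring ER by (rule ring_ER)
  assume c: "c \<in> carrier R"
  show ?thesis
    by (rule end_ring_eqI) (use c in \<open>auto simp: scale_closed wedge_closed\<close>,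
      use c in \<open>auto simp: end_ring_simps exterior_simps scale_def wedge_def\<close>,
      auto simp: wedge_sign_def r_minus)
qed

lemma wedge_square: "wedge R i \<otimes>\<^bsub>ER\<^esub> wedge R i = \<zero>\<^bsub>ER\<^esub>"
proof -
  interpret E: ring ER by (rule ring_ER)
  show ?thesis
    by (rule end_ring_eqI) (auto simp: wedge_closed, auto simp: end_ring_simps exterior_simps wedge_def,
       auto simp: wedge_sign_def)
qed

lemma wedge_anticomm: "wedge R i \<otimes>\<^bsub>ER\<^esub> wedge R j \<oplus>\<^bsub>ER\<^esub> wedge R j \<otimes>\<^bsub>ER\<^esub> wedge R i = \<zero>\<^bsub>ER\<^esub>"
proof -
  interpret E: ring ER by (rule ring_ER)
  have lt: "wedge R i \<otimes>\<^bsub>ER\<^esub> wedge R j \<oplus>\<^bsub>ER\<^esub> wedge R j \<otimes>\<^bsub>ER\<^esub> wedge R i = \<zero>\<^bsub>ER\<^esub>" if "i < j" for i j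
  proof (rule end_ring_eqI)
    fix F assume F: "F \<in> carrier (exterior_group R)"
    have c: "F T \<in> carrier R" for T using F by (simp add: exterior_simps)
    have w: "wedge R k F \<in> carrier (exterior_group R)" for k
      by (rule end_ring_closed[OF wedge_closed F])
    have "wedge R i (wedge R j F) T \<oplus> wedge R j (wedge R i F) T = \<zero>" for T
    proof (cases "i \<in> T \<and> j \<in> T")
      case True
      have 1: "{k \<in> T. k < j} = insert i {k \<in> T - {i}. k < j}" using True that by auto
      have "card {k \<in> T. k < j} = Suc (card {k \<in> T - {i}. k < j})"
        unfolding 1 by (subst card_insert_disjoint) auto
      moreover have "{k \<in> T - {j}. k < i} = {k \<in> T. k < i}" using that by auto
      moreover have "T - {i} - {j} = T - {j} - {i}" by auto
      ultimately show ?thesis using True that F w c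
        by (simp add: wedge_def) (auto simp: wedge_sign_def l_neg r_neg)
    qed (use F w c that in \<open>auto simp: wedge_def wedge_sign_def\<close>)
    then show "(wedge R i \<otimes>\<^bsub>ER\<^esub> wedge R j \<oplus>\<^bsub>ER\<^esub> wedge R j \<otimes>\<^bsub>ER\<^esub> wedge R i) F = \<zero>\<^bsub>ER\<^esub> F"
      using F by (simp add: end_ring_simps exterior_simps)
  qed (auto simp: wedge_closed)
  consider "i < j" | "j < i" | "i = j" by linarith
  then show ?thesis
  proof cases
    case 2
    then show ?thesis using lt[of j i] by (subst E.a_comm) (auto simp: wedge_closed)
  qed (auto simp: lt wedge_square)
qed

end

text \<open>\<open>dt\<^sub>i\<close> moves into a sorted product at the cost of the sign that \<^const>\<open>wedge\<close> uses.\<close>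

context de_rham_complex
begin

lemma frm_swap:
  assumes "c \<in> carrier B" "a \<in> carrier B" "b \<in> carrier B" "set bs \<subseteq> carrier B"
  shows "frm c (a # b # bs) = frm (\<ominus>\<^bsub>B\<^esub> c) (b # a # bs)"
proof -
  have 1: "frm \<one>\<^bsub>B\<^esub> [a, b] = \<ominus>\<^bsub>Om\<^esub> frm \<one>\<^bsub>B\<^esub> [b, a]"
    using d_anticomm[of a b] assms by (intro Om.add.inv_equality[symmetric]) (auto simp: frm_mult)
  interpret h: abelian_group_hom B Om "\<lambda>c. frm c (b # a # bs)" using assms by (intro frm_hom) auto
  have "frm c (a # b # bs) = frm c [] \<otimes>\<^bsub>Om\<^esub> (frm \<one>\<^bsub>B\<^esub> [a, b] \<otimes>\<^bsub>Om\<^esub> frm \<one>\<^bsub>B\<^esub> bs)"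
    using assms by (simp add: frm_mult)
  also have "\<dots> = \<ominus>\<^bsub>Om\<^esub> frm c (b # a # bs)"
    unfolding 1 using assms by (simp add: Om.l_minus Om.r_minus frm_mult)
  finally show ?thesis using assms by simp
qed

lemma frm_same:
  assumes "c \<in> carrier B" "a \<in> carrier B" "set bs \<subseteq> carrier B"
  shows "frm c (a # a # bs) = \<zero>\<^bsub>Om\<^esub>"
proof -
  have "frm c (a # a # bs) = frm c [] \<otimes>\<^bsub>Om\<^esub> (frm \<one>\<^bsub>B\<^esub> [a, a] \<otimes>\<^bsub>Om\<^esub> frm \<one>\<^bsub>B\<^esub> bs)"
    using assms by (simp add: frm_mult)
  then show ?thesis using assms by (simp add: d_d_same)
qed

lemma frm_insort:
  fixes t :: "nat \<Rightarrow> 'b"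
  assumes "sorted xs" "distinct xs" "c \<in> carrier B" "t i \<in> carrier B" "t ` set xs \<subseteq> carrier B"
  shows "frm c (t i # map t xs) = (if i \<in> set xs then \<zero>\<^bsub>Om\<^esub> else
    frm (if even (length (filter (\<lambda>j. j < i) xs)) then c else \<ominus>\<^bsub>B\<^esub> c) (map t (insort i xs)))"
  using assms
proof (induction xs arbitrary: c)
  case (Cons x xs)
  have tx: "t x \<in> carrier B" "set (map t xs) \<subseteq> carrier B" using Cons.prems by auto
  consider "i = x" | "i < x" | "x < i" by linarith
  then show ?case
  proof cases
    case 1
    then show ?thesis using Cons.prems tx by (simp add: frm_same)
  next
    case 2
    then have "filter (\<lambda>j. j < i) xs = []" "i \<notin> set xs"
      using Cons.prems by (auto simp: filter_empty_conv)
    then show ?thesis using 2 Cons.prems by simp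
  next
    case 3
    have c: "\<ominus>\<^bsub>B\<^esub> c \<in> carrier B" "t ` set xs \<subseteq> carrier B" "sorted xs" "distinct xs" using Cons.prems by auto
    have ins: "set (map t (insort i xs)) \<subseteq> carrier B" using Cons.prems by (auto simp: set_insort_key)
    have "frm c (t i # map t (x # xs)) = frm (\<ominus>\<^bsub>B\<^esub> c) (t x # t i # map t xs)"
      using frm_swap[of c "t i" "t x" "map t xs"] Cons.prems tx by simp
    also have "\<dots> = frm \<one>\<^bsub>B\<^esub> [t x] \<otimes>\<^bsub>Om\<^esub> frm (\<ominus>\<^bsub>B\<^esub> c) (t i # map t xs)"
      using Cons.prems tx by (simp add: frm_mult)
    also have "\<dots> = (if i \<in> set xs then \<zero>\<^bsub>Om\<^esub> else
      frm (if even (length (filter (\<lambda>j. j < i) xs)) then \<ominus>\<^bsub>B\<^esub> c else \<ominus>\<^bsub>B\<^esub> (\<ominus>\<^bsub>B\<^esub> c)) (t x # map t (insort i xs)))"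
      unfolding Cons.IH[OF c(3,4,1) Cons.prems(4) c(2)]
      using Cons.prems tx ins by (auto simp: frm_mult)
    finally show ?thesis using 3 Cons.prems by auto
  qed
qed auto

text \<open>The map from the exterior algebra over \<open>B\<close> to forms that sends the \<open>i\<close>-th generator to \<open>dt\<^sub>i\<close>.\<close>

definition expand :: "nat \<Rightarrow> (nat \<Rightarrow> 'b) \<Rightarrow> (nat set \<Rightarrow> 'b) \<Rightarrow> ('b list \<Rightarrow> 'b) set" where
  "expand N t F = (\<Oplus>\<^bsub>Om\<^esub>T\<in>Pow {..<N}. frm (F T) (map t (sorted_list_of_set T)))"

context
  fixes N :: nat and t :: "nat \<Rightarrow> 'b"
  assumes t: "\<And>i. i < N \<Longrightarrow> t i \<in> carrier B"
begin

abbreviation EG where "EG \<equiv> exterior_group B"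

lemma t_list: "T \<subseteq> {..<N} \<Longrightarrow> set (map t (sorted_list_of_set T)) \<subseteq> carrier B"
  using t finite_subset[of T "{..<N}"] by auto

lemma expand_term_closed:
  assumes "\<And>T. F T \<in> carrier B"
  shows "(\<lambda>T. frm (F T) (map t (sorted_list_of_set T))) \<in> Pow {..<N} \<rightarrow> carrier Om"
  using assms t_list frm_closed by (auto simp del: set_map)

lemma expand_hom: "abelian_group_hom EG Om (expand N t)"
proof (rule additive_mapI)
  show "abelian_group EG" by (rule B.abelian_group_exterior)
  fix F assume F: "F \<in> carrier EG"
  then show "expand N t F \<in> carrier Om"
    unfolding expand_def using expand_term_closed[of F] by (auto simp: exterior_simps)
  fix H assume H: "H \<in> carrier EG"
  have c: "F T \<in> carrier B" "H T \<in> carrier B" for T using F H by (auto simp: exterior_simps)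
  have "expand N t (F \<oplus>\<^bsub>EG\<^esub> H) = (\<Oplus>\<^bsub>Om\<^esub>T\<in>Pow {..<N}. frm (F T) (map t (sorted_list_of_set T))
    \<oplus>\<^bsub>Om\<^esub> frm (H T) (map t (sorted_list_of_set T)))"
    unfolding expand_def
    by (rule Om.finsum_cong')
      (use c t_list in \<open>auto simp: frm_add exterior_simps simp del: set_map set_sorted_list_of_set\<close>)
  also have "\<dots> = expand N t F \<oplus>\<^bsub>Om\<^esub> expand N t H"
    unfolding expand_def by (rule Om.finsum_addf) (use c expand_term_closed in auto)
  finally show "expand N t (F \<oplus>\<^bsub>EG\<^esub> H) = expand N t F \<oplus>\<^bsub>Om\<^esub> expand N t H" .
qed (rule Om.abelian_group_axioms)

lemma expand_scale:
  assumes "c \<in> carrier B" "F \<in> carrier EG"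
  shows "expand N t (scale B c F) = frm c [] \<otimes>\<^bsub>Om\<^esub> expand N t F"
proof -
  have F: "F T \<in> carrier B" for T using assms by (auto simp: exterior_simps)
  have "expand N t (scale B c F)
      = (\<Oplus>\<^bsub>Om\<^esub>T\<in>Pow {..<N}. frm c [] \<otimes>\<^bsub>Om\<^esub> frm (F T) (map t (sorted_list_of_set T)))"
    unfolding expand_def
    by (rule Om.finsum_cong')
      (use assms F t_list in \<open>auto simp: frm_mult scale_def simp del: set_map set_sorted_list_of_set\<close>)
  also have "\<dots> = frm c [] \<otimes>\<^bsub>Om\<^esub> expand N t F"
    unfolding expand_def
    by (rule Om.finsum_rdistr[symmetric]) (use assms expand_term_closed[of F] F in auto)
  finally show ?thesis .
qed

lemma expand_wedge:
  assumes i: "i < N" and FE: "F \<in> carrier EG"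
  shows "expand N t (wedge B i F) = frm \<one>\<^bsub>B\<^esub> [t i] \<otimes>\<^bsub>Om\<^esub> expand N t F"
proof -
  have F: "F T \<in> carrier B" for T using FE by (auto simp: exterior_simps)
  have wF: "wedge B i F T \<in> carrier B" for T
    using end_ring_closed[OF B.wedge_closed FE, of i] by (simp add: exterior_simps)
  let ?l = "\<lambda>T. map t (sorted_list_of_set T)"
  let ?P = "{T \<in> Pow {..<N}. i \<notin> T}"
  have lc: "set (?l T) \<subseteq> carrier B" if "T \<subseteq> {..<N}" for T using t_list[OF that] .
  have key: "frm \<one>\<^bsub>B\<^esub> [t i] \<otimes>\<^bsub>Om\<^esub> frm (F T) (?l T)
      = (if i \<in> T then \<zero>\<^bsub>Om\<^esub> else frm (wedge B i F (insert i T)) (?l (insert i T)))" if T: "T \<subseteq> {..<N}" for T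
  proof -
    have fin: "finite T" using T finite_subset by blast
    let ?xs = "sorted_list_of_set T"
    have "frm \<one>\<^bsub>B\<^esub> [t i] \<otimes>\<^bsub>Om\<^esub> frm (F T) (?l T) = frm (F T) (t i # ?l T)"
      using lc[OF T] F t i by (subst frm_mult) auto
    also have "\<dots> = (if i \<in> set ?xs then \<zero>\<^bsub>Om\<^esub> else
        frm (if even (length (filter (\<lambda>j. j < i) ?xs)) then F T else \<ominus>\<^bsub>B\<^esub> F T) (map t (insort i ?xs)))"
      by (rule frm_insort) (use F t i T fin in auto)
    also have "length (filter (\<lambda>j. j < i) ?xs) = card {j \<in> T. j < i}"
      using distinct_card[of "filter (\<lambda>j. j < i) ?xs"] fin by simp
    also have "{j \<in> T. j < i} = {j \<in> insert i T. j < i}" by auto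
    finally show ?thesis using fin FE by (auto simp: wedge_def wedge_sign_def sorted_list_of_set_insert)
  qed
  have "expand N t (wedge B i F) = (\<Oplus>\<^bsub>Om\<^esub>T\<in>insert i ` ?P. frm (wedge B i F T) (?l T))"
    unfolding expand_def
  proof (rule Om.add.finprod_mono_neutral_cong_right)
    show "insert i ` ?P \<subseteq> Pow {..<N}" using i by auto
    fix T assume T: "T \<in> Pow {..<N} - insert i ` ?P"
    have "i \<notin> T"
    proof
      assume "i \<in> T"
      then have "T = insert i (T - {i})" "T - {i} \<in> ?P" using T by auto
      then show False using T by blast
    qed
    then have "wedge B i F T = \<zero>\<^bsub>B\<^esub>" using FE by (simp add: wedge_def)
    then show "frm (wedge B i F T) (?l T) = \<zero>\<^bsub>Om\<^esub>" using T lc by (simp add: frm_zero del: set_map)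
  qed (use expand_term_closed[of "wedge B i F"] wF in auto)
  also have "\<dots> = (\<Oplus>\<^bsub>Om\<^esub>T\<in>?P. frm (wedge B i F (insert i T)) (?l (insert i T)))"
  proof (rule Om.finsum_reindex)
    show "(\<lambda>T. frm (wedge B i F T) (?l T)) \<in> insert i ` ?P \<rightarrow> carrier Om"
      using expand_term_closed[of "wedge B i F"] wF i by (auto simp: Pi_iff)
    show "inj_on (insert i) ?P" by (auto simp: inj_on_def)
  qed
  also have "\<dots> = (\<Oplus>\<^bsub>Om\<^esub>T\<in>Pow {..<N}. frm \<one>\<^bsub>B\<^esub> [t i] \<otimes>\<^bsub>Om\<^esub> frm (F T) (?l T))"
    by (rule Om.add.finprod_mono_neutral_cong_left)
      (use key lc F t i in \<open>auto simp del: set_map set_sorted_list_of_set\<close>)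
  also have "\<dots> = frm \<one>\<^bsub>B\<^esub> [t i] \<otimes>\<^bsub>Om\<^esub> expand N t F"
    unfolding expand_def
    by (rule Om.finsum_rdistr[symmetric]) (use expand_term_closed[of F] F t i in auto)
  finally show ?thesis .
qed

lemma expand_unit: "expand N t (\<lambda>T. if T = {} then \<one>\<^bsub>B\<^esub> else \<zero>\<^bsub>B\<^esub>) = \<one>\<^bsub>Om\<^esub>"
proof -
  have "expand N t (\<lambda>T. if T = {} then \<one>\<^bsub>B\<^esub> else \<zero>\<^bsub>B\<^esub>) = (\<Oplus>\<^bsub>Om\<^esub>T\<in>{{}::nat set}. \<one>\<^bsub>Om\<^esub>)"
    unfolding expand_def
    by (rule Om.add.finprod_mono_neutral_cong_right)
      (use t_list in \<open>auto simp: frm_one frm_zero simp del: set_map set_sorted_list_of_set\<close>)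
  then show ?thesis by simp
qed

text \<open>If \<open>db = \<Sum>\<^sub>i \<delta>\<^sub>i(b) dt\<^sub>i\<close> for derivations \<open>\<delta>\<^sub>i\<close> and for the \<open>b\<close> that occur in a given form, then sending \<open>db\<close> to the multiplication by
  \<open>\<Sum>\<^sub>i \<delta>\<^sub>i(b) e\<^sub>i\<close> on the exterior algebra makes forms act on a direct sum of copies of \<open>B\<close>, and
  \<^const>\<open>expand\<close> recovers a form from its action on the unit.  So forms have no more torsion than \<open>B\<close>.\<close>

theorem no_torsion:
  assumes \<delta>: "\<And>i b. i < N \<Longrightarrow> b \<in> carrier B \<Longrightarrow> \<delta> i b \<in> carrier B"
    and add: "\<And>i a b. i < N \<Longrightarrow> a \<in> carrier B \<Longrightarrow> b \<in> carrier B \<Longrightarrow> \<delta> i (a \<oplus>\<^bsub>B\<^esub> b) = \<delta> i a \<oplus>\<^bsub>B\<^esub> \<delta> i b"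
    and leib: "\<And>i a b. i < N \<Longrightarrow> a \<in> carrier B \<Longrightarrow> b \<in> carrier B \<Longrightarrow>
      \<delta> i (a \<otimes>\<^bsub>B\<^esub> b) = (a \<otimes>\<^bsub>B\<^esub> \<delta> i b) \<oplus>\<^bsub>B\<^esub> (b \<otimes>\<^bsub>B\<^esub> \<delta> i a)"
    and const: "\<And>i a. i < N \<Longrightarrow> a \<in> carrier B0 \<Longrightarrow> \<delta> i (g a) = \<zero>\<^bsub>B\<^esub>"
    and tf: "\<And>b. b \<in> carrier B \<Longrightarrow> [(n::nat)] \<cdot>\<^bsub>B\<^esub> b = \<zero>\<^bsub>B\<^esub> \<Longrightarrow> b = \<zero>\<^bsub>B\<^esub>"
    and s: "s \<in> carrier FW"
    and span: "\<And>w b. s w \<noteq> \<zero>\<^bsub>B\<^esub> \<Longrightarrow> b \<in> set w \<Longrightarrow> frm \<one>\<^bsub>B\<^esub> [b] = (\<Oplus>\<^bsub>Om\<^esub>i\<in>{..<N}. frm (\<delta> i b) [t i])"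
    and zero: "[n] \<cdot>\<^bsub>Om\<^esub> cls s = \<zero>\<^bsub>Om\<^esub>"
  shows "cls s = \<zero>\<^bsub>Om\<^esub>"
proof -
  let ?E = "end_ring EG"
  interpret E: ring ?E by (rule B.ring_ER)
  note sh = B.scale_hom
  have wc: "wedge B i \<in> carrier ?E" for i by (rule B.wedge_closed)
  have sc: "scale B c \<in> carrier ?E" if "c \<in> carrier B" for c using B.scale_closed[OF that] .
  have sw: "scale B c \<otimes>\<^bsub>?E\<^esub> wedge B i = wedge B i \<otimes>\<^bsub>?E\<^esub> scale B c" if "c \<in> carrier B" for c i
    using B.scale_wedge[OF that] .
  have ss: "scale B c \<otimes>\<^bsub>?E\<^esub> scale B c' = scale B c' \<otimes>\<^bsub>?E\<^esub> scale B c" if "c \<in> carrier B" "c' \<in> carrier B" for c c'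
    using that by (simp add: B.m_comm flip: ring_hom_mult[OF sh])
  define D where "D b = (\<Oplus>\<^bsub>?E\<^esub>i\<in>{..<N}. scale B (\<delta> i b) \<otimes>\<^bsub>?E\<^esub> wedge B i)" for b
  have Dt: "(\<lambda>i. scale B (\<delta> i b) \<otimes>\<^bsub>?E\<^esub> wedge B i) \<in> {..<N} \<rightarrow> carrier ?E" if "b \<in> carrier B" for b
    using that \<delta> sc wc by auto
  have Dc: "D b \<in> carrier ?E" if "b \<in> carrier B" for b
    unfolding D_def using Dt[OF that] by (rule E.finsum_closed)
  have swap: "(scale B c \<otimes>\<^bsub>?E\<^esub> wedge B i) \<otimes>\<^bsub>?E\<^esub> (scale B c' \<otimes>\<^bsub>?E\<^esub> wedge B j)
      = scale B (c \<otimes>\<^bsub>B\<^esub> c') \<otimes>\<^bsub>?E\<^esub> (wedge B i \<otimes>\<^bsub>?E\<^esub> wedge B j)" if "c \<in> carrier B" "c' \<in> carrier B" for c c' i j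
  proof -
    have "(scale B c \<otimes>\<^bsub>?E\<^esub> wedge B i) \<otimes>\<^bsub>?E\<^esub> (scale B c' \<otimes>\<^bsub>?E\<^esub> wedge B j)
      = scale B c \<otimes>\<^bsub>?E\<^esub> ((wedge B i \<otimes>\<^bsub>?E\<^esub> scale B c') \<otimes>\<^bsub>?E\<^esub> wedge B j)"
      using that sc wc by (simp add: E.m_assoc)
    also have "wedge B i \<otimes>\<^bsub>?E\<^esub> scale B c' = scale B c' \<otimes>\<^bsub>?E\<^esub> wedge B i" using sw that by simp
    finally show ?thesis using that sc wc by (simp add: E.m_assoc ring_hom_mult[OF sh])
  qed
  obtain \<Psi> where \<Psi>: "\<Psi> \<in> ring_hom Om ?E"
    and \<Psi>f: "\<And>b bs. b \<in> carrier B \<Longrightarrow> set bs \<subseteq> carrier B \<Longrightarrow>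
      \<Psi> (frm b bs) = scale B b \<otimes>\<^bsub>?E\<^esub> foldr (\<otimes>\<^bsub>?E\<^esub>) (map D bs) \<one>\<^bsub>?E\<^esub>"
  proof (rule de_rham_universal[OF E.ring_axioms sh, of D])
    fix a b assume ab: "a \<in> carrier B" "b \<in> carrier B"
    show "D (a \<oplus>\<^bsub>B\<^esub> b) = D a \<oplus>\<^bsub>?E\<^esub> D b"
    proof -
      have "D (a \<oplus>\<^bsub>B\<^esub> b) = (\<Oplus>\<^bsub>?E\<^esub>i\<in>{..<N}. scale B (\<delta> i a) \<otimes>\<^bsub>?E\<^esub> wedge B i \<oplus>\<^bsub>?E\<^esub> scale B (\<delta> i b) \<otimes>\<^bsub>?E\<^esub> wedge B i)"
        unfolding D_def by (rule E.finsum_cong')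
          (use ab \<delta> sc wc in \<open>auto simp: add ring_hom_add[OF sh] E.l_distr\<close>)
      also have "\<dots> = D a \<oplus>\<^bsub>?E\<^esub> D b" unfolding D_def by (rule E.finsum_addf[OF Dt Dt]) (use ab in auto)
      finally show ?thesis .
    qed
    show "scale B a \<otimes>\<^bsub>?E\<^esub> D b = D b \<otimes>\<^bsub>?E\<^esub> scale B a"
    proof -
      have "scale B a \<otimes>\<^bsub>?E\<^esub> D b = (\<Oplus>\<^bsub>?E\<^esub>i\<in>{..<N}. scale B a \<otimes>\<^bsub>?E\<^esub> (scale B (\<delta> i b) \<otimes>\<^bsub>?E\<^esub> wedge B i))"
        unfolding D_def by (rule E.finsum_rdistr) (use ab sc Dt in auto)
      also have "\<dots> = (\<Oplus>\<^bsub>?E\<^esub>i\<in>{..<N}. (scale B (\<delta> i b) \<otimes>\<^bsub>?E\<^esub> wedge B i) \<otimes>\<^bsub>?E\<^esub> scale B a)"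
      proof (rule E.finsum_cong')
        fix i assume "i \<in> {..<N}"
        then have di: "\<delta> i b \<in> carrier B" using \<delta> ab by auto
        have "scale B a \<otimes>\<^bsub>?E\<^esub> (scale B (\<delta> i b) \<otimes>\<^bsub>?E\<^esub> wedge B i) = (scale B (\<delta> i b) \<otimes>\<^bsub>?E\<^esub> scale B a) \<otimes>\<^bsub>?E\<^esub> wedge B i"
          using ab di sc wc ss[of a "\<delta> i b"] by (simp flip: E.m_assoc)
        also have "\<dots> = (scale B (\<delta> i b) \<otimes>\<^bsub>?E\<^esub> wedge B i) \<otimes>\<^bsub>?E\<^esub> scale B a"
          using ab di sc wc sw[of a i] by (simp add: E.m_assoc)
        finally show "scale B a \<otimes>\<^bsub>?E\<^esub> (scale B (\<delta> i b) \<otimes>\<^bsub>?E\<^esub> wedge B i) = (scale B (\<delta> i b) \<otimes>\<^bsub>?E\<^esub> wedge B i) \<otimes>\<^bsub>?E\<^esub> scale B a" .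
      qed (use ab \<delta> sc wc in auto)
      also have "\<dots> = D b \<otimes>\<^bsub>?E\<^esub> scale B a"
        unfolding D_def by (rule E.finsum_ldistr[symmetric]) (use ab sc Dt in auto)
      finally show ?thesis .
    qed
    show "D (a \<otimes>\<^bsub>B\<^esub> b) = scale B a \<otimes>\<^bsub>?E\<^esub> D b \<oplus>\<^bsub>?E\<^esub> scale B b \<otimes>\<^bsub>?E\<^esub> D a"
    proof -
      have r: "scale B a \<otimes>\<^bsub>?E\<^esub> D b = (\<Oplus>\<^bsub>?E\<^esub>i\<in>{..<N}. scale B a \<otimes>\<^bsub>?E\<^esub> (scale B (\<delta> i b) \<otimes>\<^bsub>?E\<^esub> wedge B i))"
        if "a \<in> carrier B" "b \<in> carrier B" for a b
        unfolding D_def by (rule E.finsum_rdistr) (use that sc Dt in auto)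
      have "D (a \<otimes>\<^bsub>B\<^esub> b) = (\<Oplus>\<^bsub>?E\<^esub>i\<in>{..<N}. scale B a \<otimes>\<^bsub>?E\<^esub> (scale B (\<delta> i b) \<otimes>\<^bsub>?E\<^esub> wedge B i)
          \<oplus>\<^bsub>?E\<^esub> scale B b \<otimes>\<^bsub>?E\<^esub> (scale B (\<delta> i a) \<otimes>\<^bsub>?E\<^esub> wedge B i))"
        unfolding D_def by (rule E.finsum_cong')
          (use ab \<delta> sc wc in \<open>auto simp: leib ring_hom_add[OF sh] ring_hom_mult[OF sh] E.l_distr E.m_assoc\<close>)
      also have "\<dots> = scale B a \<otimes>\<^bsub>?E\<^esub> D b \<oplus>\<^bsub>?E\<^esub> scale B b \<otimes>\<^bsub>?E\<^esub> D a"
        unfolding r[OF ab] r[OF ab(2,1)] by (rule E.finsum_addf) (use ab \<delta> sc wc in auto)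
      finally show ?thesis .
    qed
  next
    fix b assume b: "b \<in> carrier B"
    show "D b \<otimes>\<^bsub>?E\<^esub> D b = \<zero>\<^bsub>?E\<^esub>"
      unfolding D_def
    proof (rule E.finsum_square_zero[OF Dt[OF b]])
      fix i assume "i \<in> {..<N}"
      then have "\<delta> i b \<in> carrier B" using \<delta> b by auto
      then show "scale B (\<delta> i b) \<otimes>\<^bsub>?E\<^esub> wedge B i \<otimes>\<^bsub>?E\<^esub> (scale B (\<delta> i b) \<otimes>\<^bsub>?E\<^esub> wedge B i) = \<zero>\<^bsub>?E\<^esub>"
        by (simp add: swap B.wedge_square sc)
    next
      fix i j assume "i \<in> {..<N}" "j \<in> {..<N}"
      then have ij: "\<delta> i b \<in> carrier B" "\<delta> j b \<in> carrier B" using \<delta> b by auto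
      have "scale B (\<delta> i b) \<otimes>\<^bsub>?E\<^esub> wedge B i \<otimes>\<^bsub>?E\<^esub> (scale B (\<delta> j b) \<otimes>\<^bsub>?E\<^esub> wedge B j) \<oplus>\<^bsub>?E\<^esub>
          scale B (\<delta> j b) \<otimes>\<^bsub>?E\<^esub> wedge B j \<otimes>\<^bsub>?E\<^esub> (scale B (\<delta> i b) \<otimes>\<^bsub>?E\<^esub> wedge B i)
        = scale B (\<delta> i b \<otimes>\<^bsub>B\<^esub> \<delta> j b) \<otimes>\<^bsub>?E\<^esub> (wedge B i \<otimes>\<^bsub>?E\<^esub> wedge B j \<oplus>\<^bsub>?E\<^esub> wedge B j \<otimes>\<^bsub>?E\<^esub> wedge B i)"
        using ij sc wc by (simp add: swap E.r_distr B.m_comm)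
      then show "scale B (\<delta> i b) \<otimes>\<^bsub>?E\<^esub> wedge B i \<otimes>\<^bsub>?E\<^esub> (scale B (\<delta> j b) \<otimes>\<^bsub>?E\<^esub> wedge B j) \<oplus>\<^bsub>?E\<^esub>
          scale B (\<delta> j b) \<otimes>\<^bsub>?E\<^esub> wedge B j \<otimes>\<^bsub>?E\<^esub> (scale B (\<delta> i b) \<otimes>\<^bsub>?E\<^esub> wedge B i) = \<zero>\<^bsub>?E\<^esub>"
        using ij sc by (simp add: B.wedge_anticomm)
    qed
  next
    fix a assume "a \<in> carrier B0"
    then show "D (g a) = \<zero>\<^bsub>?E\<^esub>"
      unfolding D_def using wc
      by (intro E.add.finprod_one_eqI) (simp add: const ring_hom_zero[OF sh B.ring_axioms E.ring_axioms])
  qed (rule Dc, assumption, blast)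
  interpret \<Psi>: ring_hom_ring Om ?E \<Psi> by (rule ring_hom_ringI2[OF ring_Om E.ring_axioms \<Psi>])
  interpret ex: abelian_group_hom EG Om "expand N t" by (rule expand_hom)
  have at: "abelian_group_hom ?E Om (\<lambda>L. expand N t (L F))" if F: "F \<in> carrier EG" for F
    by (rule additive_mapI)
      (use F end_ring_closed[of _ EG F] in \<open>auto simp: end_ring_simps(5) E.abelian_group_axioms Om.abelian_group_axioms\<close>)
  have exc: "expand N t F \<in> carrier Om" if "F \<in> carrier EG" for F using ex.hom_closed[OF that] .
  have act1: "expand N t (D b F) = frm \<one>\<^bsub>B\<^esub> [b] \<otimes>\<^bsub>Om\<^esub> expand N t F"
    if b: "b \<in> carrier B" "frm \<one>\<^bsub>B\<^esub> [b] = (\<Oplus>\<^bsub>Om\<^esub>i\<in>{..<N}. frm (\<delta> i b) [t i])" and F: "F \<in> carrier EG" for b F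
  proof -
    interpret a: abelian_group_hom ?E Om "\<lambda>L. expand N t (L F)" by (rule at[OF F])
    have "expand N t (D b F) = (\<Oplus>\<^bsub>Om\<^esub>i\<in>{..<N}. expand N t ((scale B (\<delta> i b) \<otimes>\<^bsub>?E\<^esub> wedge B i) F))"
      unfolding D_def by (rule a.hom_finsum[OF Dt[OF b(1)]])
    also have "\<dots> = (\<Oplus>\<^bsub>Om\<^esub>i\<in>{..<N}. frm (\<delta> i b) [t i] \<otimes>\<^bsub>Om\<^esub> expand N t F)"
    proof (rule Om.finsum_cong')
      fix i assume "i \<in> {..<N}"
      then have i: "i < N" "\<delta> i b \<in> carrier B" "t i \<in> carrier B" using \<delta> b t by auto
      have "expand N t ((scale B (\<delta> i b) \<otimes>\<^bsub>?E\<^esub> wedge B i) F)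
          = frm (\<delta> i b) [] \<otimes>\<^bsub>Om\<^esub> (frm \<one>\<^bsub>B\<^esub> [t i] \<otimes>\<^bsub>Om\<^esub> expand N t F)"
        using F i end_ring_closed[OF wc F, of i]
        by (simp add: end_ring_simps(2) expand_scale expand_wedge)
      also have "\<dots> = frm (\<delta> i b) [t i] \<otimes>\<^bsub>Om\<^esub> expand N t F"
        using i exc[OF F] by (simp add: frm_mult flip: Om.m_assoc)
      finally show "expand N t ((scale B (\<delta> i b) \<otimes>\<^bsub>?E\<^esub> wedge B i) F) = frm (\<delta> i b) [t i] \<otimes>\<^bsub>Om\<^esub> expand N t F" .
    qed (use b \<delta> t exc[OF F] in auto)
    also have "\<dots> = frm \<one>\<^bsub>B\<^esub> [b] \<otimes>\<^bsub>Om\<^esub> expand N t F"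
      unfolding b(2) by (rule Om.finsum_ldistr[symmetric]) (use b \<delta> t exc[OF F] in auto)
    finally show ?thesis .
  qed
  have act: "expand N t (foldr (\<otimes>\<^bsub>?E\<^esub>) (map D bs) \<one>\<^bsub>?E\<^esub> F) = frm \<one>\<^bsub>B\<^esub> bs \<otimes>\<^bsub>Om\<^esub> expand N t F
      \<and> foldr (\<otimes>\<^bsub>?E\<^esub>) (map D bs) \<one>\<^bsub>?E\<^esub> \<in> carrier ?E"
    if "set bs \<subseteq> carrier B" "\<And>b. b \<in> set bs \<Longrightarrow> frm \<one>\<^bsub>B\<^esub> [b] = (\<Oplus>\<^bsub>Om\<^esub>i\<in>{..<N}. frm (\<delta> i b) [t i])"
      and F: "F \<in> carrier EG" for bs F
    using that(1,2)
  proof (induction bs)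
    case Nil
    then show ?case using F exc[OF F] by (intro conjI) (simp add: end_ring_simps(3) frm_one, simp)
  next
    case (Cons b bs)
    let ?P = "foldr (\<otimes>\<^bsub>?E\<^esub>) (map D bs) \<one>\<^bsub>?E\<^esub>"
    have IH: "expand N t (?P F) = frm \<one>\<^bsub>B\<^esub> bs \<otimes>\<^bsub>Om\<^esub> expand N t F" and P: "?P \<in> carrier ?E"
      using Cons by auto
    have "expand N t ((D b \<otimes>\<^bsub>?E\<^esub> ?P) F) = frm \<one>\<^bsub>B\<^esub> [b] \<otimes>\<^bsub>Om\<^esub> (frm \<one>\<^bsub>B\<^esub> bs \<otimes>\<^bsub>Om\<^esub> expand N t F)"
      using F act1[OF _ _ end_ring_closed[OF P F], of b] IH Cons.prems by (simp add: end_ring_simps(2))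
    also have "\<dots> = frm \<one>\<^bsub>B\<^esub> (b # bs) \<otimes>\<^bsub>Om\<^esub> expand N t F"
    proof -
      have "b \<in> carrier B" "set bs \<subseteq> carrier B" using Cons.prems(1) by auto
      then show ?thesis using exc[OF F] by (simp add: frm_mult flip: Om.m_assoc)
    qed
    finally show ?case using P Dc[of b] Cons.prems by simp
  qed
  define F where "F = (\<lambda>T::nat set. if T = {} then \<one>\<^bsub>B\<^esub> else \<zero>\<^bsub>B\<^esub>)"
  have F: "F \<in> carrier EG" by (simp add: F_def exterior_simps)
  interpret a: abelian_group_hom ?E Om "\<lambda>L. expand N t (L F)" by (rule at[OF F])
  have sw: "s w \<in> carrier B \<and> set w \<subseteq> carrier B" if "w \<in> W.supp s" for w
    using s that unfolding W.carrier_KM by auto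
  note cs = cls_sum_of_forms[OF s]
  have xc: "cls s \<in> carrier Om" using ring_hom_closed[OF cls_hom s] .
  have "\<Psi> (cls s) = (\<Oplus>\<^bsub>?E\<^esub>w\<in>W.supp s. \<Psi> (frm (s w) w))"
    unfolding cs(3) using \<Psi>.hom_finsum[OF cs(2)] by (simp add: o_def)
  then have "expand N t (\<Psi> (cls s) F) = (\<Oplus>\<^bsub>Om\<^esub>w\<in>W.supp s. expand N t (\<Psi> (frm (s w) w) F))"
    using a.hom_finsum[of "\<lambda>w. \<Psi> (frm (s w) w)" "W.supp s"] cs(2) by (simp add: Pi_iff)
  also have "\<dots> = (\<Oplus>\<^bsub>Om\<^esub>w\<in>W.supp s. frm (s w) w)"
  proof (rule Om.finsum_cong'[OF refl cs(2)])
    fix w assume w: "w \<in> W.supp s"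
    note sw = sw[OF w]
    have ac: "expand N t (foldr (\<otimes>\<^bsub>?E\<^esub>) (map D w) \<one>\<^bsub>?E\<^esub> F) = frm \<one>\<^bsub>B\<^esub> w"
      "foldr (\<otimes>\<^bsub>?E\<^esub>) (map D w) \<one>\<^bsub>?E\<^esub> \<in> carrier ?E"
      using act[OF _ _ F, of w] sw span w expand_unit by (auto simp: F_def)
    show "expand N t (\<Psi> (frm (s w) w) F) = frm (s w) w"
      using sw F ac end_ring_closed[OF ac(2) F]
      by (simp add: \<Psi>f end_ring_simps(2) expand_scale frm_mult)
  qed
  finally have rec: "expand N t (\<Psi> (cls s) F) = cls s" using cs(3) by simp
  have "\<Psi> (cls s) F T = \<zero>\<^bsub>B\<^esub>" for T
  proof -
    interpret c: abelian_group_hom ?E B "\<lambda>L. L F T"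
      by (rule additive_mapI)
        (use F end_ring_closed[of _ EG F] in \<open>auto simp: end_ring_simps(5) exterior_simps E.abelian_group_axioms B.abelian_group_axioms\<close>)
    have "[n] \<cdot>\<^bsub>?E\<^esub> \<Psi> (cls s) = \<zero>\<^bsub>?E\<^esub>" using \<Psi>.hom_add_pow[OF xc, of n] zero by simp
    then have "[n] \<cdot>\<^bsub>B\<^esub> (\<Psi> (cls s) F T) = \<zero>\<^bsub>B\<^esub>" using c.hom_add_pow[of "\<Psi> (cls s)" n] xc by simp
    then show ?thesis using tf[of "\<Psi> (cls s) F T"] c.hom_closed[of "\<Psi> (cls s)"] xc by simp
  qed
  then have "\<Psi> (cls s) F = \<zero>\<^bsub>EG\<^esub>" by (auto simp: exterior_simps)
  then show ?thesis using rec by simp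
qed

end

end

section \<open>Tensor products over the integers\<close>

text \<open>The tensor product of rings is the quotient of the free abelian group on pairs, with the product
  of pairs extended bilinearly, by the ideal of bilinearity relations.\<close>

definition pair_ring :: "('a, 'c) ring_scheme \<Rightarrow> ('b, 'd) ring_scheme \<Rightarrow> ('a \<times> 'b \<Rightarrow>\<^sub>0 int) ring" where
  "pair_ring A B =
    \<lparr>carrier = {c. Poly_Mapping.keys c \<subseteq> carrier A \<times> carrier B},
     monoid.mult = (\<lambda>x y. frag_extend (\<lambda>(a, b). frag_extend (\<lambda>(a', b'). frag_of (a \<otimes>\<^bsub>A\<^esub> a', b \<otimes>\<^bsub>B\<^esub> b')) y) x),
     monoid.one = frag_of (\<one>\<^bsub>A\<^esub>, \<one>\<^bsub>B\<^esub>), ring.zero = 0, ring.add = (+)\<rparr>"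

locale tensor_product = A: ring A + B: ring B
  for A :: "('a, 'c) ring_scheme" and B :: "('b, 'd) ring_scheme"
begin

abbreviation PR where "PR \<equiv> pair_ring A B"
abbreviation TR where "TR \<equiv> tensor_ring A B"
abbreviation Rel where "Rel \<equiv> tensor_relations (add_monoid A) (add_monoid B)"
abbreviation tcl where "tcl \<equiv> tensor_class (add_monoid A) (add_monoid B)"

definition pure :: "'a \<Rightarrow> 'b \<Rightarrow> (('a \<times> 'b) \<Rightarrow>\<^sub>0 int) set" where
  "pure a b = tcl (frag_of (a, b))"

lemma carrier_PR: "x \<in> carrier PR \<longleftrightarrow> Poly_Mapping.keys x \<subseteq> carrier A \<times> carrier B"
  by (simp add: pair_ring_def)

lemma PR_simps: "\<zero>\<^bsub>PR\<^esub> = 0" "x \<oplus>\<^bsub>PR\<^esub> y = x + y" "\<one>\<^bsub>PR\<^esub> = frag_of (\<one>\<^bsub>A\<^esub>, \<one>\<^bsub>B\<^esub>)"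
  by (simp_all add: pair_ring_def)

lemma PR_induct [consumes 1, case_names zero diff pure]:
  assumes "x \<in> carrier PR" "P 0"
    "\<And>x y. x \<in> carrier PR \<Longrightarrow> y \<in> carrier PR \<Longrightarrow> P x \<Longrightarrow> P y \<Longrightarrow> P (x - y)"
    "\<And>a b. a \<in> carrier A \<Longrightarrow> b \<in> carrier B \<Longrightarrow> P (frag_of (a, b))"
  shows "P x"
  by (rule free_Abelian_group_induct[of x "carrier A \<times> carrier B"]) (use assms in \<open>auto simp: carrier_PR\<close>)

lemma PR_mult_of: "frag_of (a, b) \<otimes>\<^bsub>PR\<^esub> frag_of (a', b') = frag_of (a \<otimes>\<^bsub>A\<^esub> a', b \<otimes>\<^bsub>B\<^esub> b')"
  by (simp add: pair_ring_def)

lemma PR_mult_l: "(x - y) \<otimes>\<^bsub>PR\<^esub> z = x \<otimes>\<^bsub>PR\<^esub> z - y \<otimes>\<^bsub>PR\<^esub> z" "(x + y) \<otimes>\<^bsub>PR\<^esub> z = x \<otimes>\<^bsub>PR\<^esub> z + y \<otimes>\<^bsub>PR\<^esub> z"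
  "0 \<otimes>\<^bsub>PR\<^esub> z = 0"
  by (simp_all add: pair_ring_def frag_extend_diff frag_extend_add)

lemma PR_mult_r:
  "x \<otimes>\<^bsub>PR\<^esub> (y - z) = x \<otimes>\<^bsub>PR\<^esub> y - x \<otimes>\<^bsub>PR\<^esub> z" "x \<otimes>\<^bsub>PR\<^esub> 0 = 0"
proof -
  have "x \<otimes>\<^bsub>PR\<^esub> (y - z) = x \<otimes>\<^bsub>PR\<^esub> y - x \<otimes>\<^bsub>PR\<^esub> z \<and> x \<otimes>\<^bsub>PR\<^esub> 0 = 0"
    by (induction x rule: frag_induction[OF subset_UNIV])
      (auto simp: PR_mult_l, auto simp: pair_ring_def frag_extend_diff)
  then show "x \<otimes>\<^bsub>PR\<^esub> (y - z) = x \<otimes>\<^bsub>PR\<^esub> y - x \<otimes>\<^bsub>PR\<^esub> z" "x \<otimes>\<^bsub>PR\<^esub> 0 = 0" by auto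
qed

lemma PR_mult_r_add: "x \<otimes>\<^bsub>PR\<^esub> (y + z) = x \<otimes>\<^bsub>PR\<^esub> y + x \<otimes>\<^bsub>PR\<^esub> z"
  using PR_mult_r(1)[of x y "- z"] PR_mult_r(1)[of x 0 z] by (simp add: PR_mult_r(2))

lemma keys_diff': "Poly_Mapping.keys x \<subseteq> S \<Longrightarrow> Poly_Mapping.keys y \<subseteq> S \<Longrightarrow> Poly_Mapping.keys (x - y) \<subseteq> S"
  for x y :: "'z \<Rightarrow>\<^sub>0 int"
  using keys_diff[of x y] by auto

lemma PR_mult_closed:
  assumes "x \<in> carrier PR" "y \<in> carrier PR"
  shows "x \<otimes>\<^bsub>PR\<^esub> y \<in> carrier PR"
  using assms(1)
proof (induction rule: PR_induct)
  case (pure a b)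
  note ab = pure
  show ?case using assms(2)
    by (induction rule: PR_induct)
      (use ab in \<open>auto simp: PR_mult_r PR_mult_of\<close>, auto simp: carrier_PR keys_diff' simp del: subset_iff)
qed (auto simp: PR_mult_l, auto simp: carrier_PR keys_diff')

lemma ring_PR: "ring PR"
proof (rule ringI)
  show "abelian_group PR"
  proof (rule abelian_groupI)
    fix x assume "x \<in> carrier PR"
    then show "\<exists>y\<in>carrier PR. y \<oplus>\<^bsub>PR\<^esub> x = \<zero>\<^bsub>PR\<^esub>"
      by (intro bexI[of _ "- x"]) (auto simp: PR_simps carrier_PR)
  next
    fix x y assume "x \<in> carrier PR" "y \<in> carrier PR"
    then show "x \<oplus>\<^bsub>PR\<^esub> y \<in> carrier PR"
      using keys_diff'[of x _ "- y"] by (simp add: PR_simps carrier_PR)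
  qed (simp_all add: PR_simps carrier_PR add.assoc add.commute)
  show "Group.monoid PR"
  proof (rule monoidI)
    show "\<one>\<^bsub>PR\<^esub> \<in> carrier PR" by (simp add: PR_simps carrier_PR)
    fix x assume x: "x \<in> carrier PR"
    show "\<one>\<^bsub>PR\<^esub> \<otimes>\<^bsub>PR\<^esub> x = x" using x
      by (induction rule: PR_induct) (auto simp: PR_simps PR_mult_of PR_mult_r)
    show "x \<otimes>\<^bsub>PR\<^esub> \<one>\<^bsub>PR\<^esub> = x" using x
      by (induction rule: PR_induct) (auto simp: PR_simps PR_mult_of PR_mult_l)
    fix y z assume y: "y \<in> carrier PR" and z: "z \<in> carrier PR"
    show "x \<otimes>\<^bsub>PR\<^esub> y \<otimes>\<^bsub>PR\<^esub> z = x \<otimes>\<^bsub>PR\<^esub> (y \<otimes>\<^bsub>PR\<^esub> z)" using x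
    proof (induction rule: PR_induct)
      case (pure a b)
      note ab = pure
      show ?case using y
      proof (induction rule: PR_induct)
        case (pure a' b')
        note ab' = pure
        show ?case using z
          by (induction rule: PR_induct)
            (use ab ab' in \<open>auto simp: PR_mult_r PR_mult_of A.m_assoc B.m_assoc\<close>)
      qed (auto simp: PR_mult_l PR_mult_r)
    qed (auto simp: PR_mult_l)
  qed (rule PR_mult_closed)
qed (auto simp: PR_simps PR_mult_l PR_mult_r_add)

sublocale PR: ring "pair_ring A B" by (rule ring_PR)

lemma PR_minus: "x \<in> carrier PR \<Longrightarrow> y \<in> carrier PR \<Longrightarrow> x \<ominus>\<^bsub>PR\<^esub> y = x - y"
proof -
  assume x: "x \<in> carrier PR" and y: "y \<in> carrier PR"
  have "\<ominus>\<^bsub>PR\<^esub> y = - y" using y by (intro PR.minus_equality) (auto simp: PR_simps carrier_PR)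
  then show ?thesis by (simp add: a_minus_def PR_simps)
qed

lemma free_eq: "free_Abelian_group (carrier A \<times> carrier B) = add_monoid PR"
  by (simp add: free_Abelian_group_def pair_ring_def)

definition gens where "gens = {frag_of (g \<oplus>\<^bsub>A\<^esub> g', h) - (frag_of (g, h) + frag_of (g', h)) | g g' h.
        g \<in> carrier A \<and> g' \<in> carrier A \<and> h \<in> carrier B} \<union>
     {frag_of (g, h \<oplus>\<^bsub>B\<^esub> h') - (frag_of (g, h) + frag_of (g, h')) | g h h'.
        g \<in> carrier A \<and> h \<in> carrier B \<and> h' \<in> carrier B}"

lemma gen_left: "g \<in> carrier A \<Longrightarrow> g' \<in> carrier A \<Longrightarrow> h \<in> carrier B \<Longrightarrow>
    frag_of (g \<oplus>\<^bsub>A\<^esub> g', h) - (frag_of (g, h) + frag_of (g', h)) \<in> gens"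
  and gen_right: "g \<in> carrier A \<Longrightarrow> h \<in> carrier B \<Longrightarrow> h' \<in> carrier B \<Longrightarrow>
    frag_of (g, h \<oplus>\<^bsub>B\<^esub> h') - (frag_of (g, h) + frag_of (g, h')) \<in> gens"
  unfolding gens_def by blast+

lemma gens_cases:
  assumes "x \<in> gens"
  obtains (left) g g' h where "g \<in> carrier A" "g' \<in> carrier A" "h \<in> carrier B"
      "x = frag_of (g \<oplus>\<^bsub>A\<^esub> g', h) - (frag_of (g, h) + frag_of (g', h))"
    | (right) g h h' where "g \<in> carrier A" "h \<in> carrier B" "h' \<in> carrier B"
      "x = frag_of (g, h \<oplus>\<^bsub>B\<^esub> h') - (frag_of (g, h) + frag_of (g, h'))"
  using assms unfolding gens_def by blast

lemma Rel_eq: "Rel = generate (add_monoid PR) gens"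
  unfolding tensor_relations_def gens_def by (simp add: free_eq)

lemma of_closed: "a \<in> carrier A \<Longrightarrow> b \<in> carrier B \<Longrightarrow> frag_of (a, b) \<in> carrier PR"
  by (simp add: carrier_PR)

lemma PR_add_closed: "x \<in> carrier PR \<Longrightarrow> y \<in> carrier PR \<Longrightarrow> x + y \<in> carrier PR"
  using PR.a_closed[of x y] by (simp add: PR_simps)

lemma PR_diff_closed: "x \<in> carrier PR \<Longrightarrow> y \<in> carrier PR \<Longrightarrow> x - y \<in> carrier PR"
  using keys_diff' by (simp add: carrier_PR)

lemma gens_closed: "gens \<subseteq> carrier PR"
  by (auto elim!: gens_cases intro!: PR_diff_closed PR_add_closed of_closed)

lemma Rel_induct [consumes 1, case_names zero gen add uminus]:
  assumes "x \<in> Rel" "P 0" "\<And>x. x \<in> gens \<Longrightarrow> P x"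
    "\<And>x y. x \<in> carrier PR \<Longrightarrow> y \<in> carrier PR \<Longrightarrow> P x \<Longrightarrow> P y \<Longrightarrow> P (x + y)"
    "\<And>x. x \<in> carrier PR \<Longrightarrow> P x \<Longrightarrow> P (- x)"
  shows "P x"
proof -
  have "x \<in> carrier PR \<and> P x" using assms(1) unfolding Rel_eq
  proof (induction rule: generate.induct)
    case (inv h)
    then have h: "h \<in> carrier PR" "P h" using gens_closed assms(3) by auto
    have "inv\<^bsub>add_monoid PR\<^esub> h = - h"
      using h PR.minus_equality[of "- h" h] by (simp add: a_inv_def PR_simps carrier_PR)
    then show ?case using h assms(5) by (simp add: carrier_PR)
  next
    case (eng h1 h2)
    then show ?case using assms(4) PR_add_closed by (simp add: PR_simps)
  next
    case one
    then show ?case using assms(2) by (simp add: PR_simps carrier_PR)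
  next
    case (incl h)
    then show ?case using assms(3) gens_closed by blast
  qed
  then show ?thesis ..
qed

lemma Rel_subgroup: "subgroup Rel (add_monoid PR)"
  unfolding Rel_eq by (rule group.generate_is_subgroup[OF PR.a_group]) (use gens_closed in simp)

lemma Rel_closed: "x \<in> Rel \<Longrightarrow> x \<in> carrier PR"
  using subgroup.subset[OF Rel_subgroup] by auto

lemma Rel_add: "x \<in> Rel \<Longrightarrow> y \<in> Rel \<Longrightarrow> x + y \<in> Rel"
  using subgroup.m_closed[OF Rel_subgroup, of x y] by (simp add: PR_simps)

lemma Rel_zero: "0 \<in> Rel"
  using subgroup.one_closed[OF Rel_subgroup] by (simp add: PR_simps)

lemma Rel_uminus: "x \<in> Rel \<Longrightarrow> - x \<in> Rel"
proof -
  assume x: "x \<in> Rel"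
  have "inv\<^bsub>add_monoid PR\<^esub> x = - x"
    using Rel_closed[OF x] PR.minus_equality[of "- x" x] by (simp add: a_inv_def PR_simps carrier_PR)
  then show ?thesis using subgroup.m_inv_closed[OF Rel_subgroup x] by simp
qed

lemma Rel_diff: "x \<in> Rel \<Longrightarrow> y \<in> Rel \<Longrightarrow> x - y \<in> Rel"
  using Rel_add[of x "- y"] Rel_uminus by simp

lemma gens_Rel: "x \<in> gens \<Longrightarrow> x \<in> Rel"
  unfolding Rel_eq by (rule generate.incl)

lemma Rel_ideal: "ideal Rel PR"
proof (rule idealI[OF ring_PR Rel_subgroup])
  fix r x assume r: "r \<in> Rel" and x: "x \<in> carrier PR"
  have gl: "x \<otimes>\<^bsub>PR\<^esub> r \<in> Rel" if r: "r \<in> gens" for r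
    using x
  proof (induction rule: PR_induct)
    case (pure c e)
    from r show ?case
    proof (cases rule: gens_cases)
      case (left g g' h)
      then have "frag_of (c, e) \<otimes>\<^bsub>PR\<^esub> r \<in> gens"
        using pure gen_left[of "c \<otimes>\<^bsub>A\<^esub> g" "c \<otimes>\<^bsub>A\<^esub> g'" "e \<otimes>\<^bsub>B\<^esub> h"]
        by (simp add: PR_mult_r PR_mult_r_add PR_mult_of A.r_distr)
      then show ?thesis by (rule gens_Rel)
    next
      case (right g h h')
      then have "frag_of (c, e) \<otimes>\<^bsub>PR\<^esub> r \<in> gens"
        using pure gen_right[of "c \<otimes>\<^bsub>A\<^esub> g" "e \<otimes>\<^bsub>B\<^esub> h" "e \<otimes>\<^bsub>B\<^esub> h'"]
        by (simp add: PR_mult_r PR_mult_r_add PR_mult_of B.r_distr)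
      then show ?thesis by (rule gens_Rel)
    qed
  qed (auto simp: PR_mult_l Rel_zero Rel_diff)
  have gr: "r \<otimes>\<^bsub>PR\<^esub> x \<in> Rel" if r: "r \<in> gens" for r
    using x
  proof (induction rule: PR_induct)
    case (pure c e)
    from r show ?case
    proof (cases rule: gens_cases)
      case (left g g' h)
      then have "r \<otimes>\<^bsub>PR\<^esub> frag_of (c, e) \<in> gens"
        using pure gen_left[of "g \<otimes>\<^bsub>A\<^esub> c" "g' \<otimes>\<^bsub>A\<^esub> c" "h \<otimes>\<^bsub>B\<^esub> e"]
        by (simp add: PR_mult_l PR_mult_of A.l_distr)
      then show ?thesis by (rule gens_Rel)
    next
      case (right g h h')
      then have "r \<otimes>\<^bsub>PR\<^esub> frag_of (c, e) \<in> gens"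
        using pure gen_right[of "g \<otimes>\<^bsub>A\<^esub> c" "h \<otimes>\<^bsub>B\<^esub> e" "h' \<otimes>\<^bsub>B\<^esub> e"]
        by (simp add: PR_mult_l PR_mult_of B.l_distr)
      then show ?thesis by (rule gens_Rel)
    qed
  qed (auto simp: PR_mult_r Rel_zero Rel_diff)
  show "x \<otimes>\<^bsub>PR\<^esub> r \<in> Rel" using r
    by (induction rule: Rel_induct)
      (use PR_mult_r(1)[of x 0] in \<open>auto simp: gl PR_mult_r PR_mult_r_add Rel_zero Rel_add Rel_uminus\<close>)
  show "r \<otimes>\<^bsub>PR\<^esub> x \<in> Rel" using r
    by (induction rule: Rel_induct)
      (use PR_mult_l(1)[of 0 _ x] in \<open>auto simp: gr PR_mult_l Rel_zero Rel_add Rel_uminus\<close>)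
qed

sublocale Rel: ideal "tensor_relations (add_monoid A) (add_monoid B)" "pair_ring A B" by (rule Rel_ideal)

lemma tcl_eq: "tcl = (+>\<^bsub>PR\<^esub>) Rel"
  by (rule ext) (simp add: tensor_class_def free_eq a_r_coset_def)

lemma TR_eq: "TR = PR Quot Rel"
proof -
  have 1: "tensor_group (add_monoid A) (add_monoid B) = add_monoid PR Mod Rel"
    by (simp add: tensor_group_def free_eq)
  have 2: "monoid.mult TR = rcoset_mult PR Rel"
    by (intro ext) (simp add: tensor_ring_def rcoset_mult_def tcl_eq pair_ring_def)
  show ?thesis
    using 2 by (simp add: tensor_ring_def 1 FactRing_def tcl_eq FactGroup_def A_RCOSETS_def set_add_def[abs_def]
      pair_ring_def)
qed

lemma ring_TR: "ring TR"
  unfolding TR_eq by (rule Rel.quotient_is_ring)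

sublocale TR: ring "tensor_ring A B" by (rule ring_TR)

lemma tcl_hom: "tcl \<in> ring_hom PR TR"
  unfolding TR_eq tcl_eq by (rule Rel.rcos_ring_hom)

lemma TR_cases:
  assumes "y \<in> carrier TR" obtains x where "x \<in> carrier PR" "y = tcl x"
  using assms unfolding TR_eq tcl_eq by (auto simp: FactRing_def A_RCOSETS_def')

sublocale tcl: ring_hom_ring "pair_ring A B" "tensor_ring A B" "tensor_class (add_monoid A) (add_monoid B)"
  by (rule ring_hom_ringI2[OF ring_PR ring_TR tcl_hom])

lemma tcl_zero_iff: assumes "x \<in> carrier PR" shows "tcl x = \<zero>\<^bsub>TR\<^esub> \<longleftrightarrow> x \<in> Rel"
  using assms Rel.a_rcos_const Rel.rcos_const_imp_mem unfolding TR_eq tcl_eq by (auto simp: FactRing_def)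

lemma gen_zero: "x \<in> gens \<Longrightarrow> tcl x = \<zero>\<^bsub>TR\<^esub>"
  using gens_Rel tcl_zero_iff gens_closed by blast

lemma pure_closed [simp]: "a \<in> carrier A \<Longrightarrow> b \<in> carrier B \<Longrightarrow> pure a b \<in> carrier TR"
  unfolding pure_def by (rule tcl.hom_closed) (rule of_closed)

lemma TR_induct [consumes 1, case_names pure diff]:
  assumes "y \<in> carrier TR"
    and pure: "\<And>a b. a \<in> carrier A \<Longrightarrow> b \<in> carrier B \<Longrightarrow> P (pure a b)"
    and diff: "\<And>x y. x \<in> carrier TR \<Longrightarrow> y \<in> carrier TR \<Longrightarrow> P x \<Longrightarrow> P y \<Longrightarrow> P (x \<ominus>\<^bsub>TR\<^esub> y)"
  shows "P y"
proof -
  obtain x where x: "x \<in> carrier PR" "y = tcl x" using assms(1) by (rule TR_cases)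
  from x(1) have "P (tcl x)"
  proof (induction rule: PR_induct)
    case zero
    have c: "pure \<zero>\<^bsub>A\<^esub> \<zero>\<^bsub>B\<^esub> \<in> carrier TR" by simp
    have "P (pure \<zero>\<^bsub>A\<^esub> \<zero>\<^bsub>B\<^esub> \<ominus>\<^bsub>TR\<^esub> pure \<zero>\<^bsub>A\<^esub> \<zero>\<^bsub>B\<^esub>)" by (rule diff) (use c pure in auto)
    then show ?case using c tcl.hom_zero by (simp add: TR.r_right_minus_eq PR_simps TR.r_neg a_minus_def)
  next
    case (diff x y)
    then show ?case using assms(3)[of "tcl x" "tcl y"] tcl.hom_minus[of x y] by (simp add: PR_minus)
  next
    case (pure a b)
    then show ?case using assms(2) by (simp add: pure_def)
  qed
  then show ?thesis using x by simp
qed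

lemma pure_add_l:
  assumes "a \<in> carrier A" "a' \<in> carrier A" "b \<in> carrier B"
  shows "pure (a \<oplus>\<^bsub>A\<^esub> a') b = pure a b \<oplus>\<^bsub>TR\<^esub> pure a' b"
proof -
  have c: "frag_of (a \<oplus>\<^bsub>A\<^esub> a', b) \<in> carrier PR" "frag_of (a, b) \<oplus>\<^bsub>PR\<^esub> frag_of (a', b) \<in> carrier PR"
    using assms by (auto intro!: of_closed PR.a_closed)
  have "frag_of (a \<oplus>\<^bsub>A\<^esub> a', b) \<ominus>\<^bsub>PR\<^esub> (frag_of (a, b) \<oplus>\<^bsub>PR\<^esub> frag_of (a', b)) \<in> gens"
    unfolding PR_minus[OF c] unfolding PR_simps using assms by (intro gen_left)
  then have "tcl (frag_of (a \<oplus>\<^bsub>A\<^esub> a', b)) \<ominus>\<^bsub>TR\<^esub> tcl (frag_of (a, b) \<oplus>\<^bsub>PR\<^esub> frag_of (a', b)) = \<zero>\<^bsub>TR\<^esub>"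
    using gen_zero tcl.hom_minus[OF c] by simp
  then show ?thesis using c assms of_closed by (simp add: pure_def TR.r_right_minus_eq)
qed

lemma pure_add_r:
  assumes "a \<in> carrier A" "b \<in> carrier B" "b' \<in> carrier B"
  shows "pure a (b \<oplus>\<^bsub>B\<^esub> b') = pure a b \<oplus>\<^bsub>TR\<^esub> pure a b'"
proof -
  have c: "frag_of (a, b \<oplus>\<^bsub>B\<^esub> b') \<in> carrier PR" "frag_of (a, b) \<oplus>\<^bsub>PR\<^esub> frag_of (a, b') \<in> carrier PR"
    using assms by (auto intro!: of_closed PR.a_closed)
  have "frag_of (a, b \<oplus>\<^bsub>B\<^esub> b') \<ominus>\<^bsub>PR\<^esub> (frag_of (a, b) \<oplus>\<^bsub>PR\<^esub> frag_of (a, b')) \<in> gens"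
    unfolding PR_minus[OF c] unfolding PR_simps using assms by (intro gen_right)
  then have "tcl (frag_of (a, b \<oplus>\<^bsub>B\<^esub> b')) \<ominus>\<^bsub>TR\<^esub> tcl (frag_of (a, b) \<oplus>\<^bsub>PR\<^esub> frag_of (a, b')) = \<zero>\<^bsub>TR\<^esub>"
    using gen_zero tcl.hom_minus[OF c] by simp
  then show ?thesis using c assms of_closed by (simp add: pure_def TR.r_right_minus_eq)
qed

lemma pure_hom_l: "b \<in> carrier B \<Longrightarrow> abelian_group_hom A TR (\<lambda>a. pure a b)"
  by (rule additive_mapI) (auto simp: pure_add_l A.abelian_group_axioms TR.abelian_group_axioms)

lemma pure_hom_r: "a \<in> carrier A \<Longrightarrow> abelian_group_hom B TR (\<lambda>b. pure a b)"
  by (rule additive_mapI) (auto simp: pure_add_r B.abelian_group_axioms TR.abelian_group_axioms)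

lemma pure_mult:
  assumes "a \<in> carrier A" "b \<in> carrier B" "a' \<in> carrier A" "b' \<in> carrier B"
  shows "pure a b \<otimes>\<^bsub>TR\<^esub> pure a' b' = pure (a \<otimes>\<^bsub>A\<^esub> a') (b \<otimes>\<^bsub>B\<^esub> b')"
  using assms of_closed by (simp add: pure_def PR_mult_of flip: tcl.hom_mult)

lemma pure_one: "pure \<one>\<^bsub>A\<^esub> \<one>\<^bsub>B\<^esub> = \<one>\<^bsub>TR\<^esub>"
  using tcl.hom_one by (simp add: pure_def PR_simps)

lemma pure_add_pow:
  assumes "a \<in> carrier A" "b \<in> carrier B"
  shows "pure ([(n::nat)] \<cdot>\<^bsub>A\<^esub> a) b = pure a ([n] \<cdot>\<^bsub>B\<^esub> b)"
  using abelian_group_hom.hom_add_pow[OF pure_hom_l[OF assms(2)] assms(1), of n]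
    abelian_group_hom.hom_add_pow[OF pure_hom_r[OF assms(1)] assms(2), of n] by simp

text \<open>A function on pairs extends to the free group on them.  If it kills the relations, then it detects elements of
  the tensor product.\<close>

lemma functional_exists:
  assumes M: "abelian_group M" and f: "\<And>a b. a \<in> carrier A \<Longrightarrow> b \<in> carrier B \<Longrightarrow> f a b \<in> carrier M"
  obtains h where "abelian_group_hom PR M h"
    "\<And>a b. a \<in> carrier A \<Longrightarrow> b \<in> carrier B \<Longrightarrow> h (frag_of (a, b)) = f a b"
proof -
  interpret M: abelian_group M by fact
  obtain h where h: "h \<in> hom (free_Abelian_group (carrier A \<times> carrier B)) (add_monoid M)"
    "\<And>x. x \<in> carrier A \<times> carrier B \<Longrightarrow> h (frag_of x) = f (fst x) (snd x)"
    by (rule comm_group.free_Abelian_group_universal[OF M.a_comm_group,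
        of "\<lambda>x. f (fst x) (snd x)" "carrier A \<times> carrier B"]) (use f in auto)
  have "abelian_group_hom PR M h"
    by (rule additive_mapI[OF PR.abelian_group_axioms M])
      (use h(1) in \<open>auto simp: hom_def carrier_PR PR_simps\<close>)
  then show thesis using that h(2) by auto
qed

end

lemma tensor_map_left_props:
  assumes "tensor_product A B" "tensor_product A' B" and u: "abelian_group_hom A A' u"
  shows "abelian_group_hom (tensor_ring A B) (tensor_ring A' B) (tensor_map_left (add_monoid A') (add_monoid B) u)"
    and "\<And>a b. a \<in> carrier A \<Longrightarrow> b \<in> carrier B \<Longrightarrow> tensor_map_left (add_monoid A') (add_monoid B) u (tensor_product.pure A B a b)
      = tensor_product.pure A' B (u a) b"
proof -
  interpret T: tensor_product A B by fact
  interpret T': tensor_product A' B by fact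
  interpret u: abelian_group_hom A A' u by fact
  define F where "F = frag_extend (\<lambda>(g, h). frag_of (u g, h :: 'c))"
  have Fof: "F (frag_of (a, b)) = frag_of (u a, b)" for a b by (simp add: F_def)
  have Fd: "F (x - y) = F x - F y" "F (x + y) = F x + F y" "F 0 = 0" "F (- x) = - F x" for x y
    by (simp_all add: F_def frag_extend_diff frag_extend_add frag_extend_minus)
  have Fc: "F x \<in> carrier T'.PR" if "x \<in> carrier T.PR" for x
    using that by (induction rule: T.PR_induct)
      (auto simp: Fd Fof T'.PR_diff_closed T'.of_closed, simp add: T'.carrier_PR)
  have FR: "F x \<in> T'.Rel" if "x \<in> T.Rel" for x
    using that
  proof (induction rule: T.Rel_induct)
    case (gen x)
    then show ?case
      by (cases rule: T.gens_cases) (auto simp: Fd Fof intro!: T'.gens_Rel T'.gen_left T'.gen_right)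
  qed (auto simp: Fd T'.Rel_zero T'.Rel_add T'.Rel_uminus)
  have eq: "tensor_map_left (add_monoid A') (add_monoid B) u (T.tcl x) = T'.tcl (F x)" if x: "x \<in> carrier T.PR" for x
  proof -
    have same: "T'.tcl (F y) = T'.tcl (F x)" if "y \<in> T.tcl x" for y
    proof -
      obtain r where r: "r \<in> T.Rel" "y = r + x"
        using \<open>y \<in> T.tcl x\<close> unfolding T.tcl_eq by (auto simp: a_r_coset_def' T.PR_simps)
      have "T'.tcl (F y) = T'.tcl (F r) \<oplus>\<^bsub>T'.TR\<^esub> T'.tcl (F x)"
        using Fc[OF x] T'.Rel_closed[OF FR[OF r(1)]] T'.tcl.hom_add[of "F r" "F x"] r(2)
        by (simp add: Fd T'.PR_simps)
      moreover have "T'.tcl (F r) = \<zero>\<^bsub>T'.TR\<^esub>"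
        using FR[OF r(1)] T'.tcl_zero_iff T'.Rel_closed by blast
      ultimately show ?thesis using Fc[OF x] by simp
    qed
    have "x \<in> T.tcl x" unfolding T.tcl_eq using x by (rule T.Rel.a_rcos_self)
    then show ?thesis unfolding tensor_map_left_def F_def[symmetric] using same by blast
  qed
  let ?t = "tensor_map_left (add_monoid A') (add_monoid B) u"
  show "abelian_group_hom T.TR T'.TR ?t"
  proof (rule additive_mapI[OF T.TR.abelian_group_axioms T'.TR.abelian_group_axioms])
    fix y assume "y \<in> carrier T.TR"
    then obtain x where x: "x \<in> carrier T.PR" "y = T.tcl x" by (rule T.TR_cases)
    then show "?t y \<in> carrier T'.TR" by (simp add: eq Fc)
    fix z assume "z \<in> carrier T.TR"
    then obtain w where w: "w \<in> carrier T.PR" "z = T.tcl w" by (rule T.TR_cases)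
    have "y \<oplus>\<^bsub>T.TR\<^esub> z = T.tcl (x \<oplus>\<^bsub>T.PR\<^esub> w)" using x w by simp
    then show "?t (y \<oplus>\<^bsub>T.TR\<^esub> z) = ?t y \<oplus>\<^bsub>T'.TR\<^esub> ?t z"
      using x w Fc T'.tcl.hom_add[of "F x" "F w"] T.PR_add_closed[of x w]
      by (simp add: eq T.PR_simps T'.PR_simps Fd)
  qed
  fix a b assume "a \<in> carrier A" "b \<in> carrier B"
  then show "?t (T.pure a b) = T'.pure (u a) b"
    using eq[OF T.of_closed] Fof by (simp add: T.pure_def T'.pure_def)
qed

section \<open>Flatness, rationalization and torsion\<close>

text \<open>Flatness is tested on the multiplication by a positive integer on \<open>\<int>\<close>.\<close>

lemma flat_imp_torsion_free:
  assumes M: "ring M" and flat: "flat_group (add_monoid M)"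
    and n: "n > 0" and a: "a \<in> carrier M" "[(n::nat)] \<cdot>\<^bsub>M\<^esub> a = \<zero>\<^bsub>M\<^esub>"
  shows "a = \<zero>\<^bsub>M\<^esub>"
proof -
  interpret M: ring M by fact
  define Zr :: "int ring" where "Zr = int_ring"
  have ring_Z: "ring Zr" using int_is_cring by (simp add: cring_def Zr_def)
  have Zs [simp]: "carrier Zr = UNIV" "z \<oplus>\<^bsub>Zr\<^esub> z' = z + z'" "\<zero>\<^bsub>Zr\<^esub> = 0" for z z'
    by (simp_all add: Zr_def)
  interpret T: tensor_product Zr M by (intro tensor_product.intro ring_Z M)
  define u where "u = (\<lambda>z::int. int n * z)"
  have u: "abelian_group_hom Zr Zr u"
    by (rule additive_mapI) (auto simp: u_def ring.is_abelian_group[OF ring_Z] algebra_simps)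
  note tm = tensor_map_left_props[OF T.tensor_product_axioms T.tensor_product_axioms u]
  interpret t: abelian_group_hom T.TR T.TR "tensor_map_left (add_monoid Zr) (add_monoid M) u"
    by (rule tm(1))
  have "u \<in> mon (add_monoid Zr) (add_monoid Zr)"
    using n by (auto simp: mon_def hom_def u_def inj_on_def algebra_simps)
  then have inj: "inj_on (tensor_map_left (add_monoid Zr) (add_monoid M) u)
      (carrier (tensor_group (add_monoid Zr) (add_monoid M)))"
    using flat abelian_group.a_comm_group[OF ring.is_abelian_group[OF ring_Z]] unfolding flat_group_def by blast
  have pow1: "[n] \<cdot>\<^bsub>Zr\<^esub> (1::int) = int n" by (induction n) auto
  have "tensor_map_left (add_monoid Zr) (add_monoid M) u (T.pure 1 a) = T.pure ([n] \<cdot>\<^bsub>Zr\<^esub> 1) a"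
    using a by (subst tm(2)) (auto simp: u_def pow1)
  also have "\<dots> = T.pure 1 \<zero>\<^bsub>M\<^esub>" using a T.pure_add_pow[of "1::int" a n] by simp
  also have "\<dots> = \<zero>\<^bsub>T.TR\<^esub>" using abelian_group_hom.hom_zero[OF T.pure_hom_r[of "1::int"]] by simp
  also have "\<dots> = tensor_map_left (add_monoid Zr) (add_monoid M) u \<zero>\<^bsub>T.TR\<^esub>" by (rule t.hom_zero[symmetric])
  finally have "T.pure 1 a = \<zero>\<^bsub>T.TR\<^esub>"
    using inj a T.pure_closed[of "1::int" a] T.TR.zero_closed
    by (auto simp: inj_on_def tensor_ring_def)
  then have R: "frag_of (1, a) \<in> T.Rel" using a T.tcl_zero_iff[OF T.of_closed] by (simp add: T.pure_def)
  obtain h where h: "abelian_group_hom T.PR M h"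
    and hf: "\<And>z b. z \<in> carrier Zr \<Longrightarrow> b \<in> carrier M \<Longrightarrow> h (frag_of (z, b)) = [z] \<cdot>\<^bsub>M\<^esub> b"
    by (rule T.functional_exists[OF M.abelian_group_axioms, of "\<lambda>z b. [(z::int)] \<cdot>\<^bsub>M\<^esub> b"])
      (auto simp: M.add.int_pow_closed)
  interpret h: abelian_group_hom T.PR M h by (rule h)
  have hd: "h (x - y) = h x \<ominus>\<^bsub>M\<^esub> h y" if "x \<in> carrier T.PR" "y \<in> carrier T.PR" for x y
    using h.hom_minus[OF that] that by (simp add: T.PR_minus)
  have ha: "h (x + y) = h x \<oplus>\<^bsub>M\<^esub> h y" if "x \<in> carrier T.PR" "y \<in> carrier T.PR" for x y
    using h.hom_add[OF that] by (simp add: T.PR_simps)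
  have h0: "h 0 = \<zero>\<^bsub>M\<^esub>" using h.hom_zero by (simp add: T.PR_simps)
  have "h x = \<zero>\<^bsub>M\<^esub>" if "x \<in> T.Rel" for x
    using that
  proof (induction rule: T.Rel_induct)
    case (gen x)
    then show ?case
    proof (cases rule: T.gens_cases)
      case (left z z' b)
      then show ?thesis
        using T.of_closed T.PR_add_closed[OF T.of_closed T.of_closed] M.add.int_pow_closed
        by (simp add: hd ha hf M.add.int_pow_mult M.r_right_minus_eq)
    next
      case (right z b b')
      then show ?thesis
        using T.of_closed T.PR_add_closed[OF T.of_closed T.of_closed] M.add.int_pow_closed
        by (simp add: hd ha hf M.add.int_pow_distrib M.r_right_minus_eq)
    qed
  next
    case (uminus x)
    then show ?case using hd[of 0 x] h0 by (simp add: T.carrier_PR a_minus_def)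
  qed (simp_all add: h0 ha)
  from this[OF R] have "[(1::int)] \<cdot>\<^bsub>M\<^esub> a = \<zero>\<^bsub>M\<^esub>" using a by (simp add: hf)
  then show ?thesis using a M.add.int_pow_1 by simp
qed

lemma rat_ring_simps: "carrier rat_ring = UNIV" "r \<otimes>\<^bsub>rat_ring\<^esub> s = r * s" "r \<oplus>\<^bsub>rat_ring\<^esub> s = r + s"
  "\<one>\<^bsub>rat_ring\<^esub> = 1" "\<zero>\<^bsub>rat_ring\<^esub> = 0"
  by (simp_all add: ring_of_type_algebra_def)

lemma rat_ring_pow: "[(n::nat)] \<cdot>\<^bsub>rat_ring\<^esub> r = of_nat n * r"
proof -
  interpret Q: cring rat_ring by (rule cring_from_type_algebra)
  show ?thesis by (induction n) (simp_all add: rat_ring_simps algebra_simps)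
qed

locale rationalized = A: ring A for A :: "('a, 'c) ring_scheme"
begin

sublocale T: tensor_product A rat_ring
  by (intro tensor_product.intro A.ring_axioms) (rule ring_from_type_algebra)

lemma pure_closed [simp]: "a \<in> carrier A \<Longrightarrow> T.pure a r \<in> carrier T.TR"
  using T.pure_closed by (simp add: rat_ring_simps)

lemma pure_cancel:
  assumes "a \<in> carrier A" "k > 0"
  shows "T.pure ([(k::nat)] \<cdot>\<^bsub>A\<^esub> a) (r / of_nat k) = T.pure a r"
  using T.pure_add_pow[of a "r / of_nat k" k] assms by (simp add: rat_ring_simps rat_ring_pow)

lemma pure_of_nat: "a \<in> carrier A \<Longrightarrow> T.pure a (of_nat n * r) = T.pure ([(n::nat)] \<cdot>\<^bsub>A\<^esub> a) r"
  using T.pure_add_pow[of a r n] by (simp add: rat_ring_simps rat_ring_pow)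

lemma pure_minus:
  assumes "a \<in> carrier A" "b \<in> carrier A"
  shows "T.pure (a \<ominus>\<^bsub>A\<^esub> b) r = T.pure a r \<ominus>\<^bsub>T.TR\<^esub> T.pure b r"
  using abelian_group_hom.hom_minus[OF T.pure_hom_l assms, of r] by (simp add: rat_ring_simps)

text \<open>Fractions have common denominators.\<close>

lemma fraction:
  assumes "y \<in> carrier T.TR"
  shows "\<exists>a\<in>carrier A. \<exists>m>0. y = T.pure a (1 / of_nat m)"
  using assms
proof (induction rule: T.TR_induct)
  case (pure a r)
  obtain p q where pq: "quotient_of r = (p, q)" by fastforce
  then have q: "q > 0" and r: "r = of_int p / of_int q"
    using quotient_of_denom_pos quotient_of_div by blast+
  have rq: "r = of_int p * (1 / of_nat (nat q))" using r q by simp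
  show ?case
  proof (cases "p \<ge> 0")
    case True
    then have "T.pure a r = T.pure ([nat p] \<cdot>\<^bsub>A\<^esub> a) (1 / of_nat (nat q))"
      using pure_of_nat[OF pure(1), of "nat p" "1 / of_nat (nat q)"] rq by simp
    then show ?thesis using pure q by (intro bexI[of _ "[nat p] \<cdot>\<^bsub>A\<^esub> a"] exI[of _ "nat q"]) auto
  next
    case False
    interpret h: abelian_group_hom rat_ring T.TR "\<lambda>b. T.pure a b" by (rule T.pure_hom_r[OF pure(1)])
    interpret h': abelian_group_hom A T.TR "\<lambda>c. T.pure c (1 / of_nat (nat q))"
      by (rule T.pure_hom_l) (simp add: rat_ring_simps)
    have neg: "\<ominus>\<^bsub>rat_ring\<^esub> s = - s" for s
      by (rule abelian_group.minus_equality[OF ring.is_abelian_group[OF ring_from_type_algebra]]) (auto simp: rat_ring_simps)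
    have "T.pure a r = \<ominus>\<^bsub>T.TR\<^esub> T.pure a (- r)" using h.hom_a_inv[of "- r"] by (simp add: neg rat_ring_simps)
    also have "T.pure a (- r) = T.pure ([nat (- p)] \<cdot>\<^bsub>A\<^esub> a) (1 / of_nat (nat q))"
      using False pure_of_nat[OF pure(1), of "nat (- p)" "1 / of_nat (nat q)"] rq by simp
    also have "\<ominus>\<^bsub>T.TR\<^esub> \<dots> = T.pure (\<ominus>\<^bsub>A\<^esub> ([nat (- p)] \<cdot>\<^bsub>A\<^esub> a)) (1 / of_nat (nat q))"
      using pure by simp
    finally show ?thesis using pure q
      by (intro bexI[of _ "\<ominus>\<^bsub>A\<^esub> ([nat (- p)] \<cdot>\<^bsub>A\<^esub> a)"] exI[of _ "nat q"]) auto
  qed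
next
  case (diff x y)
  then obtain a m b k where ab: "a \<in> carrier A" "m > 0" "x = T.pure a (1 / of_nat m)"
    "b \<in> carrier A" "k > 0" "y = T.pure b (1 / of_nat k)" by blast
  have "x = T.pure ([k] \<cdot>\<^bsub>A\<^esub> a) (1 / of_nat (m * k))" "y = T.pure ([m] \<cdot>\<^bsub>A\<^esub> b) (1 / of_nat (m * k))"
    using ab pure_cancel[of a k "1 / of_nat m"] pure_cancel[of b m "1 / of_nat k"] by (simp_all add: mult.commute)
  then have "x \<ominus>\<^bsub>T.TR\<^esub> y = T.pure ([k] \<cdot>\<^bsub>A\<^esub> a \<ominus>\<^bsub>A\<^esub> [m] \<cdot>\<^bsub>A\<^esub> b) (1 / of_nat (m * k))"
    using ab by (simp add: pure_minus)
  then show ?case using ab by (intro bexI[of _ "[k] \<cdot>\<^bsub>A\<^esub> a \<ominus>\<^bsub>A\<^esub> [m] \<cdot>\<^bsub>A\<^esub> b"] exI[of _ "m * k"]) auto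
qed

text \<open>For each \<open>D\<close> there is the functional \<open>a \<otimes> r \<mapsto> \<lfloor>r D\<rfloor> a\<close>; it kills a given relation as soon as \<open>D\<close> is a
  multiple of the denominators that occur.\<close>

theorem pure_one_zero:
  assumes a: "a \<in> carrier A" and zero: "T.pure a 1 = \<zero>\<^bsub>T.TR\<^esub>"
  shows "\<exists>D>0. [(D::nat)] \<cdot>\<^bsub>A\<^esub> a = \<zero>\<^bsub>A\<^esub>"
proof -
  have ex: "\<exists>h. abelian_group_hom T.PR A h \<and> (\<forall>a r. a \<in> carrier A \<longrightarrow> h (frag_of (a, r)) = [\<lfloor>r * of_nat D\<rfloor>] \<cdot>\<^bsub>A\<^esub> a)"
    for D :: nat
    by (rule T.functional_exists[OF A.abelian_group_axioms, of "\<lambda>a r. [\<lfloor>r * of_nat D\<rfloor>] \<cdot>\<^bsub>A\<^esub> a"])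
      (auto simp: rat_ring_simps A.add.int_pow_closed)
  then obtain h where h: "\<And>D::nat. abelian_group_hom T.PR A (h D)"
    and hf: "\<And>D a r. a \<in> carrier A \<Longrightarrow> h D (frag_of (a, r)) = [\<lfloor>r * of_nat D\<rfloor>] \<cdot>\<^bsub>A\<^esub> a"
    by metis
  have hd: "h D (x - y) = h D x \<ominus>\<^bsub>A\<^esub> h D y" if "x \<in> carrier T.PR" "y \<in> carrier T.PR" for x y D
    using abelian_group_hom.hom_minus[OF h that] that by (simp add: T.PR_minus)
  have ha: "h D (x + y) = h D x \<oplus>\<^bsub>A\<^esub> h D y" if "x \<in> carrier T.PR" "y \<in> carrier T.PR" for x y D
    using abelian_group_hom.hom_add[OF h that] by (simp add: T.PR_simps)
  have h0: "h D 0 = \<zero>\<^bsub>A\<^esub>" for D using abelian_group_hom.hom_zero[OF h] by (simp add: T.PR_simps)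
  have oc: "frag_of (a, r) \<in> carrier T.PR" if "a \<in> carrier A" for a r
    using T.of_closed that by (simp add: rat_ring_simps)
  have ev: "\<exists>D0>0. \<forall>D>0. D0 dvd D \<longrightarrow> h D x = \<zero>\<^bsub>A\<^esub>" if "x \<in> T.Rel" for x
    using that
  proof (induction rule: T.Rel_induct)
    case (gen x)
    then show ?case
    proof (cases rule: T.gens_cases)
      case (left b b' r)
      then have "h D x = \<zero>\<^bsub>A\<^esub>" for D
        using oc T.PR_add_closed[OF oc oc] A.add.int_pow_closed
        by (simp add: hd ha hf A.add.int_pow_distrib A.r_right_minus_eq)
      then show ?thesis by (intro exI[of _ 1]) auto
    next
      case (right b r r')
      obtain p q where pq: "quotient_of r = (p, q)" by fastforce
      obtain p' q' where pq': "quotient_of r' = (p', q')" by fastforce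
      have q: "q > 0" "r = of_int p / of_int q" "q' > 0" "r' = of_int p' / of_int q'"
        using pq pq' quotient_of_denom_pos quotient_of_div by blast+
      have "h D x = \<zero>\<^bsub>A\<^esub>" if D: "nat (q * q') dvd D" for D
      proof -
        obtain e where e: "D = nat (q * q') * e" using D by (elim dvdE)
        have rD: "r * of_nat D = of_int (p * q' * int e)" "r' * of_nat D = of_int (p' * q * int e)"
          using q e by simp_all
        have "\<lfloor>(r + r') * of_nat D\<rfloor> = \<lfloor>r * of_nat D\<rfloor> + \<lfloor>r' * of_nat D\<rfloor>"
          unfolding distrib_right rD by (simp only: flip: of_int_add) (simp only: floor_of_int)
        then show ?thesis using right oc T.PR_add_closed[OF oc oc] A.add.int_pow_closed
          by (simp add: hd ha hf rat_ring_simps A.add.int_pow_mult A.r_right_minus_eq)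
      qed
      then show ?thesis using q by (intro exI[of _ "nat (q * q')"]) auto
    qed
  next
    case (add x y)
    then obtain D1 D2 where D: "D1 > 0" "\<forall>D>0. D1 dvd D \<longrightarrow> h D x = \<zero>\<^bsub>A\<^esub>"
      "D2 > 0" "\<forall>D>0. D2 dvd D \<longrightarrow> h D y = \<zero>\<^bsub>A\<^esub>" by blast
    have "h D (x + y) = \<zero>\<^bsub>A\<^esub>" if "D > 0" "D1 * D2 dvd D" for D
    proof -
      have "D1 dvd D" "D2 dvd D" using that(2) by (auto dest: dvd_mult_left dvd_mult_right)
      then show ?thesis using D that add by (simp add: ha)
    qed
    then show ?case using D by (intro exI[of _ "D1 * D2"]) auto
  next
    case (uminus x)
    then show ?case using hd[of 0 x] h0 by (auto simp: T.carrier_PR a_minus_def)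
  qed (auto simp: h0 intro: exI[of _ 1])
  have "frag_of (a, 1) \<in> T.Rel" using zero a T.tcl_zero_iff[OF oc] by (simp add: T.pure_def)
  from ev[OF this] obtain D where "D > 0" "h D (frag_of (a, 1)) = \<zero>\<^bsub>A\<^esub>"
    using dvd_refl by metis
  then have "[int D] \<cdot>\<^bsub>A\<^esub> a = \<zero>\<^bsub>A\<^esub>" using a hf[of a D 1] by simp
  then show ?thesis using \<open>D > 0\<close> by (auto simp: add_pow_def int_pow_int)
qed

lemma cring_TR:
  assumes "cring A"
  shows "cring T.TR"
proof -
  interpret A: cring A by fact
  have "x \<otimes>\<^bsub>T.TR\<^esub> y = y \<otimes>\<^bsub>T.TR\<^esub> x" if xy: "x \<in> carrier T.TR" "y \<in> carrier T.TR" for x y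
  proof -
    obtain a m b k where ab: "a \<in> carrier A" "x = T.pure a (1 / of_nat m)"
      "b \<in> carrier A" "y = T.pure b (1 / of_nat k)" using fraction[OF xy(1)] fraction[OF xy(2)] by blast
    then show ?thesis using T.pure_mult by (simp add: rat_ring_simps A.m_comm mult.commute)
  qed
  then show ?thesis
    by (intro cring.intro T.ring_TR monoid.monoid_comm_monoidI T.TR.is_monoid) auto
qed

end

section \<open>Partial derivatives of polynomials\<close>

lemma a_kernel_iff: "x \<in> a_kernel R S h \<longleftrightarrow> x \<in> carrier R \<and> h x = \<zero>\<^bsub>S\<^esub>"
  unfolding a_kernel_def' by blast

locale polynomials = K: cring K for K :: "('k, 'c) ring_scheme" (structure) and V :: "'x set"
begin

sublocale P: monoid_algebra K "\<lparr>carrier = {M. set_mset M \<subseteq> V}, monoid.mult = (+), monoid.one = {#}\<rparr>"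
  rewrites "monoid_ring K \<lparr>carrier = {M. set_mset M \<subseteq> V}, monoid.mult = (+), monoid.one = {#}\<rparr> = mpoly_ring K V"
    and "carrier \<lparr>carrier = {M. set_mset M \<subseteq> V}, monoid.mult = (+), monoid.one = {#}\<rparr> = {M. set_mset M \<subseteq> V}"
    and "monoid.mult \<lparr>carrier = {M. set_mset M \<subseteq> V}, monoid.mult = (+), monoid.one = {#}\<rparr> = (+)"
    and "\<one>\<^bsub>\<lparr>carrier = {M. set_mset M \<subseteq> V}, monoid.mult = (+), monoid.one = {#}\<rparr>\<^esub> = {#}"
proof -
  show "monoid_algebra K \<lparr>carrier = {M. set_mset M \<subseteq> V}, monoid.mult = (+), monoid.one = {#}\<rparr>"
    by (intro monoid_algebra.intro K.cring_axioms monoidI) (auto simp: add.assoc)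
qed (simp_all add: mpoly_ring_def)

abbreviation PV where "PV \<equiv> mpoly_ring K V"

lemma cring_PV: "cring PV"
  by (rule P.cring_KM, rule comm_monoid.intro, rule P.M.monoid_axioms)
    (auto intro!: comm_monoid_axioms.intro simp: add.commute)

sublocale PV: cring "mpoly_ring K V" by (rule cring_PV)

lemma const_hom: "mpoly_const K \<in> ring_hom K PV"
  by (rule ring_hom_memI) (auto simp: mpoly_const_def P.monom_mult P.monom_add P.one_KM)

definition partial :: "'x \<Rightarrow> ('x multiset \<Rightarrow> 'k) \<Rightarrow> 'x multiset \<Rightarrow> 'k" where
  "partial v s = (\<lambda>m. [(Suc (count m v))] \<cdot> s (add_mset v m))"

lemma partial_closed [simp]:
  assumes s: "s \<in> carrier PV"
  shows "partial v s \<in> carrier PV"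
proof -
  have "P.supp (partial v s) \<subseteq> (\<lambda>m. m - {#v#}) ` P.supp s"
  proof
    fix m assume "m \<in> P.supp (partial v s)"
    then have "add_mset v m \<in> P.supp s" by (auto simp: partial_def)
    then show "m \<in> (\<lambda>m. m - {#v#}) ` P.supp s" by (intro image_eqI[of _ _ "add_mset v m"]) auto
  qed
  moreover have "finite ((\<lambda>m. m - {#v#}) ` P.supp s)" using s by (simp add: P.carrier_KM)
  moreover have "(\<lambda>m. m - {#v#}) ` P.supp s \<subseteq> {M. set_mset M \<subseteq> V}"
    using s in_diffD unfolding P.carrier_KM by fastforce
  ultimately show ?thesis using s unfolding P.carrier_KM
    by (auto intro: finite_subset simp: partial_def P.carrier_KM)
qed

lemma partial_add:
  assumes "s \<in> carrier PV" "t \<in> carrier PV"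
  shows "partial v (s \<oplus>\<^bsub>PV\<^esub> t) = partial v s \<oplus>\<^bsub>PV\<^esub> partial v t"
  using assms by (auto simp: partial_def P.add_KM K.add.nat_pow_distrib K.a_ac)

lemma partial_hom: "abelian_group_hom PV PV (partial v)"
  by (rule additive_mapI) (auto simp: partial_add P.KM.abelian_group_axioms)

lemma partial_monom:
  assumes "a \<in> carrier K"
  shows "partial v (mr_monom K a m) = mr_monom K ([(count m v)] \<cdot> a) (m - {#v#})"
proof
  fix m'
  show "partial v (mr_monom K a m) m' = mr_monom K ([(count m v)] \<cdot> a) (m - {#v#}) m'"
  proof (cases "v \<in># m")
    case True
    then obtain n where "m = add_mset v n" by (auto dest: multi_member_split)
    then show ?thesis by (auto simp: partial_def mr_monom_def)
  next
    case False
    then have "add_mset v m' \<noteq> m" "count m v = 0" by (auto simp: not_in_iff)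
    then show ?thesis by (simp add: partial_def mr_monom_def)
  qed
qed

lemma partial_const: "a \<in> carrier K \<Longrightarrow> partial v (mpoly_const K a) = \<zero>\<^bsub>PV\<^esub>"
  by (simp add: mpoly_const_def partial_monom P.monom_zero)

lemma partial_mult:
  assumes s: "s \<in> carrier PV" and t: "t \<in> carrier PV"
  shows "partial v (s \<otimes>\<^bsub>PV\<^esub> t) = s \<otimes>\<^bsub>PV\<^esub> partial v t \<oplus>\<^bsub>PV\<^esub> t \<otimes>\<^bsub>PV\<^esub> partial v s"
  using s
proof (induction rule: P.induct_terms)
  case zero
  show ?case using t partial_const[of \<zero> v]
    by (simp add: mpoly_const_def P.monom_zero)
next
  case (add x y)
  have c: "x \<otimes>\<^bsub>PV\<^esub> partial v t \<in> carrier PV" "t \<otimes>\<^bsub>PV\<^esub> partial v x \<in> carrier PV"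
    "y \<otimes>\<^bsub>PV\<^esub> partial v t \<in> carrier PV" "t \<otimes>\<^bsub>PV\<^esub> partial v y \<in> carrier PV" using add t by auto
  show ?case using add t c by (simp add: partial_add PV.l_distr PV.r_distr P.KM.a_ac)
next
  case (monom a m)
  note am = monom
  show ?case using t
  proof (induction rule: P.induct_terms)
    case zero
    show ?case using am partial_const[of \<zero> v]
      by (simp add: mpoly_const_def P.monom_zero)
  next
    case (add x y)
    let ?s = "mr_monom K a m"
    have s: "?s \<in> carrier PV" using am by simp
    have c: "x \<otimes>\<^bsub>PV\<^esub> partial v ?s \<in> carrier PV" "?s \<otimes>\<^bsub>PV\<^esub> partial v x \<in> carrier PV"
      "y \<otimes>\<^bsub>PV\<^esub> partial v ?s \<in> carrier PV" "?s \<otimes>\<^bsub>PV\<^esub> partial v y \<in> carrier PV" using add s by auto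
    show ?case using add s c by (simp add: partial_add PV.l_distr PV.r_distr P.KM.a_ac)
  next
    case (monom b n)
    have sub: "set_mset (m - {#v#}) \<subseteq> V" "set_mset (n - {#v#}) \<subseteq> V"
      using am monom by (auto dest: in_diffD)
    have 1: "mr_monom K (a \<otimes> [(count n v)] \<cdot> b) (m + (n - {#v#}))
      = mr_monom K ([(count n v)] \<cdot> (a \<otimes> b)) (m + n - {#v#})"
      using am monom by (cases "v \<in># n") (auto simp: K.add_pow_rdistr not_in_iff P.monom_zero)
    have 2: "mr_monom K (b \<otimes> [(count m v)] \<cdot> a) (n + (m - {#v#}))
      = mr_monom K ([(count m v)] \<cdot> (a \<otimes> b)) (m + n - {#v#})"
      using am monom
      by (cases "v \<in># m") (auto simp: K.add_pow_rdistr not_in_iff P.monom_zero K.m_comm add.commute)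
    show ?case using am monom sub
      by (simp add: P.monom_mult partial_monom 1 2 P.monom_add K.add.nat_pow_mult add.commute)
  qed
qed

definition var :: "'x \<Rightarrow> 'x multiset \<Rightarrow> 'k" where "var v = mr_monom K \<one> {#v#}"

lemma var_closed [simp]: "v \<in> V \<Longrightarrow> var v \<in> carrier PV"
  by (simp add: var_def)

lemma partial_var: "partial v (var w) = (if v = w then \<one>\<^bsub>PV\<^esub> else \<zero>\<^bsub>PV\<^esub>)"
  by (auto simp: var_def partial_monom P.one_KM P.monom_zero)

lemma torsion_free:
  assumes "\<And>a. a \<in> carrier K \<Longrightarrow> [(n::nat)] \<cdot> a = \<zero> \<Longrightarrow> a = \<zero>"
    and s: "s \<in> carrier PV" "[n] \<cdot>\<^bsub>PV\<^esub> s = \<zero>\<^bsub>PV\<^esub>"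
  shows "s = \<zero>\<^bsub>PV\<^esub>"
proof
  fix m
  have "[n] \<cdot> s m = ([n] \<cdot>\<^bsub>PV\<^esub> s) m"
    using abelian_group_hom.hom_add_pow[OF P.coeff_hom s(1), of n m] by simp
  then show "s m = \<zero>\<^bsub>PV\<^esub> m" using assms by (simp add: P.zero_KM)
qed

end

text \<open>The chain rule.\<close>

theorem (in de_rham_complex) d_polynomial:
  assumes B0: "cring B0" and h: "h \<in> ring_hom (mpoly_ring B0 V) B"
    and hc: "\<And>a. a \<in> carrier B0 \<Longrightarrow> h (mpoly_const B0 a) = g a"
    and v: "v ` {..<N} \<subseteq> V" "inj_on v {..<N::nat}"
    and G: "G \<in> carrier (mpoly_ring B0 V)" "\<And>m. G m \<noteq> \<zero>\<^bsub>B0\<^esub> \<Longrightarrow> set_mset m \<subseteq> v ` {..<N}"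
  shows "frm \<one>\<^bsub>B\<^esub> [h G] = (\<Oplus>\<^bsub>Om\<^esub>i\<in>{..<N}. frm (h (polynomials.partial B0 (v i) G)) [h (polynomials.var B0 (v i))])"
proof -
  interpret p: polynomials B0 V by (intro polynomials.intro B0)
  have hcl: "h x \<in> carrier B" if "x \<in> carrier p.PV" for x using ring_hom_closed[OF h that] .
  define t where "t i = h (p.var (v i))" for i
  have t: "t i \<in> carrier B" if "i < N" for i using that v hcl by (auto simp: t_def)
  define Q where "Q G = (\<Oplus>\<^bsub>Om\<^esub>i\<in>{..<N}. frm (h (p.partial (v i) G)) [t i])" for G
  have Qt: "(\<lambda>i. frm (h (p.partial (v i) G)) [t i]) \<in> {..<N} \<rightarrow> carrier Om" if "G \<in> carrier p.PV" for G
    using that t hcl by auto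
  have Qc: "Q G \<in> carrier Om" if "G \<in> carrier p.PV" for G
    unfolding Q_def by (rule Om.finsum_closed[OF Qt[OF that]])
  have Qadd: "Q (x \<oplus>\<^bsub>p.PV\<^esub> y) = Q x \<oplus>\<^bsub>Om\<^esub> Q y" if xy: "x \<in> carrier p.PV" "y \<in> carrier p.PV" for x y
  proof -
    have "Q (x \<oplus>\<^bsub>p.PV\<^esub> y)
        = (\<Oplus>\<^bsub>Om\<^esub>i\<in>{..<N}. frm (h (p.partial (v i) x)) [t i] \<oplus>\<^bsub>Om\<^esub> frm (h (p.partial (v i) y)) [t i])"
      unfolding Q_def by (rule Om.finsum_cong')
        (use xy t hcl in \<open>auto simp: p.partial_add ring_hom_add[OF h] frm_add\<close>)
    also have "\<dots> = Q x \<oplus>\<^bsub>Om\<^esub> Q y" unfolding Q_def by (rule Om.finsum_addf[OF Qt Qt]) (use xy in auto)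
    finally show ?thesis .
  qed
  have Qmult: "Q (x \<otimes>\<^bsub>p.PV\<^esub> y) = frm (h x) [] \<otimes>\<^bsub>Om\<^esub> Q y \<oplus>\<^bsub>Om\<^esub> frm (h y) [] \<otimes>\<^bsub>Om\<^esub> Q x"
    if xy: "x \<in> carrier p.PV" "y \<in> carrier p.PV" for x y
  proof -
    have r: "frm (h x) [] \<otimes>\<^bsub>Om\<^esub> Q y = (\<Oplus>\<^bsub>Om\<^esub>i\<in>{..<N}. frm (h x) [] \<otimes>\<^bsub>Om\<^esub> frm (h (p.partial (v i) y)) [t i])"
      if "x \<in> carrier p.PV" "y \<in> carrier p.PV" for x y
      unfolding Q_def by (rule Om.finsum_rdistr) (use that hcl Qt in auto)
    have "Q (x \<otimes>\<^bsub>p.PV\<^esub> y) = (\<Oplus>\<^bsub>Om\<^esub>i\<in>{..<N}. frm (h x) [] \<otimes>\<^bsub>Om\<^esub> frm (h (p.partial (v i) y)) [t i]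
        \<oplus>\<^bsub>Om\<^esub> frm (h y) [] \<otimes>\<^bsub>Om\<^esub> frm (h (p.partial (v i) x)) [t i])"
      unfolding Q_def by (rule Om.finsum_cong')
        (use xy t hcl in \<open>auto simp: p.partial_mult ring_hom_add[OF h] ring_hom_mult[OF h] frm_add frm_mult\<close>)
    also have "\<dots> = frm (h x) [] \<otimes>\<^bsub>Om\<^esub> Q y \<oplus>\<^bsub>Om\<^esub> frm (h y) [] \<otimes>\<^bsub>Om\<^esub> Q x"
      unfolding r[OF xy] r[OF xy(2,1)] by (rule Om.finsum_addf) (use xy t hcl in auto)
    finally show ?thesis .
  qed
  have Qvar: "Q (p.var (v j)) = frm \<one>\<^bsub>B\<^esub> [t j]" if j: "j < N" for j
  proof -
    have h01: "h \<zero>\<^bsub>p.PV\<^esub> = \<zero>\<^bsub>B\<^esub>" "h \<one>\<^bsub>p.PV\<^esub> = \<one>\<^bsub>B\<^esub>"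
      using ring_hom_zero[OF h p.PV.ring_axioms B.ring_axioms] ring_hom_one[OF h] by auto
    have "Q (p.var (v j)) = (\<Oplus>\<^bsub>Om\<^esub>i\<in>{..<N}. if j = i then frm \<one>\<^bsub>B\<^esub> [t i] else \<zero>\<^bsub>Om\<^esub>)"
      unfolding Q_def
    proof (rule Om.finsum_cong')
      fix i assume i: "i \<in> {..<N}"
      then have "v i = v j \<longleftrightarrow> j = i" using v(2) j by (auto simp: inj_on_def)
      then show "frm (h (p.partial (v i) (p.var (v j)))) [t i] = (if j = i then frm \<one>\<^bsub>B\<^esub> [t i] else \<zero>\<^bsub>Om\<^esub>)"
        using i t by (auto simp: p.partial_var h01 frm_zero)
    qed (use t in auto)
    also have "\<dots> = frm \<one>\<^bsub>B\<^esub> [t j]" by (rule Om.finsum_singleton) (use j t in auto)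
    finally show ?thesis .
  qed
  have Qconst: "Q (mpoly_const B0 a) = \<zero>\<^bsub>Om\<^esub>" if "a \<in> carrier B0" for a
    unfolding Q_def using that t ring_hom_zero[OF h p.PV.ring_axioms B.ring_axioms]
    by (intro Om.add.finprod_one_eqI) (auto simp: p.partial_const frm_zero)
  have mono: "frm \<one>\<^bsub>B\<^esub> [h (mr_monom B0 a m)] = Q (mr_monom B0 a m)"
    if a: "a \<in> carrier B0" and "set_mset m \<subseteq> v ` {..<N}" for a m
    using that(2)
  proof (induction m)
    case empty
    then show ?case using Qconst[OF a] hc[OF a] d_const[OF a] by (simp add: mpoly_const_def)
  next
    case (add x m)
    then obtain j where j: "j < N" "x = v j" by auto
    have mV: "set_mset m \<subseteq> V" "x \<in> V" using add.prems v(1) by auto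
    let ?m = "mr_monom B0 a m"
    have c: "?m \<in> carrier p.PV" "p.var x \<in> carrier p.PV" using a mV by auto
    have eq: "mr_monom B0 a (add_mset x m) = ?m \<otimes>\<^bsub>p.PV\<^esub> p.var x"
      using a mV by (simp add: p.var_def p.P.monom_mult)
    have "frm \<one>\<^bsub>B\<^esub> [h (?m \<otimes>\<^bsub>p.PV\<^esub> p.var x)] = frm (h ?m) [t j] \<oplus>\<^bsub>Om\<^esub> frm (t j) [h ?m]"
      using c hcl j by (simp add: ring_hom_mult[OF h] d_mult t_def)
    also have "\<dots> = frm (h ?m) [] \<otimes>\<^bsub>Om\<^esub> frm \<one>\<^bsub>B\<^esub> [t j] \<oplus>\<^bsub>Om\<^esub> frm (t j) [] \<otimes>\<^bsub>Om\<^esub> frm \<one>\<^bsub>B\<^esub> [h ?m]"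
      using c hcl t j by (simp add: frm_mult)
    also have "\<dots> = frm (h ?m) [] \<otimes>\<^bsub>Om\<^esub> Q (p.var x) \<oplus>\<^bsub>Om\<^esub> frm (h (p.var x)) [] \<otimes>\<^bsub>Om\<^esub> Q ?m"
      using add.IH add.prems j Qvar by (simp add: t_def)
    also have "\<dots> = Q (?m \<otimes>\<^bsub>p.PV\<^esub> p.var x)" using Qmult[OF c] by simp
    finally show ?case unfolding eq .
  qed
  have "frm \<one>\<^bsub>B\<^esub> [h G] = Q G"
    using G(1)
  proof (induction rule: p.P.induct_terms)
    case zero
    then show ?case using mono[of "\<zero>\<^bsub>B0\<^esub>" "{#}"] by (simp add: p.P.monom_zero)
  next
    case (monom a m)
    then show ?case using mono G(2) by auto
  next
    case (add x y)
    then show ?case using hcl by (simp add: ring_hom_add[OF h] d_add Qadd)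
  qed
  then show ?thesis by (simp add: Q_def t_def)
qed

section \<open>Forms on polynomial rings and on smooth algebras have no torsion\<close>

text \<open>A form involves only finitely many variables, and in these \<open>db\<close> is the sum of \<open>\<partial>\<^sub>v b dv\<close>.\<close>

theorem polynomial_forms_torsion_free:
  assumes K: "cring K"
    and tf: "\<And>a. a \<in> carrier K \<Longrightarrow> [(n::nat)] \<cdot>\<^bsub>K\<^esub> a = \<zero>\<^bsub>K\<^esub> \<Longrightarrow> a = \<zero>\<^bsub>K\<^esub>"
    and x: "x \<in> carrier (de_rham K (mpoly_ring K V) (mpoly_const K))"
      "[n] \<cdot>\<^bsub>de_rham K (mpoly_ring K V) (mpoly_const K)\<^esub> x = \<zero>\<^bsub>de_rham K (mpoly_ring K V) (mpoly_const K)\<^esub>"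
  shows "x = \<zero>\<^bsub>de_rham K (mpoly_ring K V) (mpoly_const K)\<^esub>"
proof -
  interpret p: polynomials K V by (intro polynomials.intro K)
  interpret D: de_rham_complex K p.PV "mpoly_const K"
    by unfold_locales (rule ring_hom_closed[OF p.const_hom])
  obtain s where s: "s \<in> carrier D.FW" "x = D.cls s" using x(1) by (rule D.Om_cases)
  define W where "W = (\<Union>w\<in>D.W.supp s. \<Union>b\<in>set w. \<Union>m\<in>p.P.supp b. set_mset m)"
  have sw: "w \<in> lists (carrier p.PV)" if "w \<in> D.W.supp s" for w
    using s(1) that unfolding D.W.carrier_KM by auto
  then have bc: "b \<in> carrier p.PV" if "w \<in> D.W.supp s" "b \<in> set w" for w b using that by auto
  have fin: "finite W" unfolding W_def
    using s(1) bc by (auto simp: D.W.carrier_KM p.P.carrier_KM)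
  obtain v where v: "bij_betw v {0..<card W} W" using ex_bij_betw_nat_finite[OF fin] by blast
  have vW: "v ` {..<card W} = W" "inj_on v {..<card W}"
    using v by (auto simp: bij_betw_def atLeast0LessThan)
  have WV: "W \<subseteq> V" unfolding W_def using bc by (fastforce simp: p.P.carrier_KM)
  have vV: "v i \<in> V" if "i < card W" for i using vW WV that by auto
  have "D.cls s = \<zero>\<^bsub>D.Om\<^esub>"
  proof (rule D.no_torsion[of "card W" "\<lambda>i. p.var (v i)" "\<lambda>i. p.partial (v i)" n s])
    fix w b assume w: "s w \<noteq> \<zero>\<^bsub>p.PV\<^esub>" "b \<in> set w"
    have "D.frm \<one>\<^bsub>p.PV\<^esub> [id b]
      = (\<Oplus>\<^bsub>D.Om\<^esub>i\<in>{..<card W}. D.frm (id (p.partial (v i) b)) [id (p.var (v i))])"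
    proof (rule D.d_polynomial[OF K id_ring_hom])
      show "b \<in> carrier p.PV" using bc w by auto
      fix m assume "b m \<noteq> \<zero>\<^bsub>K\<^esub>"
      then have "set_mset m \<subseteq> W" unfolding W_def using w by blast
      then show "set_mset m \<subseteq> v ` {..<card W}" unfolding vW(1) .
    qed (use vW WV in auto)
    then show "D.frm \<one>\<^bsub>p.PV\<^esub> [b] = (\<Oplus>\<^bsub>D.Om\<^esub>i\<in>{..<card W}. D.frm (p.partial (v i) b) [p.var (v i)])"
      by simp
  next
    fix b assume "b \<in> carrier p.PV" "[n] \<cdot>\<^bsub>p.PV\<^esub> b = \<zero>\<^bsub>p.PV\<^esub>"
    then show "b = \<zero>\<^bsub>p.PV\<^esub>" using p.torsion_free[of n b] tf by blast
  qed (use vV s x in \<open>auto simp: p.partial_add p.partial_mult p.partial_const\<close>)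
  then show ?thesis using s by simp
qed

text \<open>Write \<open>R = P/K\<close> with \<open>P\<close> a polynomial ring over \<open>R\<^sub>0\<close>.  Smoothness lifts the isomorphism of \<open>R\<close> with
  \<open>P/K\<close> to a homomorphism to \<open>P/K\<^sup>2\<close>.  The partial derivatives map \<open>K\<^sup>2\<close> to \<open>K\<close>, so they induce derivations of \<open>R\<close>,
  and these express \<open>dr\<close> through the differentials of the variables.\<close>

theorem smooth_forms_torsion_free:
  fixes R0 :: "('a, 'c) ring_scheme"
  assumes sm: "smooth_hom R0 R f"
    and tf: "\<And>r. r \<in> carrier R \<Longrightarrow> [(n::nat)] \<cdot>\<^bsub>R\<^esub> r = \<zero>\<^bsub>R\<^esub> \<Longrightarrow> r = \<zero>\<^bsub>R\<^esub>"
    and x: "x \<in> carrier (de_rham R0 R f)" "[n] \<cdot>\<^bsub>de_rham R0 R f\<^esub> x = \<zero>\<^bsub>de_rham R0 R f\<^esub>"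
  shows "x = \<zero>\<^bsub>de_rham R0 R f\<^esub>"
proof -
  interpret R0: cring R0 using sm by (simp add: smooth_hom_def)
  interpret R: cring R using sm by (simp add: smooth_hom_def)
  have f: "f \<in> ring_hom R0 R" and fs: "formally_smooth R0 R f" using sm by (simp_all add: smooth_hom_def)
  obtain N h where h: "h \<in> ring_hom (mpoly_ring R0 {..<N::nat}) R"
    and surj: "h ` carrier (mpoly_ring R0 {..<N}) = carrier R"
    and hc: "\<And>r. r \<in> carrier R0 \<Longrightarrow> h (mpoly_const R0 r) = f r"
    using sm unfolding smooth_hom_def finitely_presented_def by blast
  interpret p: polynomials R0 "{..<N}" by (intro polynomials.intro R0.cring_axioms)
  interpret D: de_rham_complex R0 R f by unfold_locales (rule ring_hom_closed[OF f])
  interpret h: ring_hom_ring p.PV R h by (rule ring_hom_ringI2[OF p.PV.ring_axioms R.ring_axioms h])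
  define K where "K = a_kernel p.PV R h"
  have K_iff: "a \<in> K \<longleftrightarrow> a \<in> carrier p.PV \<and> h a = \<zero>\<^bsub>R\<^esub>" for a
    unfolding K_def by (rule a_kernel_iff)
  define sq where "sq = {a \<otimes>\<^bsub>p.PV\<^esub> b | a b. a \<in> K \<and> b \<in> K}"
  define Q where "Q = Idl\<^bsub>p.PV\<^esub> sq"
  have sqc: "sq \<subseteq> carrier p.PV" by (auto simp: sq_def K_iff)
  interpret Q: ideal Q p.PV unfolding Q_def by (rule p.PV.genideal_ideal[OF sqc])
  have QK: "Q \<subseteq> {a \<in> carrier p.PV. h a = \<zero>\<^bsub>R\<^esub> \<and> (\<forall>i. h (p.partial i a) = \<zero>\<^bsub>R\<^esub>)}" (is "_ \<subseteq> ?L")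
    unfolding Q_def
  proof (rule p.PV.genideal_minimal)
    have pm: "p.partial i (\<ominus>\<^bsub>p.PV\<^esub> a) = \<ominus>\<^bsub>p.PV\<^esub> p.partial i a" if "a \<in> carrier p.PV" for a i
      using abelian_group_hom.hom_a_inv[OF p.partial_hom that] .
    have p0: "p.partial i \<zero>\<^bsub>p.PV\<^esub> = \<zero>\<^bsub>p.PV\<^esub>" for i
      using abelian_group_hom.hom_zero[OF p.partial_hom] .
    show "ideal ?L p.PV"
    proof (rule idealI[OF p.PV.ring_axioms])
      show "subgroup ?L (add_monoid p.PV)"
        by (rule p.P.KM.add.subgroupI)
          (auto simp: p.partial_add pm p0 intro!: exI[of _ "\<zero>\<^bsub>p.PV\<^esub>"])
    qed (auto simp: p.partial_mult)
    show "sq \<subseteq> ?L" by (auto simp: sq_def K_iff p.partial_mult)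
  qed
  let ?B = "p.PV Quot Q"
  interpret B: cring ?B by (rule Q.quotient_is_cring[OF p.cring_PV])
  define hB where "hB = (\<lambda>U. the_elem (h ` U))"
  have Qz: "h a = \<zero>\<^bsub>R\<^esub>" if "a \<in> Q" for a using QK that by blast
  have hB: "hB \<in> ring_hom ?B R" "\<And>a. a \<in> carrier p.PV \<Longrightarrow> hB (Q +>\<^bsub>p.PV\<^esub> a) = h a"
    unfolding hB_def using Q.quotient_hom[OF R.ring_axioms h Qz] by auto
  have Bc: "\<exists>a\<in>carrier p.PV. U = Q +>\<^bsub>p.PV\<^esub> a" if "U \<in> carrier ?B" for U
    using that by (auto simp: FactRing_def A_RCOSETS_def')
  have Bi: "Q +>\<^bsub>p.PV\<^esub> a \<in> carrier ?B" if "a \<in> carrier p.PV" for a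
    using ring_hom_closed[OF Q.rcos_ring_hom that] .
  interpret hB: ring_hom_ring ?B R hB by (rule ring_hom_ringI2[OF B.ring_axioms R.ring_axioms hB(1)])
  let ?J = "a_kernel ?B R hB"
  have surjB: "hB ` carrier ?B = carrier R"
  proof
    show "carrier R \<subseteq> hB ` carrier ?B"
    proof
      fix r assume "r \<in> carrier R"
      then obtain a where "a \<in> carrier p.PV" "r = h a" using surj by blast
      then show "r \<in> hB ` carrier ?B" using hB(2)[of a] Bi[of a] by (intro image_eqI[of _ _ "Q +>\<^bsub>p.PV\<^esub> a"]) auto
    qed
  qed auto
  let ?iso = "\<lambda>Y. the_elem (hB ` Y)"
  have iso: "?iso \<in> ring_iso (?B Quot ?J) R" by (rule hB.FactRing_iso_set[OF surjB])
  have isoc: "?iso (?J +>\<^bsub>?B\<^esub> U) = hB U" if "U \<in> carrier ?B" for U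
    using that by (rule hB.the_elem_simp)
  define hq where "hq = inv_into (carrier (?B Quot ?J)) ?iso"
  have bij: "bij_betw ?iso (carrier (?B Quot ?J)) (carrier R)" using iso by (simp add: ring_iso_def)
  interpret J: ideal ?J ?B by (rule hB.kernel_is_ideal)
  have "ring (?B Quot ?J)" by (rule J.quotient_is_ring)
  then have hq: "hq \<in> ring_hom R (?B Quot ?J)"
    using ring_iso_set_sym[OF _ iso] unfolding hq_def by (simp add: ring_iso_def)
  have Jc: "?J +>\<^bsub>?B\<^esub> U \<in> carrier (?B Quot ?J)" if "U \<in> carrier ?B" for U
    using ring_hom_closed[OF J.rcos_ring_hom that] .
  have gh: "(\<lambda>r. Q +>\<^bsub>p.PV\<^esub> mpoly_const R0 r) \<in> ring_hom R0 ?B"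
    using ring_hom_trans[OF p.const_hom Q.rcos_ring_hom] by (simp add: o_def)
  have sqz: "U \<otimes>\<^bsub>?B\<^esub> U' = \<zero>\<^bsub>?B\<^esub>" if U: "U \<in> ?J" "U' \<in> ?J" for U U'
  proof -
    have UB: "U \<in> carrier ?B" "hB U = \<zero>\<^bsub>R\<^esub>" "U' \<in> carrier ?B" "hB U' = \<zero>\<^bsub>R\<^esub>"
      using U[unfolded a_kernel_iff] by blast+
    obtain a b where ab: "a \<in> carrier p.PV" "U = Q +>\<^bsub>p.PV\<^esub> a" "b \<in> carrier p.PV" "U' = Q +>\<^bsub>p.PV\<^esub> b"
      using Bc[OF UB(1)] Bc[OF UB(3)] by blast
    have "h a = \<zero>\<^bsub>R\<^esub>" "h b = \<zero>\<^bsub>R\<^esub>" using UB(2,4) ab(2,4) hB(2)[OF ab(1)] hB(2)[OF ab(3)] by simp_all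
    then have "a \<in> K" "b \<in> K" using ab(1,3) K_iff by blast+
    then have "a \<otimes>\<^bsub>p.PV\<^esub> b \<in> sq" unfolding sq_def by blast
    then have "a \<otimes>\<^bsub>p.PV\<^esub> b \<in> Q" unfolding Q_def using p.PV.genideal_self[OF sqc] by blast
    then show ?thesis using ab Q.rcoset_mult_add Q.a_rcos_const by (simp add: FactRing_def)
  qed
  have comp: "hq (f r) = ?J +>\<^bsub>?B\<^esub> (Q +>\<^bsub>p.PV\<^esub> mpoly_const R0 r)" if r: "r \<in> carrier R0" for r
  proof -
    have c: "mpoly_const R0 r \<in> carrier p.PV" using ring_hom_closed[OF p.const_hom r] .
    have eq: "?iso (?J +>\<^bsub>?B\<^esub> (Q +>\<^bsub>p.PV\<^esub> mpoly_const R0 r)) = f r"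
      using isoc[OF Bi[OF c]] hB(2)[OF c] hc[OF r] by simp
    show ?thesis using inv_into_f_f[OF bij_betw_imp_inj_on[OF bij] Jc[OF Bi[OF c]]]
      unfolding hq_def eq .
  qed
  have tests: "cring ?B \<and> ideal ?J ?B \<and> (\<forall>x\<in>?J. \<forall>y\<in>?J. x \<otimes>\<^bsub>?B\<^esub> y = \<zero>\<^bsub>?B\<^esub>) \<and>
       (\<lambda>r. Q +>\<^bsub>p.PV\<^esub> mpoly_const R0 r) \<in> ring_hom R0 ?B \<and> hq \<in> ring_hom R (?B Quot ?J) \<and>
       (\<forall>r\<in>carrier R0. hq (f r) = ?J +>\<^bsub>?B\<^esub> (Q +>\<^bsub>p.PV\<^esub> mpoly_const R0 r))"
    using B.cring_axioms J.ideal_axioms gh hq comp sqz by (intro conjI ballI)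
  obtain l where l: "l \<in> ring_hom R ?B" and lf: "\<And>r. r \<in> carrier R0 \<Longrightarrow> l (f r) = Q +>\<^bsub>p.PV\<^esub> mpoly_const R0 r"
    and lq: "\<And>r. r \<in> carrier R \<Longrightarrow> ?J +>\<^bsub>?B\<^esub> l r = hq r"
    using fs[unfolded formally_smooth_def, THEN spec, THEN spec, THEN spec, THEN spec, THEN mp, OF tests]
    by (elim bexE conjE) (rule that, assumption, (erule bspec, assumption)+)
  have "\<exists>a\<in>carrier p.PV. l r = Q +>\<^bsub>p.PV\<^esub> a" if "r \<in> carrier R" for r
    using Bc ring_hom_closed[OF l that] by blast
  then obtain G where G: "\<And>r. r \<in> carrier R \<Longrightarrow> G r \<in> carrier p.PV"
    "\<And>r. r \<in> carrier R \<Longrightarrow> l r = Q +>\<^bsub>p.PV\<^esub> G r" by metis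
  have hG: "h (G r) = r" if r: "r \<in> carrier R" for r
  proof -
    have "h (G r) = ?iso (?J +>\<^bsub>?B\<^esub> l r)" using isoc[OF Bi[OF G(1)[OF r]]] hB(2)[OF G(1)[OF r]] G(2)[OF r] by simp
    also have "\<dots> = r" unfolding lq[OF r] hq_def by (rule bij_betw_inv_into_right[OF bij r])
    finally show ?thesis .
  qed
  have same: "h (p.partial i a) = h (p.partial i b)"
    if ab: "a \<in> carrier p.PV" "b \<in> carrier p.PV" "Q +>\<^bsub>p.PV\<^esub> a = Q +>\<^bsub>p.PV\<^esub> b" for a b i
  proof -
    have "a \<in> Q +>\<^bsub>p.PV\<^esub> b" using Q.a_rcos_self[OF ab(1)] ab(3) by simp
    then obtain q where q: "q \<in> Q" "a = q \<oplus>\<^bsub>p.PV\<^esub> b" by (auto simp: a_r_coset_def')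
    have "h (p.partial i q) = \<zero>\<^bsub>R\<^esub>" using QK q(1) by blast
    then show ?thesis using q ab Q.a_Hcarr[OF q(1)] by (simp add: p.partial_add)
  qed
  define \<delta> where "\<delta> i r = h (p.partial i (G r))" for i r
  have \<delta>_any: "\<delta> i r = h (p.partial i a)" if "r \<in> carrier R" "a \<in> carrier p.PV" "l r = Q +>\<^bsub>p.PV\<^esub> a" for i r a
    unfolding \<delta>_def using same[OF G(1)[OF that(1)] that(2)] G(2)[OF that(1)] that(3) by simp
  obtain s where s: "s \<in> carrier D.FW" "x = D.cls s" using x(1) by (rule D.Om_cases)
  have "D.cls s = \<zero>\<^bsub>D.Om\<^esub>"
  proof (rule D.no_torsion[of N "\<lambda>i. h (p.var i)" \<delta> n s])
    fix i a b assume ab: "a \<in> carrier R" "b \<in> carrier R"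
    note Gab = G(1)[OF ab(1)] G(1)[OF ab(2)]
    have "l (a \<oplus>\<^bsub>R\<^esub> b) = Q +>\<^bsub>p.PV\<^esub> (G a \<oplus>\<^bsub>p.PV\<^esub> G b)"
      using ring_hom_add[OF l ab] G(2)[OF ab(1)] G(2)[OF ab(2)] ring_hom_add[OF Q.rcos_ring_hom Gab] by simp
    then show "\<delta> i (a \<oplus>\<^bsub>R\<^esub> b) = \<delta> i a \<oplus>\<^bsub>R\<^esub> \<delta> i b"
      using \<delta>_any[of "a \<oplus>\<^bsub>R\<^esub> b" "G a \<oplus>\<^bsub>p.PV\<^esub> G b" i] ab Gab by (simp add: p.partial_add \<delta>_def)
    have "l (a \<otimes>\<^bsub>R\<^esub> b) = Q +>\<^bsub>p.PV\<^esub> (G a \<otimes>\<^bsub>p.PV\<^esub> G b)"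
      using ring_hom_mult[OF l ab] G(2)[OF ab(1)] G(2)[OF ab(2)] ring_hom_mult[OF Q.rcos_ring_hom Gab] by simp
    then show "\<delta> i (a \<otimes>\<^bsub>R\<^esub> b) = a \<otimes>\<^bsub>R\<^esub> \<delta> i b \<oplus>\<^bsub>R\<^esub> b \<otimes>\<^bsub>R\<^esub> \<delta> i a"
      using \<delta>_any[of "a \<otimes>\<^bsub>R\<^esub> b" "G a \<otimes>\<^bsub>p.PV\<^esub> G b" i] ab Gab hG by (simp add: p.partial_mult \<delta>_def)
  next
    fix i a assume a: "a \<in> carrier R0"
    show "\<delta> i (f a) = \<zero>\<^bsub>R\<^esub>"
      using \<delta>_any[of "f a" "mpoly_const R0 a" i] a lf ring_hom_closed[OF f a] ring_hom_closed[OF p.const_hom a]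
      by (simp add: p.partial_const)
  next
    fix w b assume w: "s w \<noteq> \<zero>\<^bsub>R\<^esub>" "b \<in> set w"
    then have b: "b \<in> carrier R" using s(1) unfolding D.W.carrier_KM by auto
    have "D.frm \<one>\<^bsub>R\<^esub> [h (G b)] = (\<Oplus>\<^bsub>D.Om\<^esub>i\<in>{..<N}. D.frm (h (p.partial (id i) (G b))) [h (p.var (id i))])"
      by (rule D.d_polynomial[OF R0.cring_axioms h hc])
        (use G(1)[OF b] in \<open>auto simp: p.P.carrier_KM\<close>)
    then show "D.frm \<one>\<^bsub>R\<^esub> [b] = (\<Oplus>\<^bsub>D.Om\<^esub>i\<in>{..<N}. D.frm (\<delta> i b) [h (p.var i)])"
      using hG[OF b] by (simp add: \<delta>_def)
  qed (use tf s x G in \<open>auto simp: \<delta>_def\<close>)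
  then show ?thesis using s by simp
qed

section \<open>Integral forms inside rational forms\<close>

locale rational_forms = A0: cring A0 + A: cring A
  for A0 :: "('a0, 'c) ring_scheme" and A :: "('a, 'd) ring_scheme" and i :: "'a0 \<Rightarrow> 'a" +
  assumes i: "i \<in> ring_hom A0 A"
begin

sublocale D: de_rham_complex A0 A i
  by unfold_locales (rule ring_hom_closed[OF i])

sublocale Q0: rationalized A0 by unfold_locales
sublocale QA: rationalized A by unfold_locales

abbreviation AQ where "AQ \<equiv> rationalization A"
abbreviation iQ where "iQ \<equiv> rationalization_map A i"

lemma rat_elem_pure: "rat_elem A a r = QA.T.pure a r" "rat_elem A0 b r = Q0.T.pure b r"
  by (simp_all add: rat_elem_def QA.T.pure_def Q0.T.pure_def)

lemma AQ_eq: "AQ = QA.T.TR" "rationalization A0 = Q0.T.TR"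
  by (simp_all add: rationalization_def)

lemma cring_AQ: "cring AQ"
  unfolding AQ_eq by (rule QA.cring_TR[OF A.cring_axioms])

sublocale AQ: cring "rationalization A" by (rule cring_AQ)

lemmas iQ_props = tensor_map_left_props[OF Q0.T.tensor_product_axioms QA.T.tensor_product_axioms
    additive_map_of_ring_hom[OF A0.ring_axioms A.ring_axioms i], folded rationalization_map_def]

lemma iQ_pure: "b \<in> carrier A0 \<Longrightarrow> iQ (rat_elem A0 b r) = rat_elem A (i b) r"
  unfolding rat_elem_pure by (rule iQ_props(2)) (simp_all add: rat_ring_simps)

lemma iQ_closed: "x \<in> carrier (rationalization A0) \<Longrightarrow> iQ x \<in> carrier AQ"
  unfolding AQ_eq by (rule abelian_group_hom.hom_closed[OF iQ_props(1)])

sublocale DQ: de_rham_complex "rationalization A0" "rationalization A" "rationalization_map A i"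
  by unfold_locales (rule iQ_closed)

lemma rat_elem_closed [simp]: "a \<in> carrier A \<Longrightarrow> rat_elem A a r \<in> carrier AQ"
  by (simp add: rat_elem_pure AQ_eq)

lemma rat_elem_mult:
  "a \<in> carrier A \<Longrightarrow> b \<in> carrier A \<Longrightarrow> rat_elem A a r \<otimes>\<^bsub>AQ\<^esub> rat_elem A b s = rat_elem A (a \<otimes>\<^bsub>A\<^esub> b) (r * s)"
  using QA.T.pure_mult[of a r b s] by (simp add: rat_elem_pure AQ_eq rat_ring_simps)

lemma rat_elem_add:
  "a \<in> carrier A \<Longrightarrow> b \<in> carrier A \<Longrightarrow> rat_elem A a r \<oplus>\<^bsub>AQ\<^esub> rat_elem A b r = rat_elem A (a \<oplus>\<^bsub>A\<^esub> b) r"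
  using QA.T.pure_add_l[of a b r] by (simp add: rat_elem_pure AQ_eq rat_ring_simps)

lemma rat_elem_one: "rat_elem A \<one>\<^bsub>A\<^esub> 1 = \<one>\<^bsub>AQ\<^esub>"
  using QA.T.pure_one by (simp add: rat_elem_pure AQ_eq rat_ring_simps)

lemma rat_elem_hom: "(\<lambda>a. rat_elem A a 1) \<in> ring_hom A AQ"
  by (rule ring_hom_memI) (simp_all add: rat_elem_mult rat_elem_add rat_elem_one)

sublocale R: de_rham_morphism A0 A i "rationalization A0" "rationalization A" "rationalization_map A i"
  "\<lambda>a. rat_elem A a 1"
proof
  fix a assume "a \<in> carrier A0"
  then show "\<exists>a'\<in>carrier (rationalization A0). rat_elem A (i a) 1 = iQ a'"
    by (intro bexI[of _ "rat_elem A0 a 1"]) (simp_all add: iQ_pure, simp add: rat_elem_pure AQ_eq)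
qed (rule rat_elem_hom)

abbreviation to_rat where "to_rat \<equiv> de_rham_to_rat A0 A i"

lemma to_rat_eq: "to_rat = R.U"
  by (simp add: de_rham_to_rat_def)

text \<open>The differential extends linearly to a derivation from \<open>A \<otimes> \<rat>\<close> to \<open>\<Omega> \<otimes> \<rat>\<close>, so the universal property of
  rational forms applies.  A form that vanishes rationally then vanishes in \<open>\<Omega> \<otimes> \<rat>\<close>, hence is torsion.\<close>

lemma rational_to_tensor:
  obtains \<Psi> where "\<Psi> \<in> ring_hom DQ.Om (tensor_ring D.Om rat_ring)"
    "\<And>w. w \<in> carrier D.Om \<Longrightarrow> \<Psi> (to_rat w) = tensor_product.pure D.Om rat_ring w 1"
proof -
  interpret O: rationalized D.Om by unfold_locales
  let ?E = "O.T.TR"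
  define u where "u = tensor_map_left (add_monoid D.Om) (add_monoid rat_ring) (\<lambda>a. D.frm a [])"
  define \<delta> where "\<delta> = tensor_map_left (add_monoid D.Om) (add_monoid rat_ring) (\<lambda>a. D.frm \<one>\<^bsub>A\<^esub> [a])"
  have hd: "abelian_group_hom A D.Om (\<lambda>a. D.frm \<one>\<^bsub>A\<^esub> [a])"
    by (rule additive_mapI) (auto simp: D.d_add A.abelian_group_axioms D.Om.abelian_group_axioms)
  note hu = D.frm_hom[of "[]", simplified]
  note up = tensor_map_left_props[OF QA.T.tensor_product_axioms O.T.tensor_product_axioms hu, folded u_def]
  note dp = tensor_map_left_props[OF QA.T.tensor_product_axioms O.T.tensor_product_axioms hd, folded \<delta>_def]
  have uf: "u (rat_elem A a r) = O.T.pure (D.frm a []) r" if "a \<in> carrier A" for a r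
    using up(2)[OF that, of r] by (simp add: rat_elem_pure rat_ring_simps)
  have df: "\<delta> (rat_elem A a r) = O.T.pure (D.frm \<one>\<^bsub>A\<^esub> [a]) r" if "a \<in> carrier A" for a r
    using dp(2)[OF that, of r] by (simp add: rat_elem_pure rat_ring_simps)
  interpret u: abelian_group_hom AQ ?E u unfolding AQ_eq by (rule up(1))
  interpret \<delta>: abelian_group_hom AQ ?E \<delta> unfolding AQ_eq by (rule dp(1))
  have frac: "\<exists>a\<in>carrier A. \<exists>r. x = rat_elem A a r" if "x \<in> carrier AQ" for x
    using QA.fraction[of x] that unfolding AQ_eq rat_elem_pure by blast
  have pm: "O.T.pure x r \<otimes>\<^bsub>?E\<^esub> O.T.pure y s = O.T.pure (x \<otimes>\<^bsub>D.Om\<^esub> y) (r * s)"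
    if "x \<in> carrier D.Om" "y \<in> carrier D.Om" for x y r s
    using O.T.pure_mult[of x r y s] that by (simp add: rat_ring_simps)
  have padd: "O.T.pure x r \<oplus>\<^bsub>?E\<^esub> O.T.pure y r = O.T.pure (x \<oplus>\<^bsub>D.Om\<^esub> y) r"
    if "x \<in> carrier D.Om" "y \<in> carrier D.Om" for x y r
    using O.T.pure_add_l[of x y r] that by (simp add: rat_ring_simps)
  have pzero: "O.T.pure \<zero>\<^bsub>D.Om\<^esub> r = \<zero>\<^bsub>?E\<^esub>" for r
    using abelian_group_hom.hom_zero[OF O.T.pure_hom_l, of r] by (simp add: rat_ring_simps)
  have pone: "O.T.pure \<one>\<^bsub>D.Om\<^esub> 1 = \<one>\<^bsub>?E\<^esub>" using O.T.pure_one by (simp add: rat_ring_simps)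
  have uhom: "u \<in> ring_hom AQ ?E"
  proof (rule ring_hom_memI)
    fix x y assume x: "x \<in> carrier AQ" and y: "y \<in> carrier AQ"
    obtain a r b s where ab: "a \<in> carrier A" "x = rat_elem A a r" "b \<in> carrier A" "y = rat_elem A b s"
      using frac[OF x] frac[OF y] by blast
    then show "u (x \<otimes>\<^bsub>AQ\<^esub> y) = u x \<otimes>\<^bsub>?E\<^esub> u y"
      by (simp add: rat_elem_mult uf pm D.frm_mult)
  next
    show "u \<one>\<^bsub>AQ\<^esub> = \<one>\<^bsub>?E\<^esub>" using uf[of "\<one>\<^bsub>A\<^esub>" 1] by (simp add: rat_elem_one D.frm_one pone)
  qed auto
  obtain \<Psi> where \<Psi>: "\<Psi> \<in> ring_hom DQ.Om ?E"
    and \<Psi>f: "\<And>b bs. b \<in> carrier AQ \<Longrightarrow> set bs \<subseteq> carrier AQ \<Longrightarrow>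
      \<Psi> (DQ.frm b bs) = u b \<otimes>\<^bsub>?E\<^esub> foldr (\<otimes>\<^bsub>?E\<^esub>) (map \<delta> bs) \<one>\<^bsub>?E\<^esub>"
  proof (rule DQ.de_rham_universal[OF O.T.ring_TR uhom, of \<delta>])
    fix x y assume x: "x \<in> carrier AQ" and y: "y \<in> carrier AQ"
    obtain a r b s where ab: "a \<in> carrier A" "x = rat_elem A a r" "b \<in> carrier A" "y = rat_elem A b s"
      using frac[OF x] frac[OF y] by blast
    then show "u x \<otimes>\<^bsub>?E\<^esub> \<delta> y = \<delta> y \<otimes>\<^bsub>?E\<^esub> u x"
      by (simp add: uf df pm D.frm_mult mult.commute)
    show "\<delta> (x \<otimes>\<^bsub>AQ\<^esub> y) = u x \<otimes>\<^bsub>?E\<^esub> \<delta> y \<oplus>\<^bsub>?E\<^esub> u y \<otimes>\<^bsub>?E\<^esub> \<delta> x"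
      using ab by (simp add: rat_elem_mult uf df pm D.frm_mult padd D.d_mult mult.commute)
  next
    fix x assume "x \<in> carrier (rationalization A0)"
    then obtain b r where b: "b \<in> carrier A0" "x = rat_elem A0 b r"
      using Q0.fraction[of x] unfolding AQ_eq rat_elem_pure by blast
    then show "\<delta> (iQ x) = \<zero>\<^bsub>?E\<^esub>"
      using ring_hom_closed[OF i b(1)] by (simp add: iQ_pure df D.d_const pzero)
  next
    fix x assume x: "x \<in> carrier AQ"
    obtain a r where "a \<in> carrier A" "x = rat_elem A a r" using frac[OF x] by blast
    then show "\<delta> x \<otimes>\<^bsub>?E\<^esub> \<delta> x = \<zero>\<^bsub>?E\<^esub>"
      by (simp add: df pm D.frm_mult D.d_d_same pzero)
  qed (auto simp: that)
  interpret E: ring ?E by (rule O.T.ring_TR)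
  have fold: "foldr (\<otimes>\<^bsub>?E\<^esub>) (map \<delta> (map (\<lambda>a. rat_elem A a 1) bs)) \<one>\<^bsub>?E\<^esub> = O.T.pure (D.frm \<one>\<^bsub>A\<^esub> bs) 1"
    if "set bs \<subseteq> carrier A" for bs
    using that by (induction bs) (simp_all add: D.frm_one pone df pm D.frm_mult)
  have "\<Psi> (to_rat w) = O.T.pure w 1" if "w \<in> carrier D.Om" for w
    using that
  proof (induction rule: D.forms_induct)
    case (frm b bs)
    have "set (map (\<lambda>a. rat_elem A a 1) bs) \<subseteq> carrier AQ" using frm by auto
    then show ?case using frm fold[of bs]
      by (simp add: to_rat_eq R.U_frm \<Psi>f uf pm D.frm_mult del: map_map)
  next
    case (add x y)
    then show ?case by (simp add: to_rat_eq padd ring_hom_add[OF \<Psi>])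
  qed
  with \<Psi> show thesis using that by blast
qed

theorem to_rat_inj:
  assumes tf: "\<And>n x. n > 0 \<Longrightarrow> x \<in> carrier D.Om \<Longrightarrow> [(n::nat)] \<cdot>\<^bsub>D.Om\<^esub> x = \<zero>\<^bsub>D.Om\<^esub> \<Longrightarrow> x = \<zero>\<^bsub>D.Om\<^esub>"
    and w: "w \<in> carrier D.Om" "w' \<in> carrier D.Om" "to_rat w = to_rat w'"
  shows "w = w'"
proof -
  interpret O: rationalized D.Om by unfold_locales
  obtain \<Psi> where \<Psi>: "\<Psi> \<in> ring_hom DQ.Om (tensor_ring D.Om rat_ring)"
    "\<And>w. w \<in> carrier D.Om \<Longrightarrow> \<Psi> (to_rat w) = O.T.pure w 1"
    by (rule rational_to_tensor) blast
  let ?v = "w \<ominus>\<^bsub>D.Om\<^esub> w'"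
  have v: "?v \<in> carrier D.Om" using w by simp
  have "O.T.pure ?v 1 = O.T.pure w 1 \<ominus>\<^bsub>O.T.TR\<^esub> O.T.pure w' 1" by (rule O.pure_minus[OF w(1,2)])
  also have "\<dots> = \<zero>\<^bsub>O.T.TR\<^esub>"
    using w \<Psi>(2)[of w] \<Psi>(2)[of w'] O.pure_closed[of w' 1] by (simp add: O.T.TR.r_right_minus_eq)
  finally obtain n :: nat where "n > 0" "[n] \<cdot>\<^bsub>D.Om\<^esub> ?v = \<zero>\<^bsub>D.Om\<^esub>" using O.pure_one_zero[OF v] by blast
  then have "?v = \<zero>\<^bsub>D.Om\<^esub>" using tf v by blast
  then show ?thesis using w by (simp add: D.Om.r_right_minus_eq)
qed

end

section \<open>The normalized Frobenius\<close>

lemma (in de_rham_complex) d_power: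
  assumes "r \<in> carrier B"
  shows "frm \<one>\<^bsub>B\<^esub> [r [^]\<^bsub>B\<^esub> (n::nat)] = [n] \<cdot>\<^bsub>Om\<^esub> frm (r [^]\<^bsub>B\<^esub> (n - 1)) [r]"
proof (induction n)
  case (Suc n)
  have c: "r [^]\<^bsub>B\<^esub> n \<in> carrier B" using assms by simp
  have "frm \<one>\<^bsub>B\<^esub> [r [^]\<^bsub>B\<^esub> Suc n] = frm (r [^]\<^bsub>B\<^esub> n) [r] \<oplus>\<^bsub>Om\<^esub> frm r [r [^]\<^bsub>B\<^esub> n]"
    using assms by (simp add: d_mult)
  also have "frm r [r [^]\<^bsub>B\<^esub> n] = frm r [] \<otimes>\<^bsub>Om\<^esub> frm \<one>\<^bsub>B\<^esub> [r [^]\<^bsub>B\<^esub> n]"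
    using assms by (simp add: frm_mult)
  also have "\<dots> = [n] \<cdot>\<^bsub>Om\<^esub> (frm r [] \<otimes>\<^bsub>Om\<^esub> frm (r [^]\<^bsub>B\<^esub> (n - 1)) [r])"
    unfolding Suc using assms by (simp add: Om.add_pow_rdistr)
  also have "\<dots> = [n] \<cdot>\<^bsub>Om\<^esub> frm (r [^]\<^bsub>B\<^esub> n) [r]"
    using assms by (cases n) (simp_all add: frm_mult B.m_comm)
  finally show ?case using assms by (simp add: Om.a_comm)
qed (simp add: d_one)

locale frobenius_forms = de_rham_complex R0 R f
  for R0 :: "('a, 'c) ring_scheme" and R :: "('r, 'd) ring_scheme" and f +
  fixes p :: nat and \<phi> :: "'r \<Rightarrow> 'r"
  assumes p: "p > 0"
    and tf: "\<And>n x. n > 0 \<Longrightarrow> x \<in> carrier Om \<Longrightarrow> [(n::nat)] \<cdot>\<^bsub>Om\<^esub> x = \<zero>\<^bsub>Om\<^esub> \<Longrightarrow> x = \<zero>\<^bsub>Om\<^esub>"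
    and \<phi>_lift: "frobenius_lift p R \<phi>"
    and \<phi>_base: "\<And>a. a \<in> carrier R0 \<Longrightarrow> \<exists>b\<in>carrier R0. \<phi> (f a) = f b"
begin

lemma \<phi>: "\<phi> \<in> ring_hom R R" using \<phi>_lift by (simp add: frobenius_lift_def)

lemma \<phi>_closed: "r \<in> carrier R \<Longrightarrow> \<phi> r \<in> carrier R" using ring_hom_closed[OF \<phi>] .

lemma \<phi>_power:
  assumes "r \<in> carrier R"
  shows "\<exists>s\<in>carrier R. \<phi> r = r [^]\<^bsub>R\<^esub> p \<oplus>\<^bsub>R\<^esub> [p] \<cdot>\<^bsub>R\<^esub> s"
proof -
  obtain s where s: "s \<in> carrier R" "\<phi> r \<ominus>\<^bsub>R\<^esub> r [^]\<^bsub>R\<^esub> p = [p] \<cdot>\<^bsub>R\<^esub> s"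
    using \<phi>_lift assms by (auto simp: frobenius_lift_def)
  have "\<phi> r = r [^]\<^bsub>R\<^esub> p \<oplus>\<^bsub>R\<^esub> (\<phi> r \<ominus>\<^bsub>R\<^esub> r [^]\<^bsub>R\<^esub> p)"
    using assms \<phi>_closed[OF assms] by (simp add: a_minus_def B.a_lcomm B.r_neg)
  then show ?thesis using s by auto
qed

lemma cancel:
  assumes "n > 0" "x \<in> carrier Om" "y \<in> carrier Om" "[(n::nat)] \<cdot>\<^bsub>Om\<^esub> x = [n] \<cdot>\<^bsub>Om\<^esub> y"
  shows "x = y"
proof -
  interpret h: abelian_group_hom Om Om "\<lambda>x. [n] \<cdot>\<^bsub>Om\<^esub> x"
    by (rule additive_mapI) (auto simp: Om.add.nat_pow_distrib Om.abelian_group_axioms)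
  have "[n] \<cdot>\<^bsub>Om\<^esub> (x \<ominus>\<^bsub>Om\<^esub> y) = \<zero>\<^bsub>Om\<^esub>" using assms by (simp add: h.hom_minus Om.r_right_minus_eq)
  then have "x \<ominus>\<^bsub>Om\<^esub> y = \<zero>\<^bsub>Om\<^esub>" using tf assms by blast
  then show ?thesis using assms by (simp add: Om.r_right_minus_eq)
qed

text \<open>If \<open>\<phi>(r) = r\<^sup>p + ps\<close>, then \<open>d\<phi>(r) = p (r\<^bsup>p-1\<^esup> dr + ds)\<close>.  As forms have no torsion, the factor in parentheses
  is a derivation along \<open>\<phi>\<close> with values of square zero, and the universal property turns it into the normalized
  Frobenius.  That this is a homomorphism of rings and satisfies \<open>d N = p N d\<close> is all that the congruences need.\<close>

lemma normalized_frobenius_props: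
  defines "N \<equiv> normalized_frobenius p R0 R f \<phi>"
  shows "N \<in> ring_hom Om Om"
    and "\<And>r. r \<in> carrier R \<Longrightarrow> N (frm r []) = frm (\<phi> r) []"
    and "\<And>x. x \<in> carrier Om \<Longrightarrow> d (N x) = [p] \<cdot>\<^bsub>Om\<^esub> N (d x)"
proof -
  obtain s where s: "\<And>r. r \<in> carrier R \<Longrightarrow> s r \<in> carrier R"
    and \<phi>s: "\<And>r. r \<in> carrier R \<Longrightarrow> \<phi> r = r [^]\<^bsub>R\<^esub> p \<oplus>\<^bsub>R\<^esub> [p] \<cdot>\<^bsub>R\<^esub> s r"
    using \<phi>_power by metis
  define D where "D r = frm (r [^]\<^bsub>R\<^esub> (p - 1)) [r] \<oplus>\<^bsub>Om\<^esub> frm \<one>\<^bsub>R\<^esub> [s r]" for r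
  have Dc [simp]: "D r \<in> carrier Om" if "r \<in> carrier R" for r using that s by (simp add: D_def)
  have Ddeg: "D r \<in> degree_part Om 1" if "r \<in> carrier R" for r
    unfolding D_def using that s frm_degree[of "r [^]\<^bsub>R\<^esub> (p - 1)" "[r]"] frm_degree[of "\<one>\<^bsub>R\<^esub>" "[s r]"]
    by (intro degree_add) auto
  interpret dh: abelian_group_hom R Om "\<lambda>a. frm \<one>\<^bsub>R\<^esub> [a]"
    by (rule additive_mapI) (auto simp: d_add B.abelian_group_axioms Om.abelian_group_axioms)
  have pD: "[p] \<cdot>\<^bsub>Om\<^esub> D r = frm \<one>\<^bsub>R\<^esub> [\<phi> r]" if r: "r \<in> carrier R" for r
    using r s dh.hom_add_pow[of "s r" p]
    by (simp add: D_def \<phi>s d_add d_power Om.add.nat_pow_distrib)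
  have uh: "(\<lambda>r. frm (\<phi> r) []) \<in> ring_hom R Om"
    by (rule ring_hom_memI) (auto simp: \<phi>_closed frm_mult frm_add frm_one
        ring_hom_mult[OF \<phi>] ring_hom_add[OF \<phi>] ring_hom_one[OF \<phi>])
  obtain \<Psi> where \<Psi>: "\<Psi> \<in> ring_hom Om Om"
    and \<Psi>f: "\<And>b bs. b \<in> carrier R \<Longrightarrow> set bs \<subseteq> carrier R \<Longrightarrow>
      \<Psi> (frm b bs) = frm (\<phi> b) [] \<otimes>\<^bsub>Om\<^esub> foldr (\<otimes>\<^bsub>Om\<^esub>) (map D bs) \<one>\<^bsub>Om\<^esub>"
  proof (rule de_rham_universal[OF ring_Om uh, of D])
    fix a b assume ab: "a \<in> carrier R" "b \<in> carrier R"
    show "frm (\<phi> a) [] \<otimes>\<^bsub>Om\<^esub> D b = D b \<otimes>\<^bsub>Om\<^esub> frm (\<phi> a) []"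
      using ab by (intro frm_central) (auto simp: \<phi>_closed)
    show "D (a \<oplus>\<^bsub>R\<^esub> b) = D a \<oplus>\<^bsub>Om\<^esub> D b"
      by (rule cancel[OF p])
        (use ab in \<open>auto simp: pD Om.add.nat_pow_distrib d_add ring_hom_add[OF \<phi>] \<phi>_closed\<close>)
    show "D (a \<otimes>\<^bsub>R\<^esub> b) = frm (\<phi> a) [] \<otimes>\<^bsub>Om\<^esub> D b \<oplus>\<^bsub>Om\<^esub> frm (\<phi> b) [] \<otimes>\<^bsub>Om\<^esub> D a"
      by (rule cancel[OF p])
        (use ab in \<open>auto simp: pD Om.add.nat_pow_distrib d_mult ring_hom_mult[OF \<phi>] \<phi>_closed frm_mult
          simp flip: Om.add_pow_rdistr\<close>)
  next
    fix a assume a: "a \<in> carrier R0"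
    then obtain b where "b \<in> carrier R0" "\<phi> (f a) = f b" using \<phi>_base by blast
    then have "[p] \<cdot>\<^bsub>Om\<^esub> D (f a) = \<zero>\<^bsub>Om\<^esub>" using a by (simp add: pD g_closed d_const)
    then show "D (f a) = \<zero>\<^bsub>Om\<^esub>" using tf[OF p] a by (simp add: g_closed)
  next
    fix b assume b: "b \<in> carrier R"
    have "[p] \<cdot>\<^bsub>Om\<^esub> ([p] \<cdot>\<^bsub>Om\<^esub> (D b \<otimes>\<^bsub>Om\<^esub> D b)) = ([p] \<cdot>\<^bsub>Om\<^esub> D b) \<otimes>\<^bsub>Om\<^esub> ([p] \<cdot>\<^bsub>Om\<^esub> D b)"
      using b by (simp add: Om.add_pow_ldistr Om.add_pow_rdistr)
    also have "\<dots> = \<zero>\<^bsub>Om\<^esub>" using b by (simp add: pD d_square \<phi>_closed)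
    finally show "D b \<otimes>\<^bsub>Om\<^esub> D b = \<zero>\<^bsub>Om\<^esub>" using tf[OF p] b by simp
  qed (auto intro: that)
  interpret \<Psi>: ring_hom_ring Om Om \<Psi> by (rule ring_hom_ringI2[OF ring_Om ring_Om \<Psi>])
  have fc [simp]: "foldr (\<otimes>\<^bsub>Om\<^esub>) (map D bs) \<one>\<^bsub>Om\<^esub> \<in> carrier Om" if "set bs \<subseteq> carrier R" for bs
    using that by (induction bs) auto
  have fold: "[(p ^ length bs)] \<cdot>\<^bsub>Om\<^esub> foldr (\<otimes>\<^bsub>Om\<^esub>) (map D bs) \<one>\<^bsub>Om\<^esub> = frm \<one>\<^bsub>R\<^esub> (map \<phi> bs)"
    if "set bs \<subseteq> carrier R" for bs
    using that
  proof (induction bs)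
    case (Cons b bs)
    have cl: "set (map \<phi> bs) \<subseteq> carrier R" using Cons.prems by (auto simp: \<phi>_closed)
    let ?P = "foldr (\<otimes>\<^bsub>Om\<^esub>) (map D bs) \<one>\<^bsub>Om\<^esub>"
    have P: "?P \<in> carrier Om" using Cons.prems by simp
    have "[(p ^ length (b # bs))] \<cdot>\<^bsub>Om\<^esub> (D b \<otimes>\<^bsub>Om\<^esub> ?P)
        = [p] \<cdot>\<^bsub>Om\<^esub> ([(p ^ length bs)] \<cdot>\<^bsub>Om\<^esub> (D b \<otimes>\<^bsub>Om\<^esub> ?P))"
      using Om.add.nat_pow_pow[of "D b \<otimes>\<^bsub>Om\<^esub> ?P" p "p ^ length bs"] Cons.prems P
      by (simp only: length_Cons power_Suc2) simp
    also have "\<dots> = ([p] \<cdot>\<^bsub>Om\<^esub> D b) \<otimes>\<^bsub>Om\<^esub> ([(p ^ length bs)] \<cdot>\<^bsub>Om\<^esub> ?P)"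
      using Om.add_pow_ldistr[of "D b" "[(p ^ length bs)] \<cdot>\<^bsub>Om\<^esub> ?P" p]
        Om.add_pow_rdistr[of "D b" ?P "p ^ length bs"] Cons.prems P by simp
    also have "\<dots> = frm \<one>\<^bsub>R\<^esub> (map \<phi> (b # bs))"
      using Cons cl by (simp add: pD frm_mult \<phi>_closed)
    finally show ?case by simp
  qed (simp add: frm_one)
  have \<Psi>p: "[(p ^ length bs)] \<cdot>\<^bsub>Om\<^esub> \<Psi> (frm b bs) = frm (\<phi> b) (map \<phi> bs)"
    if b: "b \<in> carrier R" "set bs \<subseteq> carrier R" for b bs
  proof -
    have cl: "set (map \<phi> bs) \<subseteq> carrier R" using b by (auto simp: \<phi>_closed)
    have "[(p ^ length bs)] \<cdot>\<^bsub>Om\<^esub> \<Psi> (frm b bs)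
        = frm (\<phi> b) [] \<otimes>\<^bsub>Om\<^esub> ([(p ^ length bs)] \<cdot>\<^bsub>Om\<^esub> foldr (\<otimes>\<^bsub>Om\<^esub>) (map D bs) \<one>\<^bsub>Om\<^esub>)"
      using b by (simp add: \<Psi>f Om.add_pow_rdistr \<phi>_closed)
    then show ?thesis using b cl by (simp add: fold frm_mult \<phi>_closed)
  qed
  have fdeg: "foldr (\<otimes>\<^bsub>Om\<^esub>) (map D bs) \<one>\<^bsub>Om\<^esub> \<in> degree_part Om (length bs)"
    if "set bs \<subseteq> carrier R" for bs
    using that
  proof (induction bs)
    case Nil
    then show ?case using frm_degree[of "\<one>\<^bsub>R\<^esub>" "[]"] by (simp add: frm_one)
  next
    case (Cons b bs)
    then show ?case using degree_mult[OF Ddeg[of b], of "foldr (\<otimes>\<^bsub>Om\<^esub>) (map D bs) \<one>\<^bsub>Om\<^esub>" "length bs"] by simp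
  qed
  have \<Psi>deg: "\<Psi> x \<in> degree_part Om q" if "x \<in> degree_part Om q" for x q
    using that
  proof (induction rule: degree_induct)
    case (frm b bs)
    then show ?case
      using degree_mult[OF frm_degree[of "\<phi> b" "[]"] fdeg[of bs]] by (simp add: \<Psi>f \<phi>_closed)
  qed (simp add: degree_closed degree_add)
  define \<Phi> where "\<Phi> = restrict \<Psi> (carrier Om)"
  have N: "N = \<Phi>"
    unfolding N_def normalized_frobenius_def
  proof (rule the_equality)
    have "\<Phi> ` degree_part Om q \<subseteq> degree_part Om q" for q
      using \<Psi>deg degree_closed by (auto simp: \<Phi>_def)
    moreover have "\<Phi> \<in> hom (add_monoid Om) (add_monoid Om)" by (rule homI) (simp_all add: \<Phi>_def)
    moreover have "[(p ^ length rs)] \<cdot>\<^bsub>Om\<^esub> \<Phi> (frm r rs) = frm (\<phi> r) (map \<phi> rs)"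
      if "r \<in> carrier R" "rs \<in> lists (carrier R)" for r rs
    proof -
      have rs: "set rs \<subseteq> carrier R" using that(2) by auto
      show ?thesis using \<Psi>p[OF that(1) rs] frm_closed[OF that(1) rs] by (simp add: \<Phi>_def)
    qed
    moreover have "\<Phi> \<in> extensional (carrier Om)" by (simp add: \<Phi>_def)
    ultimately show "\<Phi> \<in> extensional (carrier Om) \<and> \<Phi> \<in> hom (add_monoid Om) (add_monoid Om) \<and>
      (\<forall>q. \<Phi> ` degree_part Om q \<subseteq> degree_part Om q) \<and>
      (\<forall>r\<in>carrier R. \<forall>rs\<in>lists (carrier R).
        [(p ^ length rs)] \<cdot>\<^bsub>Om\<^esub> \<Phi> (frm r rs) = frm (\<phi> r) (map \<phi> rs))" by blast
  next
    fix \<Phi>' assume "\<Phi>' \<in> extensional (carrier Om) \<and> \<Phi>' \<in> hom (add_monoid Om) (add_monoid Om) \<and>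
      (\<forall>q. \<Phi>' ` degree_part Om q \<subseteq> degree_part Om q) \<and>
      (\<forall>r\<in>carrier R. \<forall>rs\<in>lists (carrier R).
        [(p ^ length rs)] \<cdot>\<^bsub>Om\<^esub> \<Phi>' (frm r rs) = frm (\<phi> r) (map \<phi> rs))"
    then have ext: "\<Phi>' \<in> extensional (carrier Om)" and hm: "\<Phi>' \<in> hom (add_monoid Om) (add_monoid Om)"
      and pf: "\<And>r rs. r \<in> carrier R \<Longrightarrow> rs \<in> lists (carrier R) \<Longrightarrow>
        [(p ^ length rs)] \<cdot>\<^bsub>Om\<^esub> \<Phi>' (frm r rs) = frm (\<phi> r) (map \<phi> rs)" by blast+
    have cl: "\<Phi>' x \<in> carrier Om" if "x \<in> carrier Om" for x using hm that by (auto simp: hom_def)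
    have "\<Phi>' x = \<Psi> x" if "x \<in> carrier Om" for x
      using that
    proof (induction rule: forms_induct)
      case (frm b bs)
      have "bs \<in> lists (carrier R)" using frm by auto
      then show ?case
        using cancel[of "p ^ length bs" "\<Phi>' (frm b bs)" "\<Psi> (frm b bs)"] p frm cl pf[of b bs] \<Psi>p[of b bs]
        by simp
    next
      case (add x y)
      then show ?case using hm by (simp add: hom_def)
    qed
    then show "\<Phi>' = \<Phi>" using ext by (intro extensionalityI[of _ "carrier Om"]) (auto simp: \<Phi>_def)
  qed
  show "N \<in> ring_hom Om Om"
    unfolding N \<Phi>_def by (rule ring_hom_memI) auto
  show "N (frm r []) = frm (\<phi> r) []" if "r \<in> carrier R" for r
    using that \<Psi>f[of r "[]"] by (simp add: N \<Phi>_def \<phi>_closed)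
  have "d (\<Psi> x) = [p] \<cdot>\<^bsub>Om\<^esub> \<Psi> (d x)" if "x \<in> carrier Om" for x
    using that
  proof (induction rule: forms_induct)
    case (frm b bs)
    have cl: "set (map \<phi> bs) \<subseteq> carrier R" using frm by (auto simp: \<phi>_closed)
    have dx: "frm \<one>\<^bsub>R\<^esub> (b # bs) \<in> carrier Om" using frm by simp
    have "[(p ^ length bs)] \<cdot>\<^bsub>Om\<^esub> d (\<Psi> (frm b bs)) = d (frm (\<phi> b) (map \<phi> bs))"
      using frm d.hom_add_pow[of "\<Psi> (frm b bs)" "p ^ length bs"] by (simp add: \<Psi>p)
    also have "\<dots> = [(p ^ length (b # bs))] \<cdot>\<^bsub>Om\<^esub> \<Psi> (frm \<one>\<^bsub>R\<^esub> (b # bs))"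
      using frm cl \<Psi>p[of "\<one>\<^bsub>R\<^esub>" "b # bs"] by (simp add: d_frm \<phi>_closed ring_hom_one[OF \<phi>])
    also have "\<dots> = [(p ^ length bs)] \<cdot>\<^bsub>Om\<^esub> ([p] \<cdot>\<^bsub>Om\<^esub> \<Psi> (d (frm b bs)))"
      using frm dx by (simp add: d_frm Om.add.nat_pow_pow)
    finally show ?case
      using cancel[of "p ^ length bs" "d (\<Psi> (frm b bs))" "[p] \<cdot>\<^bsub>Om\<^esub> \<Psi> (d (frm b bs))"] p frm by simp
  next
    case (add x y)
    then show ?case by (simp add: Om.add.nat_pow_distrib)
  qed
  then show "d (N x) = [p] \<cdot>\<^bsub>Om\<^esub> N (d x)" if "x \<in> carrier Om" for x
    using that by (simp add: N \<Phi>_def)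
qed

end

section \<open>The Dwork congruences\<close>

lemma (in cring) power_sum_expansion:
  assumes "y \<in> carrier R" "t \<in> carrier R"
  shows "\<exists>e\<in>carrier R. (y \<oplus> t) [^] (n::nat) = y [^] n \<oplus> [n] \<cdot> (y [^] (n - 1) \<otimes> t) \<oplus> t \<otimes> t \<otimes> e"
proof (induction n)
  case 0
  show ?case by (rule bexI[of _ \<zero>]) (use assms in auto)
next
  case (Suc n)
  then obtain e where e: "e \<in> carrier R"
    "(y \<oplus> t) [^] n = y [^] n \<oplus> [n] \<cdot> (y [^] (n - 1) \<otimes> t) \<oplus> t \<otimes> t \<otimes> e" by blast
  let ?q = "y [^] (n - 1)"
  have c: "?q \<in> carrier R" "y [^] n \<in> carrier R" "[n] \<cdot> ?q \<in> carrier R" using assms by auto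
  have 1: "[n] \<cdot> (?q \<otimes> t) = ([n] \<cdot> ?q) \<otimes> t" using assms by (simp add: add_pow_ldistr)
  have 2: "([n] \<cdot> ?q) \<otimes> y = [n] \<cdot> (y [^] n)"
    using add_pow_ldistr[of ?q y n] assms by (cases n) auto
  have "(y \<oplus> t) [^] Suc n = (y [^] n \<oplus> ([n] \<cdot> ?q) \<otimes> t \<oplus> t \<otimes> t \<otimes> e) \<otimes> (y \<oplus> t)"
    using e 1 by simp
  also have "\<dots> = y [^] n \<otimes> y \<oplus> (([n] \<cdot> ?q) \<otimes> y \<otimes> t \<oplus> y [^] n \<otimes> t)
      \<oplus> t \<otimes> t \<otimes> ([n] \<cdot> ?q \<oplus> e \<otimes> y \<oplus> e \<otimes> t)"
    using assms c e(1) by algebra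
  also have "([n] \<cdot> ?q) \<otimes> y \<otimes> t \<oplus> y [^] n \<otimes> t = [(Suc n)] \<cdot> (y [^] n \<otimes> t)"
    unfolding 2 using assms by (simp add: add_pow_ldistr)
  finally have "(y \<oplus> t) [^] Suc n = y [^] Suc n \<oplus> [(Suc n)] \<cdot> (y [^] (Suc n - 1) \<otimes> t)
      \<oplus> t \<otimes> t \<otimes> ([n] \<cdot> ?q \<oplus> e \<otimes> y \<oplus> e \<otimes> t)" by simp
  moreover have "[n] \<cdot> ?q \<oplus> e \<otimes> y \<oplus> e \<otimes> t \<in> carrier R" using assms c e by simp
  ultimately show ?case by blast
qed

text \<open>In the expansion of the power, the linear term has the factor \<open>p\<close>, and the others have the square of \<open>p\<^bsup>m+1\<^esup>\<close>.\<close>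

lemma (in cring) power_congruence:
  assumes "y \<in> carrier R" "z \<in> carrier R"
  shows "\<exists>z'\<in>carrier R. (y \<oplus> [(p ^ Suc m)] \<cdot> z) [^] (p::nat) = y [^] p \<oplus> [(p ^ Suc (Suc m))] \<cdot> z'"
proof -
  let ?P = "p ^ Suc m"
  let ?t = "[?P] \<cdot> z"
  obtain e where e: "e \<in> carrier R"
    "(y \<oplus> ?t) [^] p = y [^] p \<oplus> [p] \<cdot> (y [^] (p - 1) \<otimes> ?t) \<oplus> ?t \<otimes> ?t \<otimes> e"
    using power_sum_expansion[of y ?t p] assms by auto
  have pp: "[a] \<cdot> ([b] \<cdot> x) = [(a * b)] \<cdot> x" if "x \<in> carrier R" for a b :: nat and x
    using add.nat_pow_pow[OF that, of a b] by (simp add: mult.commute)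
  let ?q = "y [^] (p - 1)"
  have c: "?q \<in> carrier R" "z \<otimes> z \<otimes> e \<in> carrier R" using assms e by auto
  have 1: "[p] \<cdot> (?q \<otimes> ?t) = [(p ^ Suc (Suc m))] \<cdot> (?q \<otimes> z)"
    using add_pow_rdistr[of ?q z ?P] assms c pp[of "?q \<otimes> z" p ?P] by simp
  have "?t \<otimes> ?t \<otimes> e = [(?P * ?P)] \<cdot> (z \<otimes> z \<otimes> e)"
    using assms e pp by (simp add: add_pow_ldistr add_pow_rdistr)
  also have "?P * ?P = p ^ Suc (Suc m) * p ^ m" by simp
  also have "[(p ^ Suc (Suc m) * p ^ m)] \<cdot> (z \<otimes> z \<otimes> e) = [(p ^ Suc (Suc m))] \<cdot> ([(p ^ m)] \<cdot> (z \<otimes> z \<otimes> e))"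
    using pp[OF c(2)] by simp
  finally have 2: "?t \<otimes> ?t \<otimes> e = [(p ^ Suc (Suc m))] \<cdot> ([(p ^ m)] \<cdot> (z \<otimes> z \<otimes> e))" .
  have "(y \<oplus> ?t) [^] p = y [^] p \<oplus> [(p ^ Suc (Suc m))] \<cdot> (?q \<otimes> z \<oplus> [(p ^ m)] \<cdot> (z \<otimes> z \<otimes> e))"
    unfolding e(2) 1 2 using assms c by (simp add: add.nat_pow_distrib a_assoc del: power_Suc)
  moreover have "?q \<otimes> z \<oplus> [(p ^ m)] \<cdot> (z \<otimes> z \<otimes> e) \<in> carrier R" using assms c by simp
  ultimately show ?thesis by blast
qed

context frobenius_forms
begin

abbreviation N where "N \<equiv> normalized_frobenius p R0 R f \<phi>"

sublocale N: ring_hom_ring "de_rham R0 R f" "de_rham R0 R f" "normalized_frobenius p R0 R f \<phi>"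
  by (rule ring_hom_ringI2[OF ring_Om ring_Om normalized_frobenius_props(1)])

lemma pow_pow: "x \<in> carrier Om \<Longrightarrow> [a] \<cdot>\<^bsub>Om\<^esub> ([b] \<cdot>\<^bsub>Om\<^esub> x) = [(a * b :: nat)] \<cdot>\<^bsub>Om\<^esub> x"
  using Om.add.nat_pow_pow[of x a b] by (simp add: mult.commute)

definition exact_mod :: "nat \<Rightarrow> ('r list \<Rightarrow> 'r) set set" where
  "exact_mod m = {([m] \<cdot>\<^bsub>Om\<^esub> \<alpha>) \<oplus>\<^bsub>Om\<^esub> d \<beta> | \<alpha> \<beta>. \<alpha> \<in> carrier Om \<and> \<beta> \<in> carrier Om}"

lemma exact_modI: "\<alpha> \<in> carrier Om \<Longrightarrow> \<beta> \<in> carrier Om \<Longrightarrow> ([m] \<cdot>\<^bsub>Om\<^esub> \<alpha>) \<oplus>\<^bsub>Om\<^esub> d \<beta> \<in> exact_mod m"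
  by (auto simp: exact_mod_def)

lemma exact_mod_multiple: "\<alpha> \<in> carrier Om \<Longrightarrow> [m] \<cdot>\<^bsub>Om\<^esub> \<alpha> \<in> exact_mod m"
  using exact_modI[of \<alpha> "\<zero>\<^bsub>Om\<^esub>" m] by simp

lemma exact_mod_d: "\<beta> \<in> carrier Om \<Longrightarrow> d \<beta> \<in> exact_mod m"
  using exact_modI[of "\<zero>\<^bsub>Om\<^esub>" \<beta> m] by simp

lemma exact_mod_add:
  assumes "x \<in> exact_mod m" "y \<in> exact_mod m"
  shows "x \<oplus>\<^bsub>Om\<^esub> y \<in> exact_mod m"
proof -
  obtain a b a' b' where ab: "a \<in> carrier Om" "b \<in> carrier Om" "x = ([m] \<cdot>\<^bsub>Om\<^esub> a) \<oplus>\<^bsub>Om\<^esub> d b"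
    "a' \<in> carrier Om" "b' \<in> carrier Om" "y = ([m] \<cdot>\<^bsub>Om\<^esub> a') \<oplus>\<^bsub>Om\<^esub> d b'"
    using assms by (auto simp: exact_mod_def)
  then have "x \<oplus>\<^bsub>Om\<^esub> y = ([m] \<cdot>\<^bsub>Om\<^esub> (a \<oplus>\<^bsub>Om\<^esub> a')) \<oplus>\<^bsub>Om\<^esub> d (b \<oplus>\<^bsub>Om\<^esub> b')"
    by (simp add: Om.add.nat_pow_distrib Om.a_ac)
  then show ?thesis using ab exact_modI[of "a \<oplus>\<^bsub>Om\<^esub> a'" "b \<oplus>\<^bsub>Om\<^esub> b'" m] by simp
qed

lemma exact_mod_uminus:
  assumes "x \<in> exact_mod m"
  shows "\<ominus>\<^bsub>Om\<^esub> x \<in> exact_mod m"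
proof -
  obtain a b where ab: "a \<in> carrier Om" "b \<in> carrier Om" "x = ([m] \<cdot>\<^bsub>Om\<^esub> a) \<oplus>\<^bsub>Om\<^esub> d b"
    using assms by (auto simp: exact_mod_def)
  then have "\<ominus>\<^bsub>Om\<^esub> x = ([m] \<cdot>\<^bsub>Om\<^esub> (\<ominus>\<^bsub>Om\<^esub> a)) \<oplus>\<^bsub>Om\<^esub> d (\<ominus>\<^bsub>Om\<^esub> b)"
    by (simp add: Om.minus_add Om.add.nat_pow_inv)
  then show ?thesis using ab exact_modI[of "\<ominus>\<^bsub>Om\<^esub> a" "\<ominus>\<^bsub>Om\<^esub> b" m] by simp
qed

definition dwork :: "nat \<Rightarrow> (nat \<Rightarrow> ('r list \<Rightarrow> 'r) set) \<Rightarrow> bool" where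
  "dwork n \<omega> \<longleftrightarrow> (\<forall>k\<le>n. \<omega> k \<in> carrier Om) \<and>
    (\<forall>k<n. N (\<omega> k) \<ominus>\<^bsub>Om\<^esub> \<omega> (Suc k) \<in> exact_mod (p ^ Suc k))"

lemma dwork_closed: "dwork n \<omega> \<Longrightarrow> k \<le> n \<Longrightarrow> \<omega> k \<in> carrier Om"
  by (simp add: dwork_def)

lemma dwork_cong: "dwork n \<omega> \<Longrightarrow> (\<And>k. k \<le> n \<Longrightarrow> \<omega> k = \<omega>' k) \<Longrightarrow> dwork n \<omega>'"
  by (auto simp: dwork_def)

lemma dwork_one: "dwork n (\<lambda>k. \<one>\<^bsub>Om\<^esub>)"
proof -
  have "\<one>\<^bsub>Om\<^esub> \<ominus>\<^bsub>Om\<^esub> \<one>\<^bsub>Om\<^esub> \<in> exact_mod m" for m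
    using exact_mod_d[of "\<zero>\<^bsub>Om\<^esub>" m] by (simp add: a_minus_def Om.r_neg)
  then show ?thesis by (simp add: dwork_def)
qed

lemma dwork_add:
  assumes "dwork n x" "dwork n y"
  shows "dwork n (\<lambda>k. x k \<oplus>\<^bsub>Om\<^esub> y k)"
  unfolding dwork_def
proof (intro conjI allI impI)
  fix k assume k: "k < n"
  then have c: "x k \<in> carrier Om" "y k \<in> carrier Om" "x (Suc k) \<in> carrier Om" "y (Suc k) \<in> carrier Om"
    using assms dwork_closed by auto
  have "N (x k \<oplus>\<^bsub>Om\<^esub> y k) \<ominus>\<^bsub>Om\<^esub> (x (Suc k) \<oplus>\<^bsub>Om\<^esub> y (Suc k))
      = (N (x k) \<ominus>\<^bsub>Om\<^esub> x (Suc k)) \<oplus>\<^bsub>Om\<^esub> (N (y k) \<ominus>\<^bsub>Om\<^esub> y (Suc k))"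
    using c by (simp add: a_minus_def Om.minus_add Om.a_ac)
  then show "N (x k \<oplus>\<^bsub>Om\<^esub> y k) \<ominus>\<^bsub>Om\<^esub> (x (Suc k) \<oplus>\<^bsub>Om\<^esub> y (Suc k)) \<in> exact_mod (p ^ Suc k)"
    using assms k exact_mod_add by (simp add: dwork_def)
qed (use assms dwork_closed in auto)

lemma dwork_uminus:
  assumes "dwork n x"
  shows "dwork n (\<lambda>k. \<ominus>\<^bsub>Om\<^esub> x k)"
  unfolding dwork_def
proof (intro conjI allI impI)
  fix k assume k: "k < n"
  then have c: "x k \<in> carrier Om" "x (Suc k) \<in> carrier Om" using assms dwork_closed by auto
  have "N (\<ominus>\<^bsub>Om\<^esub> x k) \<ominus>\<^bsub>Om\<^esub> (\<ominus>\<^bsub>Om\<^esub> x (Suc k)) = \<ominus>\<^bsub>Om\<^esub> (N (x k) \<ominus>\<^bsub>Om\<^esub> x (Suc k))"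
    using c by (simp add: a_minus_def Om.minus_add)
  then show "N (\<ominus>\<^bsub>Om\<^esub> x k) \<ominus>\<^bsub>Om\<^esub> (\<ominus>\<^bsub>Om\<^esub> x (Suc k)) \<in> exact_mod (p ^ Suc k)"
    using assms k exact_mod_uminus by (simp add: dwork_def)
qed (use assms dwork_closed in auto)

lemma dwork_step:
  assumes "dwork n \<omega>" "k < n"
  obtains \<alpha> \<beta> where "\<alpha> \<in> carrier Om" "\<beta> \<in> carrier Om"
    "N (\<omega> k) \<ominus>\<^bsub>Om\<^esub> \<omega> (Suc k) = ([(p ^ Suc k)] \<cdot>\<^bsub>Om\<^esub> \<alpha>) \<oplus>\<^bsub>Om\<^esub> d \<beta>"
  using assms unfolding dwork_def exact_mod_def by blast

text \<open>Since \<open>d \<phi> = p \<phi> d\<close>, the congruences force \<open>d\<omega>\<^sub>k\<close> to be divisible by \<open>p\<^sup>k\<close>.  This makes them compatible with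
  products and with the divided differential.\<close>

lemma dwork_divisible:
  assumes "dwork n \<omega>" "k \<le> n"
  shows "\<exists>\<eta>\<in>carrier Om. d (\<omega> k) = [(p ^ k)] \<cdot>\<^bsub>Om\<^esub> \<eta>"
  using assms(2)
proof (induction k)
  case 0
  then show ?case using dwork_closed[OF assms(1), of 0] by (intro bexI[of _ "d (\<omega> 0)"]) auto
next
  case (Suc k)
  then obtain \<eta> where \<eta>: "\<eta> \<in> carrier Om" "d (\<omega> k) = [(p ^ k)] \<cdot>\<^bsub>Om\<^esub> \<eta>" by auto
  obtain \<alpha> \<beta> where ab: "\<alpha> \<in> carrier Om" "\<beta> \<in> carrier Om"
    "N (\<omega> k) \<ominus>\<^bsub>Om\<^esub> \<omega> (Suc k) = ([(p ^ Suc k)] \<cdot>\<^bsub>Om\<^esub> \<alpha>) \<oplus>\<^bsub>Om\<^esub> d \<beta>"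
    using dwork_step[OF assms(1), of k] Suc.prems by auto
  have c: "\<omega> k \<in> carrier Om" "\<omega> (Suc k) \<in> carrier Om" using Suc.prems dwork_closed[OF assms(1)] by auto
  have "\<omega> (Suc k) = N (\<omega> k) \<ominus>\<^bsub>Om\<^esub> (N (\<omega> k) \<ominus>\<^bsub>Om\<^esub> \<omega> (Suc k))"
    using c N.hom_closed[OF c(1)] by algebra
  then have "d (\<omega> (Suc k)) = d (N (\<omega> k)) \<ominus>\<^bsub>Om\<^esub> d (([(p ^ Suc k)] \<cdot>\<^bsub>Om\<^esub> \<alpha>) \<oplus>\<^bsub>Om\<^esub> d \<beta>)"
    using c ab by (metis Om.a_closed Om.add.nat_pow_closed N.hom_closed d.hom_closed d.hom_minus)
  also have "d (([(p ^ Suc k)] \<cdot>\<^bsub>Om\<^esub> \<alpha>) \<oplus>\<^bsub>Om\<^esub> d \<beta>) = [(p ^ Suc k)] \<cdot>\<^bsub>Om\<^esub> d \<alpha>"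
    using ab by (simp add: d.hom_add_pow d_d del: power_Suc)
  also have "d (N (\<omega> k)) = [(p ^ Suc k)] \<cdot>\<^bsub>Om\<^esub> N \<eta>"
    using c \<eta> pow_pow[of "N \<eta>" p "p ^ k"] by (simp add: normalized_frobenius_props(3) N.hom_add_pow)
  finally have "d (\<omega> (Suc k)) = [(p ^ Suc k)] \<cdot>\<^bsub>Om\<^esub> (N \<eta> \<ominus>\<^bsub>Om\<^esub> d \<alpha>)"
    using \<eta> ab by (simp add: a_minus_def Om.add.nat_pow_distrib Om.add.nat_pow_inv del: power_Suc)
  then show ?case using \<eta> ab by (intro bexI[of _ "N \<eta> \<ominus>\<^bsub>Om\<^esub> d \<alpha>"]) auto
qed

text \<open>If \<open>N x\<^sub>k = x\<^sub>k\<^sub>+\<^sub>1 + e\<close> and \<open>N y\<^sub>k = y\<^sub>k\<^sub>+\<^sub>1 + e'\<close>, then the error of the product is \<open>N(x\<^sub>k) e' + e y\<^sub>k\<^sub>+\<^sub>1\<close>.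
  The exact parts of \<open>e\<close> and \<open>e'\<close> are multiplied by forms whose differential is divisible by \<open>p\<^bsup>k+1\<^esup>\<close>, so these products
  are exact modulo \<open>p\<^bsup>k+1\<^esup>\<close> by the Leibniz rule.\<close>

lemma dwork_mult:
  assumes "dwork n x" "dwork n y"
  shows "dwork n (\<lambda>k. x k \<otimes>\<^bsub>Om\<^esub> y k)"
  unfolding dwork_def
proof (intro conjI allI impI)
  fix k assume k: "k < n"
  let ?P = "p ^ Suc k"
  have c: "x k \<in> carrier Om" "y k \<in> carrier Om" "x (Suc k) \<in> carrier Om" "y (Suc k) \<in> carrier Om"
    using assms k dwork_closed by auto
  obtain \<sigma> where \<sigma>: "\<sigma> \<in> ring_hom Om Om"
    and \<sigma>\<sigma>: "\<And>x. x \<in> carrier Om \<Longrightarrow> \<sigma> (\<sigma> x) = x"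
    and d\<sigma>: "\<And>x. x \<in> carrier Om \<Longrightarrow> d (\<sigma> x) = \<ominus>\<^bsub>Om\<^esub> \<sigma> (d x)"
    and leib: "\<And>x y. x \<in> carrier Om \<Longrightarrow> y \<in> carrier Om \<Longrightarrow>
      d (x \<otimes>\<^bsub>Om\<^esub> y) = \<sigma> x \<otimes>\<^bsub>Om\<^esub> d y \<oplus>\<^bsub>Om\<^esub> d x \<otimes>\<^bsub>Om\<^esub> y"
    by (rule differential_exists) blast
  interpret \<sigma>: ring_hom_ring Om Om \<sigma> by (rule ring_hom_ringI2[OF ring_Om ring_Om \<sigma>])
  obtain a b where ab: "a \<in> carrier Om" "b \<in> carrier Om"
    "N (x k) \<ominus>\<^bsub>Om\<^esub> x (Suc k) = ([?P] \<cdot>\<^bsub>Om\<^esub> a) \<oplus>\<^bsub>Om\<^esub> d b" by (rule dwork_step[OF assms(1) k])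
  obtain a' b' where ab': "a' \<in> carrier Om" "b' \<in> carrier Om"
    "N (y k) \<ominus>\<^bsub>Om\<^esub> y (Suc k) = ([?P] \<cdot>\<^bsub>Om\<^esub> a') \<oplus>\<^bsub>Om\<^esub> d b'" by (rule dwork_step[OF assms(2) k])
  obtain \<eta> where \<eta>: "\<eta> \<in> carrier Om" "d (x k) = [(p ^ k)] \<cdot>\<^bsub>Om\<^esub> \<eta>"
    using dwork_divisible[OF assms(1), of k] k by auto
  obtain \<theta> where \<theta>: "\<theta> \<in> carrier Om" "d (y (Suc k)) = [?P] \<cdot>\<^bsub>Om\<^esub> \<theta>"
    using dwork_divisible[OF assms(2), of "Suc k"] k by (auto simp del: power_Suc)
  have dNx: "d (N (x k)) = [?P] \<cdot>\<^bsub>Om\<^esub> N \<eta>"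
    using c \<eta> pow_pow[of "N \<eta>" p "p ^ k"] by (simp add: normalized_frobenius_props(3) N.hom_add_pow)
  have ex1: "N (x k) \<otimes>\<^bsub>Om\<^esub> d b' \<in> exact_mod ?P"
  proof -
    let ?s = "\<sigma> (N (x k))"
    have s: "?s \<in> carrier Om" "N (x k) \<in> carrier Om" using c by auto
    have ds: "d ?s = [?P] \<cdot>\<^bsub>Om\<^esub> (\<ominus>\<^bsub>Om\<^esub> \<sigma> (N \<eta>))"
      using d\<sigma>[OF s(2)] \<sigma>.hom_add_pow[of "N \<eta>" ?P] \<eta> dNx by (simp add: Om.add.nat_pow_inv del: power_Suc)
    have "d (?s \<otimes>\<^bsub>Om\<^esub> b') = N (x k) \<otimes>\<^bsub>Om\<^esub> d b' \<oplus>\<^bsub>Om\<^esub> d ?s \<otimes>\<^bsub>Om\<^esub> b'"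
      using leib[OF s(1) ab'(2)] \<sigma>\<sigma>[OF s(2)] by simp
    then have "N (x k) \<otimes>\<^bsub>Om\<^esub> d b' = d (?s \<otimes>\<^bsub>Om\<^esub> b') \<oplus>\<^bsub>Om\<^esub> \<ominus>\<^bsub>Om\<^esub> (d ?s \<otimes>\<^bsub>Om\<^esub> b')"
      using s ab' by (simp add: Om.a_assoc Om.r_neg)
    also have "d ?s \<otimes>\<^bsub>Om\<^esub> b' = [?P] \<cdot>\<^bsub>Om\<^esub> ((\<ominus>\<^bsub>Om\<^esub> \<sigma> (N \<eta>)) \<otimes>\<^bsub>Om\<^esub> b')"
      unfolding ds using \<eta> ab' by (intro Om.add_pow_ldistr) auto
    finally show ?thesis using exact_mod_add[OF exact_mod_d exact_mod_uminus[OF exact_mod_multiple]] s ab' \<eta>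
      by (simp del: power_Suc)
  qed
  have ex2: "d b \<otimes>\<^bsub>Om\<^esub> y (Suc k) \<in> exact_mod ?P"
  proof -
    have "d (b \<otimes>\<^bsub>Om\<^esub> y (Suc k)) = \<sigma> b \<otimes>\<^bsub>Om\<^esub> d (y (Suc k)) \<oplus>\<^bsub>Om\<^esub> d b \<otimes>\<^bsub>Om\<^esub> y (Suc k)"
      using leib ab c by simp
    then have "d b \<otimes>\<^bsub>Om\<^esub> y (Suc k) = d (b \<otimes>\<^bsub>Om\<^esub> y (Suc k)) \<oplus>\<^bsub>Om\<^esub> \<ominus>\<^bsub>Om\<^esub> (\<sigma> b \<otimes>\<^bsub>Om\<^esub> d (y (Suc k)))"
      using ab c \<sigma>.hom_closed[OF ab(2)] by (simp add: Om.a_ac Om.r_neg2 Om.r_neg Om.r_neg1)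
    also have "\<sigma> b \<otimes>\<^bsub>Om\<^esub> d (y (Suc k)) = [?P] \<cdot>\<^bsub>Om\<^esub> (\<sigma> b \<otimes>\<^bsub>Om\<^esub> \<theta>)"
      unfolding \<theta>(2) using ab \<theta> by (intro Om.add_pow_rdistr) auto
    finally show ?thesis using exact_mod_add[OF exact_mod_d exact_mod_uminus[OF exact_mod_multiple]] ab c \<theta>
      by (simp del: power_Suc)
  qed
  let ?e = "N (x k) \<ominus>\<^bsub>Om\<^esub> x (Suc k)" and ?e' = "N (y k) \<ominus>\<^bsub>Om\<^esub> y (Suc k)"
  have Nc: "N (x k) \<in> carrier Om" "N (y k) \<in> carrier Om" using c by auto
  have "N (x k \<otimes>\<^bsub>Om\<^esub> y k) \<ominus>\<^bsub>Om\<^esub> x (Suc k) \<otimes>\<^bsub>Om\<^esub> y (Suc k)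
      = N (x k) \<otimes>\<^bsub>Om\<^esub> ?e' \<oplus>\<^bsub>Om\<^esub> ?e \<otimes>\<^bsub>Om\<^esub> y (Suc k)"
    unfolding N.hom_mult[OF c(1,2)] using c Nc by algebra
  also have "\<dots> = ([?P] \<cdot>\<^bsub>Om\<^esub> (N (x k) \<otimes>\<^bsub>Om\<^esub> a') \<oplus>\<^bsub>Om\<^esub> N (x k) \<otimes>\<^bsub>Om\<^esub> d b') \<oplus>\<^bsub>Om\<^esub>
      ([?P] \<cdot>\<^bsub>Om\<^esub> (a \<otimes>\<^bsub>Om\<^esub> y (Suc k)) \<oplus>\<^bsub>Om\<^esub> d b \<otimes>\<^bsub>Om\<^esub> y (Suc k))"
    unfolding ab(3) ab'(3) using ab ab' c Nc
    by (simp add: Om.r_distr Om.l_distr Om.add_pow_ldistr Om.add_pow_rdistr del: power_Suc)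
  also have "\<dots> \<in> exact_mod ?P"
    using ex1 ex2 ab ab' c Nc by (intro exact_mod_add exact_mod_multiple) auto
  finally show "N (x k \<otimes>\<^bsub>Om\<^esub> y k) \<ominus>\<^bsub>Om\<^esub> x (Suc k) \<otimes>\<^bsub>Om\<^esub> y (Suc k) \<in> exact_mod ?P" .
qed (use assms dwork_closed in auto)

text \<open>Apply \<open>d\<close> to the congruences for \<open>\<omega>\<close> and cancel \<open>p\<^bsup>k+1\<^esup>\<close>, which is possible as \<open>d N = p N d\<close>; the exact error
  disappears and \<open>p\<^bsup>k+1\<^esup> \<alpha>\<close> becomes the exact form \<open>d\<alpha>\<close>.\<close>

lemma dwork_divided_differential:
  assumes \<omega>: "dwork n \<omega>"
    and \<eta>: "\<And>k. k \<le> n \<Longrightarrow> \<eta> k \<in> carrier Om" "\<And>k. k \<le> n \<Longrightarrow> [(p ^ k)] \<cdot>\<^bsub>Om\<^esub> \<eta> k = d (\<omega> k)"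
  shows "dwork n \<eta>"
  unfolding dwork_def
proof (intro conjI allI impI)
  fix k assume k: "k < n"
  let ?P = "p ^ Suc k"
  obtain a b where ab: "a \<in> carrier Om" "b \<in> carrier Om"
    "N (\<omega> k) \<ominus>\<^bsub>Om\<^esub> \<omega> (Suc k) = ([?P] \<cdot>\<^bsub>Om\<^esub> a) \<oplus>\<^bsub>Om\<^esub> d b" by (rule dwork_step[OF \<omega> k])
  have c: "\<omega> k \<in> carrier Om" "\<omega> (Suc k) \<in> carrier Om" "\<eta> k \<in> carrier Om" "\<eta> (Suc k) \<in> carrier Om"
    using k dwork_closed[OF \<omega>] \<eta> by auto
  have "[?P] \<cdot>\<^bsub>Om\<^esub> N (\<eta> k) = d (N (\<omega> k))"
    using c \<eta>(2)[of k] k pow_pow[of "N (\<eta> k)" p "p ^ k"] N.hom_add_pow[of "\<eta> k" "p ^ k"]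
    by (simp add: normalized_frobenius_props(3))
  then have "[?P] \<cdot>\<^bsub>Om\<^esub> (N (\<eta> k) \<ominus>\<^bsub>Om\<^esub> \<eta> (Suc k)) = d (N (\<omega> k)) \<ominus>\<^bsub>Om\<^esub> d (\<omega> (Suc k))"
    using c \<eta>(2)[of "Suc k"] k
    by (simp add: a_minus_def Om.add.nat_pow_distrib Om.add.nat_pow_inv del: power_Suc)
  also have "\<dots> = d (([?P] \<cdot>\<^bsub>Om\<^esub> a) \<oplus>\<^bsub>Om\<^esub> d b)"
    using c by (simp add: d.hom_minus del: power_Suc flip: ab(3))
  also have "\<dots> = [?P] \<cdot>\<^bsub>Om\<^esub> d a" using ab by (simp add: d.hom_add_pow d_d del: power_Suc)
  finally have "N (\<eta> k) \<ominus>\<^bsub>Om\<^esub> \<eta> (Suc k) = d a"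
    using cancel[of ?P "N (\<eta> k) \<ominus>\<^bsub>Om\<^esub> \<eta> (Suc k)" "d a"] p c ab by simp
  then show "N (\<eta> k) \<ominus>\<^bsub>Om\<^esub> \<eta> (Suc k) \<in> exact_mod ?P" using ab exact_mod_d by simp
qed (use \<eta> in auto)

lemma \<phi>_power_congruence:
  assumes a: "a \<in> carrier R"
  shows "\<exists>z\<in>carrier R. \<phi> a [^]\<^bsub>R\<^esub> (p ^ i) = a [^]\<^bsub>R\<^esub> (p ^ Suc i) \<oplus>\<^bsub>R\<^esub> [(p ^ Suc i)] \<cdot>\<^bsub>R\<^esub> z"
proof (induction i)
  case 0
  then show ?case using \<phi>_power[OF a] a \<phi>_closed[OF a] by (simp add: B.nat_pow_eone)
next
  case (Suc i)
  then obtain z where z: "z \<in> carrier R"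
    "\<phi> a [^]\<^bsub>R\<^esub> (p ^ i) = a [^]\<^bsub>R\<^esub> (p ^ Suc i) \<oplus>\<^bsub>R\<^esub> [(p ^ Suc i)] \<cdot>\<^bsub>R\<^esub> z" by blast
  have "\<phi> a [^]\<^bsub>R\<^esub> (p ^ Suc i) = (\<phi> a [^]\<^bsub>R\<^esub> (p ^ i)) [^]\<^bsub>R\<^esub> p"
    using \<phi>_closed[OF a] by (simp add: B.nat_pow_pow mult.commute)
  moreover have "a [^]\<^bsub>R\<^esub> (p ^ Suc (Suc i)) = (a [^]\<^bsub>R\<^esub> (p ^ Suc i)) [^]\<^bsub>R\<^esub> p"
    using a by (simp add: B.nat_pow_pow ac_simps)
  ultimately show ?case
    using B.power_congruence[of "a [^]\<^bsub>R\<^esub> (p ^ Suc i)" z p i] a z by (simp del: power_Suc)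
qed

text \<open>The ghost components of \<open>V\<close> applied to the Teichmueller lift of \<open>a\<close>.  At the step from \<open>j - 1\<close> to \<open>j\<close> the
  new component is itself divisible by \<open>p\<^sup>j\<close>; afterwards the error is \<open>p\<^sup>j\<close> times the error for powers of \<open>a\<close>.\<close>

lemma dwork_Verschiebung:
  assumes a: "a \<in> carrier R"
  shows "dwork n (\<lambda>k. if j \<le> k then frm ([(p ^ j)] \<cdot>\<^bsub>R\<^esub> (a [^]\<^bsub>R\<^esub> (p ^ (k - j)))) [] else \<zero>\<^bsub>Om\<^esub>)"
    (is "dwork n ?v")
  unfolding dwork_def
proof (intro conjI allI impI)
  interpret fh: abelian_group_hom R Om "\<lambda>b. frm b []" by (rule frm_hom) simp
  fix k assume k: "k < n"
  let ?P = "p ^ Suc k"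
  consider "Suc k < j" | "j = Suc k" | "j \<le> k" by linarith
  then show "N (?v k) \<ominus>\<^bsub>Om\<^esub> ?v (Suc k) \<in> exact_mod ?P"
  proof cases
    case 1
    then show ?thesis using exact_mod_d[of "\<zero>\<^bsub>Om\<^esub>"] by (simp add: a_minus_def)
  next
    case 2
    then have "N (?v k) \<ominus>\<^bsub>Om\<^esub> ?v (Suc k) = \<ominus>\<^bsub>Om\<^esub> ([?P] \<cdot>\<^bsub>Om\<^esub> frm a [])"
      using a fh.hom_add_pow[OF a, of ?P] by (simp add: a_minus_def B.nat_pow_eone del: power_Suc)
    then show ?thesis using exact_mod_uminus[OF exact_mod_multiple[of "frm a []" ?P]] a by simp
  next
    case 3
    define i where "i = k - j"
    have ij: "k = j + i" "Suc k - j = Suc i" using 3 by (auto simp: i_def)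
    obtain z where z: "z \<in> carrier R"
      "\<phi> a [^]\<^bsub>R\<^esub> (p ^ i) = a [^]\<^bsub>R\<^esub> (p ^ Suc i) \<oplus>\<^bsub>R\<^esub> [(p ^ Suc i)] \<cdot>\<^bsub>R\<^esub> z"
      using \<phi>_power_congruence[OF a] by blast
    interpret \<phi>: ring_hom_cring R R \<phi> by unfold_locales (rule \<phi>)
    let ?y = "a [^]\<^bsub>R\<^esub> (p ^ Suc i)"
    have y: "?y \<in> carrier R" using a by simp
    have P: "?P = p ^ j * p ^ Suc i" using ij by (simp add: power_add)
    have "\<phi> ([(p ^ j)] \<cdot>\<^bsub>R\<^esub> (a [^]\<^bsub>R\<^esub> (p ^ i))) = [(p ^ j)] \<cdot>\<^bsub>R\<^esub> (\<phi> a [^]\<^bsub>R\<^esub> (p ^ i))"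
      using a additive_map_of_ring_hom[OF B.ring_axioms B.ring_axioms \<phi>, THEN abelian_group_hom.hom_add_pow]
      by (simp add: \<phi>.ring.hom_nat_pow)
    also have "\<dots> = [(p ^ j)] \<cdot>\<^bsub>R\<^esub> ?y \<oplus>\<^bsub>R\<^esub> [?P] \<cdot>\<^bsub>R\<^esub> z"
      unfolding z(2) P using y z(1) B.add.nat_pow_pow[OF z(1), of "p ^ j" "p ^ Suc i"]
      by (simp add: B.add.nat_pow_distrib mult.commute del: power_Suc)
    finally have "N (?v k) = frm ([(p ^ j)] \<cdot>\<^bsub>R\<^esub> ?y) [] \<oplus>\<^bsub>Om\<^esub> [?P] \<cdot>\<^bsub>Om\<^esub> frm z []"
      using a 3 y z(1) fh.hom_add_pow[OF z(1), of ?P]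
      by (simp add: normalized_frobenius_props(2) i_def del: power_Suc)
    moreover have "?v (Suc k) = frm ([(p ^ j)] \<cdot>\<^bsub>R\<^esub> ?y) []" using 3 ij by simp
    ultimately have "N (?v k) \<ominus>\<^bsub>Om\<^esub> ?v (Suc k) = [?P] \<cdot>\<^bsub>Om\<^esub> frm z []"
      using y z(1) by (simp add: a_minus_def Om.a_ac Om.r_neg Om.r_neg1 Om.r_neg2 del: power_Suc)
    then show ?thesis using exact_mod_multiple z by simp
  qed
qed (use a in auto)

end

section \<open>Differential graded subrings and ideals generated by homogeneous elements\<close>

text \<open>The degree parts need not lie in the carrier: this covers differential graded subrings, which inherit
  the degree parts of the ambient ring.\<close>

locale graded_ring = ring D for D :: "('e, 'x) dg_ring_scheme" (structure) +
  assumes deg_zero: "\<zero> \<in> degree_part D q"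
    and deg_add: "x \<in> carrier D \<Longrightarrow> y \<in> carrier D \<Longrightarrow> x \<in> degree_part D q \<Longrightarrow> y \<in> degree_part D q \<Longrightarrow>
      x \<oplus> y \<in> degree_part D q"
    and deg_minus: "x \<in> carrier D \<Longrightarrow> x \<in> degree_part D q \<Longrightarrow> \<ominus> x \<in> degree_part D q"
    and deg_mult: "x \<in> carrier D \<Longrightarrow> y \<in> carrier D \<Longrightarrow> x \<in> degree_part D q \<Longrightarrow> y \<in> degree_part D r \<Longrightarrow>
      x \<otimes> y \<in> degree_part D (q + r)"
    and deg_one: "\<one> \<in> degree_part D 0"
    and diff_hom: "abelian_group_hom D D (differential D)"
    and diff_deg: "x \<in> carrier D \<Longrightarrow> x \<in> degree_part D q \<Longrightarrow> differential D x \<in> degree_part D (Suc q)"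
begin

text \<open>Differential graded subrings and ideals are required to contain the homogeneous components of their elements.
  The set of sums of homogeneous elements of \<open>P\<close> always has this property, and it inherits closure under the operations
  from \<open>P\<close>; so membership in generated subrings and ideals can be bounded by conditions \<open>P\<close> that are not graded.\<close>

definition graded_span :: "'e set \<Rightarrow> 'e set" where
  "graded_span P = {(\<Oplus>q\<in>{..M::nat}. y q) | M y. \<forall>q\<le>M. y q \<in> P \<inter> degree_part D q}"

context
  fixes P
  assumes P: "P \<subseteq> carrier D" "\<zero> \<in> P"
    and P_add: "\<And>x y. x \<in> P \<Longrightarrow> y \<in> P \<Longrightarrow> x \<oplus> y \<in> P"
    and P_minus: "\<And>x. x \<in> P \<Longrightarrow> \<ominus> x \<in> P"
begin

lemma graded_span_P: "graded_span P \<subseteq> P"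
proof -
  have "(\<Oplus>q\<in>{..M::nat}. y q) \<in> P" if "\<forall>q\<le>M. y q \<in> P \<inter> degree_part D q" for M y
    by (rule finsum_induct) (use that P P_add in auto)
  then show ?thesis by (auto simp: graded_span_def)
qed

lemma homogeneous_in_span:
  assumes "x \<in> P" "x \<in> degree_part D q"
  shows "x \<in> graded_span P"
proof -
  have xc: "x \<in> carrier D" using assms P by auto
  have "(\<Oplus>r\<in>{..q}. if q = r then x else \<zero>) = x" by (rule finsum_singleton) (use xc in auto)
  moreover have "\<forall>r\<le>q. (if q = r then x else \<zero>) \<in> P \<inter> degree_part D r"
    using assms P deg_zero by auto
  ultimately show ?thesis unfolding graded_span_def
    by (intro CollectI exI[of _ q] exI[of _ "\<lambda>r. if q = r then x else \<zero>"] conjI) (rule sym)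
qed

lemma graded_span_pad:
  assumes "x \<in> graded_span P"
  shows "\<exists>M0. \<forall>M\<ge>M0. \<exists>y. (\<forall>q\<le>M. y q \<in> P \<inter> degree_part D q) \<and> x = (\<Oplus>q\<in>{..M}. y q)"
proof -
  obtain M0 y where y: "\<forall>q\<le>M0. y q \<in> P \<inter> degree_part D q" "x = (\<Oplus>q\<in>{..M0}. y q)"
    using assms by (auto simp: graded_span_def)
  have "\<exists>y. (\<forall>q\<le>M. y q \<in> P \<inter> degree_part D q) \<and> x = (\<Oplus>q\<in>{..M}. y q)" if "M \<ge> M0" for M
  proof (intro exI conjI)
    show "\<forall>q\<le>M. (if q \<le> M0 then y q else \<zero>) \<in> P \<inter> degree_part D q" using y P deg_zero by auto
    show "x = (\<Oplus>q\<in>{..M}. if q \<le> M0 then y q else \<zero>)"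
      unfolding y(2) by (rule add.finprod_mono_neutral_cong_left) (use y that P in auto)
  qed
  then show ?thesis by blast
qed

lemma graded_span_add:
  assumes "x \<in> graded_span P" "x' \<in> graded_span P"
  shows "x \<oplus> x' \<in> graded_span P"
proof -
  obtain M1 M2 where M: "\<forall>M\<ge>M1. \<exists>y. (\<forall>q\<le>M. y q \<in> P \<inter> degree_part D q) \<and> x = (\<Oplus>q\<in>{..M}. y q)"
    "\<forall>M\<ge>M2. \<exists>y. (\<forall>q\<le>M. y q \<in> P \<inter> degree_part D q) \<and> x' = (\<Oplus>q\<in>{..M}. y q)"
    using graded_span_pad[OF assms(1)] graded_span_pad[OF assms(2)] by blast
  let ?M = "max M1 M2"
  obtain y where y: "\<forall>q\<le>?M. y q \<in> P \<inter> degree_part D q" "x = (\<Oplus>q\<in>{..?M}. y q)"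
    using M(1)[rule_format, of ?M] by auto
  obtain y' where y': "\<forall>q\<le>?M. y' q \<in> P \<inter> degree_part D q" "x' = (\<Oplus>q\<in>{..?M}. y' q)"
    using M(2)[rule_format, of ?M] by auto
  have "x \<oplus> x' = (\<Oplus>q\<in>{..?M}. y q \<oplus> y' q)"
    unfolding y(2) y'(2) by (rule finsum_addf[symmetric]) (use y y' P in auto)
  moreover have "\<forall>q\<le>?M. y q \<oplus> y' q \<in> P \<inter> degree_part D q"
  proof (intro allI impI IntI)
    fix q assume "q \<le> ?M"
    then have c: "y q \<in> P" "y q \<in> degree_part D q" "y' q \<in> P" "y' q \<in> degree_part D q"
      using y(1) y'(1) by auto
    show "y q \<oplus> y' q \<in> P" using c P_add by simp
    show "y q \<oplus> y' q \<in> degree_part D q" using c P by (intro deg_add) auto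
  qed
  ultimately show ?thesis unfolding graded_span_def
    by (intro CollectI exI[of _ ?M] exI[of _ "\<lambda>q. y q \<oplus> y' q"] conjI)
qed

lemma graded_span_zero: "\<zero> \<in> graded_span P"
  using homogeneous_in_span[OF P(2) deg_zero] .

lemma graded_span_finsum:
  assumes "\<And>q. q \<in> Q \<Longrightarrow> y q \<in> graded_span P"
  shows "(\<Oplus>q\<in>Q. y q) \<in> graded_span P"
proof (rule finsum_induct[of "\<lambda>x. x \<in> graded_span P"])
  show "\<And>q. q \<in> Q \<Longrightarrow> y q \<in> carrier D \<and> y q \<in> graded_span P"
    using assms graded_span_P P by blast
qed (rule graded_span_zero, rule graded_span_add)

lemma graded_span_cases:
  assumes "x \<in> graded_span P"
  obtains M y where "\<And>q. q \<in> {..M::nat} \<Longrightarrow> y q \<in> P \<and> y q \<in> degree_part D q \<and> y q \<in> carrier D"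
    "x = (\<Oplus>q\<in>{..M}. y q)"
proof -
  obtain M y where "\<forall>q\<le>M. y q \<in> P \<inter> degree_part D q" "x = (\<Oplus>q\<in>{..M}. y q)"
    using assms unfolding graded_span_def by blast
  then show thesis using P by (intro that[of M y]) auto
qed

lemma graded_span_image:
  assumes h: "abelian_group_hom D D h"
    and hP: "\<And>x q. x \<in> P \<Longrightarrow> x \<in> degree_part D q \<Longrightarrow> h x \<in> graded_span P"
    and x: "x \<in> graded_span P"
  shows "h x \<in> graded_span P"
proof -
  obtain M y where y: "\<And>q. q \<in> {..M::nat} \<Longrightarrow> y q \<in> P \<and> y q \<in> degree_part D q \<and> y q \<in> carrier D"
    "x = (\<Oplus>q\<in>{..M}. y q)" using x by (rule graded_span_cases) blast
  have "h x = (\<Oplus>q\<in>{..M}. h (y q))"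
    unfolding y(2) by (rule abelian_group_hom.hom_finsum[OF h]) (use y in auto)
  also have "\<dots> \<in> graded_span P" by (rule graded_span_finsum) (use y hP in blast)
  finally show ?thesis .
qed

lemma graded_span_minus:
  assumes "x \<in> graded_span P"
  shows "\<ominus> x \<in> graded_span P"
proof (rule graded_span_image[where h = "\<lambda>x. \<ominus> x", OF _ _ assms])
  show "abelian_group_hom D D (\<lambda>x. \<ominus> x)"
    by (rule additive_mapI) (auto simp: minus_add abelian_group_axioms)
  fix x q assume "x \<in> P" "x \<in> degree_part D q"
  then show "\<ominus> x \<in> graded_span P" using homogeneous_in_span[OF P_minus deg_minus] P by blast
qed

lemma graded_subset_span: "graded_subset (graded_span P) D"
  unfolding graded_subset_def
proof
  fix x assume "x \<in> graded_span P"
  then obtain M y where y: "\<forall>q\<le>M. y q \<in> P \<inter> degree_part D q" "x = (\<Oplus>q\<in>{..M}. y q)"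
    by (auto simp: graded_span_def)
  then have "\<forall>q\<le>M. y q \<in> graded_span P \<inter> degree_part D q" using homogeneous_in_span by blast
  then show "\<exists>M y. (\<forall>q\<le>M. y q \<in> graded_span P \<inter> degree_part D q) \<and> x = (\<Oplus>q\<in>{..M}. y q)"
    using y(2) by blast
qed

lemma graded_span_diff:
  assumes "\<And>x. x \<in> P \<Longrightarrow> differential D x \<in> P" "x \<in> graded_span P"
  shows "differential D x \<in> graded_span P"
proof (rule graded_span_image[OF diff_hom _ assms(2)])
  fix x q assume "x \<in> P" "x \<in> degree_part D q"
  then show "differential D x \<in> graded_span P"
    using homogeneous_in_span[OF assms(1) diff_deg] P by blast
qed

lemma dg_subring_span:
  assumes one: "\<one> \<in> P" and mult: "\<And>x y. x \<in> P \<Longrightarrow> y \<in> P \<Longrightarrow> x \<otimes> y \<in> P"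
    and diff: "\<And>x. x \<in> P \<Longrightarrow> differential D x \<in> P"
  shows "dg_subring (graded_span P) D"
  unfolding dg_subring_def
proof (intro conjI ballI graded_subset_span graded_span_diff[OF diff])
  show "subring (graded_span P) D"
  proof (rule subringI)
    show "graded_span P \<subseteq> carrier D" using graded_span_P P by blast
    show "\<one> \<in> graded_span P" by (rule homogeneous_in_span[OF one deg_one])
    fix x z assume x: "x \<in> graded_span P" and z: "z \<in> graded_span P"
    obtain M y where y: "\<And>q. q \<in> {..M::nat} \<Longrightarrow> y q \<in> P \<and> y q \<in> degree_part D q \<and> y q \<in> carrier D"
      "x = (\<Oplus>q\<in>{..M}. y q)" using x by (rule graded_span_cases) blast
    have zc: "z \<in> carrier D" using z graded_span_P P by blast
    have "x \<otimes> z = (\<Oplus>q\<in>{..M}. y q \<otimes> z)"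
      unfolding y(2) by (rule finsum_ldistr) (use y zc in auto)
    moreover have "y q \<otimes> z \<in> graded_span P" if q: "q \<in> {..M}" for q
    proof (rule graded_span_image[OF _ _ z])
      show "abelian_group_hom D D (\<lambda>z. y q \<otimes> z)"
        by (rule additive_mapI) (use y(1)[OF q] in \<open>auto simp: r_distr abelian_group_axioms\<close>)
      fix v r assume v: "v \<in> P" "v \<in> degree_part D r"
      have c: "v \<in> carrier D" "y q \<in> P" "y q \<in> carrier D" "y q \<in> degree_part D q" using y(1)[OF q] v P by auto
      show "y q \<otimes> v \<in> graded_span P"
        by (rule homogeneous_in_span[OF mult[OF c(2) v(1)] deg_mult[OF c(3,1,4) v(2)]])
    qed
    ultimately show "x \<otimes> z \<in> graded_span P" by (simp only: graded_span_finsum)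
    show "x \<oplus> z \<in> graded_span P" using x z by (rule graded_span_add)
    show "\<ominus> x \<in> graded_span P" using x by (rule graded_span_minus)
  qed
qed

lemma dg_ideal_span:
  assumes gen: "\<And>r. r \<in> carrier D \<Longrightarrow> \<exists>M y. (\<forall>q\<le>M::nat. y q \<in> carrier D \<and> y q \<in> degree_part D q) \<and> r = (\<Oplus>q\<in>{..M}. y q)"
    and absorb: "\<And>x r. x \<in> P \<Longrightarrow> r \<in> carrier D \<Longrightarrow> r \<otimes> x \<in> P" "\<And>x r. x \<in> P \<Longrightarrow> r \<in> carrier D \<Longrightarrow> x \<otimes> r \<in> P"
    and diff: "\<And>x. x \<in> P \<Longrightarrow> differential D x \<in> P"
  shows "dg_ideal (graded_span P) D"
  unfolding dg_ideal_def
proof (intro conjI ballI graded_subset_span graded_span_diff[OF diff])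
  have sub: "graded_span P \<subseteq> carrier D" using graded_span_P P by blast
  show "ideal (graded_span P) D"
  proof (rule idealI[OF ring_axioms])
    show "subgroup (graded_span P) (add_monoid D)"
      by (rule add.subgroupI) (use sub graded_span_zero graded_span_minus graded_span_add in auto)
    fix x r assume x: "x \<in> graded_span P" and r: "r \<in> carrier D"
    obtain M y where y0: "\<forall>q\<le>M::nat. y q \<in> carrier D \<and> y q \<in> degree_part D q" "r = (\<Oplus>q\<in>{..M}. y q)"
      using gen[OF r] by (elim exE conjE)
    then have y: "\<And>q. q \<in> {..M} \<Longrightarrow> y q \<in> carrier D \<and> y q \<in> degree_part D q" "r = (\<Oplus>q\<in>{..M}. y q)"
      by auto
    have xc: "x \<in> carrier D" using x sub by blast
    have "r \<otimes> x = (\<Oplus>q\<in>{..M}. y q \<otimes> x)"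
      unfolding y(2) by (rule finsum_ldistr) (use y xc in auto)
    moreover have "y q \<otimes> x \<in> graded_span P" if q: "q \<in> {..M}" for q
    proof (rule graded_span_image[OF _ _ x])
      show "abelian_group_hom D D (\<lambda>z. y q \<otimes> z)"
        by (rule additive_mapI) (use y(1)[OF q] in \<open>auto simp: r_distr abelian_group_axioms\<close>)
      fix v r assume v: "v \<in> P" "v \<in> degree_part D r"
      have c: "v \<in> carrier D" "y q \<in> carrier D" "y q \<in> degree_part D q" using y(1)[OF q] v P by auto
      show "y q \<otimes> v \<in> graded_span P"
        by (rule homogeneous_in_span[OF absorb(1)[OF v(1) c(2)] deg_mult[OF c(2,1,3) v(2)]])
    qed
    ultimately show "r \<otimes> x \<in> graded_span P" by (simp only: graded_span_finsum)
    have "x \<otimes> r = (\<Oplus>q\<in>{..M}. x \<otimes> y q)"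
      unfolding y(2) by (rule finsum_rdistr) (use y xc in auto)
    moreover have "x \<otimes> y q \<in> graded_span P" if q: "q \<in> {..M}" for q
    proof (rule graded_span_image[OF _ _ x])
      show "abelian_group_hom D D (\<lambda>z. z \<otimes> y q)"
        by (rule additive_mapI) (use y(1)[OF q] in \<open>auto simp: l_distr abelian_group_axioms\<close>)
      fix v r assume v: "v \<in> P" "v \<in> degree_part D r"
      have c: "v \<in> carrier D" "y q \<in> carrier D" "y q \<in> degree_part D q" using y(1)[OF q] v P by auto
      show "v \<otimes> y q \<in> graded_span P"
        by (rule homogeneous_in_span[OF absorb(2)[OF v(1) c(2)] deg_mult[OF c(1,2) v(2) c(3)]])
    qed
    ultimately show "x \<otimes> r \<in> graded_span P" by (simp only: graded_span_finsum)
  qed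
qed

end

end

lemma power_ring_simps:
  "carrier (power_ring S A) = S \<rightarrow>\<^sub>E carrier A"
  "x \<otimes>\<^bsub>power_ring S A\<^esub> y = (\<lambda>k\<in>S. x k \<otimes>\<^bsub>A\<^esub> y k)"
  "\<one>\<^bsub>power_ring S A\<^esub> = (\<lambda>k\<in>S. \<one>\<^bsub>A\<^esub>)"
  "\<zero>\<^bsub>power_ring S A\<^esub> = (\<lambda>k\<in>S. \<zero>\<^bsub>A\<^esub>)"
  "x \<oplus>\<^bsub>power_ring S A\<^esub> y = (\<lambda>k\<in>S. x k \<oplus>\<^bsub>A\<^esub> y k)"
  by (simp_all add: power_ring_def)

lemma (in ring) ring_power_ring: "ring (power_ring S R)"
proof (rule ringI)
  show "abelian_group (power_ring S R)"
  proof (rule abelian_groupI)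
    fix x assume x: "x \<in> carrier (power_ring S R)"
    have "(\<lambda>k\<in>S. \<ominus> x k) \<oplus>\<^bsub>power_ring S R\<^esub> x = \<zero>\<^bsub>power_ring S R\<^esub>"
      unfolding power_ring_simps by (rule restrict_ext) (use x in \<open>auto simp: power_ring_simps l_neg PiE_iff\<close>)
    moreover have "(\<lambda>k\<in>S. \<ominus> x k) \<in> carrier (power_ring S R)" using x by (auto simp: power_ring_simps)
    ultimately show "\<exists>y\<in>carrier (power_ring S R). y \<oplus>\<^bsub>power_ring S R\<^esub> x = \<zero>\<^bsub>power_ring S R\<^esub>" by blast
  next
    fix x assume x: "x \<in> carrier (power_ring S R)"
    show "\<zero>\<^bsub>power_ring S R\<^esub> \<oplus>\<^bsub>power_ring S R\<^esub> x = x"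
      by (rule extensionalityI[of _ S]) (use x in \<open>auto simp: power_ring_simps PiE_iff\<close>)
  qed (auto simp: power_ring_simps PiE_iff a_ac cong: restrict_cong)
  show "Group.monoid (power_ring S R)"
  proof (rule monoidI)
    fix x assume x: "x \<in> carrier (power_ring S R)"
    show "\<one>\<^bsub>power_ring S R\<^esub> \<otimes>\<^bsub>power_ring S R\<^esub> x = x"
      by (rule extensionalityI[of _ S]) (use x in \<open>auto simp: power_ring_simps PiE_iff\<close>)
    show "x \<otimes>\<^bsub>power_ring S R\<^esub> \<one>\<^bsub>power_ring S R\<^esub> = x"
      by (rule extensionalityI[of _ S]) (use x in \<open>auto simp: power_ring_simps PiE_iff\<close>)
  qed (auto simp: power_ring_simps PiE_iff m_assoc cong: restrict_cong)
qed (auto simp: power_ring_simps PiE_iff l_distr r_distr cong: restrict_cong)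

section \<open>The ghost map of a presentation\<close>

lemma (in ring) finsum_subring:
  assumes H: "subring H R" and y: "y \<in> Q \<rightarrow> H"
  shows "finsum (R\<lparr>carrier := H\<rparr>) y Q = finsum R y Q"
proof -
  interpret H: ring "R\<lparr>carrier := H\<rparr>" by (rule subring_is_ring[OF H])
  have sub: "H \<subseteq> carrier R" using H by (rule subringE(1))
  show ?thesis using y
  proof (induction Q rule: infinite_finite_induct)
    case (insert q Q)
    then have "y \<in> Q \<rightarrow> H" "y q \<in> H" by auto
    then show ?case using insert sub H.finsum_insert[of Q q y] by (auto simp: Pi_iff subset_iff)
  qed auto
qed

lemma (in de_rham_complex) graded_ring_Om: "graded_ring Om"
  by (intro graded_ring.intro ring_Om graded_ring_axioms.intro)
    (auto simp: degree_zero degree_add degree_minus degree_mult d_degree d_hom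
      intro: frm_degree[of "\<one>\<^bsub>B\<^esub>" "[]", simplified frm_one, simplified])

lemma (in de_rham_complex) Om_homogeneous_sum:
  assumes "r \<in> carrier Om"
  shows "\<exists>M y. (\<forall>q\<le>M::nat. y q \<in> carrier Om \<and> y q \<in> degree_part Om q) \<and> r = (\<Oplus>\<^bsub>Om\<^esub>q\<in>{..M}. y q)"
proof -
  interpret G: graded_ring Om by (rule graded_ring_Om)
  have P: "carrier Om \<subseteq> carrier Om" "\<zero>\<^bsub>Om\<^esub> \<in> carrier Om"
    "\<And>x y. x \<in> carrier Om \<Longrightarrow> y \<in> carrier Om \<Longrightarrow> x \<oplus>\<^bsub>Om\<^esub> y \<in> carrier Om"
    "\<And>x. x \<in> carrier Om \<Longrightarrow> \<ominus>\<^bsub>Om\<^esub> x \<in> carrier Om" by auto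
  have "r \<in> G.graded_span (carrier Om)"
    using assms
  proof (induction rule: forms_induct)
    case (frm b bs)
    then show ?case using frm_degree[of b bs] by (intro G.homogeneous_in_span[OF P]) auto
  next
    case (add x y)
    then show ?case by (intro G.graded_span_add[OF P])
  qed
  then show ?thesis by (auto simp: G.graded_span_def)
qed

context rational_forms
begin

lemmas complexes = D.de_rham_complex_axioms DQ.de_rham_complex_axioms

lemma to_rat_hom: "to_rat \<in> ring_hom D.Om (de_rham_rat A0 A i)"
  unfolding to_rat_eq de_rham_rat_def by (rule R.U_hom)

lemma to_rat_d: "x \<in> carrier D.Om \<Longrightarrow> to_rat (D.d x) = differential (de_rham_rat A0 A i) (to_rat x)"
  unfolding to_rat_eq de_rham_rat_def by (rule R.U_d)

lemma to_rat_degree: "x \<in> degree_part D.Om q \<Longrightarrow> to_rat x \<in> degree_part (de_rham_rat A0 A i) q"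
  unfolding to_rat_eq de_rham_rat_def by (rule R.U_degree)

lemma rat_form_one: "a \<in> carrier A \<Longrightarrow> rat_form A0 A i a 1 = to_rat (D.frm a [])"
  using R.U_frm[of a "[]"] by (simp add: rat_form_def to_rat_eq)

lemma unit_fraction_degree: "rat_form A0 A i \<one>\<^bsub>A\<^esub> r \<in> degree_part (de_rham_rat A0 A i) 0"
  unfolding rat_form_def de_rham_rat_def using DQ.frm_degree[of "rat_elem A \<one>\<^bsub>A\<^esub> r" "[]"] by simp

lemma unit_fraction_cancel:
  assumes m: "m > 0" and w: "w \<in> carrier D.Om"
  shows "rat_form A0 A i \<one>\<^bsub>A\<^esub> (1 / of_nat m) \<otimes>\<^bsub>de_rham_rat A0 A i\<^esub> to_rat ([m] \<cdot>\<^bsub>D.Om\<^esub> w) = to_rat w"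
proof -
  let ?c = "rat_form A0 A i \<one>\<^bsub>A\<^esub> (1 / of_nat m)"
  let ?e = "rat_elem A \<one>\<^bsub>A\<^esub> (1 / of_nat m)"
  interpret h: abelian_group_hom "rationalization A" DQ.Om "\<lambda>b. DQ.frm b []" by (rule DQ.frm_hom) simp
  have e: "?e \<in> carrier (rationalization A)" by simp
  have c: "?c \<in> carrier DQ.Om" unfolding rat_form_def using e by simp
  have "[m] \<cdot>\<^bsub>rationalization A\<^esub> ?e = rat_elem A ([m] \<cdot>\<^bsub>A\<^esub> \<one>\<^bsub>A\<^esub>) (1 / of_nat m)"
    using abelian_group_hom.hom_add_pow[OF QA.T.pure_hom_l[of "1 / of_nat m"], of "\<one>\<^bsub>A\<^esub>" m]
    by (simp add: rat_elem_pure AQ_eq rat_ring_simps)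
  also have "\<dots> = \<one>\<^bsub>rationalization A\<^esub>"
    using QA.pure_cancel[of "\<one>\<^bsub>A\<^esub>" m 1] m rat_elem_one by (simp add: rat_elem_pure)
  finally have "[m] \<cdot>\<^bsub>DQ.Om\<^esub> ?c = \<one>\<^bsub>DQ.Om\<^esub>"
    using h.hom_add_pow[OF e, of m] by (simp add: rat_form_def DQ.frm_one)
  moreover have tw: "to_rat w \<in> carrier DQ.Om" using w R.U.hom_closed by (simp add: to_rat_eq)
  ultimately have "([m] \<cdot>\<^bsub>DQ.Om\<^esub> ?c) \<otimes>\<^bsub>DQ.Om\<^esub> to_rat w = to_rat w" by simp
  then have "?c \<otimes>\<^bsub>DQ.Om\<^esub> ([m] \<cdot>\<^bsub>DQ.Om\<^esub> to_rat w) = to_rat w"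
    using DQ.Om.add_pow_ldistr[OF c tw] DQ.Om.add_pow_rdistr[OF c tw] by simp
  then show ?thesis using R.U.hom_add_pow[OF w, of m] by (simp add: to_rat_eq de_rham_rat_def)
qed

end

locale ghost_presentation = A: cring A
  for A0 :: "('a0, 'c) ring_scheme" and A :: "('a, 'd) ring_scheme" and i :: "'a0 \<Rightarrow> 'a"
    and R0 :: "('r0, 'e) ring_scheme" and R :: "('r, 'g) ring_scheme" and f :: "'r0 \<Rightarrow> 'r"
    and p :: nat and \<phi> :: "'r \<Rightarrow> 'r" +
  fixes \<pi> :: "'a \<Rightarrow> 'r" and n :: nat and S :: "nat set"
  assumes rat: "rational_forms A0 A i"
    and frob: "frobenius_forms R0 R f p \<phi>"
    and \<pi>: "\<pi> \<in> ring_hom A R"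
    and \<pi>_surj: "\<pi> ` carrier A = carrier R"
    and \<pi>_base: "\<And>a. a \<in> carrier A0 \<Longrightarrow> \<exists>r\<in>carrier R0. \<pi> (i a) = f r"
    and p1: "p > 1"
    and S: "S = (\<lambda>k. p ^ k) ` {..n}"
    and tfA: "\<And>m x. m > 0 \<Longrightarrow> x \<in> carrier (de_rham A0 A i) \<Longrightarrow>
      [(m::nat)] \<cdot>\<^bsub>de_rham A0 A i\<^esub> x = \<zero>\<^bsub>de_rham A0 A i\<^esub> \<Longrightarrow> x = \<zero>\<^bsub>de_rham A0 A i\<^esub>"
begin

abbreviation OA where "OA \<equiv> de_rham A0 A i"
abbreviation OQ where "OQ \<equiv> de_rham_rat A0 A i"
abbreviation OR where "OR \<equiv> de_rham R0 R f"
abbreviation fA where "fA \<equiv> form A0 A i"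
abbreviation fR where "fR \<equiv> form R0 R f"
abbreviation tr where "tr \<equiv> de_rham_to_rat A0 A i"
abbreviation pr where "pr \<equiv> de_rham_map A R0 R f \<pi>"
abbreviation GD where "GD \<equiv> ghost_dg S A0 A i"
abbreviation dwork where "dwork \<equiv> frobenius_forms.dwork R0 R f p \<phi>"

lemmas DA = rational_forms.complexes(1)[OF rat]
lemmas DQ = rational_forms.complexes(2)[OF rat]
lemma DR: "de_rham_complex R0 R f" by (rule frobenius_forms.axioms(1)[OF frob])
lemma cring_R: "cring R" by (rule de_rham_complex.axioms(1)[OF DR])
lemma ring_R: "ring R" by (rule cring.axioms(1)[OF cring_R])

lemmas form_closed [simp] = de_rham_complex.frm_closed[OF DA]
lemmas form_mult = de_rham_complex.frm_mult[OF DA]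
lemmas form_add = de_rham_complex.frm_add[OF DA]
lemmas form_one = de_rham_complex.frm_one[OF DA]
lemmas form_zero = de_rham_complex.frm_zero[OF DA]
lemmas form_hom = de_rham_complex.frm_hom[OF DA]
lemmas form_degree = de_rham_complex.frm_degree[OF DA]
lemmas form_d_add = de_rham_complex.d_add[OF DA]
lemmas form_d_one = de_rham_complex.d_one[OF DA]
lemmas form_d_power = de_rham_complex.d_power[OF DA]
lemmas diff_form = de_rham_complex.d_frm[OF DA]
lemmas diff_diff = de_rham_complex.d_d[OF DA]
lemmas graded_ring_OA = de_rham_complex.graded_ring_Om[OF DA]
lemmas OA_homogeneous_sum = de_rham_complex.Om_homogeneous_sum[OF DA]
lemmas form_zero_R = de_rham_complex.frm_zero[OF DR]
lemmas OQ_degree = de_rham_complex.degree_zero[OF DQ, folded de_rham_rat_def]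
  de_rham_complex.degree_add[OF DQ, folded de_rham_rat_def]
  de_rham_complex.degree_minus[OF DQ, folded de_rham_rat_def]
  de_rham_complex.degree_mult[OF DQ, folded de_rham_rat_def]
  de_rham_complex.d_degree[OF DQ, folded de_rham_rat_def]
lemmas unit_fraction_degree = rational_forms.unit_fraction_degree[OF rat]
lemmas unit_fraction_closed [simp] =
  de_rham_complex.degree_closed[OF DQ, folded de_rham_rat_def, OF unit_fraction_degree]
lemmas unit_fraction_cancel = rational_forms.unit_fraction_cancel[OF rat]
lemmas rat_form_one = rational_forms.rat_form_one[OF rat]
lemmas tr_d = rational_forms.to_rat_d[OF rat]
lemmas tr_degree = rational_forms.to_rat_degree[OF rat]
lemmas dwork_cong = frobenius_forms.dwork_cong[OF frob]
lemmas dwork_add = frobenius_forms.dwork_add[OF frob]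
lemmas dwork_uminus = frobenius_forms.dwork_uminus[OF frob]
lemmas dwork_mult = frobenius_forms.dwork_mult[OF frob]
lemmas dwork_one = frobenius_forms.dwork_one[OF frob]
lemmas dwork_divided_differential = frobenius_forms.dwork_divided_differential[OF frob]
lemmas dwork_Verschiebung = frobenius_forms.dwork_Verschiebung[OF frob]

lemma ring_OQ: "ring OQ"
  unfolding de_rham_rat_def by (rule de_rham_complex.ring_Om[OF DQ])

lemma morphism: "de_rham_morphism A0 A i R0 R f \<pi>"
  by (intro de_rham_morphism.intro de_rham_morphism_axioms.intro DA DR \<pi> \<pi>_base)

lemmas pr_form = de_rham_morphism.U_frm[OF morphism]
lemmas pr_d = de_rham_morphism.U_d[OF morphism]

sublocale OA: ring "de_rham A0 A i" by (rule de_rham_complex.ring_Om[OF DA])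
sublocale OQ: ring "de_rham_rat A0 A i" by (rule ring_OQ)
sublocale OR: ring "de_rham R0 R f" by (rule de_rham_complex.ring_Om[OF DR])
sublocale dA: abelian_group_hom "de_rham A0 A i" "de_rham A0 A i" "differential (de_rham A0 A i)"
  by (rule de_rham_complex.d_hom[OF DA])
sublocale dQ: abelian_group_hom "de_rham_rat A0 A i" "de_rham_rat A0 A i" "differential (de_rham_rat A0 A i)"
  unfolding de_rham_rat_def by (rule de_rham_complex.d_hom[OF DQ])
sublocale pr: ring_hom_ring "de_rham A0 A i" "de_rham R0 R f" "de_rham_map A R0 R f \<pi>"
  by (rule ring_hom_ringI2[OF OA.ring_axioms OR.ring_axioms de_rham_morphism.U_hom[OF morphism]])
sublocale tr: ring_hom_ring "de_rham A0 A i" "de_rham_rat A0 A i" "de_rham_to_rat A0 A i"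
  by (rule ring_hom_ringI2[OF OA.ring_axioms ring_OQ rational_forms.to_rat_hom[OF rat]])

lemma tr_inj: "x \<in> carrier OA \<Longrightarrow> y \<in> carrier OA \<Longrightarrow> tr x = tr y \<Longrightarrow> x = y"
  by (rule rational_forms.to_rat_inj[OF rat tfA])

lemma OQ_degree_one: "\<one>\<^bsub>OQ\<^esub> \<in> degree_part OQ 0"
  using tr_degree[OF form_degree[of "\<one>\<^bsub>A\<^esub>" "[]"]] by (simp add: form_one)

lemma S_pos: "m \<in> S \<Longrightarrow> m > 0" using p1 by (auto simp: S)
lemma S_mem: "k \<le> n \<Longrightarrow> p ^ k \<in> S" by (auto simp: S)

lemma GD_simps:
  "carrier GD = S \<rightarrow>\<^sub>E carrier OQ"
  "x \<otimes>\<^bsub>GD\<^esub> y = (\<lambda>k\<in>S. x k \<otimes>\<^bsub>OQ\<^esub> y k)"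
  "\<one>\<^bsub>GD\<^esub> = (\<lambda>k\<in>S. \<one>\<^bsub>OQ\<^esub>)"
  "\<zero>\<^bsub>GD\<^esub> = (\<lambda>k\<in>S. \<zero>\<^bsub>OQ\<^esub>)"
  "x \<oplus>\<^bsub>GD\<^esub> y = (\<lambda>k\<in>S. x k \<oplus>\<^bsub>OQ\<^esub> y k)"
  "degree_part GD q = S \<rightarrow>\<^sub>E degree_part OQ q"
  "differential GD x = (\<lambda>m\<in>S. rat_form A0 A i \<one>\<^bsub>A\<^esub> (1 / of_nat m) \<otimes>\<^bsub>OQ\<^esub> differential OQ (x m))"
  by (simp_all add: ghost_dg_def ring.defs power_ring_simps)

lemma ring_GD: "ring GD"
  by (rule ring_cong_ops[OF ring.ring_power_ring[OF OQ.ring_axioms, of S]])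
    (simp_all add: ghost_dg_def ring.defs)

sublocale GD: ring "ghost_dg S A0 A i" by (rule ring_GD)

lemma GD_minus: "x \<in> carrier GD \<Longrightarrow> \<ominus>\<^bsub>GD\<^esub> x = (\<lambda>k\<in>S. \<ominus>\<^bsub>OQ\<^esub> x k)"
  by (rule GD.minus_equality) (auto simp: GD_simps PiE_iff OQ.l_neg cong: restrict_cong)

lemma graded_ring_GD: "graded_ring GD"
proof (intro graded_ring.intro ring_GD graded_ring_axioms.intro)
  fix q r x y
  show "\<zero>\<^bsub>GD\<^esub> \<in> degree_part GD q" by (simp add: GD_simps OQ_degree)
  show "\<one>\<^bsub>GD\<^esub> \<in> degree_part GD 0"
    by (simp add: GD_simps OQ_degree_one)
  assume x: "x \<in> carrier GD" "x \<in> degree_part GD q"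
  show "\<ominus>\<^bsub>GD\<^esub> x \<in> degree_part GD q" using x by (auto simp: GD_minus GD_simps PiE_iff OQ_degree)
  show "differential GD x \<in> degree_part GD (Suc q)"
  proof -
    have "rat_form A0 A i \<one>\<^bsub>A\<^esub> (1 / of_nat m) \<otimes>\<^bsub>OQ\<^esub> differential OQ (x m) \<in> degree_part OQ (0 + Suc q)"
      if "m \<in> S" for m
      using x(2) that by (intro OQ_degree(4) unit_fraction_degree OQ_degree(5)) (auto simp: GD_simps)
    then show ?thesis by (simp add: GD_simps)
  qed
  show "x \<oplus>\<^bsub>GD\<^esub> y \<in> degree_part GD q" if "y \<in> carrier GD" "y \<in> degree_part GD q"
    using x that by (auto simp: GD_simps PiE_iff OQ_degree)
  show "x \<otimes>\<^bsub>GD\<^esub> y \<in> degree_part GD (q + r)" if "y \<in> carrier GD" "y \<in> degree_part GD r"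
    using x that by (auto simp: GD_simps PiE_iff OQ_degree)
next
  show "abelian_group_hom GD GD (differential GD)"
  proof (rule additive_mapI[OF GD.abelian_group_axioms GD.abelian_group_axioms])
    fix x assume x: "x \<in> carrier GD"
    then show "differential GD x \<in> carrier GD" by (auto simp: GD_simps PiE_iff)
    fix y assume y: "y \<in> carrier GD"
    have da: "differential OQ (a \<oplus>\<^bsub>OQ\<^esub> b) = differential OQ a \<oplus>\<^bsub>OQ\<^esub> differential OQ b"
      if "a \<in> carrier OQ" "b \<in> carrier OQ" for a b
      using that by simp
    show "differential GD (x \<oplus>\<^bsub>GD\<^esub> y) = differential GD x \<oplus>\<^bsub>GD\<^esub> differential GD y"
      unfolding GD_simps by (rule restrict_ext)
        (use x y in \<open>auto simp: GD_simps PiE_iff da OQ.r_distr\<close>)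
  qed
qed

sublocale GD: graded_ring "ghost_dg S A0 A i" by (rule graded_ring_GD)

definition emb where "emb w = (\<lambda>m\<in>S. tr (w m))"

lemma emb_closed: "(\<And>m. m \<in> S \<Longrightarrow> w m \<in> carrier OA) \<Longrightarrow> emb w \<in> carrier GD"
  by (auto simp: emb_def GD_simps)

lemma emb_inj:
  assumes "emb w = emb v" "m \<in> S" "w m \<in> carrier OA" "v m \<in> carrier OA"
  shows "w m = v m"
proof (rule tr_inj[OF assms(3,4)])
  show "tr (w m) = tr (v m)" using fun_cong[OF assms(1), of m] assms(2) by (simp add: emb_def)
qed

lemma emb_ops:
  assumes "\<And>m. m \<in> S \<Longrightarrow> w m \<in> carrier OA" "\<And>m. m \<in> S \<Longrightarrow> v m \<in> carrier OA"
  shows "emb w \<oplus>\<^bsub>GD\<^esub> emb v = emb (\<lambda>m. w m \<oplus>\<^bsub>OA\<^esub> v m)"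
    and "emb w \<otimes>\<^bsub>GD\<^esub> emb v = emb (\<lambda>m. w m \<otimes>\<^bsub>OA\<^esub> v m)"
    and "\<ominus>\<^bsub>GD\<^esub> emb w = emb (\<lambda>m. \<ominus>\<^bsub>OA\<^esub> w m)"
  proof -
  show "\<ominus>\<^bsub>GD\<^esub> emb w = emb (\<lambda>m. \<ominus>\<^bsub>OA\<^esub> w m)"
  proof -
    have w: "emb w \<in> carrier GD" using assms by (intro emb_closed)
    show ?thesis
    using GD_minus[OF w] unfolding emb_def by (simp add: assms cong: restrict_cong)
  qed
qed (auto simp: assms GD_simps emb_def intro!: restrict_ext)

text \<open>The differential of the ambient ring divides by \<open>m\<close>; stated with a multiplication, it makes sense for
  integral families.\<close>

definition derivative where
  "derivative w v \<longleftrightarrow> (\<forall>m\<in>S. w m \<in> carrier OA \<and> v m \<in> carrier OA \<and> [m] \<cdot>\<^bsub>OA\<^esub> v m = differential OA (w m))"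

lemma derivative_emb: "derivative w v \<Longrightarrow> differential GD (emb w) = emb v"
  unfolding emb_def GD_simps
proof (rule restrict_ext)
  fix m assume dv: "derivative w v" and m: "m \<in> S"
  then have c: "w m \<in> carrier OA" "v m \<in> carrier OA" "[m] \<cdot>\<^bsub>OA\<^esub> v m = differential OA (w m)"
    by (auto simp: derivative_def)
  have "differential OQ (restrict (\<lambda>m. tr (w m)) S m) = tr ([m] \<cdot>\<^bsub>OA\<^esub> v m)"
    using m tr_d[OF c(1)] c(3) by simp
  then show "rat_form A0 A i \<one>\<^bsub>A\<^esub> (1 / rat_of_nat m) \<otimes>\<^bsub>OQ\<^esub> differential OQ (restrict (\<lambda>m. tr (w m)) S m) = tr (v m)"
    using unit_fraction_cancel[OF S_pos[OF m] c(2)] by (simp only:)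
qed

lemma derivative_add: "derivative w v \<Longrightarrow> derivative w' v' \<Longrightarrow>
    derivative (\<lambda>m. w m \<oplus>\<^bsub>OA\<^esub> w' m) (\<lambda>m. v m \<oplus>\<^bsub>OA\<^esub> v' m)"
  by (simp add: derivative_def OA.add.nat_pow_distrib)

lemma derivative_minus: "derivative w v \<Longrightarrow> derivative (\<lambda>m. \<ominus>\<^bsub>OA\<^esub> w m) (\<lambda>m. \<ominus>\<^bsub>OA\<^esub> v m)"
  by (simp add: derivative_def OA.add.nat_pow_inv)

lemma derivative_mult:
  obtains \<sigma> where "\<sigma> \<in> ring_hom OA OA"
    "\<And>x. x \<in> carrier OA \<Longrightarrow> differential OA (\<sigma> x) = \<ominus>\<^bsub>OA\<^esub> \<sigma> (differential OA x)"
    "\<And>a. a \<in> carrier A \<Longrightarrow> \<sigma> (fA a []) = fA a []"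
    "\<And>w v w' v'. derivative w v \<Longrightarrow> derivative w' v' \<Longrightarrow>
      derivative (\<lambda>m. w m \<otimes>\<^bsub>OA\<^esub> w' m) (\<lambda>m. \<sigma> (w m) \<otimes>\<^bsub>OA\<^esub> v' m \<oplus>\<^bsub>OA\<^esub> v m \<otimes>\<^bsub>OA\<^esub> w' m)"
proof -
  obtain \<sigma> where \<sigma>: "\<sigma> \<in> ring_hom OA OA"
    and \<sigma>f: "\<And>b bs. b \<in> carrier A \<Longrightarrow> set bs \<subseteq> carrier A \<Longrightarrow>
      \<sigma> (fA b bs) = de_rham_complex.signed A0 A i (length bs) (fA b bs)"
    and \<sigma>d: "\<And>x. x \<in> carrier OA \<Longrightarrow> differential OA (\<sigma> x) = \<ominus>\<^bsub>OA\<^esub> \<sigma> (differential OA x)"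
    and leib: "\<And>x y. x \<in> carrier OA \<Longrightarrow> y \<in> carrier OA \<Longrightarrow>
      differential OA (x \<otimes>\<^bsub>OA\<^esub> y) = \<sigma> x \<otimes>\<^bsub>OA\<^esub> differential OA y \<oplus>\<^bsub>OA\<^esub> differential OA x \<otimes>\<^bsub>OA\<^esub> y"
    by (rule de_rham_complex.differential_exists[OF DA]) blast
  have sc: "\<sigma> x \<in> carrier OA" if "x \<in> carrier OA" for x using ring_hom_closed[OF \<sigma> that] .
  have "derivative (\<lambda>m. w m \<otimes>\<^bsub>OA\<^esub> w' m) (\<lambda>m. \<sigma> (w m) \<otimes>\<^bsub>OA\<^esub> v' m \<oplus>\<^bsub>OA\<^esub> v m \<otimes>\<^bsub>OA\<^esub> w' m)"
    if dv: "derivative w v" "derivative w' v'" for w v w' v'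
    unfolding derivative_def
  proof (intro ballI conjI)
    fix m assume m: "m \<in> S"
    then have c: "w m \<in> carrier OA" "v m \<in> carrier OA" "w' m \<in> carrier OA" "v' m \<in> carrier OA"
      "[m] \<cdot>\<^bsub>OA\<^esub> v m = differential OA (w m)" "[m] \<cdot>\<^bsub>OA\<^esub> v' m = differential OA (w' m)"
      using dv by (auto simp: derivative_def)
    then show "w m \<otimes>\<^bsub>OA\<^esub> w' m \<in> carrier OA"
      "\<sigma> (w m) \<otimes>\<^bsub>OA\<^esub> v' m \<oplus>\<^bsub>OA\<^esub> v m \<otimes>\<^bsub>OA\<^esub> w' m \<in> carrier OA" using sc by auto
    show "[m] \<cdot>\<^bsub>OA\<^esub> (\<sigma> (w m) \<otimes>\<^bsub>OA\<^esub> v' m \<oplus>\<^bsub>OA\<^esub> v m \<otimes>\<^bsub>OA\<^esub> w' m) = differential OA (w m \<otimes>\<^bsub>OA\<^esub> w' m)"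
      using c sc OA.add_pow_rdistr[of "\<sigma> (w m)" "v' m" m] OA.add_pow_ldistr[of "v m" "w' m" m]
      by (simp add: OA.add.nat_pow_distrib leib)
  qed
  moreover have "\<sigma> (fA a []) = fA a []" if "a \<in> carrier A" for a
    using \<sigma>f[OF that, of "[]"] by (simp add: de_rham_complex.signed_def[OF DA])
  ultimately show thesis using that[OF \<sigma> \<sigma>d] by blast
qed

text \<open>Since \<open>m dv\<^sub>m = d dw\<^sub>m = 0\<close> and forms have no torsion.\<close>

lemma derivative_derivative: "derivative w v \<Longrightarrow> derivative v (\<lambda>m. \<zero>\<^bsub>OA\<^esub>)"
  unfolding derivative_def
proof (intro ballI conjI)
  fix m assume dv: "\<forall>m\<in>S. w m \<in> carrier OA \<and> v m \<in> carrier OA \<and> [m] \<cdot>\<^bsub>OA\<^esub> v m = differential OA (w m)" and m: "m \<in> S"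
  then have "[m] \<cdot>\<^bsub>OA\<^esub> differential OA (v m) = \<zero>\<^bsub>OA\<^esub>"
    using dA.hom_add_pow[of "v m" m] diff_diff[of "w m"] by simp
  then have "differential OA (v m) = \<zero>\<^bsub>OA\<^esub>" using tfA[OF S_pos[OF m]] dv m by simp
  then show "[m] \<cdot>\<^bsub>OA\<^esub> \<zero>\<^bsub>OA\<^esub> = differential OA (v m)" by simp
qed auto

end

section \<open>The ghost image satisfies the congruences\<close>

context ghost_presentation
begin

text \<open>A subring of the families of forms that is closed under the divided differential and contains
  the \<open>V\<^sub>m\<langle>a\<rangle>\<close>, hence contains all of the differential graded ring of the \<open>V\<^sub>m\<langle>a\<rangle>\<close>.\<close>

definition T where "T = {w. (\<exists>v. derivative w v) \<and> dwork n (\<lambda>k. pr (w (p ^ k)))}"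

lemma T_closed: "w \<in> T \<Longrightarrow> m \<in> S \<Longrightarrow> w m \<in> carrier OA"
  by (auto simp: T_def derivative_def)

lemma T_cong:
  assumes "w \<in> T" "\<And>m. m \<in> S \<Longrightarrow> w m = w' m"
  shows "w' \<in> T"
proof -
  obtain v where "derivative w v" using assms(1) by (auto simp: T_def)
  then have "derivative w' v" using assms(2) by (simp add: derivative_def)
  moreover have "dwork n (\<lambda>k. pr (w' (p ^ k)))"
    by (rule dwork_cong[of n "\<lambda>k. pr (w (p ^ k))"]) (use assms S_mem in \<open>auto simp: T_def\<close>)
  ultimately show ?thesis by (auto simp: T_def)
qed

lemma T_add: assumes "w \<in> T" "w' \<in> T" shows "(\<lambda>m. w m \<oplus>\<^bsub>OA\<^esub> w' m) \<in> T"
proof -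
  have "dwork n (\<lambda>k. pr (w (p ^ k)) \<oplus>\<^bsub>OR\<^esub> pr (w' (p ^ k)))"
    by (rule dwork_add) (use assms in \<open>auto simp: T_def\<close>)
  then have "dwork n (\<lambda>k. pr (w (p ^ k) \<oplus>\<^bsub>OA\<^esub> w' (p ^ k)))"
    by (rule dwork_cong) (use assms T_closed S_mem in simp)
  then show ?thesis using assms derivative_add unfolding T_def by blast
qed

lemma T_minus: assumes "w \<in> T" shows "(\<lambda>m. \<ominus>\<^bsub>OA\<^esub> w m) \<in> T"
proof -
  have "dwork n (\<lambda>k. \<ominus>\<^bsub>OR\<^esub> pr (w (p ^ k)))"
    by (rule dwork_uminus) (use assms in \<open>auto simp: T_def\<close>)
  then have "dwork n (\<lambda>k. pr (\<ominus>\<^bsub>OA\<^esub> w (p ^ k)))"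
    by (rule dwork_cong) (use assms T_closed S_mem in simp)
  then show ?thesis using assms derivative_minus unfolding T_def by blast
qed

lemma T_mult: assumes "w \<in> T" "w' \<in> T" shows "(\<lambda>m. w m \<otimes>\<^bsub>OA\<^esub> w' m) \<in> T"
proof -
  have "dwork n (\<lambda>k. pr (w (p ^ k)) \<otimes>\<^bsub>OR\<^esub> pr (w' (p ^ k)))"
    by (rule dwork_mult) (use assms in \<open>auto simp: T_def\<close>)
  then have 1: "dwork n (\<lambda>k. pr (w (p ^ k) \<otimes>\<^bsub>OA\<^esub> w' (p ^ k)))"
    by (rule dwork_cong) (use assms T_closed S_mem in simp)
  obtain v v' where dv: "derivative w v" "derivative w' v'" using assms by (auto simp: T_def)
  have "\<exists>u. derivative (\<lambda>m. w m \<otimes>\<^bsub>OA\<^esub> w' m) u"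
    by (rule derivative_mult) (use dv in blast)
  then show ?thesis using 1 by (auto simp: T_def)
qed

lemma T_derivative: assumes "w \<in> T" "derivative w v" shows "v \<in> T"
proof -
  have "dwork n (\<lambda>k. pr (v (p ^ k)))"
  proof (rule dwork_divided_differential)
    show "dwork n (\<lambda>k. pr (w (p ^ k)))" using assms by (simp add: T_def)
    fix k assume "k \<le> n"
    then have "p ^ k \<in> S" by (rule S_mem)
    then have c: "w (p ^ k) \<in> carrier OA" "v (p ^ k) \<in> carrier OA"
      "[(p ^ k)] \<cdot>\<^bsub>OA\<^esub> v (p ^ k) = differential OA (w (p ^ k))" using assms(2) by (auto simp: derivative_def)
    then show "pr (v (p ^ k)) \<in> carrier OR" by simp
    show "[(p ^ k)] \<cdot>\<^bsub>OR\<^esub> pr (v (p ^ k)) = differential OR (pr (w (p ^ k)))"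
      using c pr.hom_add_pow[OF c(2), of "p ^ k"] pr_d[OF c(1)] by simp
  qed
  then show ?thesis using derivative_derivative[OF assms(2)] by (auto simp: T_def)
qed

lemma const_derivative: "a \<in> carrier A \<Longrightarrow> fA \<one>\<^bsub>A\<^esub> [a] = \<zero>\<^bsub>OA\<^esub> \<Longrightarrow> derivative (\<lambda>m. fA a []) (\<lambda>m. \<zero>\<^bsub>OA\<^esub>)"
  by (simp add: derivative_def diff_form)

lemma T_one: "(\<lambda>m. \<one>\<^bsub>OA\<^esub>) \<in> T"
  using const_derivative[of "\<one>\<^bsub>A\<^esub>"] dwork_one by (auto simp: T_def form_one form_d_one)

lemma T_zero: "(\<lambda>m. \<zero>\<^bsub>OA\<^esub>) \<in> T"
  using T_add[OF T_one T_minus[OF T_one]] by (simp add: OA.r_neg)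

text \<open>The divided differential of \<open>V\<^sub>m\<langle>a\<rangle>\<close> has components \<open>a\<^bsup>k/m-1\<^esup> da\<close>.\<close>

definition V_form where "V_form m a k = fA (V_elem S A m a k) []"
definition dV_form :: "nat \<Rightarrow> 'a \<Rightarrow> nat \<Rightarrow> ('a list \<Rightarrow> 'a) set" where
  "dV_form m a k = (if m dvd k then fA (a [^]\<^bsub>A\<^esub> (k div m - 1)) [a] else \<zero>\<^bsub>OA\<^esub>)"

lemma V_closed: "a \<in> carrier A \<Longrightarrow> k \<in> S \<Longrightarrow> V_elem S A m a k \<in> carrier A"
  by (simp add: V_elem_def)

lemma V_derivative:
  assumes a: "a \<in> carrier A"
  shows "derivative (V_form m a) (dV_form m a)"
  unfolding derivative_def
proof (intro ballI conjI)
  fix k assume k: "k \<in> S"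
  show "V_form m a k \<in> carrier OA" using V_closed[OF a k] by (simp add: V_form_def)
  show "dV_form m a k \<in> carrier OA" using a by (simp add: dV_form_def)
  interpret dh: abelian_group_hom A OA "\<lambda>a. fA \<one>\<^bsub>A\<^esub> [a]"
    by (rule additive_mapI) (auto simp: form_d_add A.abelian_group_axioms OA.abelian_group_axioms)
  show "[k] \<cdot>\<^bsub>OA\<^esub> dV_form m a k = differential OA (V_form m a k)"
  proof (cases "m dvd k")
    case True
    then have km: "(k div m) * m = k" by simp
    let ?x = "fA (a [^]\<^bsub>A\<^esub> (k div m - 1)) [a]"
    have x: "?x \<in> carrier OA" using a by simp
    have "differential OA (V_form m a k) = fA \<one>\<^bsub>A\<^esub> [[m] \<cdot>\<^bsub>A\<^esub> (a [^]\<^bsub>A\<^esub> (k div m))]"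
      using True k a by (simp add: V_form_def V_elem_def diff_form)
    also have "\<dots> = [m] \<cdot>\<^bsub>OA\<^esub> ([(k div m)] \<cdot>\<^bsub>OA\<^esub> ?x)"
      using a dh.hom_add_pow[of "a [^]\<^bsub>A\<^esub> (k div m)" m] by (simp add: form_d_power)
    also have "\<dots> = [k] \<cdot>\<^bsub>OA\<^esub> ?x"
      using OA.add.nat_pow_pow[OF x, of m "k div m"] km by (simp add: mult.commute)
    finally show ?thesis using True by (simp add: dV_form_def)
  next
    case False
    then show ?thesis using k by (simp add: V_form_def dV_form_def V_elem_def form_zero)
  qed
qed

lemma V_T:
  assumes a: "a \<in> carrier A" and m: "m \<in> S"
  shows "V_form m a \<in> T"
proof -
  obtain j where j: "m = p ^ j" using m by (auto simp: S)
  interpret \<pi>: ring_hom_cring A R \<pi>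
    by (intro ring_hom_cring.intro ring_hom_cring_axioms.intro A.cring_axioms cring_R \<pi>)
  have pa: "\<pi> a \<in> carrier R" using a by simp
  have "dwork n (\<lambda>k. pr (V_form m a (p ^ k)))"
  proof (rule dwork_cong[OF dwork_Verschiebung[OF pa, of n j]])
    fix k assume k: "k \<le> n"
    have dv: "p ^ j dvd p ^ k \<longleftrightarrow> j \<le> k" using p1 power_dvd_imp_le[of p j k] le_imp_power_dvd[of j k p] by blast
    show "(if j \<le> k then fR ([(p ^ j)] \<cdot>\<^bsub>R\<^esub> (\<pi> a [^]\<^bsub>R\<^esub> (p ^ (k - j)))) [] else \<zero>\<^bsub>OR\<^esub>) = pr (V_form m a (p ^ k))"
      using k a S_mem[OF k] p1 dv j additive_map_of_ring_hom[OF A.ring_axioms ring_R \<pi>, THEN abelian_group_hom.hom_add_pow]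
      by (auto simp: V_form_def V_elem_def pr_form power_diff \<pi>.ring.hom_nat_pow form_zero_R)
  qed
  then show ?thesis using V_derivative[OF a] by (auto simp: T_def)
qed

lemma X_embed_eq: "x \<in> carrier (power_ring S A) \<Longrightarrow> X_embed S A0 A i x = emb (\<lambda>k. fA (x k) [])"
  unfolding X_embed_def emb_def by (rule restrict_ext) (auto simp: power_ring_simps rat_form_one PiE_iff)

sublocale PA: ring "power_ring S A" by (rule A.ring_power_ring)

abbreviation gensX where "gensX \<equiv> {V_elem S A m a | m a. m \<in> S \<and> a \<in> carrier A}"

lemma V_elem_closed: "a \<in> carrier A \<Longrightarrow> V_elem S A m a \<in> carrier (power_ring S A)"
  by (auto simp: power_ring_simps V_elem_def)

lemma gensX_closed: "gensX \<subseteq> carrier (power_ring S A)"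
  using V_elem_closed by auto

lemma X_ring_closed: "X_ring S A \<subseteq> carrier (power_ring S A)"
  unfolding X_ring_def by (rule PA.generate_ring_incl[OF gensX_closed])

lemma frm_nil_hom: "abelian_group_hom A OA (\<lambda>b. fA b [])"
  by (rule form_hom) simp

lemma X_ring_T:
  assumes "x \<in> X_ring S A"
  shows "(\<lambda>k. fA (x k) []) \<in> T"
  using assms[unfolded X_ring_def]
proof (induction rule: generate_ring.induct)
  case one
  show ?case by (rule T_cong[OF T_one]) (simp add: power_ring_simps form_one)
next
  case (incl h)
  then obtain m a where ma: "m \<in> S" "a \<in> carrier A" "h = V_elem S A m a" by blast
  show ?case using V_T[OF ma(2,1)] by (rule T_cong) (simp add: V_form_def ma(3))
next
  case (a_inv h)
  then have h: "h \<in> carrier (power_ring S A)" using PA.generate_ring_in_carrier[OF gensX_closed] by blast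
  have eq: "\<ominus>\<^bsub>power_ring S A\<^esub> h = (\<lambda>k\<in>S. \<ominus>\<^bsub>A\<^esub> h k)"
    by (rule PA.minus_equality) (use h in \<open>auto simp: power_ring_simps PiE_iff A.l_neg cong: restrict_cong\<close>)
  show ?case using T_minus[OF a_inv.IH]
    by (rule T_cong) (use h in \<open>auto simp: eq power_ring_simps PiE_iff abelian_group_hom.hom_a_inv[OF frm_nil_hom]\<close>)
next
  case (eng_add h1 h2)
  then have h: "h1 \<in> carrier (power_ring S A)" "h2 \<in> carrier (power_ring S A)"
    using PA.generate_ring_in_carrier[OF gensX_closed] by blast+
  show ?case using T_add[OF eng_add.IH]
    by (rule T_cong) (use h in \<open>auto simp: power_ring_simps PiE_iff form_add\<close>)
next
  case (eng_mult h1 h2)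
  then have h: "h1 \<in> carrier (power_ring S A)" "h2 \<in> carrier (power_ring S A)"
    using PA.generate_ring_in_carrier[OF gensX_closed] by blast+
  show ?case using T_mult[OF eng_mult.IH]
    by (rule T_cong) (use h in \<open>auto simp: power_ring_simps PiE_iff form_mult\<close>)
qed

lemma X_embed_T: "x \<in> X_ring S A \<Longrightarrow> X_embed S A0 A i x \<in> emb ` T"
  using X_embed_eq X_ring_closed X_ring_T by blast

lemma X_embed_degree: "x \<in> X_ring S A \<Longrightarrow> X_embed S A0 A i x \<in> degree_part GD 0"
proof -
  assume x: "x \<in> X_ring S A"
  then have xc: "x k \<in> carrier A" if "k \<in> S" for k
    using X_ring_closed that by (auto simp: power_ring_simps PiE_iff)
  then have "rat_form A0 A i (x k) 1 \<in> degree_part OQ 0" if "k \<in> S" for k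
    using that form_degree[of "x k" "[]"] by (simp add: rat_form_one tr_degree)
  then show ?thesis by (auto simp: X_embed_def GD_simps)
qed

abbreviation UX where "UX \<equiv> X_embed S A0 A i ` X_ring S A"
definition Xc where "Xc = dg_subring_gen GD UX"

lemma embT:
  shows "emb ` T \<subseteq> carrier GD" "\<zero>\<^bsub>GD\<^esub> \<in> emb ` T"
    "\<And>x y. x \<in> emb ` T \<Longrightarrow> y \<in> emb ` T \<Longrightarrow> x \<oplus>\<^bsub>GD\<^esub> y \<in> emb ` T"
    "\<And>x. x \<in> emb ` T \<Longrightarrow> \<ominus>\<^bsub>GD\<^esub> x \<in> emb ` T"
    "\<one>\<^bsub>GD\<^esub> \<in> emb ` T"
    "\<And>x y. x \<in> emb ` T \<Longrightarrow> y \<in> emb ` T \<Longrightarrow> x \<otimes>\<^bsub>GD\<^esub> y \<in> emb ` T"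
    "\<And>x. x \<in> emb ` T \<Longrightarrow> differential GD x \<in> emb ` T"
proof -
  show "emb ` T \<subseteq> carrier GD" using emb_closed T_closed by auto
  have "emb (\<lambda>m. \<zero>\<^bsub>OA\<^esub>) = \<zero>\<^bsub>GD\<^esub>" "emb (\<lambda>m. \<one>\<^bsub>OA\<^esub>) = \<one>\<^bsub>GD\<^esub>" by (auto simp: emb_def GD_simps)
  then show "\<zero>\<^bsub>GD\<^esub> \<in> emb ` T" "\<one>\<^bsub>GD\<^esub> \<in> emb ` T" using T_zero T_one by (metis imageI)+
  fix x assume "x \<in> emb ` T"
  then obtain w where w: "w \<in> T" "x = emb w" by blast
  have wc: "\<And>m. m \<in> S \<Longrightarrow> w m \<in> carrier OA" using T_closed[OF w(1)] .
  have "\<ominus>\<^bsub>GD\<^esub> emb w = emb (\<lambda>m. \<ominus>\<^bsub>OA\<^esub> w m)" by (rule emb_ops(3)[of w w]) (fact wc)+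
  then show "\<ominus>\<^bsub>GD\<^esub> x \<in> emb ` T" unfolding w(2) using T_minus[OF w(1)] by simp
  obtain v where v: "derivative w v" using w(1) by (auto simp: T_def)
  show "differential GD x \<in> emb ` T" unfolding w(2) derivative_emb[OF v]
    using T_derivative[OF w(1) v] by (rule imageI)
  fix y assume "y \<in> emb ` T"
  then obtain w' where w': "w' \<in> T" "y = emb w'" by blast
  have w'c: "\<And>m. m \<in> S \<Longrightarrow> w' m \<in> carrier OA" using T_closed[OF w'(1)] .
  have "emb w \<oplus>\<^bsub>GD\<^esub> emb w' = emb (\<lambda>m. w m \<oplus>\<^bsub>OA\<^esub> w' m)" by (rule emb_ops(1)) (fact wc w'c)+
  then show "x \<oplus>\<^bsub>GD\<^esub> y \<in> emb ` T" unfolding w(2) w'(2) using T_add[OF w(1) w'(1)] by simp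
  have "emb w \<otimes>\<^bsub>GD\<^esub> emb w' = emb (\<lambda>m. w m \<otimes>\<^bsub>OA\<^esub> w' m)" by (rule emb_ops(2)) (fact wc w'c)+
  then show "x \<otimes>\<^bsub>GD\<^esub> y \<in> emb ` T" unfolding w(2) w'(2) using T_mult[OF w(1) w'(1)] by simp
qed

lemma dg_subring_family: "dg_subring (GD.graded_span (emb ` T)) GD" "UX \<subseteq> GD.graded_span (emb ` T)"
proof -
  show "dg_subring (GD.graded_span (emb ` T)) GD"
    by (rule GD.dg_subring_span[OF embT(1-4) embT(5-7)])
  show "UX \<subseteq> GD.graded_span (emb ` T)"
    using GD.homogeneous_in_span[OF embT(1-4)] X_embed_T X_embed_degree by blast
qed

lemma Xc_T: "Xc \<subseteq> emb ` T"
proof -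
  have "Xc \<subseteq> GD.graded_span (emb ` T)"
    unfolding Xc_def dg_subring_gen_def using dg_subring_family by blast
  then show ?thesis using GD.graded_span_P[OF embT(1-4)] by blast
qed

lemma Xc_subring: "subring Xc GD"
  unfolding Xc_def dg_subring_gen_def
  by (rule GD.subring_Inter) (use dg_subring_family in \<open>auto simp: dg_subring_def\<close>)

lemma Xc_diff: "x \<in> Xc \<Longrightarrow> differential GD x \<in> Xc"
  unfolding Xc_def dg_subring_gen_def by (auto simp: dg_subring_def)

lemma UX_Xc: "x \<in> X_ring S A \<Longrightarrow> X_embed S A0 A i x \<in> Xc"
  unfolding Xc_def dg_subring_gen_def by auto

text \<open>By minimality: the sums of homogeneous elements of the generated subring form a differential graded subring
  that contains the generators, which have degree 0.\<close>

lemma Xc_homogeneous_sum: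
  assumes "x \<in> Xc"
  shows "\<exists>M y. (\<forall>q\<le>M::nat. y q \<in> Xc \<and> y q \<in> degree_part GD q) \<and> x = (\<Oplus>\<^bsub>GD\<^esub>q\<in>{..M}. y q)"
proof -
  note sr = subringE[OF Xc_subring]
  note P = sr(1,2,7,5)
  have "dg_subring (GD.graded_span Xc) GD"
    by (rule GD.dg_subring_span[OF P sr(3,6) Xc_diff])
  moreover have "UX \<subseteq> GD.graded_span Xc"
    using GD.homogeneous_in_span[OF P] UX_Xc X_embed_degree by blast
  ultimately have "Xc \<subseteq> GD.graded_span Xc"
    by (subst (1) Xc_def) (auto simp: dg_subring_gen_def)
  then show ?thesis using assms unfolding GD.graded_span_def by blast
qed

end

lemma preimage_ideal:
  assumes h: "ring_hom_ring R S h" and I: "ideal I S"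
  shows "ideal {r \<in> carrier R. h r \<in> I} R"
proof -
  interpret h: ring_hom_ring R S h by (rule h)
  interpret I: ideal I S by (rule I)
  show ?thesis
  proof (rule idealI[OF h.R.ring_axioms])
    show "subgroup {r \<in> carrier R. h r \<in> I} (add_monoid R)"
      by (rule h.R.add.subgroupI) (auto intro: I.a_closed I.a_inv_closed intro!: exI[of _ "\<zero>\<^bsub>R\<^esub>"] I.zero_closed)
  qed (auto intro: I.I_l_closed I.I_r_closed)
qed

context ghost_presentation
begin

abbreviation KI where "KI \<equiv> kernel_forms A0 A i (a_kernel A R \<pi>)"
abbreviation XD where "XD \<equiv> X_dg S A0 A i"
abbreviation XR where "XR \<equiv> (power_ring S A)\<lparr>carrier := X_ring S A\<rparr>"
abbreviation XI where "XI \<equiv> X_dg_ideal S A0 A i (a_kernel A R \<pi>)"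

lemma \<pi>_ring_hom_cring: "ring_hom_cring A R \<pi>"
  by (intro ring_hom_cring.intro ring_hom_cring_axioms.intro A.cring_axioms cring_R \<pi>)

text \<open>To bound \<open>I\<^sup>\<bullet>\<close> it suffices to have an ideal, graded or not, that is closed under the differential.\<close>

lemma KI_span:
  assumes P: "P \<subseteq> carrier OA" "\<zero>\<^bsub>OA\<^esub> \<in> P"
      "\<And>x y. x \<in> P \<Longrightarrow> y \<in> P \<Longrightarrow> x \<oplus>\<^bsub>OA\<^esub> y \<in> P" "\<And>x. x \<in> P \<Longrightarrow> \<ominus>\<^bsub>OA\<^esub> x \<in> P"
    and absorb: "\<And>x r. x \<in> P \<Longrightarrow> r \<in> carrier OA \<Longrightarrow> r \<otimes>\<^bsub>OA\<^esub> x \<in> P"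
      "\<And>x r. x \<in> P \<Longrightarrow> r \<in> carrier OA \<Longrightarrow> x \<otimes>\<^bsub>OA\<^esub> r \<in> P"
    and diff: "\<And>x. x \<in> P \<Longrightarrow> differential OA x \<in> P"
    and gen: "\<And>a. a \<in> a_kernel A R \<pi> \<Longrightarrow> fA a [] \<in> P"
  shows "\<exists>H. dg_ideal H OA \<and> (\<lambda>a. fA a []) ` a_kernel A R \<pi> \<subseteq> H" and "KI \<subseteq> P"
proof -
  interpret G: graded_ring OA by (rule graded_ring_OA)
  have dgi: "dg_ideal (G.graded_span P) OA"
    by (rule G.dg_ideal_span[OF P OA_homogeneous_sum absorb diff])
  have gens: "(\<lambda>a. fA a []) ` a_kernel A R \<pi> \<subseteq> G.graded_span P"
  proof
    fix x assume "x \<in> (\<lambda>a. fA a []) ` a_kernel A R \<pi>"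
    then obtain a where a: "a \<in> a_kernel A R \<pi>" "x = fA a []" by blast
    then have "a \<in> carrier A" using a_kernel_iff[of a A R \<pi>] by blast
    then have d: "x \<in> degree_part OA 0" using form_degree[of a "[]"] a(2) by simp
    have xP: "x \<in> P" using gen[OF a(1)] a(2) by simp
    show "x \<in> G.graded_span P" by (rule G.homogeneous_in_span[OF P xP d])
  qed
  show "\<exists>H. dg_ideal H OA \<and> (\<lambda>a. fA a []) ` a_kernel A R \<pi> \<subseteq> H" using dgi gens by blast
  have "KI \<subseteq> G.graded_span P" unfolding kernel_forms_def dg_ideal_gen_def using dgi gens by blast
  then show "KI \<subseteq> P" using G.graded_span_P[OF P] by blast
qed

lemma pr_kernel_closed:
  shows "\<exists>H. dg_ideal H OA \<and> (\<lambda>a. fA a []) ` a_kernel A R \<pi> \<subseteq> H"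
    and "KI \<subseteq> {x \<in> carrier OA. pr x = \<zero>\<^bsub>OR\<^esub>}"
proof -
  have gen: "fA a [] \<in> {x \<in> carrier OA. pr x = \<zero>\<^bsub>OR\<^esub>}" if "a \<in> a_kernel A R \<pi>" for a
  proof -
    have a: "a \<in> carrier A" "\<pi> a = \<zero>\<^bsub>R\<^esub>" using that a_kernel_iff[of a A R \<pi>] by auto
    then show ?thesis using pr_form[of a "[]"] form_zero_R[of "[]"] by simp
  qed
  interpret dR: abelian_group_hom OR OR "differential OR" by (rule de_rham_complex.d_hom[OF DR])
  have diff: "differential OA x \<in> {x \<in> carrier OA. pr x = \<zero>\<^bsub>OR\<^esub>}"
    if "x \<in> {x \<in> carrier OA. pr x = \<zero>\<^bsub>OR\<^esub>}" for x
    using that pr_d[of x] by simp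
  show "\<exists>H. dg_ideal H OA \<and> (\<lambda>a. fA a []) ` a_kernel A R \<pi> \<subseteq> H"
    by (rule KI_span(1)[of "{x \<in> carrier OA. pr x = \<zero>\<^bsub>OR\<^esub>}"]) (use diff gen in auto)
  show "KI \<subseteq> {x \<in> carrier OA. pr x = \<zero>\<^bsub>OR\<^esub>}"
    by (rule KI_span(2)) (use diff gen in auto)
qed

lemma KI_pr: "x \<in> KI \<Longrightarrow> x \<in> carrier OA \<and> pr x = \<zero>\<^bsub>OR\<^esub>"
  using pr_kernel_closed(2) by blast

lemma KI_gen: "a \<in> a_kernel A R \<pi> \<Longrightarrow> fA a [] \<in> KI"
  by (auto simp: kernel_forms_def dg_ideal_gen_def)

lemma KI_d: "x \<in> KI \<Longrightarrow> differential OA x \<in> KI"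
  by (auto simp: kernel_forms_def dg_ideal_gen_def dg_ideal_def)

lemma KI_ideal: "ideal KI OA"
  unfolding kernel_forms_def dg_ideal_gen_def
  by (rule OA.i_Intersect) (use pr_kernel_closed(1) in \<open>auto simp: dg_ideal_def\<close>)

text \<open>The sign automorphism preserves \<open>I\<^sup>\<bullet>\<close>.  This is needed because the Leibniz rule for
  \<open>x y\<close> with \<open>x\<close> in \<open>I\<^sup>\<bullet>\<close> involves the sign-twisted factor.\<close>

lemma KI_sign:
  assumes \<sigma>: "\<sigma> \<in> ring_hom OA OA"
    and \<sigma>d: "\<And>x. x \<in> carrier OA \<Longrightarrow> differential OA (\<sigma> x) = \<ominus>\<^bsub>OA\<^esub> \<sigma> (differential OA x)"
    and \<sigma>c: "\<And>a. a \<in> carrier A \<Longrightarrow> \<sigma> (fA a []) = fA a []"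
    and x: "x \<in> KI"
  shows "\<sigma> x \<in> KI"
proof -
  interpret KI: ideal "kernel_forms A0 A i (a_kernel A R \<pi>)" "de_rham A0 A i" by (rule KI_ideal)
  have c: "y \<in> KI \<Longrightarrow> y \<in> carrier OA" for y using KI_pr by blast
  have sc: "y \<in> carrier OA \<Longrightarrow> \<sigma> y \<in> carrier OA" for y using ring_hom_closed[OF \<sigma>] .
  have s: "\<sigma> \<zero>\<^bsub>OA\<^esub> = \<zero>\<^bsub>OA\<^esub>" by (rule ring_hom_zero[OF \<sigma> OA.ring_axioms OA.ring_axioms])
  have sm: "\<sigma> (\<ominus>\<^bsub>OA\<^esub> y) = \<ominus>\<^bsub>OA\<^esub> \<sigma> y" if "y \<in> carrier OA" for y
    by (rule abelian_group_hom.hom_a_inv[OF additive_map_of_ring_hom[OF OA.ring_axioms OA.ring_axioms \<sigma>] that])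
  let ?P = "{y \<in> KI. \<sigma> y \<in> KI}"
  have "KI \<subseteq> ?P"
  proof (rule KI_span(2))
    show "?P \<subseteq> carrier OA" using c by blast
    show "\<zero>\<^bsub>OA\<^esub> \<in> ?P" using s KI.zero_closed by simp
    show "y \<oplus>\<^bsub>OA\<^esub> z \<in> ?P" if "y \<in> ?P" "z \<in> ?P" for y z
      using that c KI.a_closed by (simp add: ring_hom_add[OF \<sigma>])
    show "\<ominus>\<^bsub>OA\<^esub> y \<in> ?P" if "y \<in> ?P" for y
      using that c KI.a_inv_closed by (simp add: sm)
    show "r \<otimes>\<^bsub>OA\<^esub> y \<in> ?P" "y \<otimes>\<^bsub>OA\<^esub> r \<in> ?P" if "y \<in> ?P" "r \<in> carrier OA" for y r
      using that c sc KI.I_l_closed KI.I_r_closed by (simp_all add: ring_hom_mult[OF \<sigma>])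
    show "differential OA y \<in> ?P" if y: "y \<in> ?P" for y
    proof -
      have yc: "y \<in> carrier OA" using y c by blast
      have "\<sigma> (differential OA y) = \<ominus>\<^bsub>OA\<^esub> differential OA (\<sigma> y)"
        using \<sigma>d[OF yc] yc sc by simp
      then show ?thesis using y KI_d KI.a_inv_closed by simp
    qed
    show "fA a [] \<in> ?P" if "a \<in> a_kernel A R \<pi>" for a
      using KI_gen[OF that] that a_kernel_iff[of a A R \<pi>] by (simp add: \<sigma>c)
  qed
  then show ?thesis using x by blast
qed

lemma XD_eq: "XD = GD\<lparr>carrier := Xc\<rparr>"
  by (simp add: X_dg_def Xc_def)

lemma XD_simps: "carrier XD = Xc" "monoid.mult XD = monoid.mult GD" "\<one>\<^bsub>XD\<^esub> = \<one>\<^bsub>GD\<^esub>" "\<zero>\<^bsub>XD\<^esub> = \<zero>\<^bsub>GD\<^esub>"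
  "ring.add XD = ring.add GD" "degree_part XD = degree_part GD" "differential XD = differential GD"
  by (simp_all add: XD_eq)

lemma ring_XD: "ring XD"
  unfolding XD_eq by (rule GD.subring_is_ring[OF Xc_subring])

lemmas Xc_closed = subringE[OF Xc_subring]

lemma XD_minus: "x \<in> Xc \<Longrightarrow> \<ominus>\<^bsub>XD\<^esub> x = \<ominus>\<^bsub>GD\<^esub> x"
proof -
  interpret XD: ring XD by (rule ring_XD)
  assume x: "x \<in> Xc"
  show ?thesis
    by (rule XD.minus_equality) (use x Xc_closed(1,5) in \<open>auto simp: XD_simps GD.l_neg\<close>)
qed

lemma graded_ring_XD: "graded_ring XD"
proof (intro graded_ring.intro ring_XD graded_ring_axioms.intro)
  interpret XD: ring XD by (rule ring_XD)
  have sub: "x \<in> Xc \<Longrightarrow> x \<in> carrier GD" for x using Xc_closed(1) by blast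
  show "abelian_group_hom XD XD (differential XD)"
    by (rule additive_mapI[OF XD.abelian_group_axioms XD.abelian_group_axioms])
      (auto simp: XD_simps Xc_diff sub abelian_group_hom.hom_add[OF GD.diff_hom])
  fix q r x y
  show "\<zero>\<^bsub>XD\<^esub> \<in> degree_part XD q" "\<one>\<^bsub>XD\<^esub> \<in> degree_part XD 0"
    by (simp_all add: XD_simps GD.deg_zero GD.deg_one)
  assume x: "x \<in> carrier XD" "x \<in> degree_part XD q"
  show "\<ominus>\<^bsub>XD\<^esub> x \<in> degree_part XD q" "differential XD x \<in> degree_part XD (Suc q)"
    using x by (simp_all add: XD_simps XD_minus sub GD.deg_minus GD.diff_deg)
  show "x \<oplus>\<^bsub>XD\<^esub> y \<in> degree_part XD q" if "y \<in> carrier XD" "y \<in> degree_part XD q"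
    using x that by (simp add: XD_simps sub GD.deg_add)
  show "x \<otimes>\<^bsub>XD\<^esub> y \<in> degree_part XD (q + r)" if "y \<in> carrier XD" "y \<in> degree_part XD r"
    using x that by (simp add: XD_simps sub GD.deg_mult)
qed

interpretation XD: graded_ring "X_dg S A0 A i" by (rule graded_ring_XD)

text \<open>Elements of the ideal have components in \<open>I\<^sup>\<bullet>\<close>: families in \<open>I\<^sup>\<bullet>\<close> with divided differential in \<open>I\<^sup>\<bullet>\<close>
  form a differential graded ideal that contains the generators.\<close>

definition small where
  "small = {x \<in> Xc. \<exists>w v. x = emb w \<and> derivative w v \<and> (\<forall>m\<in>S. w m \<in> KI \<and> v m \<in> KI)}"

lemma smallI:
  assumes "x \<in> Xc" "x = emb w" "derivative w v" "\<And>m. m \<in> S \<Longrightarrow> w m \<in> KI" "\<And>m. m \<in> S \<Longrightarrow> v m \<in> KI"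
  shows "x \<in> small"
  using assms unfolding small_def by blast

lemma smallE:
  assumes "x \<in> small"
  obtains w v where "x \<in> Xc" "x = emb w" "derivative w v" "\<And>m. m \<in> S \<Longrightarrow> w m \<in> KI" "\<And>m. m \<in> S \<Longrightarrow> v m \<in> KI"
    "\<And>m. m \<in> S \<Longrightarrow> w m \<in> carrier OA" "\<And>m. m \<in> S \<Longrightarrow> v m \<in> carrier OA"
  using assms unfolding small_def derivative_def by blast

lemma Xc_cases:
  assumes "x \<in> Xc"
  obtains w v where "w \<in> T" "x = emb w" "derivative w v" "\<And>m. m \<in> S \<Longrightarrow> w m \<in> carrier OA"
    "\<And>m. m \<in> S \<Longrightarrow> v m \<in> carrier OA"
proof -
  obtain w where w: "w \<in> T" "x = emb w" using assms Xc_T by blast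
  then obtain v where v: "derivative w v" by (auto simp: T_def)
  show thesis by (rule that[OF w v]) (use v in \<open>auto simp: derivative_def\<close>)
qed

lemma small_ideal: "dg_ideal (XD.graded_span small) XD" and small_span: "XD.graded_span small \<subseteq> small"
  and small_homogeneous: "x \<in> small \<Longrightarrow> x \<in> degree_part GD q \<Longrightarrow> x \<in> XD.graded_span small"
proof -
  interpret KI: ideal "kernel_forms A0 A i (a_kernel A R \<pi>)" "de_rham A0 A i" by (rule KI_ideal)
  have zero: "\<zero>\<^bsub>XD\<^esub> \<in> small"
  proof (rule smallI)
    show "\<zero>\<^bsub>XD\<^esub> \<in> Xc" using Xc_closed(2) by (simp add: XD_simps)
    show "\<zero>\<^bsub>XD\<^esub> = emb (\<lambda>m. \<zero>\<^bsub>OA\<^esub>)" by (auto simp: XD_simps GD_simps emb_def)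
    show "derivative (\<lambda>m. \<zero>\<^bsub>OA\<^esub>) (\<lambda>m. \<zero>\<^bsub>OA\<^esub>)" by (simp add: derivative_def)
  qed (simp_all add: KI.zero_closed)
  have add: "x \<oplus>\<^bsub>XD\<^esub> y \<in> small" if xy: "x \<in> small" "y \<in> small" for x y
  proof -
    obtain w v where w: "x \<in> Xc" "x = emb w" "derivative w v" "\<And>m. m \<in> S \<Longrightarrow> w m \<in> KI" "\<And>m. m \<in> S \<Longrightarrow> v m \<in> KI"
      "\<And>m. m \<in> S \<Longrightarrow> w m \<in> carrier OA" "\<And>m. m \<in> S \<Longrightarrow> v m \<in> carrier OA" using smallE[OF xy(1)] by metis
    obtain w' v' where w': "y \<in> Xc" "y = emb w'" "derivative w' v'" "\<And>m. m \<in> S \<Longrightarrow> w' m \<in> KI" "\<And>m. m \<in> S \<Longrightarrow> v' m \<in> KI"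
      "\<And>m. m \<in> S \<Longrightarrow> w' m \<in> carrier OA" "\<And>m. m \<in> S \<Longrightarrow> v' m \<in> carrier OA" using smallE[OF xy(2)] by metis
    show ?thesis
    proof (rule smallI[OF _ _ derivative_add[OF w(3) w'(3)]])
      show "x \<oplus>\<^bsub>XD\<^esub> y \<in> Xc" using w w' Xc_closed(7) by (simp add: XD_simps)
      show "x \<oplus>\<^bsub>XD\<^esub> y = emb (\<lambda>m. w m \<oplus>\<^bsub>OA\<^esub> w' m)"
        unfolding XD_simps w(2) w'(2) by (rule emb_ops(1)) (use w w' in auto)
    qed (use w w' in \<open>auto intro: KI.a_closed\<close>)
  qed
  have minus: "\<ominus>\<^bsub>XD\<^esub> x \<in> small" if x: "x \<in> small" for x
  proof -
    obtain w v where w: "x \<in> Xc" "x = emb w" "derivative w v" "\<And>m. m \<in> S \<Longrightarrow> w m \<in> KI" "\<And>m. m \<in> S \<Longrightarrow> v m \<in> KI"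
      "\<And>m. m \<in> S \<Longrightarrow> w m \<in> carrier OA" "\<And>m. m \<in> S \<Longrightarrow> v m \<in> carrier OA" using smallE[OF x] by metis
    show ?thesis
    proof (rule smallI[OF _ _ derivative_minus[OF w(3)]])
      show "\<ominus>\<^bsub>XD\<^esub> x \<in> Xc" using w Xc_closed(5) by (simp add: XD_minus)
      show "\<ominus>\<^bsub>XD\<^esub> x = emb (\<lambda>m. \<ominus>\<^bsub>OA\<^esub> w m)"
        unfolding XD_minus[OF w(1)] unfolding w(2) by (rule emb_ops(3)[of w w]) (use w in auto)
    qed (use w in \<open>auto intro: KI.a_inv_closed\<close>)
  qed
  have absorb: "r \<otimes>\<^bsub>XD\<^esub> x \<in> small \<and> x \<otimes>\<^bsub>XD\<^esub> r \<in> small" if x: "x \<in> small" and r: "r \<in> carrier XD" for x r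
  proof -
    obtain w v where w: "x \<in> Xc" "x = emb w" "derivative w v" "\<And>m. m \<in> S \<Longrightarrow> w m \<in> KI" "\<And>m. m \<in> S \<Longrightarrow> v m \<in> KI"
      "\<And>m. m \<in> S \<Longrightarrow> w m \<in> carrier OA" "\<And>m. m \<in> S \<Longrightarrow> v m \<in> carrier OA" using smallE[OF x] by metis
    have rX: "r \<in> Xc" using r by (simp add: XD_simps)
    obtain w' v' where w': "r = emb w'" "derivative w' v'" "\<And>m. m \<in> S \<Longrightarrow> w' m \<in> carrier OA"
      "\<And>m. m \<in> S \<Longrightarrow> v' m \<in> carrier OA" using Xc_cases[OF rX] by metis
    obtain \<sigma> where \<sigma>: "\<sigma> \<in> ring_hom OA OA"
      and \<sigma>d: "\<And>x. x \<in> carrier OA \<Longrightarrow> differential OA (\<sigma> x) = \<ominus>\<^bsub>OA\<^esub> \<sigma> (differential OA x)"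
      and \<sigma>c: "\<And>a. a \<in> carrier A \<Longrightarrow> \<sigma> (fA a []) = fA a []"
      and dm: "\<And>w v w' v'. derivative w v \<Longrightarrow> derivative w' v' \<Longrightarrow>
        derivative (\<lambda>m. w m \<otimes>\<^bsub>OA\<^esub> w' m) (\<lambda>m. \<sigma> (w m) \<otimes>\<^bsub>OA\<^esub> v' m \<oplus>\<^bsub>OA\<^esub> v m \<otimes>\<^bsub>OA\<^esub> w' m)"
      by (rule derivative_mult) blast
    have sc: "\<sigma> y \<in> carrier OA" if "y \<in> carrier OA" for y using ring_hom_closed[OF \<sigma> that] .
    show ?thesis
    proof
      show "r \<otimes>\<^bsub>XD\<^esub> x \<in> small"
      proof (rule smallI[OF _ _ dm[OF w'(2) w(3)]])
        show "r \<otimes>\<^bsub>XD\<^esub> x \<in> Xc" using w rX Xc_closed(6) by (simp add: XD_simps)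
        show "r \<otimes>\<^bsub>XD\<^esub> x = emb (\<lambda>m. w' m \<otimes>\<^bsub>OA\<^esub> w m)"
          unfolding XD_simps w(2) w'(1) by (rule emb_ops(2)) (use w w' in auto)
      qed (use w w' sc in \<open>auto intro!: KI.a_closed KI.I_l_closed\<close>)
      show "x \<otimes>\<^bsub>XD\<^esub> r \<in> small"
      proof (rule smallI)
        show "x \<otimes>\<^bsub>XD\<^esub> r = emb (\<lambda>m. w m \<otimes>\<^bsub>OA\<^esub> w' m)"
          unfolding XD_simps w(2) w'(1) by (rule emb_ops(2)) (use w w' in auto)
        show "x \<otimes>\<^bsub>XD\<^esub> r \<in> Xc" using w rX Xc_closed(6) by (simp add: XD_simps)
        show "derivative (\<lambda>m. w m \<otimes>\<^bsub>OA\<^esub> w' m) (\<lambda>m. \<sigma> (w m) \<otimes>\<^bsub>OA\<^esub> v' m \<oplus>\<^bsub>OA\<^esub> v m \<otimes>\<^bsub>OA\<^esub> w' m)"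
          by (rule dm[OF w(3) w'(2)])
        fix m assume m: "m \<in> S"
        show "w m \<otimes>\<^bsub>OA\<^esub> w' m \<in> KI" using w w' m by (intro KI.I_r_closed)
        have "\<sigma> (w m) \<in> KI" by (rule KI_sign[OF \<sigma> \<sigma>d \<sigma>c]) (use w(4)[OF m] in auto)
        then show "\<sigma> (w m) \<otimes>\<^bsub>OA\<^esub> v' m \<oplus>\<^bsub>OA\<^esub> v m \<otimes>\<^bsub>OA\<^esub> w' m \<in> KI"
          using w w' m by (intro KI.a_closed KI.I_r_closed)
      qed
    qed
  qed
  have diff: "differential XD x \<in> small" if x: "x \<in> small" for x
  proof -
    obtain w v where w: "x \<in> Xc" "x = emb w" "derivative w v" "\<And>m. m \<in> S \<Longrightarrow> w m \<in> KI" "\<And>m. m \<in> S \<Longrightarrow> v m \<in> KI"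
      using smallE[OF x] by metis
    show ?thesis
    proof (rule smallI[OF _ _ derivative_derivative[OF w(3)]])
      show "differential XD x \<in> Xc" using Xc_diff[OF w(1)] by (simp add: XD_simps)
      show "differential XD x = emb v" unfolding XD_simps w(2) by (rule derivative_emb[OF w(3)])
    qed (use w in \<open>auto intro: KI.zero_closed\<close>)
  qed
  have P: "small \<subseteq> carrier XD" by (auto simp: small_def XD_simps)
  note Q = P zero add minus
  have gen: "\<exists>M y. (\<forall>q\<le>M::nat. y q \<in> carrier XD \<and> y q \<in> degree_part XD q) \<and> r = (\<Oplus>\<^bsub>XD\<^esub>q\<in>{..M}. y q)"
    if "r \<in> carrier XD" for r
  proof -
    obtain M :: nat and y where y: "\<forall>q\<le>M. y q \<in> Xc \<and> y q \<in> degree_part GD q" "r = (\<Oplus>\<^bsub>GD\<^esub>q\<in>{..M}. y q)"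
      using Xc_homogeneous_sum[of r] \<open>r \<in> carrier XD\<close> unfolding XD_simps by blast
    have "(\<Oplus>\<^bsub>GD\<^esub>q\<in>{..M}. y q) = (\<Oplus>\<^bsub>XD\<^esub>q\<in>{..M}. y q)"
      unfolding XD_eq by (rule GD.finsum_subring[OF Xc_subring, symmetric]) (use y in auto)
    then show ?thesis using y by (intro exI[of _ M] exI[of _ y]) (simp add: XD_simps)
  qed
  show "dg_ideal (XD.graded_span small) XD"
    by (rule XD.dg_ideal_span[OF Q gen]) (use absorb diff in blast)+
  show "XD.graded_span small \<subseteq> small" by (rule XD.graded_span_P[OF Q])
  show "x \<in> XD.graded_span small" if "x \<in> small" "x \<in> degree_part GD q"
  proof -
    have "x \<in> degree_part XD q" using that(2) by (simp only: XD_simps)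
    then show ?thesis using XD.homogeneous_in_span[OF Q that(1), of q] by (simp only:)
  qed
qed

lemma X_ring_subring: "subring (X_ring S A) (power_ring S A)"
  unfolding X_ring_def by (rule PA.generate_ring_is_subring[OF gensX_closed])

lemma V_elem_X: "m \<in> S \<Longrightarrow> a \<in> carrier A \<Longrightarrow> V_elem S A m a \<in> X_ring S A"
  unfolding X_ring_def by (rule generate_ring.incl) blast

lemma X_embed_V: "a \<in> carrier A \<Longrightarrow> X_embed S A0 A i (V_elem S A m a) = emb (V_form m a)"
  using X_embed_eq[OF V_elem_closed[of a m]] by (simp add: V_form_def[abs_def])

lemma X_embed_hom: "ring_hom_ring XR XD (X_embed S A0 A i)"
proof (rule ring_hom_ringI2[OF PA.subring_is_ring[OF X_ring_subring] ring_XD ring_hom_memI])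
  fix x assume x: "x \<in> carrier XR"
  then show "X_embed S A0 A i x \<in> carrier XD" using UX_Xc by (simp add: XD_simps)
  have xc: "x k \<in> carrier A" if "k \<in> S" for k
    using x X_ring_closed that by (auto simp: power_ring_simps PiE_iff)
  fix y assume y: "y \<in> carrier XR"
  have yc: "y k \<in> carrier A" if "k \<in> S" for k
    using y X_ring_closed that by (auto simp: power_ring_simps PiE_iff)
  show "X_embed S A0 A i (x \<otimes>\<^bsub>XR\<^esub> y) = X_embed S A0 A i x \<otimes>\<^bsub>XD\<^esub> X_embed S A0 A i y"
    "X_embed S A0 A i (x \<oplus>\<^bsub>XR\<^esub> y) = X_embed S A0 A i x \<oplus>\<^bsub>XD\<^esub> X_embed S A0 A i y"
    unfolding X_embed_def XD_simps GD_simps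
    by (rule restrict_ext, simp add: power_ring_simps xc yc rat_form_one form_mult form_add flip: tr.hom_mult tr.hom_add)+
next
  show "X_embed S A0 A i \<one>\<^bsub>XR\<^esub> = \<one>\<^bsub>XD\<^esub>"
    unfolding X_embed_def XD_simps GD_simps
    by (rule restrict_ext) (simp add: power_ring_simps rat_form_one form_one)
qed

lemma V_small:
  assumes m: "m \<in> S" and a: "a \<in> a_kernel A R \<pi>"
  shows "emb (V_form m a) \<in> small"
proof -
  interpret KI: ideal "kernel_forms A0 A i (a_kernel A R \<pi>)" "de_rham A0 A i" by (rule KI_ideal)
  interpret \<pi>: ring_hom_cring A R \<pi> by (rule \<pi>_ring_hom_cring)
  have ac: "a \<in> carrier A" "\<pi> a = \<zero>\<^bsub>R\<^esub>" using a a_kernel_iff[of a A R \<pi>] by auto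
  show ?thesis
  proof (rule smallI[OF _ refl V_derivative[OF ac(1)]])
    show "emb (V_form m a) \<in> Xc" using UX_Xc[OF V_elem_X[OF m ac(1)]] X_embed_V[OF ac(1)] by simp
    fix k assume k: "k \<in> S"
    have e: "k div m > 0" if "m dvd k" using that S_pos[OF k] S_pos[OF m] by (simp add: dvd_imp_le div_greater_zero_iff)
    have "\<pi> (V_elem S A m a k) = \<zero>\<^bsub>R\<^esub>"
    proof (cases "m dvd k")
      case True
      have "\<pi> ([m] \<cdot>\<^bsub>A\<^esub> (a [^]\<^bsub>A\<^esub> (k div m))) = [m] \<cdot>\<^bsub>R\<^esub> \<pi> (a [^]\<^bsub>A\<^esub> (k div m))"
        by (rule abelian_group_hom.hom_add_pow[OF additive_map_of_ring_hom[OF A.ring_axioms ring_R \<pi>]])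
          (use ac in simp)
      also have "\<pi> (a [^]\<^bsub>A\<^esub> (k div m)) = \<zero>\<^bsub>R\<^esub>"
        using ac e[OF True] by (simp add: \<pi>.ring.hom_nat_pow \<pi>.S.nat_pow_zero)
      finally show ?thesis using True k by (simp add: V_elem_def)
    qed (use k in \<open>simp add: V_elem_def\<close>)
    then have "V_elem S A m a k \<in> a_kernel A R \<pi>"
      using V_closed[OF ac(1) k] a_kernel_iff[of _ A R \<pi>] by blast
    then show "V_form m a k \<in> KI" unfolding V_form_def by (rule KI_gen)
    show "dV_form m a k \<in> KI"
    proof (cases "m dvd k")
      case True
      have "dV_form m a k = fA (a [^]\<^bsub>A\<^esub> (k div m - 1)) [] \<otimes>\<^bsub>OA\<^esub> differential OA (fA a [])"
        using True ac by (simp add: dV_form_def form_mult diff_form)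
      then show ?thesis using KI_d[OF KI_gen[OF a]] ac KI.I_l_closed by simp
    qed (simp add: dV_form_def KI.zero_closed)
  qed
qed

lemma XI_facts: "ideal XI XD" "XI \<subseteq> small"
proof -
  interpret e: ring_hom_ring XR XD "X_embed S A0 A i" by (rule X_embed_hom)
  have id: "ideal (XD.graded_span small) XD" using small_ideal by (simp add: dg_ideal_def)
  have "X_ideal S A (a_kernel A R \<pi>) \<subseteq> {r \<in> carrier XR. X_embed S A0 A i r \<in> XD.graded_span small}"
    unfolding X_ideal_def
  proof (rule e.R.genideal_minimal[OF preimage_ideal[OF X_embed_hom id]], rule subsetI)
    fix x assume "x \<in> {V_elem S A m a | m a. m \<in> S \<and> a \<in> a_kernel A R \<pi>}"
    then obtain m a where ma: "m \<in> S" "a \<in> a_kernel A R \<pi>" "x = V_elem S A m a" by blast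
    have ac: "a \<in> carrier A" using ma a_kernel_iff[of a A R \<pi>] by blast
    have xX: "x \<in> X_ring S A" using V_elem_X[OF ma(1) ac] ma by simp
    have "X_embed S A0 A i x \<in> XD.graded_span small"
      by (rule small_homogeneous[OF _ X_embed_degree[OF xX]])
        (use V_small[OF ma(1,2)] X_embed_V[OF ac] ma in simp)
    then show "x \<in> {r \<in> carrier XR. X_embed S A0 A i r \<in> XD.graded_span small}" using xX by simp
  qed
  then have mem: "XD.graded_span small \<in> {H. dg_ideal H XD \<and> X_embed S A0 A i ` X_ideal S A (a_kernel A R \<pi>) \<subseteq> H}"
    using small_ideal by auto
  show "ideal XI XD" unfolding X_dg_ideal_def dg_ideal_gen_def
    by (rule XD.i_Intersect) (use mem in \<open>auto simp: dg_ideal_def\<close>)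
  have "XI \<subseteq> XD.graded_span small" unfolding X_dg_ideal_def dg_ideal_gen_def using mem by blast
  then show "XI \<subseteq> small" using small_span by blast
qed

end

section \<open>Families that satisfy the congruences are ghost families\<close>

lemma (in abelian_group) minus_via:
  assumes "a \<in> carrier G" "x \<in> carrier G" "y \<in> carrier G"
  shows "y \<ominus> x = (a \<ominus> x) \<oplus> \<ominus> (a \<ominus> y)"
proof -
  have "(a \<ominus> x) \<oplus> \<ominus> (a \<ominus> y) = (a \<oplus> \<ominus> a) \<oplus> (y \<ominus> x)"
    using assms by (simp add: a_minus_def minus_add a_ac)
  then show ?thesis using assms by (simp add: r_neg)
qed

text \<open>Two solutions that agree below \<open>k\<close> can only differ at \<open>k\<close> by an element that occurs as the lowest
  component of a ghost family.\<close>

lemma (in frobenius_forms) dwork_difference: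
  assumes x: "dwork n x" and y: "dwork n y" and eq: "\<And>j. j < k \<Longrightarrow> x j = y j" and k: "k \<le> n"
  shows "y k \<ominus>\<^bsub>Om\<^esub> x k \<in> exact_mod (p ^ k)"
proof (cases k)
  case 0
  have "y k \<ominus>\<^bsub>Om\<^esub> x k \<in> carrier Om" using dwork_closed[OF x k] dwork_closed[OF y k] by simp
  then show ?thesis using exact_mod_multiple[of "y k \<ominus>\<^bsub>Om\<^esub> x k" "1::nat"] 0 by simp
next
  case (Suc j)
  let ?a = "N (x j)"
  have j: "j < n" using k Suc by simp
  have c: "?a \<in> carrier Om" "x k \<in> carrier Om" "y k \<in> carrier Om"
    using dwork_closed[OF x] dwork_closed[OF y] k j by simp_all
  have "?a \<ominus>\<^bsub>Om\<^esub> x k \<in> exact_mod (p ^ k)" using x j Suc by (simp add: dwork_def)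
  moreover have "?a \<ominus>\<^bsub>Om\<^esub> y k \<in> exact_mod (p ^ k)" using y j Suc eq[of j] by (simp add: dwork_def)
  ultimately have "(?a \<ominus>\<^bsub>Om\<^esub> x k) \<oplus>\<^bsub>Om\<^esub> \<ominus>\<^bsub>Om\<^esub> (?a \<ominus>\<^bsub>Om\<^esub> y k) \<in> exact_mod (p ^ k)"
    by (intro exact_mod_add exact_mod_uminus)
  then show ?thesis using Om.minus_via[OF c] by simp
qed

context ghost_presentation
begin

abbreviation exact_mod where "exact_mod \<equiv> frobenius_forms.exact_mod R0 R f"

text \<open>Two representatives of a class differ by a family in \<open>I\<^sup>\<bullet>\<close>, and rational components come from unique integral
  forms.  So the choices in the definition of the ghost map do not matter.\<close>

lemma ghost_map_class:
  assumes w: "emb w \<in> Xc" and wc: "\<And>m. m \<in> S \<Longrightarrow> w m \<in> carrier OA"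
  shows "ghost_map S R0 R f A0 A i \<pi> (XI +>\<^bsub>XD\<^esub> emb w) = (\<lambda>m\<in>S. pr (w m))"
  unfolding ghost_map_def
proof (rule restrict_ext)
  interpret KI: ideal "kernel_forms A0 A i (a_kernel A R \<pi>)" "de_rham A0 A i" by (rule KI_ideal)
  fix k assume k: "k \<in> S"
  let ?c = "XI +>\<^bsub>XD\<^esub> emb w"
  have wk: "w k \<in> carrier OA" using wc k .
  have sub: "{KI +>\<^bsub>OA\<^esub> w' | w' x. x \<in> ?c \<and> w' \<in> carrier OA \<and> tr w' = x k} \<subseteq> {KI +>\<^bsub>OA\<^esub> w k}"
  proof
    fix U assume "U \<in> {KI +>\<^bsub>OA\<^esub> w' | w' x. x \<in> ?c \<and> w' \<in> carrier OA \<and> tr w' = x k}"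
    then obtain w' x where U: "U = KI +>\<^bsub>OA\<^esub> w'" and x: "x \<in> ?c" and w': "w' \<in> carrier OA" "tr w' = x k"
      by blast
    obtain j where j: "j \<in> XI" "x = j \<oplus>\<^bsub>XD\<^esub> emb w" using x unfolding a_r_coset_def' by blast
    have "j \<in> small" using j(1) XI_facts(2) by blast
    then obtain u where u: "j = emb u" "u k \<in> KI" "u k \<in> carrier OA"
      using smallE[of j] k by metis
    have "x k = tr (u k) \<oplus>\<^bsub>OQ\<^esub> tr (w k)" using k by (simp add: j(2) u(1) XD_simps GD_simps emb_def)
    then have "tr w' = tr (u k \<oplus>\<^bsub>OA\<^esub> w k)" using w'(2) u(3) wk by simp
    then have "w' = u k \<oplus>\<^bsub>OA\<^esub> w k" using tr_inj w'(1) u(3) wk by simp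
    then have "w' \<in> KI +>\<^bsub>OA\<^esub> w k" using u(2) unfolding a_r_coset_def' by blast
    then have "KI +>\<^bsub>OA\<^esub> w k = KI +>\<^bsub>OA\<^esub> w'" using wk by (rule KI.a_repr_independence')
    then show "U \<in> {KI +>\<^bsub>OA\<^esub> w k}" using U by simp
  qed
  have z: "\<zero>\<^bsub>XD\<^esub> \<in> XI" by (rule additive_subgroup.zero_closed[OF ideal.axioms(1)[OF XI_facts(1)]])
  have "\<zero>\<^bsub>XD\<^esub> \<oplus>\<^bsub>XD\<^esub> emb w = emb w"
    using GD.l_zero[OF emb_closed[of w, OF wc]] by (simp add: XD_simps)
  moreover have "\<zero>\<^bsub>XD\<^esub> \<oplus>\<^bsub>XD\<^esub> emb w \<in> ?c" using z unfolding a_r_coset_def' by blast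
  ultimately have "emb w \<in> ?c" by (simp only:)
  moreover have "tr (w k) = emb w k" using k by (simp add: emb_def)
  ultimately have "KI +>\<^bsub>OA\<^esub> w k \<in> {KI +>\<^bsub>OA\<^esub> w' | w' x. x \<in> ?c \<and> w' \<in> carrier OA \<and> tr w' = x k}"
    using wk by blast
  then have "{KI +>\<^bsub>OA\<^esub> w' | w' x. x \<in> ?c \<and> w' \<in> carrier OA \<and> tr w' = x k} = {KI +>\<^bsub>OA\<^esub> w k}"
    using sub by blast
  then have q: "ghost_map_quot S A0 A i (a_kernel A R \<pi>) ?c k = KI +>\<^bsub>OA\<^esub> w k"
    using k by (simp add: ghost_map_quot_def)
  have im: "pr (j \<oplus>\<^bsub>OA\<^esub> w k) = pr (w k)" if "j \<in> KI" for j
    using KI_pr[OF that] wk by simp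
  have "pr ` (KI +>\<^bsub>OA\<^esub> w k) = {pr (w k)}"
  proof
    show "pr ` (KI +>\<^bsub>OA\<^esub> w k) \<subseteq> {pr (w k)}" unfolding a_r_coset_def' using im by auto
    have "\<zero>\<^bsub>OA\<^esub> \<oplus>\<^bsub>OA\<^esub> w k \<in> KI +>\<^bsub>OA\<^esub> w k"
      using KI.zero_closed unfolding a_r_coset_def' by blast
    then have "pr (\<zero>\<^bsub>OA\<^esub> \<oplus>\<^bsub>OA\<^esub> w k) \<in> pr ` (KI +>\<^bsub>OA\<^esub> w k)" by (rule imageI)
    then show "{pr (w k)} \<subseteq> pr ` (KI +>\<^bsub>OA\<^esub> w k)"
      unfolding im[OF KI.zero_closed] by (intro subsetI) (simp only: singleton_iff)
  qed
  then show "the_elem (pr ` ghost_map_quot S A0 A i (a_kernel A R \<pi>) ?c k) = pr (w k)"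
    unfolding q by simp
qed

text \<open>Families with vanishing components below \<open>p\<^sup>K\<close> allow to correct the component at \<open>p\<^sup>K\<close> without
  disturbing the earlier ones.\<close>

definition realizable where
  "realizable K z \<longleftrightarrow> (\<exists>v. emb v \<in> Xc \<and> (\<forall>m\<in>S. v m \<in> carrier OA) \<and> (\<forall>j<K. v (p ^ j) = \<zero>\<^bsub>OA\<^esub>) \<and> v (p ^ K) = z)"

lemma realizable_add:
  assumes K: "K \<le> n" and "realizable K y" "realizable K z"
  shows "realizable K (y \<oplus>\<^bsub>OA\<^esub> z)"
proof -
  obtain u v where u: "emb u \<in> Xc" "\<forall>m\<in>S. u m \<in> carrier OA" "\<forall>j<K. u (p ^ j) = \<zero>\<^bsub>OA\<^esub>" "u (p ^ K) = y"
    and v: "emb v \<in> Xc" "\<forall>m\<in>S. v m \<in> carrier OA" "\<forall>j<K. v (p ^ j) = \<zero>\<^bsub>OA\<^esub>" "v (p ^ K) = z"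
    using assms(2,3) unfolding realizable_def by blast
  have "emb u \<oplus>\<^bsub>GD\<^esub> emb v = emb (\<lambda>m. u m \<oplus>\<^bsub>OA\<^esub> v m)" by (rule emb_ops(1)) (use u v in auto)
  then have "emb (\<lambda>m. u m \<oplus>\<^bsub>OA\<^esub> v m) \<in> Xc" using Xc_closed(7)[OF u(1) v(1)] by simp
  then show ?thesis unfolding realizable_def using u v
    by (intro exI[of _ "\<lambda>m. u m \<oplus>\<^bsub>OA\<^esub> v m"]) simp
qed

lemma Xc_mult:
  assumes "emb u \<in> Xc" "emb v \<in> Xc" "\<And>m. m \<in> S \<Longrightarrow> u m \<in> carrier OA" "\<And>m. m \<in> S \<Longrightarrow> v m \<in> carrier OA"
  shows "emb (\<lambda>m. u m \<otimes>\<^bsub>OA\<^esub> v m) \<in> Xc"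
proof -
  have "emb u \<otimes>\<^bsub>GD\<^esub> emb v = emb (\<lambda>m. u m \<otimes>\<^bsub>OA\<^esub> v m)" by (rule emb_ops(2)) (fact assms)+
  then show ?thesis using Xc_closed(6)[OF assms(1,2)] by simp
qed

lemma V_facts:
  assumes K: "K \<le> n" and b: "b \<in> carrier A"
  shows "emb (V_form (p ^ K) b) \<in> Xc" and "emb (dV_form (p ^ K) b) \<in> Xc"
    and "m \<in> S \<Longrightarrow> V_form (p ^ K) b m \<in> carrier OA" and "m \<in> S \<Longrightarrow> dV_form (p ^ K) b m \<in> carrier OA"
    and "j < K \<Longrightarrow> V_form (p ^ K) b (p ^ j) = \<zero>\<^bsub>OA\<^esub>" and "j < K \<Longrightarrow> dV_form (p ^ K) b (p ^ j) = \<zero>\<^bsub>OA\<^esub>"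
    and "V_form (p ^ K) b (p ^ K) = fA ([(p ^ K)] \<cdot>\<^bsub>A\<^esub> b) []" and "dV_form (p ^ K) b (p ^ K) = fA \<one>\<^bsub>A\<^esub> [b]"
proof -
  note dv = V_derivative[OF b, of "p ^ K"]
  have pK: "p ^ K > 0" using p1 by simp
  show X: "emb (V_form (p ^ K) b) \<in> Xc"
    using UX_Xc[OF V_elem_X[OF S_mem[OF K] b]] X_embed_V[OF b] by simp
  show "emb (dV_form (p ^ K) b) \<in> Xc" using Xc_diff[OF X] derivative_emb[OF dv] by simp
  show "m \<in> S \<Longrightarrow> V_form (p ^ K) b m \<in> carrier OA" "m \<in> S \<Longrightarrow> dV_form (p ^ K) b m \<in> carrier OA"
    using dv by (auto simp: derivative_def)
  show "V_form (p ^ K) b (p ^ K) = fA ([(p ^ K)] \<cdot>\<^bsub>A\<^esub> b) []" "dV_form (p ^ K) b (p ^ K) = fA \<one>\<^bsub>A\<^esub> [b]"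
    using S_mem[OF K] b pK by (simp_all add: V_form_def dV_form_def V_elem_def)
  assume j: "j < K"
  then have nd: "\<not> p ^ K dvd p ^ j" using power_dvd_imp_le[of p K j] p1 by auto
  then show "V_form (p ^ K) b (p ^ j) = \<zero>\<^bsub>OA\<^esub>" "dV_form (p ^ K) b (p ^ j) = \<zero>\<^bsub>OA\<^esub>"
    using S_mem[of j] j K form_zero[of "[]"] by (simp_all add: V_form_def dV_form_def V_elem_def)
qed

lemma Xc_products:
  assumes K: "K \<le> n" and "set bs \<subseteq> carrier A"
  shows "\<exists>v. emb v \<in> Xc \<and> (\<forall>m\<in>S. v m \<in> carrier OA) \<and> v (p ^ K) = fA \<one>\<^bsub>A\<^esub> bs"
  using assms(2)
proof (induction bs)
  case Nil
  have "emb (\<lambda>m. \<one>\<^bsub>OA\<^esub>) = \<one>\<^bsub>GD\<^esub>" by (auto simp: emb_def GD_simps)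
  then show ?case using Xc_closed(3) by (intro exI[of _ "\<lambda>m. \<one>\<^bsub>OA\<^esub>"]) (simp add: form_one)
next
  case (Cons b bs)
  then obtain v where v: "emb v \<in> Xc" "\<forall>m\<in>S. v m \<in> carrier OA" "v (p ^ K) = fA \<one>\<^bsub>A\<^esub> bs" by auto
  have b: "b \<in> carrier A" using Cons.prems by simp
  have "emb (\<lambda>m. dV_form (p ^ K) b m \<otimes>\<^bsub>OA\<^esub> v m) \<in> Xc"
    by (rule Xc_mult) (use v V_facts(2,4)[OF K b] in auto)
  then show ?case using v V_facts(4,8)[OF K b] Cons.prems
    by (intro exI[of _ "\<lambda>m. dV_form (p ^ K) b m \<otimes>\<^bsub>OA\<^esub> v m"]) (simp add: form_mult)
qed

text \<open>The family \<open>V\<langle>b\<rangle>\<close> at \<open>p\<^sup>K\<close> has the component \<open>p\<^sup>K b\<close> there, its divided differential has the component \<open>db\<close>,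
  and both vanish below.  Their products with further divided differentials give \<open>p\<^sup>K b db\<^sub>1 \<dots> db\<^sub>q\<close> and
  \<open>db db\<^sub>1 \<dots> db\<^sub>q\<close>.\<close>

lemma realizable_form:
  assumes K: "K \<le> n" and b: "b \<in> carrier A" "set bs \<subseteq> carrier A"
  shows "realizable K ([(p ^ K)] \<cdot>\<^bsub>OA\<^esub> fA b bs)" and "realizable K (differential OA (fA b bs))"
proof -
  obtain v where v: "emb v \<in> Xc" "\<forall>m\<in>S. v m \<in> carrier OA" "v (p ^ K) = fA \<one>\<^bsub>A\<^esub> bs"
    using Xc_products[OF K b(2)] by blast
  have vz: "v (p ^ j) \<in> carrier OA" if "j < K" for j using v(2) S_mem[of j] that K by simp
  have "emb (\<lambda>m. V_form (p ^ K) b m \<otimes>\<^bsub>OA\<^esub> v m) \<in> Xc"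
    by (rule Xc_mult) (use v V_facts(1,3)[OF K b(1)] in auto)
  moreover have "V_form (p ^ K) b (p ^ K) \<otimes>\<^bsub>OA\<^esub> v (p ^ K) = [(p ^ K)] \<cdot>\<^bsub>OA\<^esub> fA b bs"
    using b abelian_group_hom.hom_add_pow[OF form_hom[OF b(2)] b(1), of "p ^ K"]
    by (simp add: V_facts(7)[OF K b(1)] v(3) form_mult)
  ultimately show "realizable K ([(p ^ K)] \<cdot>\<^bsub>OA\<^esub> fA b bs)" unfolding realizable_def
    using v vz V_facts(3,5)[OF K b(1)] by (intro exI[of _ "\<lambda>m. V_form (p ^ K) b m \<otimes>\<^bsub>OA\<^esub> v m"]) simp
  have "emb (\<lambda>m. dV_form (p ^ K) b m \<otimes>\<^bsub>OA\<^esub> v m) \<in> Xc"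
    by (rule Xc_mult) (use v V_facts(2,4)[OF K b(1)] in auto)
  moreover have "dV_form (p ^ K) b (p ^ K) \<otimes>\<^bsub>OA\<^esub> v (p ^ K) = differential OA (fA b bs)"
    using b by (simp add: V_facts(8)[OF K b(1)] v(3) form_mult diff_form)
  ultimately show "realizable K (differential OA (fA b bs))" unfolding realizable_def
    using v vz V_facts(4,6)[OF K b(1)] by (intro exI[of _ "\<lambda>m. dV_form (p ^ K) b m \<otimes>\<^bsub>OA\<^esub> v m"]) simp
qed

lemma realizable_exact:
  assumes K: "K \<le> n" and z: "x \<in> carrier OA" "y \<in> carrier OA"
  shows "realizable K ([(p ^ K)] \<cdot>\<^bsub>OA\<^esub> x \<oplus>\<^bsub>OA\<^esub> differential OA y)"
proof (rule realizable_add[OF K])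
  show "realizable K ([(p ^ K)] \<cdot>\<^bsub>OA\<^esub> x)"
    by (rule de_rham_complex.forms_induct[OF DA z(1), where P = "\<lambda>x. realizable K ([(p ^ K)] \<cdot>\<^bsub>OA\<^esub> x)"])
      (auto simp: OA.add.nat_pow_distrib intro: realizable_form[OF K] realizable_add[OF K])
  show "realizable K (differential OA y)"
    by (rule de_rham_complex.forms_induct[OF DA z(2), where P = "\<lambda>x. realizable K (differential OA x)"])
      (auto intro: realizable_form[OF K] realizable_add[OF K])
qed

lemma pr_surj:
  assumes "x \<in> carrier OR"
  shows "\<exists>y\<in>carrier OA. pr y = x"
proof (rule de_rham_complex.forms_induct[OF DR assms, where P = "\<lambda>x. \<exists>y\<in>carrier OA. pr y = x"])
  fix r rs assume r: "r \<in> carrier R" and rs: "set rs \<subseteq> carrier R"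
  let ?h = "inv_into (carrier A) \<pi>"
  have h: "?h s \<in> carrier A" "\<pi> (?h s) = s" if "s \<in> carrier R" for s
    using that \<pi>_surj by (auto intro: inv_into_into f_inv_into_f)
  have hs: "set (map ?h rs) \<subseteq> carrier A" using rs h(1) by auto
  have "map \<pi> (map ?h rs) = rs" unfolding map_map by (rule map_idI) (use rs h(2) in auto)
  then have "pr (fA (?h r) (map ?h rs)) = fR r rs" using pr_form[OF h(1)[OF r] hs] h(2)[OF r] by simp
  then show "\<exists>y\<in>carrier OA. pr y = fR r rs" using form_closed[OF h(1)[OF r] hs] by blast
next
  fix x y assume "\<exists>u\<in>carrier OA. pr u = x" "\<exists>u\<in>carrier OA. pr u = y"
  then obtain u v where "u \<in> carrier OA" "v \<in> carrier OA" "pr u = x" "pr v = y" by blast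
  then show "\<exists>z\<in>carrier OA. pr z = x \<oplus>\<^bsub>OR\<^esub> y" by (intro bexI[of _ "u \<oplus>\<^bsub>OA\<^esub> v"]) simp_all
qed

lemma exact_realizable:
  assumes K: "K \<le> n" and z: "z \<in> exact_mod (p ^ K)"
  shows "\<exists>y. realizable K y \<and> y \<in> carrier OA \<and> pr y = z"
proof -
  obtain \<alpha> \<beta> where ab: "\<alpha> \<in> carrier OR" "\<beta> \<in> carrier OR" "z = ([(p ^ K)] \<cdot>\<^bsub>OR\<^esub> \<alpha>) \<oplus>\<^bsub>OR\<^esub> differential OR \<beta>"
    using z unfolding frobenius_forms.exact_mod_def[OF frob] by blast
  obtain x y where xy: "x \<in> carrier OA" "pr x = \<alpha>" "y \<in> carrier OA" "pr y = \<beta>"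
    using pr_surj ab(1,2) by metis
  have "pr ([(p ^ K)] \<cdot>\<^bsub>OA\<^esub> x \<oplus>\<^bsub>OA\<^esub> differential OA y) = z"
    using xy ab pr_d[OF xy(3)] pr.hom_add_pow[OF xy(1), of "p ^ K"] by simp
  then show ?thesis using realizable_exact[OF K xy(1,3)] xy by auto
qed

lemma Xc_zero: "emb (\<lambda>m. \<zero>\<^bsub>OA\<^esub>) \<in> Xc"
proof -
  have "emb (\<lambda>m. \<zero>\<^bsub>OA\<^esub>) = \<zero>\<^bsub>GD\<^esub>" by (auto simp: emb_def GD_simps)
  then show ?thesis using Xc_closed(2) by simp
qed

lemma Xc_dwork:
  assumes v: "emb v \<in> Xc" "\<And>m. m \<in> S \<Longrightarrow> v m \<in> carrier OA"
  shows "dwork n (\<lambda>k. pr (v (p ^ k)))"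
proof -
  obtain w where w: "w \<in> T" "emb v = emb w" using v(1) Xc_T by blast
  have "w m = v m" if "m \<in> S" for m
    using emb_inj[OF w(2) that v(2)[OF that] T_closed[OF w(1) that]] by simp
  then have "v \<in> T" by (rule T_cong[OF w(1)])
  then show ?thesis by (simp add: T_def)
qed

text \<open>The components are matched one at a time: what is missing at \<open>p\<^sup>K\<close> is realized by a family that vanishes below.\<close>

lemma ghost_family_below:
  assumes \<eta>: "dwork n \<eta>"
  shows "K \<le> Suc n \<Longrightarrow> \<exists>v. emb v \<in> Xc \<and> (\<forall>m\<in>S. v m \<in> carrier OA) \<and> (\<forall>j<K. pr (v (p ^ j)) = \<eta> j)"
proof (induction K)
  case 0
  then show ?case using Xc_zero by (intro exI[of _ "\<lambda>m. \<zero>\<^bsub>OA\<^esub>"]) simp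
next
  case (Suc K)
  then obtain v where v: "emb v \<in> Xc" "\<forall>m\<in>S. v m \<in> carrier OA" "\<forall>j<K. pr (v (p ^ j)) = \<eta> j" by auto
  have K: "K \<le> n" using Suc.prems by simp
  have vK: "v (p ^ K) \<in> carrier OA" using v(2) S_mem[OF K] by blast
  have \<eta>K: "\<eta> K \<in> carrier OR" by (rule frobenius_forms.dwork_closed[OF frob \<eta> K])
  have dv: "dwork n (\<lambda>k. pr (v (p ^ k)))" by (rule Xc_dwork) (use v in auto)
  have "\<eta> K \<ominus>\<^bsub>OR\<^esub> pr (v (p ^ K)) \<in> exact_mod (p ^ K)"
    by (rule frobenius_forms.dwork_difference[OF frob dv \<eta> _ K]) (use v in auto)
  then obtain y where y: "realizable K y" "y \<in> carrier OA" "pr y = \<eta> K \<ominus>\<^bsub>OR\<^esub> pr (v (p ^ K))"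
    using exact_realizable[OF K] by blast
  obtain u where u: "emb u \<in> Xc" "\<forall>m\<in>S. u m \<in> carrier OA" "\<forall>j<K. u (p ^ j) = \<zero>\<^bsub>OA\<^esub>" "u (p ^ K) = y"
    using y(1) unfolding realizable_def by blast
  have "emb v \<oplus>\<^bsub>GD\<^esub> emb u = emb (\<lambda>m. v m \<oplus>\<^bsub>OA\<^esub> u m)" by (rule emb_ops(1)) (use u v in auto)
  then have X: "emb (\<lambda>m. v m \<oplus>\<^bsub>OA\<^esub> u m) \<in> Xc" using Xc_closed(7)[OF v(1) u(1)] by simp
  have "pr (v (p ^ j) \<oplus>\<^bsub>OA\<^esub> u (p ^ j)) = \<eta> j" if j: "j < Suc K" for j
  proof (cases "j = K")
    case True
    have "pr (v (p ^ K)) \<oplus>\<^bsub>OR\<^esub> (\<eta> K \<ominus>\<^bsub>OR\<^esub> pr (v (p ^ K))) = \<eta> K"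
      using \<eta>K vK by (simp add: a_minus_def OR.a_lcomm OR.r_neg)
    then show ?thesis using True u(4) y(2,3) vK by simp
  next
    case False
    then have jK: "j < K" using j by simp
    then have "v (p ^ j) \<in> carrier OA" using v(2) S_mem[of j] K by simp
    then show ?thesis using jK u(3) v(3) by simp
  qed
  then show ?case using X u v by (intro exI[of _ "\<lambda>m. v m \<oplus>\<^bsub>OA\<^esub> u m"]) simp
qed

theorem ghost_image_iff:
  assumes \<omega>: "\<omega> \<in> extensional S"
  shows "\<omega> \<in> ghost_map S R0 R f A0 A i \<pi> ` carrier (E_forms S A0 A i (a_kernel A R \<pi>))
    \<longleftrightarrow> dwork n (\<lambda>k. \<omega> (p ^ k))"
proof -
  have E: "carrier (E_forms S A0 A i (a_kernel A R \<pi>)) = (\<lambda>x. XI +>\<^bsub>XD\<^esub> x) ` Xc"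
    by (auto simp: E_forms_def FactRing_def A_RCOSETS_def' XD_simps)
  show ?thesis
  proof
    assume "\<omega> \<in> ghost_map S R0 R f A0 A i \<pi> ` carrier (E_forms S A0 A i (a_kernel A R \<pi>))"
    then obtain x where x: "x \<in> Xc" "\<omega> = ghost_map S R0 R f A0 A i \<pi> (XI +>\<^bsub>XD\<^esub> x)" unfolding E by blast
    obtain w where w: "w \<in> T" "x = emb w" using x(1) Xc_T by blast
    have w\<omega>: "\<omega> = (\<lambda>m\<in>S. pr (w m))"
      unfolding x(2) w(2) by (rule ghost_map_class) (use x w T_closed in auto)
    have "pr (w (p ^ k)) = \<omega> (p ^ k)" if "k \<le> n" for k unfolding w\<omega> using S_mem[OF that] by simp
    moreover have "dwork n (\<lambda>k. pr (w (p ^ k)))" using w(1) by (simp add: T_def)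
    ultimately show "dwork n (\<lambda>k. \<omega> (p ^ k))" by (rule dwork_cong[rotated])
  next
    assume "dwork n (\<lambda>k. \<omega> (p ^ k))"
    from ghost_family_below[OF this, of "Suc n"] obtain v where v: "emb v \<in> Xc" "\<forall>m\<in>S. v m \<in> carrier OA"
      "\<forall>j<Suc n. pr (v (p ^ j)) = \<omega> (p ^ j)" by blast
    have "pr (v m) = \<omega> m" if "m \<in> S" for m using that v(3) by (auto simp: S)
    then have "\<omega> = (\<lambda>m\<in>S. pr (v m))" by (intro extensionalityI[OF \<omega>]) auto
    also have "\<dots> = ghost_map S R0 R f A0 A i \<pi> (XI +>\<^bsub>XD\<^esub> emb v)"
      by (rule ghost_map_class[symmetric]) (use v in auto)
    finally show "\<omega> \<in> ghost_map S R0 R f A0 A i \<pi> ` carrier (E_forms S A0 A i (a_kernel A R \<pi>))"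
      unfolding E using v(1) by blast
  qed
qed

end

theorem theoremB1:
  fixes p n :: nat
    and S :: "nat set"
    and R0 :: "'r0 ring" and R :: "'r ring" and f :: "'r0 \<Rightarrow> 'r"
    and A0 :: "'a ring" and U :: "'x set"
    and \<pi>0 :: "'a \<Rightarrow> 'r0" and \<pi> :: "('x multiset \<Rightarrow> 'a) \<Rightarrow> 'r"
    and \<phi> :: "'r \<Rightarrow> 'r" and \<phi>0 :: "'r0 \<Rightarrow> 'r0"
    and \<omega> :: "nat \<Rightarrow> ('r list \<Rightarrow> 'r) set"
  defines "S \<equiv> (\<lambda>k. p ^ k) ` {..n}"
    and "A \<equiv> mpoly_ring A0 U"
    and "\<Omega> \<equiv> de_rham R0 R f"
  assumes "Factorial_Ring.prime p"
    and "flat_Z_algebra R0" and "flat_Z_algebra R"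
    and "smooth_hom R0 R f"
    and "presentation R0 R f A0 U \<pi>0 \<pi>"
    and "frobenius_lift p R \<phi>"
    and "\<phi>0 \<in> ring_hom R0 R0"
    and "\<forall>r\<in>carrier R0. f (\<phi>0 r) = \<phi> (f r)"
    and "\<omega> \<in> carrier (power_ring S \<Omega>)"
  shows "\<omega> \<in> ghost_map S R0 R f A0 A (mpoly_const A0) \<pi> `
        carrier (E_forms S A0 A (mpoly_const A0) (a_kernel A R \<pi>))
    \<longleftrightarrow> (\<forall>k<n. normalized_frobenius p R0 R f \<phi> (\<omega> (p ^ k)) \<ominus>\<^bsub>\<Omega>\<^esub> \<omega> (p ^ (k + 1))
          \<in> {([(p ^ (k + 1))] \<cdot>\<^bsub>\<Omega>\<^esub> \<alpha>) \<oplus>\<^bsub>\<Omega>\<^esub> differential \<Omega> \<beta> | \<alpha> \<beta>.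
               \<alpha> \<in> carrier \<Omega> \<and> \<beta> \<in> carrier \<Omega>})"
proof -
  have smooth: "cring R0" "cring R" "f \<in> ring_hom R0 R" using assms(7) by (simp_all add: smooth_hom_def)
  have flat: "flat_Z_algebra A0" and \<pi>0: "\<pi>0 \<in> ring_hom A0 R0" and \<pi>: "\<pi> \<in> ring_hom A R" "\<pi> ` carrier A = carrier R"
    and \<pi>c: "\<And>a. a \<in> carrier A0 \<Longrightarrow> \<pi> (mpoly_const A0 a) = f (\<pi>0 a)"
    using assms(8) by (auto simp: presentation_def A_def)
  interpret P: polynomials A0 U
    by (rule polynomials.intro) (use flat in \<open>simp add: flat_Z_algebra_def\<close>)
  have p1: "p > 1" by (rule prime_gt_1_nat[OF assms(4)])
  have tfA0: "a = \<zero>\<^bsub>A0\<^esub>" if "m > 0" "a \<in> carrier A0" "[(m::nat)] \<cdot>\<^bsub>A0\<^esub> a = \<zero>\<^bsub>A0\<^esub>" for m a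
    by (rule flat_imp_torsion_free[OF P.K.ring_axioms _ that]) (use flat in \<open>simp add: flat_Z_algebra_def\<close>)
  have tfR: "r = \<zero>\<^bsub>R\<^esub>" if "m > 0" "r \<in> carrier R" "[(m::nat)] \<cdot>\<^bsub>R\<^esub> r = \<zero>\<^bsub>R\<^esub>" for m r
    by (rule flat_imp_torsion_free[OF cring.axioms(1)[OF smooth(2)] _ that])
      (use assms(6) in \<open>simp add: flat_Z_algebra_def\<close>)
  have cA: "cring A" unfolding A_def by (rule P.cring_PV)
  have rat: "rational_forms A0 A (mpoly_const A0)"
    by (intro rational_forms.intro rational_forms_axioms.intro P.K.cring_axioms cA) (simp add: A_def P.const_hom)
  have frob: "frobenius_forms R0 R f p \<phi>"
  proof (intro frobenius_forms.intro frobenius_forms_axioms.intro de_rham_complex.intro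
      de_rham_complex_axioms.intro smooth(2) assms(9))
    show "f a \<in> carrier R" if "a \<in> carrier R0" for a using ring_hom_closed[OF smooth(3) that] .
    show "p > 0" using p1 by simp
    show "x = \<zero>\<^bsub>de_rham R0 R f\<^esub>" if "m > 0" "x \<in> carrier (de_rham R0 R f)"
      "[(m::nat)] \<cdot>\<^bsub>de_rham R0 R f\<^esub> x = \<zero>\<^bsub>de_rham R0 R f\<^esub>" for m x
      by (rule smooth_forms_torsion_free[OF assms(7) tfR[OF that(1)] that(2,3)])
    show "\<exists>b\<in>carrier R0. \<phi> (f a) = f b" if "a \<in> carrier R0" for a
      using assms(11) that ring_hom_closed[OF assms(10) that] by (intro bexI[of _ "\<phi>0 a"]) simp_all
  qed
  interpret G: ghost_presentation A0 A "mpoly_const A0" R0 R f p \<phi> \<pi> n S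
  proof (intro ghost_presentation.intro ghost_presentation_axioms.intro cA rat frob \<pi> p1)
    show "\<exists>r\<in>carrier R0. \<pi> (mpoly_const A0 a) = f r" if "a \<in> carrier A0" for a
      using \<pi>c[OF that] ring_hom_closed[OF \<pi>0 that] by blast
    show "S = (\<lambda>k. p ^ k) ` {..n}" by (simp add: S_def)
    show "x = \<zero>\<^bsub>de_rham A0 A (mpoly_const A0)\<^esub>" if "m > 0" "x \<in> carrier (de_rham A0 A (mpoly_const A0))"
      "[(m::nat)] \<cdot>\<^bsub>de_rham A0 A (mpoly_const A0)\<^esub> x = \<zero>\<^bsub>de_rham A0 A (mpoly_const A0)\<^esub>" for m x
      using polynomial_forms_torsion_free[OF P.K.cring_axioms tfA0[OF that(1)]] that(2,3) unfolding A_def by blast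
  qed
  have \<omega>: "\<omega> \<in> S \<rightarrow>\<^sub>E carrier \<Omega>" using assms(12) by (simp add: power_ring_simps)
  have "\<omega> (p ^ k) \<in> carrier (de_rham R0 R f)" if "k \<le> n" for k
    using \<omega> G.S_mem[OF that] by (auto simp: \<Omega>_def)
  then have "G.dwork n (\<lambda>k. \<omega> (p ^ k)) \<longleftrightarrow>
      (\<forall>k<n. normalized_frobenius p R0 R f \<phi> (\<omega> (p ^ k)) \<ominus>\<^bsub>\<Omega>\<^esub> \<omega> (p ^ (k + 1))
          \<in> {([(p ^ (k + 1))] \<cdot>\<^bsub>\<Omega>\<^esub> \<alpha>) \<oplus>\<^bsub>\<Omega>\<^esub> differential \<Omega> \<beta> | \<alpha> \<beta>.
               \<alpha> \<in> carrier \<Omega> \<and> \<beta> \<in> carrier \<Omega>})"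
    unfolding frobenius_forms.dwork_def[OF frob] frobenius_forms.exact_mod_def[OF frob] \<Omega>_def by simp
  then show ?thesis using G.ghost_image_iff[of \<omega>] \<omega> by (simp add: PiE_iff)
qed

end
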